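(* For any real $m\ge1$, $\mathrm{Diff}^m_{\mathrm{ap}}(\mathbb{R}^n)$ is a topological subgroup of $\mathrm{diff}^m_b(\mathbb{R}^n)$. Moreover, for any integer $r\ge0$ the maps $$\circ:\mathrm{Diff}^{m+r}_{\mathrm{ap}}(\mathbb{R}^n)\times\mathrm{Diff}^m_{\mathrm{ap}}(\mathbb{R}^n)\to\mathrm{Diff}^m_{\mathrm{ap}}(\mathbb{R}^n),\ (\varphi,\psi)\mapsto\varphi\circ\psi,$$ and $$\imath:\mathrm{Diff}^{m+r}_{\mathrm{ap}}(\mathbb{R}^n)\to\mathrm{Diff}^m_{\mathrm{ap}}(\mathbb{R}^n),\ \varphi\mapsto\varphi^{-1},$$ are $C^r$-smooth.
   Context: For real $m\ge0$, $C^m_b(\mathbb{R}^n,\mathbb{R})$ is the standard Hölder space: for integer $m$, $C^m$ functions with bounded continuous derivatives of order $\le m$, norm $|f|_m=\max_{|\beta|\le m}\sup|\partial^\beta f|$; for $m=k+\gamma$ ($0<\gamma<1$), functions in $C^k_b$ with $\gamma$-Hölder order-$k$ derivatives, norm $|f|_k$ plus the $\gamma$-Hölder seminorm of the order-$k$ derivatives. $c^m_b$ is the closure of $C^\infty_b=\bigcap_kC^k_b$ in $C^m_b$. For $f\in C^m_b$, $\mathcal S_f=\{f(\cdot+c)\}_{c\in\mathbb{R}^n}$ and $C^m_{\mathrm{ap}}=\{f\in C^m_b:\mathcal S_f\text{ precompact in }C^m_b\}$. Vector-valued spaces are componentwise. $\mathrm{diff}^m_b(\mathbb{R}^n)$ is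 the set of $\varphi=\mathrm{id}+f$ with $f\in c^m_b(\mathbb{R}^n,\mathbb{R}^n)$ and $\inf_x\det(I+[d_xf])>0$; $\mathrm{Diff}^m_{\mathrm{ap}}(\mathbb{R}^n)$ is the set of $\varphi=\mathrm{id}+f$ with $f\in C^m_{\mathrm{ap}}(\mathbb{R}^n,\mathbb{R}^n)$ and $\inf_x\det(I+[d_xf])>0$; both are Banach manifolds via $\varphi\mapsto\varphi-\mathrm{id}$ (open subsets of $c^m_b(\mathbb{R}^n,\mathbb{R}^n)$, resp. $C^m_{\mathrm{ap}}(\mathbb{R}^n,\mathbb{R}^n)$). *)

theory Defs
  imports "HOL-Analysis.Analysis" "HOL-Library.Function_Algebras"
begin

instantiation "fun" :: (type, real_vector) real_vector
begin
definition scaleR_fun :: "real \<Rightarrow> ('a \<Rightarrow> 'b) \<Rightarrow> 'a \<Rightarrow> 'b" where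
  "scaleR_fun c f = (\<lambda>x. c *\<^sub>R f x)"
instance
  by standard (auto simp: scaleR_fun_def fun_eq_iff algebra_simps)
end

text \<open>A normed space is given by a carrier (a linear subspace VA of a real vector
  space) together with a norm NA on it.  Higher derivatives are represented as
  k-multilinear maps, i.e. functions of an argument family h :: nat => 'a of which
  only the slots 0..k-1 matter.\<close>

definition ml_bounded ::
  "nat \<Rightarrow> 'a::real_vector set \<Rightarrow> ('a \<Rightarrow> real) \<Rightarrow> 'b::real_vector set \<Rightarrow> ('b \<Rightarrow> real)
     \<Rightarrow> ((nat \<Rightarrow> 'a) \<Rightarrow> 'b) \<Rightarrow> bool" where
  "ml_bounded k VA NA VB NB M \<longleftrightarrow>
     (\<forall>h h'. (\<forall>i<k. h i = h' i) \<longrightarrow> M h = M h') \<and>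
     (\<forall>h. (\<forall>i<k. h i \<in> VA) \<longrightarrow> M h \<in> VB) \<and>
     (\<forall>h i u v c. i < k \<longrightarrow> (\<forall>j<k. h j \<in> VA) \<longrightarrow> u \<in> VA \<longrightarrow> v \<in> VA \<longrightarrow>
          M (h(i := u + v)) = M (h(i := u)) + M (h(i := v)) \<and>
          M (h(i := c *\<^sub>R u)) = c *\<^sub>R M (h(i := u))) \<and>
     (\<exists>C. \<forall>h. (\<forall>i<k. h i \<in> VA) \<longrightarrow> NB (M h) \<le> C * (\<Prod>i<k. NA (h i)))"

definition ml_norm ::
  "nat \<Rightarrow> 'a set \<Rightarrow> ('a \<Rightarrow> real) \<Rightarrow> ('b \<Rightarrow> real) \<Rightarrow> ((nat \<Rightarrow> 'a) \<Rightarrow> 'b) \<Rightarrow> real" where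
  "ml_norm k VA NA NB M = Sup {NB (M h) | h. \<forall>i<k. h i \<in> VA \<and> NA (h i) \<le> 1}"

definition norm_open :: "'a::real_vector set \<Rightarrow> ('a \<Rightarrow> real) \<Rightarrow> 'a set \<Rightarrow> bool" where
  "norm_open VA NA U \<longleftrightarrow> U \<subseteq> VA \<and>
     (\<forall>x\<in>U. \<exists>e>0. \<forall>y\<in>VA. NA (y - x) < e \<longrightarrow> y \<in> U)"

definition is_Cr ::
  "nat \<Rightarrow> 'a::real_vector set \<Rightarrow> ('a \<Rightarrow> real) \<Rightarrow> 'b::real_vector set \<Rightarrow> ('b \<Rightarrow> real)
     \<Rightarrow> 'a set \<Rightarrow> ('a \<Rightarrow> 'b) \<Rightarrow> bool" where
  "is_Cr r VA NA VB NB U F \<longleftrightarrow>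
     norm_open VA NA U \<and> (\<forall>x\<in>U. F x \<in> VB) \<and>
     (\<exists>D :: nat \<Rightarrow> 'a \<Rightarrow> (nat \<Rightarrow> 'a) \<Rightarrow> 'b.
        (\<forall>x\<in>U. \<forall>h. D 0 x h = F x) \<and>
        (\<forall>k\<le>r. \<forall>x\<in>U. ml_bounded k VA NA VB NB (D k x)) \<and>
        (\<forall>k<r. \<forall>x\<in>U. \<forall>e>0. \<exists>d>0. \<forall>y\<in>U. NA (y - x) < d \<longrightarrow>
            ml_norm k VA NA NB (\<lambda>h. D k y h - D k x h - D (Suc k) x (h(k := y - x)))
              \<le> e * NA (y - x)) \<and>
        (\<forall>k\<le>r. \<forall>x\<in>U. \<forall>e>0. \<exists>d>0. \<forall>y\<in>U. NA (y - x) < d \<longrightarrow>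
            ml_norm k VA NA NB (\<lambda>h. D k y h - D k x h) < e))"

definition pderiv_dir :: "'n::finite \<Rightarrow> (real^'n \<Rightarrow> real) \<Rightarrow> real^'n \<Rightarrow> real" where
  "pderiv_dir i g x = deriv (\<lambda>t. g (x + t *\<^sub>R axis i 1)) 0"

fun pd :: "'n::finite list \<Rightarrow> (real^'n \<Rightarrow> real) \<Rightarrow> real^'n \<Rightarrow> real" where
  "pd [] g = g"
| "pd (i # is) g = pderiv_dir i (pd is g)"

definition Ck_b :: "nat \<Rightarrow> (real^'n::finite \<Rightarrow> real) \<Rightarrow> bool" where
  "Ck_b k g \<longleftrightarrow>
     (\<forall>is i x. length is < k \<longrightarrow>
        ((\<lambda>t. pd is g (x + t *\<^sub>R axis i 1)) has_real_derivative pd (i # is) g x) (at 0)) \<and>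
     (\<forall>is. length is \<le> k \<longrightarrow> continuous_on UNIV (pd is g) \<and> bounded (range (pd is g)))"

definition ck_norm :: "nat \<Rightarrow> (real^'n::finite \<Rightarrow> real) \<Rightarrow> real" where
  "ck_norm k g = (SUP is \<in> {is. length is \<le> k}. SUP x. \<bar>pd is g x\<bar>)"

definition hoelder_semi :: "nat \<Rightarrow> real \<Rightarrow> (real^'n::finite \<Rightarrow> real) \<Rightarrow> real" where
  "hoelder_semi k \<gamma> g = Sup {\<bar>pd is g x - pd is g y\<bar> / norm (x - y) powr \<gamma> | is x y.
                                length is = k \<and> x \<noteq> y}"

definition hk :: "real \<Rightarrow> nat" where "hk m = nat \<lfloor>m\<rfloor>"
definition hgam :: "real \<Rightarrow> real" where "hgam m = m - of_int \<lfloor>m\<rfloor>"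

definition Cm_b :: "real \<Rightarrow> (real^'n::finite \<Rightarrow> real) \<Rightarrow> bool" where
  "Cm_b m g \<longleftrightarrow> Ck_b (hk m) g \<and>
     (hgam m > 0 \<longrightarrow> (\<exists>C. \<forall>is x y. length is = hk m \<longrightarrow>
          \<bar>pd is g x - pd is g y\<bar> \<le> C * norm (x - y) powr hgam m))"

definition Cm_norm :: "real \<Rightarrow> (real^'n::finite \<Rightarrow> real) \<Rightarrow> real" where
  "Cm_norm m g = ck_norm (hk m) g + (if hgam m = 0 then 0 else hoelder_semi (hk m) (hgam m) g)"

definition Cmv_b :: "real \<Rightarrow> (real^'n::finite \<Rightarrow> real^'n) \<Rightarrow> bool" where
  "Cmv_b m f \<longleftrightarrow> (\<forall>j. Cm_b m (\<lambda>x. f x $ j))"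

definition Cmv_norm :: "real \<Rightarrow> (real^'n::finite \<Rightarrow> real^'n) \<Rightarrow> real" where
  "Cmv_norm m f = Max (range (\<lambda>j. Cm_norm m (\<lambda>x. f x $ j)))"

definition Cinfv_b :: "(real^'n::finite \<Rightarrow> real^'n) \<Rightarrow> bool" where
  "Cinfv_b f \<longleftrightarrow> (\<forall>k::nat. Cmv_b (real k) f)"

definition cmv_b :: "real \<Rightarrow> (real^'n::finite \<Rightarrow> real^'n) set" where
  "cmv_b m = {f. Cmv_b m f \<and>
     (\<forall>e>0. \<exists>g. Cinfv_b g \<and> Cmv_norm m (\<lambda>x. f x - g x) < e)}"

text \<open>C^m_ap: the set of translates is precompact (relatively compact) in C^m_b.\<close>
definition Cmv_ap :: "real \<Rightarrow> (real^'n::finite \<Rightarrow> real^'n) set" where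
  "Cmv_ap m = {f. Cmv_b m f \<and>
     (\<forall>s :: nat \<Rightarrow> real^'n. \<exists>\<sigma> g. strict_mono \<sigma> \<and> Cmv_b m g \<and>
        (\<lambda>k. Cmv_norm m (\<lambda>x. f (x + s (\<sigma> k)) - g x)) \<longlonglongrightarrow> 0)}"

definition jac :: "(real^'n::finite \<Rightarrow> real^'n) \<Rightarrow> real^'n \<Rightarrow> real^'n^'n" where
  "jac f x = (\<chi> i j. pd [j] (\<lambda>y. f y $ i) x)"

definition chart :: "(real^'n::finite \<Rightarrow> real^'n) \<Rightarrow> real^'n \<Rightarrow> real^'n" where
  "chart \<phi> = (\<lambda>x. \<phi> x - x)"

definition diff_b :: "real \<Rightarrow> (real^'n::finite \<Rightarrow> real^'n) set" where
  "diff_b m = {\<phi>. chart \<phi> \<in> cmv_b m \<and>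
      (\<exists>c>0. \<forall>x. c \<le> det (mat 1 + jac (chart \<phi>) x))}"

definition Diff_ap :: "real \<Rightarrow> (real^'n::finite \<Rightarrow> real^'n) set" where
  "Diff_ap m = {\<phi>. chart \<phi> \<in> Cmv_ap m \<and>
      (\<exists>c>0. \<forall>x. c \<le> det (mat 1 + jac (chart \<phi>) x))}"

end

theory Submission
  imports Defs
begin

text \<open>For fixed \<open>F\<close>, the map \<open>g \<mapsto> F \<circ> (id + g)\<close> into $C^{p+\gamma}_b$ is Lipschitz if \<open>F\<close> has one more
  bounded derivative, and it has a quadratic first-order remainder if \<open>F\<close> has two more. An almost
  periodic function is a limit of smooth almost periodic ones: precompactness of the set of translates
  makes translation norm-continuous, so that mollification converges in the full norm. Approximating
  \<open>F\<close> therefore gives continuity of composition without loss of derivatives and differentiability with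
  the loss of a single one, and it shows that \<open>C\<^sub>a\<^sub>p\<close> is contained in the little Hoelder space.

  Maps of class $C^r$ are handled as families of multilinear maps, closed under sums, products,
  reciprocals and composition, whose derivatives are families with one more slot.

  A map \<open>\<phi> = id + f\<close> with Jacobian determinant bounded below is a proper local homeomorphism, hence a
  bijection. Its inverse \<open>id + g\<close> satisfies \<open>g = - f \<circ> (id + g)\<close>, from which almost periodicity of \<open>g\<close>
  and continuity of \<open>f \<mapsto> g\<close> follow; the derivative in direction \<open>u\<close> is
  $-((I + df)^{-1} u) \circ \phi^{-1}$, and induction on \<open>r\<close> gives smoothness.\<close>

subsection \<open>Partial derivatives\<close>

text \<open>The obstacle is that composition is not continuous on the full Hoelder space: without a
  spare derivative, \<open>F \<circ> (id + g)\<close> can depend discontinuously on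
  \<open>g\<close>. Approximation by smooth functions repairs this for one fixed \<open>F\<close>,
  but not uniformly over a bounded set of functions, and derivatives measured in operator norm
  always involve such a set, the values of a multilinear map on the unit ball. Hence the constants
  are linear in the bound of \<open>F\<close>, and the presence of slots costs one further
  derivative; the first differentiation creates a slot but also lowers the remaining smoothness by
  one, so the orders \<open>m + r\<close> and \<open>m\<close> balance. Inversion has a difficulty
  of its own: its equation controls differences of inverses at first only in the supremum norm, so
  Hoelder control at the lowest order comes from interpolation with a uniform Lipschitz bound, and
  Lipschitz dependence on \<open>f\<close> from absorbing a small remainder. Continuity of the group
  operations, which makes the subgroup topological, is contained in the smoothness statements at
  \<open>r = 0\<close>.\<close>

definition has_pd :: "'n::finite \<Rightarrow> (real^'n \<Rightarrow> real) \<Rightarrow> (real^'n \<Rightarrow> real) \<Rightarrow> bool" where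
  "has_pd i f f' \<longleftrightarrow> (\<forall>x. ((\<lambda>t. f (x + t *\<^sub>R axis i 1)) has_real_derivative f' x) (at 0))"

lemma has_pd_pderiv_dir: "has_pd i f f' \<Longrightarrow> pderiv_dir i f = f'"
  by (auto simp: has_pd_def pderiv_dir_def fun_eq_iff intro: DERIV_imp_deriv)

lemma has_pd_line:
  assumes "has_pd i f f'"
  shows "((\<lambda>t. f (x + t *\<^sub>R axis i 1)) has_real_derivative f' (x + t *\<^sub>R axis i 1)) (at t)"
proof -
  have "((\<lambda>s. f ((x + t *\<^sub>R axis i 1) + s *\<^sub>R axis i 1)) has_real_derivative f' (x + t *\<^sub>R axis i 1)) (at 0)"
    using assms by (simp add: has_pd_def)
  then have "((\<lambda>s. f (x + (t + s) *\<^sub>R axis i 1)) has_real_derivative f' (x + t *\<^sub>R axis i 1)) (at 0)"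
    by (simp add: algebra_simps)
  then show ?thesis
    using DERIV_shift[of "\<lambda>s. f (x + s *\<^sub>R axis i 1)" _ 0 t] by (simp add: add.commute)
qed

lemma has_pd_const [simp]: "has_pd i (\<lambda>x. c) (\<lambda>x. 0)"
  by (auto simp: has_pd_def)

lemma has_pd_add: "has_pd i f f' \<Longrightarrow> has_pd i g g' \<Longrightarrow> has_pd i (\<lambda>x. f x + g x) (\<lambda>x. f' x + g' x)"
  by (auto simp: has_pd_def intro!: DERIV_add)

lemma has_pd_diff: "has_pd i f f' \<Longrightarrow> has_pd i g g' \<Longrightarrow> has_pd i (\<lambda>x. f x - g x) (\<lambda>x. f' x - g' x)"
  by (auto simp: has_pd_def intro!: DERIV_diff)

lemma has_pd_cmult: "has_pd i f f' \<Longrightarrow> has_pd i (\<lambda>x. a * f x) (\<lambda>x. a * f' x)"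
  by (auto simp: has_pd_def intro!: DERIV_cmult)

lemma has_pd_mult:
  "has_pd i f f' \<Longrightarrow> has_pd i g g' \<Longrightarrow> has_pd i (\<lambda>x. f x * g x) (\<lambda>x. f x * g' x + f' x * g x)"
  unfolding has_pd_def
  by (auto intro!: derivative_eq_intros)

lemma has_pd_sum:
  "(\<And>j. j \<in> S \<Longrightarrow> has_pd i (f j) (f' j)) \<Longrightarrow> has_pd i (\<lambda>x. \<Sum>j\<in>S. f j x) (\<lambda>x. \<Sum>j\<in>S. f' j x)"
  unfolding has_pd_def by (auto intro!: DERIV_sum)

lemma has_pd_translate: "has_pd i f f' \<Longrightarrow> has_pd i (\<lambda>x. f (x + c)) (\<lambda>x. f' (x + c))"
  unfolding has_pd_def
proof
  fix x assume *: "\<forall>x. ((\<lambda>t. f (x + t *\<^sub>R axis i 1)) has_real_derivative f' x) (at 0)"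
  have "((\<lambda>t. f ((x + c) + t *\<^sub>R axis i 1)) has_real_derivative f' (x + c)) (at 0)"
    using * by blast
  then show "((\<lambda>t. f (x + t *\<^sub>R axis i 1 + c)) has_real_derivative f' (x + c)) (at 0)"
    by (simp add: algebra_simps)
qed

lemma has_pd_recip:
  assumes "has_pd i d d'" "\<And>x. d x \<noteq> 0"
  shows "has_pd i (\<lambda>x. 1 / d x) (\<lambda>x. - ((1 / d x) * (1 / d x) * d' x))"
  unfolding has_pd_def
proof
  fix x
  show "((\<lambda>t. 1 / d (x + t *\<^sub>R axis i 1)) has_real_derivative - ((1 / d x) * (1 / d x) * d' x)) (at 0)"
    using assms unfolding has_pd_def
    by (auto intro!: derivative_eq_intros simp: field_simps power2_eq_square)
qed

text \<open>The increment is split into one-coordinate steps, each handled by the mean value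
  inequality; continuity of the partial derivatives at \<open>x\<close> makes the errors small
  relative to the norm of the increment.\<close>

lemma C1_has_derivative:
  fixes f :: "real^'n::finite \<Rightarrow> real"
  assumes pd: "\<And>i. has_pd i f (f' i)" and cont: "\<And>i. continuous_on UNIV (f' i)"
  shows "(f has_derivative (\<lambda>h. \<Sum>i\<in>UNIV. h $ i * f' i x)) (at x)"
proof (rule has_derivativeI)
  show "bounded_linear (\<lambda>h. \<Sum>i\<in>UNIV. h $ i * f' i x)"
    by (intro bounded_linear_sum bounded_linear_compose[OF bounded_linear_mult_left bounded_linear_vec_nth])
  show "(\<lambda>y. ((f y - f x) - (\<Sum>i\<in>UNIV. (y - x) $ i * f' i x)) /\<^sub>R norm (y - x)) \<midarrow>x\<rightarrow> 0"
  proof (rule LIM_I)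
    fix e :: real assume e: "e > 0"
    define n where "n = real CARD('n)"
    have n: "n > 0" by (simp add: n_def)
    define e' where "e' = e / (2 * n)"
    have e': "e' > 0" using e n by (simp add: e'_def)
    have "\<forall>i. \<exists>d>0. \<forall>z. norm (z - x) < d \<longrightarrow> \<bar>f' i z - f' i x\<bar> < e'"
      using cont e' unfolding continuous_on_iff by (auto simp: dist_norm)
    then obtain d where d: "\<And>i. d i > 0" "\<And>i z. norm (z - x) < d i \<Longrightarrow> \<bar>f' i z - f' i x\<bar> < e'"
      by metis
    define D where "D = Min (range d)"
    have D: "D > 0" "\<And>i. D \<le> d i" using d(1) by (auto simp: D_def)
    have main: "\<bar>f y - f x - (\<Sum>i\<in>UNIV. (y - x) $ i * f' i x)\<bar> \<le> n * e' * norm (y - x)"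
      if y: "norm (y - x) < D" for y
    proof -
      define h where "h = y - x"
      \<comment> \<open>\<open>P S\<close> keeps the coordinates of \<open>h\<close> in
        \<open>S\<close>; the induction adds one coordinate at a time and collects one error
        \<open>e' * norm h\<close> per step.\<close>
      define P where "P = (\<lambda>S. (\<chi> i. if i \<in> S then h $ i else 0) :: real^'n)"
      have "\<bar>f (x + P S) - f x - (\<Sum>i\<in>S. h $ i * f' i x)\<bar> \<le> real (card S) * e' * norm h" if "finite S" for S
        using that
      proof induction
        case empty
        have "P {} = 0" by (simp add: P_def vec_eq_iff)
        then show ?case by simp
      next
        case (insert i S)
        have Pi: "P (insert i S) = P S + h $ i *\<^sub>R axis i 1"
          using insert by (auto simp: P_def vec_eq_iff axis_def)
        \<comment> \<open>Subtracting the linear term leaves a function whose derivative is the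
          oscillation of \<open>f' i\<close>, at most \<open>e'\<close> on the segment since
          truncating \<open>h\<close> does not increase its norm.\<close>
        let ?u = "\<lambda>t. f ((x + P S) + t *\<^sub>R axis i 1) - t * f' i x"
        have "\<bar>?u (h $ i) - ?u 0\<bar> \<le> e' * \<bar>h $ i - 0\<bar>"
        proof -
          have "norm (?u (h $ i) - ?u 0) \<le> e' * norm (h $ i - 0)"
          proof (rule field_differentiable_bound[where S = "closed_segment 0 (h $ i)" and f' = "\<lambda>t. f' i ((x + P S) + t *\<^sub>R axis i 1) - f' i x"])
            fix t assume t: "t \<in> closed_segment 0 (h $ i)"
            have "\<bar>t\<bar> \<le> \<bar>h $ i\<bar>" using t by (auto simp: closed_segment_eq_real_ivl split: if_splits)
            then have "norm (P S + t *\<^sub>R axis i 1) \<le> norm h"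
              using insert by (intro norm_le_componentwise_cart) (auto simp: P_def axis_def)
            then have "norm (((x + P S) + t *\<^sub>R axis i 1) - x) < d i"
              using y D(2)[of i] by (simp add: h_def algebra_simps)
            then show "norm (f' i ((x + P S) + t *\<^sub>R axis i 1) - f' i x) \<le> e'"
              using d(2)[of "(x + P S) + t *\<^sub>R axis i 1" i] by simp
          next
            fix t
            show "(?u has_field_derivative f' i ((x + P S) + t *\<^sub>R axis i 1) - f' i x) (at t within closed_segment 0 (h $ i))"
              by (rule has_field_derivative_at_within)
                (auto intro!: derivative_eq_intros has_pd_line[OF pd])
          qed auto
          then show ?thesis by simp
        qed
        also have "e' * \<bar>h $ i - 0\<bar> \<le> e' * norm h"
          using e' component_le_norm_cart[of h i] by simp
        finally have "\<bar>f (x + P (insert i S)) - f (x + P S) - h $ i * f' i x\<bar> \<le> e' * norm h"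
          by (simp add: Pi algebra_simps)
        with insert show ?case by (simp add: algebra_simps)
      qed
      from this[of UNIV] have "\<bar>f (x + P UNIV) - f x - (\<Sum>i\<in>UNIV. h $ i * f' i x)\<bar> \<le> n * e' * norm h"
        by (simp add: n_def)
      moreover have "P UNIV = h" by (simp add: P_def vec_eq_iff)
      ultimately show ?thesis by (simp add: h_def)
    qed
    show "\<exists>s>0. \<forall>y. y \<noteq> x \<and> norm (y - x) < s \<longrightarrow>
        norm (((f y - f x) - (\<Sum>i\<in>UNIV. (y - x) $ i * f' i x)) /\<^sub>R norm (y - x) - 0) < e"
    proof (intro exI[of _ D] conjI allI impI)
      fix y assume y: "y \<noteq> x \<and> norm (y - x) < D"
      have "n * e' < e" using e n by (simp add: e'_def)
      then have "n * e' * norm (y - x) < e * norm (y - x)" using y by (intro mult_strict_right_mono) auto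
      with main[of y] y have "\<bar>f y - f x - (\<Sum>i\<in>UNIV. (y - x) $ i * f' i x)\<bar> < e * norm (y - x)" by linarith
      with y show "norm (((f y - f x) - (\<Sum>i\<in>UNIV. (y - x) $ i * f' i x)) /\<^sub>R norm (y - x) - 0) < e"
        by (simp add: divide_simps mult.commute)
    qed (use D in auto)
  qed
qed

lemma has_pd_of_has_derivative:
  fixes f :: "real^'n::finite \<Rightarrow> real"
  assumes "\<And>x. (f has_derivative (\<lambda>h. \<Sum>i\<in>UNIV. h $ i * f' i x)) (at x)"
  shows "has_pd i f (f' i)"
  unfolding has_pd_def
proof
  fix x :: "real^'n"
  have "((\<lambda>t. x + t *\<^sub>R axis i 1) has_derivative (\<lambda>t. t *\<^sub>R axis i 1)) (at (0::real))"
    by (auto intro!: derivative_eq_intros)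
  moreover have "(f has_derivative (\<lambda>h. \<Sum>i\<in>UNIV. h $ i * f' i x)) (at (x + 0 *\<^sub>R axis i 1))"
    using assms[of x] by simp
  ultimately have "((\<lambda>t. f (x + t *\<^sub>R axis i 1)) has_derivative
      (\<lambda>t. \<Sum>j\<in>UNIV. (t *\<^sub>R axis i 1) $ j * f' j x)) (at 0)"
    by (rule has_derivative_compose)
  moreover have "(\<lambda>t::real. \<Sum>j\<in>UNIV. (t *\<^sub>R axis i 1 :: real^'n) $ j * f' j x) = (\<lambda>t. f' i x * t)"
    by (auto simp: axis_def fun_eq_iff if_distrib[of "\<lambda>u. _ * u * _"] cong: if_cong)
  ultimately show "((\<lambda>t. f (x + t *\<^sub>R axis i 1)) has_real_derivative f' i x) (at 0)"
    by (simp add: has_field_derivative_def)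
qed

text \<open>The mean value theorem is applied twice: to the increment in direction \<open>j\<close>
  as a function of the \<open>i\<close>-th coordinate, then to \<open>fi\<close> in direction
  \<open>j\<close>. The left side is symmetric in \<open>i\<close> and \<open>j\<close>, which
  yields the equality of mixed derivatives.\<close>

lemma mixed_difference:
  fixes f :: "real^'n::finite \<Rightarrow> real" and x :: "real^'n" and s :: real
  assumes "has_pd i f fi" "has_pd j fi fij" "s > (0::real)"
  obtains \<theta> \<theta>' where "0 < \<theta>" "\<theta> < s" "0 < \<theta>'" "\<theta>' < s"
    "f (x + s *\<^sub>R axis i 1 + s *\<^sub>R axis j 1) - f (x + s *\<^sub>R axis i 1) - f (x + s *\<^sub>R axis j 1) + f x
      = s * s * fij (x + \<theta> *\<^sub>R axis i 1 + \<theta>' *\<^sub>R axis j 1)"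
proof -
  let ?u = "\<lambda>t. f ((x + s *\<^sub>R axis j 1) + t *\<^sub>R axis i 1) - f (x + t *\<^sub>R axis i 1)"
  have "\<exists>\<theta>. 0 < \<theta> \<and> \<theta> < s \<and> ?u s - ?u 0 = (s - 0) * (fi ((x + s *\<^sub>R axis j 1) + \<theta> *\<^sub>R axis i 1) - fi (x + \<theta> *\<^sub>R axis i 1))"
    by (rule MVT2) (auto intro!: assms DERIV_diff has_pd_line)
  then obtain \<theta> where \<theta>: "0 < \<theta>" "\<theta> < s"
    "?u s - ?u 0 = s * (fi ((x + s *\<^sub>R axis j 1) + \<theta> *\<^sub>R axis i 1) - fi (x + \<theta> *\<^sub>R axis i 1))" by auto
  let ?w = "\<lambda>t. fi ((x + \<theta> *\<^sub>R axis i 1) + t *\<^sub>R axis j 1)"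
  have "\<exists>\<theta>'. 0 < \<theta>' \<and> \<theta>' < s \<and> ?w s - ?w 0 = (s - 0) * fij ((x + \<theta> *\<^sub>R axis i 1) + \<theta>' *\<^sub>R axis j 1)"
    by (rule MVT2) (auto intro!: assms has_pd_line)
  then obtain \<theta>' where \<theta>': "0 < \<theta>'" "\<theta>' < s"
    "?w s - ?w 0 = s * fij ((x + \<theta> *\<^sub>R axis i 1) + \<theta>' *\<^sub>R axis j 1)" by auto
  show ?thesis
    by (rule that[of \<theta> \<theta>']) (use \<theta> \<theta>' in \<open>auto simp: algebra_simps\<close>)
qed

lemma mixed_partials_commute:
  fixes f :: "real^'n::finite \<Rightarrow> real"
  assumes pd: "has_pd i f fi" "has_pd j fi fij" "has_pd j f fj" "has_pd i fj fji"
    and cont: "continuous_on UNIV fij" "continuous_on UNIV fji"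
  shows "fij x = fji x"
proof (rule ccontr)
  assume "fij x \<noteq> fji x"
  define e where "e = \<bar>fij x - fji x\<bar> / 2"
  have e: "e > 0" using \<open>fij x \<noteq> fji x\<close> by (simp add: e_def)
  obtain d1 where d1: "d1 > 0" "\<And>z. norm (z - x) < d1 \<Longrightarrow> \<bar>fij z - fij x\<bar> < e"
    using cont(1)[unfolded continuous_on_iff, rule_format, of x e] e by (auto simp: dist_norm)
  obtain d2 where d2: "d2 > 0" "\<And>z. norm (z - x) < d2 \<Longrightarrow> \<bar>fji z - fji x\<bar> < e"
    using cont(2)[unfolded continuous_on_iff, rule_format, of x e] e by (auto simp: dist_norm)
  define s where "s = min d1 d2 / 2"
  have s: "s > 0" using d1 d2 by (simp add: s_def)
  have small: "norm ((x + \<theta> *\<^sub>R axis k 1 + \<theta>' *\<^sub>R axis l 1) - x) < min d1 d2"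
    if "0 < \<theta>" "\<theta> < s" "0 < \<theta>'" "\<theta>' < s" for \<theta> \<theta>' k l
  proof -
    have "norm (\<theta> *\<^sub>R axis k 1 + \<theta>' *\<^sub>R axis l (1::real)) \<le> \<bar>\<theta>\<bar> + \<bar>\<theta>'\<bar>"
      by (rule norm_triangle_le) simp
    also have "\<dots> < min d1 d2" using that by (simp add: s_def)
    finally show ?thesis by (simp add: algebra_simps)
  qed
  obtain \<theta> \<theta>' where 1: "0 < \<theta>" "\<theta> < s" "0 < \<theta>'" "\<theta>' < s"
    "f (x + s *\<^sub>R axis i 1 + s *\<^sub>R axis j 1) - f (x + s *\<^sub>R axis i 1) - f (x + s *\<^sub>R axis j 1) + f x
      = s * s * fij (x + \<theta> *\<^sub>R axis i 1 + \<theta>' *\<^sub>R axis j 1)"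
    using mixed_difference[OF pd(1,2) s] by blast
  obtain \<eta> \<eta>' where 2: "0 < \<eta>" "\<eta> < s" "0 < \<eta>'" "\<eta>' < s"
    "f (x + s *\<^sub>R axis j 1 + s *\<^sub>R axis i 1) - f (x + s *\<^sub>R axis j 1) - f (x + s *\<^sub>R axis i 1) + f x
      = s * s * fji (x + \<eta> *\<^sub>R axis j 1 + \<eta>' *\<^sub>R axis i 1)"
    using mixed_difference[OF pd(3,4) s] by blast
  have "s * s * fij (x + \<theta> *\<^sub>R axis i 1 + \<theta>' *\<^sub>R axis j 1) = s * s * fji (x + \<eta> *\<^sub>R axis j 1 + \<eta>' *\<^sub>R axis i 1)"
    using 1(5) 2(5) by (simp add: algebra_simps)
  then have "fij (x + \<theta> *\<^sub>R axis i 1 + \<theta>' *\<^sub>R axis j 1) = fji (x + \<eta> *\<^sub>R axis j 1 + \<eta>' *\<^sub>R axis i 1)"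
    using s by simp
  moreover have "\<bar>fij (x + \<theta> *\<^sub>R axis i 1 + \<theta>' *\<^sub>R axis j 1) - fij x\<bar> < e"
    using small[OF 1(1-4)] by (intro d1) simp
  moreover have "\<bar>fji (x + \<eta> *\<^sub>R axis j 1 + \<eta>' *\<^sub>R axis i 1) - fji x\<bar> < e"
    using small[OF 2(1-4)] by (intro d2) simp
  ultimately have "\<bar>fij x - fji x\<bar> < 2 * e" by linarith
  then show False by (simp add: e_def)
qed

section \<open>Composition with a displacement of the identity\<close>

definition shift :: "('n::finite \<Rightarrow> real^'n \<Rightarrow> real) \<Rightarrow> real^'n \<Rightarrow> real^'n" where
  "shift g x = x + (\<chi> j. g j x)"

lemma shift_nth [simp]: "shift g x $ j = x $ j + g j x"
  by (simp add: shift_def)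

lemma continuous_shift: "(\<And>j. continuous_on UNIV (g j)) \<Longrightarrow> continuous_on UNIV (shift g)"
  unfolding shift_def by (intro continuous_intros) auto

text \<open>The chain rule with the identity part split off: the Jacobian of \<open>shift g\<close>
  is the unit matrix plus that of \<open>g\<close>, hence the isolated term
  \<open>f' i\<close>.\<close>

lemma has_pd_comp_shift:
  fixes f :: "real^'n::finite \<Rightarrow> real"
  assumes pd: "\<And>i. has_pd i f (f' i)" and cont: "\<And>i. continuous_on UNIV (f' i)"
    and g: "\<And>j. has_pd i (g j) (g' j)"
  shows "has_pd i (\<lambda>x. f (shift g x)) (\<lambda>x. f' i (shift g x) + (\<Sum>j\<in>UNIV. f' j (shift g x) * g' j x))"
  unfolding has_pd_def
proof
  fix x :: "real^'n"
  let ?v = "(axis i 1 + (\<chi> j. g' j x)) :: real^'n"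
  have vec: "((\<lambda>t. \<chi> j. g j (x + t *\<^sub>R axis i 1)) has_derivative (\<lambda>t. \<chi> j. t * g' j x)) (at 0)"
  proof (subst has_derivative_componentwise_within, intro ballI)
    fix b :: "real^'n" assume "b \<in> Basis"
    then obtain j where b: "b = axis j 1" by (auto simp: Basis_vec_def)
    have "((\<lambda>t. g j (x + t *\<^sub>R axis i 1)) has_derivative (\<lambda>t. t * g' j x)) (at 0)"
      using g[of j] unfolding has_pd_def has_field_derivative_def by (simp add: mult_commute_abs)
    then show "((\<lambda>t. (\<chi> j. g j (x + t *\<^sub>R axis i 1)) \<bullet> b) has_derivative (\<lambda>t. (\<chi> j. t * g' j x) \<bullet> b)) (at 0)"
      by (simp add: b inner_axis)
  qed
  have "((\<lambda>t. shift g (x + t *\<^sub>R axis i 1)) has_derivative (\<lambda>t. t *\<^sub>R ?v)) (at 0)"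
    unfolding shift_def
    by (rule derivative_eq_intros vec | simp)+ (auto simp: fun_eq_iff vec_eq_iff algebra_simps)
  moreover have "(f has_derivative (\<lambda>h. \<Sum>i\<in>UNIV. h $ i * f' i (shift g x))) (at (shift g (x + 0 *\<^sub>R axis i 1)))"
    using C1_has_derivative[OF pd cont] by simp
  ultimately have "((\<lambda>t. f (shift g (x + t *\<^sub>R axis i 1))) has_derivative
      (\<lambda>t. \<Sum>j\<in>UNIV. (t *\<^sub>R ?v) $ j * f' j (shift g x))) (at 0)"
    by (rule has_derivative_compose)
  moreover have "(\<Sum>j\<in>UNIV. (t *\<^sub>R ?v) $ j * f' j (shift g x)) =
      (f' i (shift g x) + (\<Sum>j\<in>UNIV. f' j (shift g x) * g' j x)) * t" for t
  proof -
    have "(\<Sum>j\<in>UNIV. (t *\<^sub>R ?v) $ j * f' j (shift g x)) = (\<Sum>j\<in>UNIV. t * (if j = i then f' j (shift g x) else 0) + t * (f' j (shift g x) * g' j x))"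
      by (intro sum.cong) (auto simp: axis_def algebra_simps)
    also have "\<dots> = t * f' i (shift g x) + t * (\<Sum>j\<in>UNIV. f' j (shift g x) * g' j x)"
      by (simp add: sum.distrib sum_distrib_left[symmetric])
    finally show ?thesis by (simp add: algebra_simps)
  qed
  ultimately show "((\<lambda>t. f (shift g (x + t *\<^sub>R axis i 1))) has_real_derivative
        f' i (shift g x) + (\<Sum>j\<in>UNIV. f' j (shift g x) * g' j x)) (at 0)"
    by (simp add: has_field_derivative_def)
qed

lemma C1_lipschitz:
  fixes f :: "real^'n::finite \<Rightarrow> real"
  assumes pd: "\<And>i. has_pd i f (f' i)" and cont: "\<And>i. continuous_on UNIV (f' i)"
    and bound: "\<And>i x. \<bar>f' i x\<bar> \<le> c"
  shows "\<bar>f x - f y\<bar> \<le> real CARD('n) * c * norm (x - y)"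
proof -
  have "norm (f x - f y) \<le> (real CARD('n) * c) * norm (x - y)"
  proof (rule differentiable_bound[where S = UNIV and f' = "\<lambda>x h. \<Sum>i\<in>UNIV. h $ i * f' i x"])
    fix x :: "real^'n"
    show "(f has_derivative (\<lambda>h. \<Sum>i\<in>UNIV. h $ i * f' i x)) (at x within UNIV)"
      using C1_has_derivative[OF pd cont] by simp
    show "onorm (\<lambda>h. \<Sum>i\<in>UNIV. h $ i * f' i x) \<le> real CARD('n) * c"
    proof (rule onorm_le)
      fix h :: "real^'n"
      have "norm (\<Sum>i\<in>UNIV. h $ i * f' i x) \<le> (\<Sum>i\<in>(UNIV::'n set). norm h * c)"
        by (rule sum_norm_le) (auto simp: abs_mult intro!: mult_mono component_le_norm_cart bound)
      then show "norm (\<Sum>i\<in>UNIV. h $ i * f' i x) \<le> real CARD('n) * c * norm h"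
        by (simp add: algebra_simps)
    qed
  qed auto
  then show ?thesis by simp
qed

subsection \<open>Hoelder bounds\<close>

definition lip :: "real \<Rightarrow> (real^'n::finite \<Rightarrow> real^'n) \<Rightarrow> bool" where
  "lip L \<psi> \<longleftrightarrow> (\<forall>x y. norm (\<psi> x - \<psi> y) \<le> L * norm (x - y))"

lemma lip_mono:
  assumes "lip L \<psi>" "L \<le> L'" shows "lip L' \<psi>"
  unfolding lip_def
proof (intro allI)
  fix x y
  have "norm (\<psi> x - \<psi> y) \<le> L * norm (x - y)" using assms by (auto simp: lip_def)
  also have "\<dots> \<le> L' * norm (x - y)" using assms by (intro mult_right_mono) auto
  finally show "norm (\<psi> x - \<psi> y) \<le> L' * norm (x - y)" .
qed

text \<open>The constant of the product estimate. At order 0 the factor 2 counts the two terms of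
  the Hoelder seminorm of a product. Each further order has two Leibniz terms, and in each the
  undifferentiated factor is lowered by one order at the cost \<open>2 * CARD('n)\<close>.\<close>

definition Kmul :: "'n::finite itself \<Rightarrow> nat \<Rightarrow> real" where
  "Kmul _ p = 2 * (4 * real CARD('n)) ^ p"

lemma Kmul_pos: "Kmul T p > 0"
  by (simp add: Kmul_def)

text \<open>A bound for the norm of $C^{p+\gamma}_b$, kept as a predicate so that no suprema are needed.
  For \<open>\<gamma> = 0\<close> the Hoelder clause only says that the oscillation is at most \<open>c\<close>.\<close>
locale hoelder =
  fixes \<gamma> :: real
  assumes \<gamma>: "0 \<le> \<gamma>" "\<gamma> < 1"
begin

primrec bd :: "nat \<Rightarrow> real \<Rightarrow> (real^'n::finite \<Rightarrow> real) \<Rightarrow> bool" where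
  "bd 0 c f \<longleftrightarrow> continuous_on UNIV f \<and> (\<forall>x. \<bar>f x\<bar> \<le> c) \<and>
     (\<forall>x y. \<bar>f x - f y\<bar> \<le> c * norm (x - y) powr \<gamma>)"
| "bd (Suc p) c f \<longleftrightarrow> continuous_on UNIV f \<and> (\<forall>x. \<bar>f x\<bar> \<le> c) \<and>
     (\<forall>i. has_pd i f (pderiv_dir i f) \<and> bd p c (pderiv_dir i f))"

lemma bd_cont: "bd p c f \<Longrightarrow> continuous_on UNIV f"
  by (cases p) auto

lemma bd_abs: "bd p c f \<Longrightarrow> \<bar>f x\<bar> \<le> c"
  by (cases p) auto

lemma bd0_hoelder: "bd 0 c f \<Longrightarrow> \<bar>f x - f y\<bar> \<le> c * norm (x - y) powr \<gamma>"
  by simp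

lemma bd_nonneg: "bd p c f \<Longrightarrow> 0 \<le> c"
  using bd_abs[of p c f undefined] by simp

lemma bd_has_pd: "bd (Suc p) c f \<Longrightarrow> has_pd i f (pderiv_dir i f)"
  by simp

lemma bd_pd: "bd (Suc p) c f \<Longrightarrow> bd p c (pderiv_dir i f)"
  by simp

lemma bd_pd_cont: "bd (Suc p) c f \<Longrightarrow> continuous_on UNIV (pderiv_dir i f)"
  using bd_cont bd_pd by blast

lemma bd_SucI:
  assumes "continuous_on UNIV f" "\<And>x. \<bar>f x\<bar> \<le> c" "\<And>i. has_pd i f (f' i)" "\<And>i. bd p c (f' i)"
  shows "bd (Suc p) c f"
  using assms has_pd_pderiv_dir[OF assms(3)] by auto

lemma bd_mono: "bd p c f \<Longrightarrow> c \<le> d \<Longrightarrow> bd p d f"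
proof (induction p arbitrary: f)
  case 0
  have "c * norm (x - y) powr \<gamma> \<le> d * norm (x - y) powr \<gamma>" for x y :: "real^'a"
    using 0 by (intro mult_right_mono) auto
  with 0 show ?case by (fastforce intro: order_trans)
next
  case (Suc p)
  then show ?case by (auto intro: order_trans)
qed

lemma bd_zero: "0 \<le> c \<Longrightarrow> bd p c (\<lambda>x. 0)"
proof (induction p)
  case (Suc p)
  show ?case by (rule bd_SucI[where f' = "\<lambda>_ _. 0"]) (use Suc in auto)
qed auto

lemma bd_const: "bd p \<bar>a\<bar> (\<lambda>x. a)"
proof (cases p)
  case (Suc q)
  show ?thesis unfolding Suc by (rule bd_SucI[where f' = "\<lambda>_ _. 0"]) (auto intro: bd_zero)
qed auto

lemma bd_add: "bd p c f \<Longrightarrow> bd p d g \<Longrightarrow> bd p (c + d) (\<lambda>x. f x + g x)"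
proof (induction p arbitrary: f g)
  case 0
  show ?case
    unfolding bd.simps
  proof (intro conjI allI)
    fix x y
    show "\<bar>f x + g x\<bar> \<le> c + d"
      using bd_abs[OF 0(1), of x] bd_abs[OF 0(2), of x] by linarith
    show "\<bar>f x + g x - (f y + g y)\<bar> \<le> (c + d) * norm (x - y) powr \<gamma>"
      using bd0_hoelder[OF 0(1), of x y] bd0_hoelder[OF 0(2), of x y] by (simp add: distrib_right)
  next
    show "continuous_on UNIV (\<lambda>x. f x + g x)"
      by (intro continuous_on_add bd_cont[OF 0(1)] bd_cont[OF 0(2)])
  qed
next
  case (Suc p)
  show ?case
  proof (rule bd_SucI)
    fix x show "\<bar>f x + g x\<bar> \<le> c + d"
      using bd_abs[OF Suc.prems(1), of x] bd_abs[OF Suc.prems(2), of x] by linarith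
  next
    fix i
    show "has_pd i (\<lambda>x. f x + g x) (\<lambda>x. pderiv_dir i f x + pderiv_dir i g x)"
      by (intro has_pd_add bd_has_pd[OF Suc.prems(1)] bd_has_pd[OF Suc.prems(2)])
    show "bd p (c + d) (\<lambda>x. pderiv_dir i f x + pderiv_dir i g x)"
      by (intro Suc.IH bd_pd[OF Suc.prems(1)] bd_pd[OF Suc.prems(2)])
  next
    show "continuous_on UNIV (\<lambda>x. f x + g x)"
      by (intro continuous_on_add bd_cont[OF Suc.prems(1)] bd_cont[OF Suc.prems(2)])
  qed
qed

lemma bd_cmult: "bd p c f \<Longrightarrow> bd p (\<bar>a\<bar> * c) (\<lambda>x. a * f x)"
proof (induction p arbitrary: f)
  case 0
  have "\<bar>a * f x - a * f y\<bar> \<le> \<bar>a\<bar> * c * norm (x - y) powr \<gamma>" for x y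
  proof -
    have "\<bar>a\<bar> * \<bar>f x - f y\<bar> \<le> \<bar>a\<bar> * (c * norm (x - y) powr \<gamma>)" using 0 by (intro mult_left_mono) auto
    then show ?thesis by (simp add: abs_mult[symmetric] algebra_simps)
  qed
  with 0 show ?case by (auto intro!: continuous_intros simp: abs_mult mult_left_mono)
next
  case (Suc p)
  show ?case
    by (rule bd_SucI[where f' = "\<lambda>i x. a * pderiv_dir i f x"])
      (use Suc in \<open>auto intro!: continuous_intros has_pd_cmult simp: abs_mult mult_left_mono\<close>)
qed

lemma bd_minus: "bd p c f \<Longrightarrow> bd p c (\<lambda>x. - f x)"
  using bd_cmult[of p c f "-1"] by simp

lemma bd_diff: "bd p c f \<Longrightarrow> bd p d g \<Longrightarrow> bd p (c + d) (\<lambda>x. f x - g x)"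
  using bd_add[OF _ bd_minus, of p c f d g] by simp

lemma bd_sum: "(\<And>j. j \<in> S \<Longrightarrow> bd p (c j) (f j)) \<Longrightarrow> bd p (\<Sum>j\<in>S. c j) (\<lambda>x. \<Sum>j\<in>S. f j x)"
proof (induction S rule: infinite_finite_induct)
  case (insert j S)
  have "bd p (c j + (\<Sum>j\<in>S. c j)) (\<lambda>x. f j x + (\<Sum>j\<in>S. f j x))"
    by (rule bd_add[OF insert.prems insert.IH[OF insert.prems]]) auto
  with insert.hyps show ?case by simp
qed (auto intro: bd_zero)

lemma bd_sum_const:
  fixes f :: "'i::finite \<Rightarrow> real^'n::finite \<Rightarrow> real"
  assumes "\<And>j. bd p c (f j)"
  shows "bd p (real CARD('i) * c) (\<lambda>x. \<Sum>j\<in>UNIV. f j x)"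
  using bd_sum[of UNIV p "\<lambda>_. c" f] assms by simp

lemma bd_translate: "bd p c f \<Longrightarrow> bd p c (\<lambda>x. f (x + a))"
proof (induction p arbitrary: f)
  case 0
  have "\<bar>f (x + a) - f (y + a)\<bar> \<le> c * norm (x - y) powr \<gamma>" for x y
    using 0[unfolded bd.simps, THEN conjunct2, THEN conjunct2, rule_format, of "x + a" "y + a"] by simp
  moreover have "continuous_on UNIV (\<lambda>x. f (x + a))"
    using bd_cont[OF 0] by (rule continuous_on_compose2) (auto intro!: continuous_intros)
  ultimately show ?case using 0 by simp
next
  case (Suc p)
  show ?case
  proof (rule bd_SucI[where f' = "\<lambda>i x. pderiv_dir i f (x + a)"])
    show "continuous_on UNIV (\<lambda>x. f (x + a))"
      using bd_cont[OF Suc.prems] by (rule continuous_on_compose2) (auto intro!: continuous_intros)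
    show "\<bar>f (x + a)\<bar> \<le> c" for x by (rule bd_abs[OF Suc.prems])
    show "has_pd i (\<lambda>x. f (x + a)) (\<lambda>x. pderiv_dir i f (x + a))" for i
      by (intro has_pd_translate bd_has_pd[OF Suc.prems])
    show "bd p c (\<lambda>x. pderiv_dir i f (x + a))" for i
      by (intro Suc.IH bd_pd[OF Suc.prems])
  qed
qed

lemma bd_lipschitz:
  fixes f :: "real^'n::finite \<Rightarrow> real"
  assumes "bd (Suc p) c f"
  shows "\<bar>f x - f y\<bar> \<le> real CARD('n) * c * norm (x - y)"
  by (rule C1_lipschitz[OF bd_has_pd[OF assms] bd_pd_cont[OF assms] bd_abs[OF bd_pd[OF assms]]])

lemma powr_ge_self: "0 \<le> t \<Longrightarrow> t \<le> 1 \<Longrightarrow> t \<le> t powr \<gamma>"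
  using powr_mono'[of \<gamma> 1 t] \<gamma> by (cases "t = 0") auto

lemma powr_ge_one: "1 \<le> t \<Longrightarrow> 1 \<le> t powr \<gamma>"
  using ge_one_powr_ge_zero \<gamma> by blast

text \<open>At distance at most 1 the Lipschitz bound suffices because
  \<open>t \<le> t powr \<gamma>\<close>; at larger distances the oscillation \<open>2 * c\<close>
  does. Only the top order has a Hoelder clause, so the constant does not grow with
  \<open>p\<close>.\<close>

lemma bd_embed:
  fixes f :: "real^'n::finite \<Rightarrow> real"
  shows "bd (Suc p) c f \<Longrightarrow> bd p (2 * real CARD('n) * c) f"
proof (induction p arbitrary: f)
  case 0
  define n where "n = real CARD('n)"
  have n: "n \<ge> 1" by (simp add: n_def Suc_leI)
  have c: "c \<ge> 0" using bd_nonneg[OF 0] .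
  have nc: "c \<le> 2 * n * c" using n c by (simp add: mult_le_cancel_right1)
  have "\<bar>f x - f y\<bar> \<le> 2 * n * c * norm (x - y) powr \<gamma>" for x y
  proof (cases "norm (x - y) \<le> 1")
    case True
    have "\<bar>f x - f y\<bar> \<le> n * c * norm (x - y)" using bd_lipschitz[OF 0] by (simp add: n_def)
    also have "\<dots> \<le> (2 * n * c) * norm (x - y) powr \<gamma>"
      using n c True by (intro mult_mono powr_ge_self) auto
    finally show ?thesis .
  next
    case False
    have "\<bar>f x - f y\<bar> \<le> 2 * c * 1" using bd_abs[OF 0, of x] bd_abs[OF 0, of y] by linarith
    also have "\<dots> \<le> (2 * n * c) * norm (x - y) powr \<gamma>"
      using n c False by (intro mult_mono powr_ge_one) (auto simp: mult_le_cancel_right1)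
    finally show ?thesis .
  qed
  moreover have "\<bar>f x\<bar> \<le> 2 * n * c" for x using bd_abs[OF 0, of x] nc by linarith
  ultimately show ?case using bd_cont[OF 0] by (simp add: n_def)
next
  case (Suc p)
  have c: "c \<ge> 0" using bd_nonneg[OF Suc.prems] .
  have "1 \<le> 2 * real CARD('n)" using zero_less_card_finite[where 'a='n] by linarith
  then have nc: "c \<le> 2 * real CARD('n) * c" using c by (simp add: mult_le_cancel_right1)
  show ?case
    by (rule bd_SucI[OF bd_cont[OF Suc.prems] order_trans[OF bd_abs[OF Suc.prems] nc]
        bd_has_pd[OF Suc.prems] Suc.IH[OF bd_pd[OF Suc.prems]]])
qed

lemma bd_embed_le:
  fixes f :: "real^'n::finite \<Rightarrow> real"
  assumes "p \<le> q" shows "bd q c f \<Longrightarrow> bd p ((2 * real CARD('n)) ^ (q - p) * c) f"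
  using assms
proof (induction q arbitrary: c rule: dec_induct)
  case (step q)
  from step.IH[OF bd_embed[OF step.prems]] step.hyps show ?case
    by (simp add: Suc_diff_le mult.assoc mult.left_commute)
qed auto

lemma bd_mult:
  fixes f :: "real^'n::finite \<Rightarrow> real"
  shows "bd p c f \<Longrightarrow> bd p d g \<Longrightarrow> bd p (Kmul TYPE('n) p * c * d) (\<lambda>x. f x * g x)"
proof (induction p arbitrary: f g c d)
  case 0
  have c: "c \<ge> 0" "d \<ge> 0" using bd_nonneg 0 by blast+
  have "\<bar>f x * g x - f y * g y\<bar> \<le> 2 * c * d * norm (x - y) powr \<gamma>" for x y
  proof -
    have "\<bar>f x * g x - f y * g y\<bar> = \<bar>f x * (g x - g y) + (f x - f y) * g y\<bar>" by (simp add: algebra_simps)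
    also have "\<dots> \<le> \<bar>f x\<bar> * \<bar>g x - g y\<bar> + \<bar>f x - f y\<bar> * \<bar>g y\<bar>"
      by (metis abs_mult abs_triangle_ineq)
    also have "\<dots> \<le> c * (d * norm (x - y) powr \<gamma>) + (c * norm (x - y) powr \<gamma>) * d"
      using 0 c by (intro add_mono mult_mono) auto
    finally show ?thesis by (simp add: algebra_simps)
  qed
  moreover have "\<bar>f x * g x\<bar> \<le> 2 * c * d" for x
  proof -
    have "\<bar>f x * g x\<bar> \<le> c * d" using 0 c by (auto simp: abs_mult intro!: mult_mono)
    also have "\<dots> \<le> 2 * c * d" using c by simp
    finally show ?thesis .
  qed
  ultimately show ?case using 0 by (auto simp: Kmul_def intro!: continuous_intros)
next
  case (Suc p)
  let ?n = "real CARD('n)" and ?K = "Kmul TYPE('n)"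
  have c: "c \<ge> 0" "d \<ge> 0" using bd_nonneg Suc.prems by blast+
  have K: "?K (Suc p) = 4 * ?n * ?K p" by (simp add: Kmul_def)
  have n1: "1 \<le> ?n" by (simp add: Suc_leI)
  have K1: "1 \<le> ?K (Suc p)"
  proof -
    have "1 \<le> (4 * ?n) ^ (Suc p)" using n1 by (intro one_le_power) linarith
    then show ?thesis by (simp add: Kmul_def)
  qed
  show ?case
  proof (rule bd_SucI)
    fix x
    have "\<bar>f x * g x\<bar> \<le> c * d"
      using bd_abs[OF Suc.prems(1)] bd_abs[OF Suc.prems(2)] c by (auto simp: abs_mult intro!: mult_mono)
    also have "\<dots> \<le> ?K (Suc p) * (c * d)" using K1 c mult_right_mono[of 1 "?K (Suc p)" "c * d"] by simp
    finally show "\<bar>f x * g x\<bar> \<le> ?K (Suc p) * c * d" by (simp add: mult.assoc)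
  next
    fix i
    show "has_pd i (\<lambda>x. f x * g x) (\<lambda>x. f x * pderiv_dir i g x + pderiv_dir i f x * g x)"
      by (intro has_pd_mult bd_has_pd[OF Suc.prems(1)] bd_has_pd[OF Suc.prems(2)])
    have "bd p (?K p * (2 * ?n * c) * d + ?K p * c * (2 * ?n * d)) (\<lambda>x. f x * pderiv_dir i g x + pderiv_dir i f x * g x)"
      by (intro bd_add Suc.IH[OF bd_embed[OF Suc.prems(1)] bd_pd[OF Suc.prems(2)]]
          Suc.IH[OF bd_pd[OF Suc.prems(1)] bd_embed[OF Suc.prems(2)]])
    then show "bd p (?K (Suc p) * c * d) (\<lambda>x. f x * pderiv_dir i g x + pderiv_dir i f x * g x)"
      by (simp add: K algebra_simps)
  next
    show "continuous_on UNIV (\<lambda>x. f x * g x)"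
      by (intro continuous_on_mult bd_cont[OF Suc.prems(1)] bd_cont[OF Suc.prems(2)])
  qed
qed

text \<open>Bounds are kept as a predicate, so the least bound has to be shown to be a bound;
  \<open>bd_absorb\<close> takes an infimum of bounds.\<close>

lemma bd_closed: "(\<And>e. e > 0 \<Longrightarrow> bd p (c + e) f) \<Longrightarrow> bd p c f"
proof (induction p arbitrary: f)
  case 0
  have "\<bar>f x\<bar> \<le> c" for x by (rule field_le_epsilon) (rule bd_abs[OF 0])
  moreover have "\<bar>f x - f y\<bar> \<le> c * norm (x - y) powr \<gamma>" for x y
  proof (rule field_le_epsilon)
    fix e :: real assume e: "e > 0"
    let ?N = "norm (x - y) powr \<gamma>"
    have N: "1 + ?N > 0" by (rule add_pos_nonneg) auto
    have "\<bar>f x - f y\<bar> \<le> (c + e / (1 + ?N)) * ?N"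
      by (rule bd0_hoelder[OF 0]) (use e N in simp)
    also have "\<dots> = c * ?N + e * (?N / (1 + ?N))" by (simp add: algebra_simps)
    also have "\<dots> \<le> c * ?N + e * 1"
    proof (intro add_left_mono mult_left_mono)
      show "?N / (1 + ?N) \<le> 1" using N by simp
    qed (use e in auto)
    finally show "\<bar>f x - f y\<bar> \<le> c * ?N + e" by simp
  qed
  ultimately show ?case using bd_cont[OF 0[of 1]] by simp
next
  case (Suc p)
  have "\<bar>f x\<bar> \<le> c" for x by (rule field_le_epsilon) (rule bd_abs[OF Suc.prems])
  moreover have "bd p c (pderiv_dir i f)" for i
    by (rule Suc.IH) (rule bd_pd[OF Suc.prems])
  ultimately show ?case
    using bd_cont[OF Suc.prems[of 1]] bd_has_pd[OF Suc.prems[of 1]] by simp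
qed

text \<open>One \<open>K\<close> serves all \<open>f\<close> with the same \<open>c\<close> and
  \<open>\<delta>\<close>, which continuity of the reciprocal requires. The step writes the
  derivative as $-(1/f)^2 f'$ and bounds both copies of \<open>1 / f\<close> by the induction
  hypothesis at the lower order.\<close>

lemma bd_recip:
  fixes c \<delta> :: real
  assumes "\<delta> > 0"
  shows "\<exists>K. \<forall>f::real^'n::finite \<Rightarrow> real. bd p c f \<longrightarrow> (\<forall>x. \<delta> \<le> f x) \<longrightarrow> bd p K (\<lambda>x. 1 / f x)"
proof (induction p arbitrary: c)
  case 0
  show ?case
  proof (intro exI[of _ "max (1 / \<delta>) (c / (\<delta> * \<delta>))"] allI impI)
    fix f :: "real^'n \<Rightarrow> real" assume f: "bd 0 c f" "\<forall>x. \<delta> \<le> f x"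
    have pos: "f x > 0" for x using f(2) assms by (auto intro: less_le_trans)
    have "\<bar>1 / f x - 1 / f y\<bar> \<le> max (1 / \<delta>) (c / (\<delta> * \<delta>)) * norm (x - y) powr \<gamma>" for x y
    proof -
      have "\<bar>1 / f x - 1 / f y\<bar> = \<bar>f y - f x\<bar> / (f x * f y)"
        using pos[of x] pos[of y] by (simp add: field_simps abs_mult)
      also have "\<dots> \<le> (c * norm (x - y) powr \<gamma>) / (\<delta> * \<delta>)"
        using f assms pos[of x] pos[of y] bd_nonneg[OF f(1)]
        by (intro frac_le mult_mono) (auto simp: abs_minus_commute intro: less_imp_le)
      also have "\<dots> = c / (\<delta> * \<delta>) * norm (x - y) powr \<gamma>" by simp
      also have "\<dots> \<le> max (1 / \<delta>) (c / (\<delta> * \<delta>)) * norm (x - y) powr \<gamma>"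
        by (intro mult_right_mono) auto
      finally show ?thesis .
    qed
    moreover have "\<bar>1 / f x\<bar> \<le> max (1 / \<delta>) (c / (\<delta> * \<delta>))" for x
      using f(2)[rule_format, of x] pos[of x] assms by (simp add: frac_le le_max_iff_disj)
    ultimately show "bd 0 (max (1 / \<delta>) (c / (\<delta> * \<delta>))) (\<lambda>x. 1 / f x)"
      using bd_cont[OF f(1)] pos by (auto intro!: continuous_intros simp: less_imp_neq[symmetric])
  qed
next
  case (Suc p)
  let ?n = "real CARD('n)" and ?K = "Kmul TYPE('n) p"
  from Suc[of "2 * ?n * c"] obtain K where K:
    "\<And>f::real^'n \<Rightarrow> real. bd p (2 * ?n * c) f \<Longrightarrow> (\<forall>x. \<delta> \<le> f x) \<Longrightarrow> bd p K (\<lambda>x. 1 / f x)" by blast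
  let ?M = "max (1 / \<delta>) (?K * (?K * K * K) * c)"
  show ?case
  proof (intro exI[of _ ?M] allI impI)
    fix f :: "real^'n \<Rightarrow> real" assume f: "bd (Suc p) c f" "\<forall>x. \<delta> \<le> f x"
    have pos: "f x > 0" for x using f(2) assms by (auto intro: less_le_trans)
    show "bd (Suc p) ?M (\<lambda>x. 1 / f x)"
    proof (rule bd_SucI)
      show "continuous_on UNIV (\<lambda>x. 1 / f x)"
        using bd_cont[OF f(1)] pos by (auto intro!: continuous_intros simp: less_imp_neq[symmetric])
      fix x show "\<bar>1 / f x\<bar> \<le> ?M"
        using f(2)[rule_format, of x] pos[of x] assms by (simp add: frac_le le_max_iff_disj)
    next
      fix i
      show "has_pd i (\<lambda>x. 1 / f x) (\<lambda>x. - ((1 / f x) * (1 / f x) * pderiv_dir i f x))"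
        using pos by (intro has_pd_recip bd_has_pd[OF f(1)]) (simp add: less_imp_neq[symmetric])
      show "bd p ?M (\<lambda>x. - ((1 / f x) * (1 / f x) * pderiv_dir i f x))"
        by (rule bd_mono[OF bd_minus[OF bd_mult[OF bd_mult[OF K[OF bd_embed[OF f(1)] f(2)] K[OF bd_embed[OF f(1)] f(2)]] bd_pd[OF f(1)]]]])
          simp
    qed
  qed
qed

text \<open>A mean value inequality in the Hoelder norm. The Hoelder clause applies the scalar
  theorem to \<open>u t x - u t y\<close> for a fixed pair of points; the intermediate time depends
  on the pair, but the bound on \<open>w\<close> does not depend on time.\<close>

lemma bd0_mvt:
  assumes "\<And>x t. ((\<lambda>t. u t x) has_real_derivative w t x) (at t)"
    and w: "\<And>t. 0 \<le> t \<Longrightarrow> t \<le> 1 \<Longrightarrow> bd 0 M (w t)"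
    and "continuous_on UNIV (\<lambda>x. u 1 x - u 0 x)"
  shows "bd 0 M (\<lambda>x. u 1 x - u 0 x)"
proof -
  have "\<bar>u 1 x - u 0 x\<bar> \<le> M" for x
  proof -
    obtain z where z: "0 < z" "z < 1" "u 1 x - u 0 x = (1 - 0) * w z x"
      using MVT2[of 0 1 "\<lambda>t. u t x" "\<lambda>t. w t x"] assms(1) by auto
    then show ?thesis using bd_abs[OF w, of z x] by simp
  qed
  moreover have "\<bar>(u 1 x - u 0 x) - (u 1 y - u 0 y)\<bar> \<le> M * norm (x - y) powr \<gamma>" for x y
  proof -
    obtain z where z: "0 < z" "z < 1" "(u 1 x - u 1 y) - (u 0 x - u 0 y) = (1 - 0) * (w z x - w z y)"
      using MVT2[of 0 1 "\<lambda>t. u t x - u t y" "\<lambda>t. w t x - w t y", OF _ DERIV_diff[OF assms(1) assms(1)]]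
      by auto
    have "\<bar>w z x - w z y\<bar> \<le> M * norm (x - y) powr \<gamma>" using w[of z] z by auto
    then show ?thesis using z by (simp add: algebra_simps)
  qed
  ultimately show ?thesis using assms(3) by simp
qed

lemma bd_comp_cont:
  fixes F :: "real^'n::finite \<Rightarrow> real"
  shows "bd p c F \<Longrightarrow> (\<And>j. bd q R (g j)) \<Longrightarrow> continuous_on UNIV (\<lambda>x. F (shift g x))"
  by (rule continuous_on_compose2[of UNIV F UNIV "shift g"]) (auto intro: bd_cont continuous_shift)

lemma bd_comp_has_pd:
  fixes F :: "real^'n::finite \<Rightarrow> real"
  assumes "bd (Suc p) c F" "\<And>j. bd (Suc q) R (g j)"
  shows "has_pd i (\<lambda>x. F (shift g x))
    (\<lambda>x. pderiv_dir i F (shift g x) + (\<Sum>j\<in>UNIV. pderiv_dir j F (shift g x) * pderiv_dir i (g j) x))"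
  by (rule has_pd_comp_shift) (use assms bd_pd_cont[OF assms(1)] in auto)

lemma lip_nonneg:
  assumes "lip R (\<psi> :: real^'n::finite \<Rightarrow> real^'n)"
  shows "0 \<le> R"
proof -
  have "0 \<le> R * norm (axis undefined 1 - 0 :: real^'n)"
    using assms unfolding lip_def by (meson norm_ge_zero order_trans)
  then show ?thesis by simp
qed

lemma lip_shift_convex:
  assumes "lip R (shift g)" "lip R (shift h)" "0 \<le> t" "t \<le> 1"
  shows "lip R (shift (\<lambda>j x. g j x + t * (h j x - g j x)))"
  unfolding lip_def
proof (intro allI)
  fix x y
  have eq: "shift (\<lambda>j x. g j x + t * (h j x - g j x)) x = (1 - t) *\<^sub>R shift g x + t *\<^sub>R shift h x" for x
    by (simp add: vec_eq_iff algebra_simps)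
  have "norm (shift (\<lambda>j x. g j x + t * (h j x - g j x)) x - shift (\<lambda>j x. g j x + t * (h j x - g j x)) y)
     = norm ((1 - t) *\<^sub>R (shift g x - shift g y) + t *\<^sub>R (shift h x - shift h y))"
    unfolding eq by (simp add: algebra_simps)
  also have "\<dots> \<le> (1 - t) * norm (shift g x - shift g y) + t * norm (shift h x - shift h y)"
    using assms by (intro norm_triangle_le) simp
  also have "\<dots> \<le> (1 - t) * (R * norm (x - y)) + t * (R * norm (x - y))"
    using assms by (intro add_mono mult_left_mono) (auto simp: lip_def)
  finally show "norm (shift (\<lambda>j x. g j x + t * (h j x - g j x)) x - shift (\<lambda>j x. g j x + t * (h j x - g j x)) y)
      \<le> R * norm (x - y)" by (simp add: algebra_simps)
qed

text \<open>The estimate is linear in the bound of \<open>F\<close>, so one \<open>K\<close> serves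
  whole families. The Lipschitz bound is a separate hypothesis because order 0 gives only Hoelder
  continuity of \<open>g\<close>, and with that alone the Hoelder exponent of the composite would
  drop.\<close>

lemma bd_comp:
  "\<exists>K\<ge>1. \<forall>(F::real^'n::finite \<Rightarrow> real) c (g::'n \<Rightarrow> real^'n \<Rightarrow> real). bd p c F \<longrightarrow> (\<forall>j. bd p R (g j)) \<longrightarrow> lip R (shift g) \<longrightarrow>
     bd p (K * c) (\<lambda>x. F (shift g x))"
proof (induction p arbitrary: R)
  case 0
  show ?case
  proof (intro exI[of _ "max 1 (R powr \<gamma>)"] conjI allI impI)
    fix F :: "real^'n \<Rightarrow> real" and c and g :: "'n \<Rightarrow> real^'n \<Rightarrow> real"
    assume F: "bd 0 c F" and g: "\<forall>j. bd 0 R (g j)" and l: "lip R (shift g)"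
    have c: "c \<ge> 0" using bd_nonneg[OF F] .
    have R: "R \<ge> 0" using lip_nonneg[OF l] .
    have "\<bar>F (shift g x) - F (shift g y)\<bar> \<le> max 1 (R powr \<gamma>) * c * norm (x - y) powr \<gamma>" for x y
    proof -
      have "\<bar>F (shift g x) - F (shift g y)\<bar> \<le> c * norm (shift g x - shift g y) powr \<gamma>" using F by simp
      also have "\<dots> \<le> c * (R * norm (x - y)) powr \<gamma>"
        using l c \<gamma> by (intro mult_left_mono powr_mono2) (auto simp: lip_def)
      also have "\<dots> = c * R powr \<gamma> * norm (x - y) powr \<gamma>" using R by (simp add: powr_mult)
      also have "\<dots> \<le> c * max 1 (R powr \<gamma>) * norm (x - y) powr \<gamma>"
        using c by (intro mult_right_mono mult_left_mono) auto
      finally show ?thesis by (simp add: mult_ac)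
    qed
    moreover have "\<bar>F (shift g x)\<bar> \<le> max 1 (R powr \<gamma>) * c" for x
      using bd_abs[OF F, of "shift g x"] c mult_right_mono[of 1 "max 1 (R powr \<gamma>)" c] by linarith
    ultimately show "bd 0 (max 1 (R powr \<gamma>) * c) (\<lambda>x. F (shift g x))"
      using bd_comp_cont[OF F, of 0 R g] g by simp
  qed simp
next
  case (Suc p)
  let ?n = "real CARD('n)" and ?K = "Kmul TYPE('n) p"
  define E where "E = 2 * ?n"
  have E: "1 \<le> E" unfolding E_def using zero_less_card_finite[where 'a='n] by linarith
  from Suc[of "E * R"] obtain K where K: "K \<ge> 1"
    "\<And>(F::real^'n \<Rightarrow> real) c (g::'n \<Rightarrow> real^'n \<Rightarrow> real). bd p c F \<Longrightarrow> (\<forall>j. bd p (E * R) (g j)) \<Longrightarrow> lip (E * R) (shift g) \<Longrightarrow>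
     bd p (K * c) (\<lambda>x. F (shift g x))" by metis
  \<comment> \<open>\<open>K\<close> comes from the identity part of the chain rule, the other
    summand from the \<open>n\<close> products with derivatives of \<open>g\<close>.\<close>
  let ?M = "K + ?n * (?K * K * \<bar>R\<bar>)"
  show ?case
  proof (intro exI[of _ ?M] conjI allI impI)
    have nn: "0 \<le> ?n * (?K * K * \<bar>R\<bar>)" using K Kmul_pos[of "TYPE('n)" p] by simp
    then show "1 \<le> ?M" using K(1) by linarith
    fix F :: "real^'n \<Rightarrow> real" and c and g :: "'n \<Rightarrow> real^'n \<Rightarrow> real"
    assume F: "bd (Suc p) c F" and g: "\<forall>j. bd (Suc p) R (g j)" and l: "lip R (shift g)"
    have c: "c \<ge> 0" using bd_nonneg[OF F] .
    have R: "R \<ge> 0" using lip_nonneg[OF l] .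
    have l': "lip (E * R) (shift g)" using l by (rule lip_mono) (use R E in \<open>simp add: mult_le_cancel_right1\<close>)
    have g': "\<forall>j. bd p (E * R) (g j)" using g bd_embed unfolding E_def by blast
    show "bd (Suc p) (?M * c) (\<lambda>x. F (shift g x))"
    proof (rule bd_SucI)
      show "continuous_on UNIV (\<lambda>x. F (shift g x))" using bd_comp_cont[OF F, of "Suc p" R g] g by simp
      have "1 \<le> ?M" using nn K(1) by linarith
      then show "\<bar>F (shift g x)\<bar> \<le> ?M * c" for x
        using bd_abs[OF F, of "shift g x"] c mult_right_mono[of 1 ?M c] by linarith
      fix i
      show "has_pd i (\<lambda>x. F (shift g x))
        (\<lambda>x. pderiv_dir i F (shift g x) + (\<Sum>j\<in>UNIV. pderiv_dir j F (shift g x) * pderiv_dir i (g j) x))"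
        using bd_comp_has_pd[OF F, of p R g i] g by blast
      have "bd p (K * c + ?n * (?K * (K * c) * R))
        (\<lambda>x. pderiv_dir i F (shift g x) + (\<Sum>j\<in>UNIV. pderiv_dir j F (shift g x) * pderiv_dir i (g j) x))"
        by (intro bd_add[OF K(2)[OF bd_pd[OF F] g' l']] bd_sum_const
            bd_mult[OF K(2)[OF bd_pd[OF F] g' l'] bd_pd[OF g[rule_format]]])
      then show "bd p (?M * c)
        (\<lambda>x. pderiv_dir i F (shift g x) + (\<Sum>j\<in>UNIV. pderiv_dir j F (shift g x) * pderiv_dir i (g j) x))"
        using R by (simp add: algebra_simps)
    qed
  qed
qed

text \<open>Fixing one constant for each order and radius lets the estimate be used as a rule with a
  named bound; \<open>Kdiff\<close> and \<open>Krem\<close> are introduced in the same way.\<close>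

definition Kcomp :: "'n::finite itself \<Rightarrow> nat \<Rightarrow> real \<Rightarrow> real" where
  "Kcomp _ p R = (SOME K. K \<ge> 1 \<and> (\<forall>(F::real^'n \<Rightarrow> real) c (g::'n \<Rightarrow> real^'n \<Rightarrow> real). bd p c F \<longrightarrow>
     (\<forall>j. bd p R (g j)) \<longrightarrow> lip R (shift g) \<longrightarrow> bd p (K * c) (\<lambda>x. F (shift g x))))"

lemma Kcomp_ge: "Kcomp TYPE('n::finite) p R \<ge> 1"
  and bd_compI: "\<lbrakk>bd p c (F::real^'n::finite \<Rightarrow> real); \<forall>j. bd p R (g j); lip R (shift g)\<rbrakk> \<Longrightarrow>
     bd p (Kcomp TYPE('n) p R * c) (\<lambda>x. F (shift g x))"
  using someI_ex[OF bd_comp[where ?'n = 'n, of p R]] unfolding Kcomp_def by blast+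

end

section \<open>First-order estimates for composition\<close>

lemma line_derivative:
  fixes f :: "real^'n::finite \<Rightarrow> real"
  assumes pd: "\<And>i. has_pd i f (f' i)" and cont: "\<And>i. continuous_on UNIV (f' i)"
  shows "((\<lambda>t. f (a + t *\<^sub>R v)) has_real_derivative (\<Sum>j\<in>UNIV. f' j (a + t *\<^sub>R v) * v $ j)) (at t)"
proof -
  have "((\<lambda>t. a + t *\<^sub>R v) has_derivative (\<lambda>t. t *\<^sub>R v)) (at t)"
    by (auto intro!: derivative_eq_intros)
  from has_derivative_compose[OF this C1_has_derivative[OF pd cont]]
  have "((\<lambda>t. f (a + t *\<^sub>R v)) has_derivative (\<lambda>s. \<Sum>j\<in>UNIV. (s *\<^sub>R v) $ j * f' j (a + t *\<^sub>R v))) (at t)" .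
  moreover have "(\<lambda>s. \<Sum>j\<in>UNIV. (s *\<^sub>R v) $ j * f' j (a + t *\<^sub>R v)) = (*) (\<Sum>j\<in>UNIV. f' j (a + t *\<^sub>R v) * v $ j)"
    by (simp add: fun_eq_iff sum_distrib_left sum_distrib_right mult_ac)
  ultimately show ?thesis by (simp add: has_field_derivative_def)
qed

text \<open>The algebra of differentiating the Taylor remainder of composition. \<open>A\<close> and
  \<open>A'\<close> stand for the first derivatives of \<open>F\<close> along the two inner maps,
  \<open>G\<close> and \<open>G'\<close> for the \<open>i\<close>-th derivatives of the
  displacements, \<open>v\<close> for the difference of the displacements, \<open>D\<close> for the
  Hessian. Every term on the right contains a remainder for a derivative of \<open>F\<close> or a
  product of two first differences, hence is again quadratic; symmetry of the Hessian matches the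
  double sums.\<close>

lemma comp_rem_derivative_eq:
  fixes D :: "'n::finite \<Rightarrow> 'n \<Rightarrow> real"
  assumes sym: "\<And>l j. D l j = D j l"
  shows "((A' i + (\<Sum>j\<in>UNIV. A' j * G' j)) - (A i + (\<Sum>j\<in>UNIV. A j * G j)))
      - (\<Sum>j\<in>UNIV. A j * (G' j - G j) + (D i j + (\<Sum>l\<in>UNIV. D l j * G l)) * v j)
    = (A' i - A i - (\<Sum>j\<in>UNIV. D j i * v j))
      + (\<Sum>j\<in>UNIV. G j * (A' j - A j - (\<Sum>l\<in>UNIV. D l j * v l)) + (A' j - A j) * (G' j - G j))"
proof -
  have "(\<Sum>j\<in>UNIV. (\<Sum>l\<in>UNIV. D l j * G l) * v j) = (\<Sum>j\<in>UNIV. \<Sum>l\<in>UNIV. D l j * G l * v j)"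
    by (simp add: sum_distrib_right)
  also have "\<dots> = (\<Sum>l\<in>UNIV. \<Sum>j\<in>UNIV. D l j * G l * v j)" by (rule sum.swap)
  also have "\<dots> = (\<Sum>l\<in>UNIV. G l * (\<Sum>j\<in>UNIV. D j l * v j))"
    by (intro sum.cong refl) (simp add: sum_distrib_left mult_ac sym)
  finally have sw: "(\<Sum>j\<in>UNIV. (\<Sum>l\<in>UNIV. D l j * G l) * v j) = (\<Sum>l\<in>UNIV. G l * (\<Sum>j\<in>UNIV. D j l * v j))" .
  have e1: "(\<Sum>j\<in>UNIV. D i j * v j) = (\<Sum>j\<in>UNIV. D j i * v j)"
    by (intro sum.cong refl) (simp add: sym)
  show ?thesis
    by (simp add: sum.distrib sum_subtractf distrib_right right_diff_distrib left_diff_distrib sw e1 sum_negf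
        mult.commute[of "G _" "A _"] mult.commute[of "G _" "A' _"])
qed

context hoelder
begin

lemma bd_convex:
  assumes "bd p R g" "bd p R h" "0 \<le> t" "t \<le> 1"
  shows "bd p R (\<lambda>x. g x + t * (h x - g x))"
proof -
  have "bd p (\<bar>1 - t\<bar> * R + \<bar>t\<bar> * R) (\<lambda>x. (1 - t) * g x + t * h x)"
    by (intro bd_add bd_cmult assms)
  moreover have "\<bar>1 - t\<bar> * R + \<bar>t\<bar> * R = R" using assms by (simp add: algebra_simps)
  moreover have "(\<lambda>x. (1 - t) * g x + t * h x) = (\<lambda>x. g x + t * (h x - g x))" by (simp add: algebra_simps)
  ultimately show ?thesis by simp
qed

text \<open>Composition loses one derivative when it is to be Lipschitz in the inner map.\<close>
lemma bd_comp_diff_ex: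
  "\<exists>K\<ge>0. \<forall>(F::real^'n::finite \<Rightarrow> real) c (g::'n \<Rightarrow> real^'n \<Rightarrow> real) g' d.
     bd (Suc p) c F \<longrightarrow> (\<forall>j. bd p R (g j)) \<longrightarrow> (\<forall>j. bd p R (g' j)) \<longrightarrow> lip R (shift g) \<longrightarrow> lip R (shift g') \<longrightarrow>
     (\<forall>j. bd p d (\<lambda>x. g' j x - g j x)) \<longrightarrow> bd p (K * c * d) (\<lambda>x. F (shift g' x) - F (shift g x))"
proof (induction p arbitrary: R)
  case 0
  let ?n = "real CARD('n)" and ?K = "Kmul TYPE('n) 0" and ?C = "Kcomp TYPE('n) 0 R"
  show ?case
  proof (intro exI[of _ "?n * ?K * ?C"] conjI allI impI)
    fix F :: "real^'n \<Rightarrow> real" and c d and g g' :: "'n \<Rightarrow> real^'n \<Rightarrow> real"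
    assume F: "bd (Suc 0) c F" and g: "\<forall>j. bd 0 R (g j)" and g': "\<forall>j. bd 0 R (g' j)"
      and l: "lip R (shift g)" and l': "lip R (shift g')"
      and d: "\<forall>j. bd 0 d (\<lambda>x. g' j x - g j x)"
    \<comment> \<open>The segment joining the two inner maps; convexity keeps it within the bounds
      \<open>R\<close>, so \<open>bd0_mvt\<close> applies with a derivative bounded uniformly in
      \<open>t\<close>.\<close>
    define s where "s = (\<lambda>t. shift (\<lambda>j x. g j x + t * (g' j x - g j x)))"
    have s_eq: "s t x = shift g x + t *\<^sub>R (\<chi> j. g' j x - g j x)" for t x
      by (simp add: s_def vec_eq_iff)
    have "bd 0 (?n * (?K * (?C * c) * d)) (\<lambda>x. F (s 1 x) - F (s 0 x))"
    proof (rule bd0_mvt[where w = "\<lambda>t x. \<Sum>j\<in>UNIV. pderiv_dir j F (s t x) * (g' j x - g j x)"])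
      fix x t
      show "((\<lambda>t. F (s t x)) has_real_derivative (\<Sum>j\<in>UNIV. pderiv_dir j F (s t x) * (g' j x - g j x))) (at t)"
        unfolding s_eq using line_derivative[OF bd_has_pd[OF F] bd_pd_cont[OF F], where v = "\<chi> j. g' j x - g j x"] by simp
    next
      fix t :: real assume t: "0 \<le> t" "t \<le> 1"
      have bt: "\<forall>j. bd 0 R (\<lambda>x. g j x + t * (g' j x - g j x))"
        using bd_convex[OF g[rule_format] g'[rule_format] t] by blast
      show "bd 0 (?n * (?K * (?C * c) * d)) (\<lambda>x. \<Sum>j\<in>UNIV. pderiv_dir j F (s t x) * (g' j x - g j x))"
        unfolding s_def
        by (intro bd_sum_const bd_mult[OF bd_compI[OF bd_pd[OF F] bt lip_shift_convex[OF l l' t]] d[rule_format]])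
    next
      have "continuous_on UNIV (\<lambda>x. F (shift g' x))" "continuous_on UNIV (\<lambda>x. F (shift g x))"
        using bd_comp_cont[OF F g'[rule_format]] bd_comp_cont[OF F g[rule_format]] by auto
      then show "continuous_on UNIV (\<lambda>x. F (s 1 x) - F (s 0 x))"
        by (simp add: s_def continuous_on_diff)
    qed
    then show "bd 0 (?n * ?K * ?C * c * d) (\<lambda>x. F (shift g' x) - F (shift g x))"
      by (simp add: s_def mult_ac)
  qed (use Kcomp_ge[where ?'n = 'n, of 0 R] Kmul_pos[of "TYPE('n)" 0] in simp)
next
  case (Suc p)
  let ?n = "real CARD('n)" and ?K = "Kmul TYPE('n) p"
  define E where "E = 2 * ?n"
  have E: "1 \<le> E" unfolding E_def using zero_less_card_finite[where 'a='n] by linarith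
  have EK: "?K > 0" by (rule Kmul_pos)
  let ?C = "Kcomp TYPE('n) p (E * R)"
  have C: "?C \<ge> 1" by (rule Kcomp_ge)
  obtain K where K: "K \<ge> 0" and KI:
    "\<forall>(F::real^'n \<Rightarrow> real) c (g::'n \<Rightarrow> real^'n \<Rightarrow> real) g' d.
     bd (Suc p) c F \<longrightarrow> (\<forall>j. bd p (E*R) (g j)) \<longrightarrow> (\<forall>j. bd p (E*R) (g' j)) \<longrightarrow> lip (E*R) (shift g) \<longrightarrow> lip (E*R) (shift g') \<longrightarrow>
     (\<forall>j. bd p d (\<lambda>x. g' j x - g j x)) \<longrightarrow> bd p (K * c * d) (\<lambda>x. F (shift g' x) - F (shift g x))"
    using Suc[of "E*R"] by blast
  \<comment> \<open>The first two summands bound the derivatives, following the terms of the chain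
    rule; the last one, from \<open>F\<close> and the displacements embedded one order lower, bounds
    the difference itself.\<close>
  let ?M = "K * E + ?n * (?K * (K * E) * \<bar>R\<bar> + ?K * (?C * E)) + K * E * E"
  have nn: "0 \<le> K * E" "0 \<le> ?n * (?K * (K * E) * \<bar>R\<bar> + ?K * (?C * E))" "0 \<le> K * E * E"
    using K E EK C by (auto intro!: add_nonneg_nonneg mult_nonneg_nonneg)
  show ?case
  proof (intro exI[of _ ?M] conjI allI impI)
    show "0 \<le> ?M" using nn by linarith
    fix F :: "real^'n \<Rightarrow> real" and c d and g g' :: "'n \<Rightarrow> real^'n \<Rightarrow> real"
    assume F: "bd (Suc (Suc p)) c F" and g: "\<forall>j. bd (Suc p) R (g j)" and g': "\<forall>j. bd (Suc p) R (g' j)"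
      and l: "lip R (shift g)" and l': "lip R (shift g')"
      and d: "\<forall>j. bd (Suc p) d (\<lambda>x. g' j x - g j x)"
    have c0: "0 \<le> c * d" using bd_nonneg[OF F] bd_nonneg[OF d[rule_format]] by simp
    have R: "R \<ge> 0" using lip_nonneg[OF l] .
    have RE: "R \<le> E * R" using R E by (simp add: mult_le_cancel_right1)
    have L: "lip (E * R) (shift g)" "lip (E * R) (shift g')" using lip_mono[OF l RE] lip_mono[OF l' RE] .
    have G: "\<forall>j. bd p (E * R) (g j)" "\<forall>j. bd p (E * R) (g' j)" "\<forall>j. bd p (E * d) (\<lambda>x. g' j x - g j x)"
      unfolding E_def using bd_embed[OF g[rule_format]] bd_embed[OF g'[rule_format]] bd_embed[OF d[rule_format]] by blast+
    have FE: "bd (Suc p) (E * c) F" unfolding E_def by (rule bd_embed[OF F])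
    have diffF: "bd p (K * (E * c) * (E * d)) (\<lambda>x. F (shift g' x) - F (shift g x))"
      by (rule KI[rule_format, OF FE]) (use G L in auto)
    have diffdF: "bd p (K * c * (E * d)) (\<lambda>x. pderiv_dir j F (shift g' x) - pderiv_dir j F (shift g x))" for j
      by (rule KI[rule_format, OF bd_pd[OF F]]) (use G L in auto)
    have compdF: "bd p (?C * (E * c)) (\<lambda>x. pderiv_dir j F (shift g x))" for j
      unfolding E_def by (rule bd_compI[OF bd_pd[OF bd_embed[OF F]]]) (use G L in \<open>auto simp: E_def\<close>)
    have pdd: "bd p d (\<lambda>x. pderiv_dir i (g' j) x - pderiv_dir i (g j) x)" for i j
      using bd_pd[OF d[rule_format], of i j]
        has_pd_pderiv_dir[OF has_pd_diff[OF bd_has_pd[OF g'[rule_format]] bd_has_pd[OF g[rule_format]]], of i j j] by simp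
    show "bd (Suc p) (?M * c * d) (\<lambda>x. F (shift g' x) - F (shift g x))"
    proof (rule bd_SucI)
      show "continuous_on UNIV (\<lambda>x. F (shift g' x) - F (shift g x))" by (rule bd_cont[OF diffF])
      fix x
      have "\<bar>F (shift g' x) - F (shift g x)\<bar> \<le> (K * E * E) * (c * d)"
        using bd_abs[OF diffF, of x] by (simp add: mult_ac)
      also have "\<dots> \<le> ?M * (c * d)" using nn c0 by (intro mult_right_mono) linarith+
      finally show "\<bar>F (shift g' x) - F (shift g x)\<bar> \<le> ?M * c * d" by (simp only: mult.assoc)
    next
      fix i
      \<comment> \<open>Differences of products are telescoped as $A'G' - AG = (A' - A)G' + A(G' -
        G)$.\<close>
      let ?D = "\<lambda>x. (pderiv_dir i F (shift g' x) - pderiv_dir i F (shift g x)) +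
         (\<Sum>j\<in>UNIV. (pderiv_dir j F (shift g' x) - pderiv_dir j F (shift g x)) * pderiv_dir i (g' j) x +
           pderiv_dir j F (shift g x) * (pderiv_dir i (g' j) x - pderiv_dir i (g j) x))"
      have "has_pd i (\<lambda>x. F (shift g' x) - F (shift g x))
        (\<lambda>x. (pderiv_dir i F (shift g' x) + (\<Sum>j\<in>UNIV. pderiv_dir j F (shift g' x) * pderiv_dir i (g' j) x))
         - (pderiv_dir i F (shift g x) + (\<Sum>j\<in>UNIV. pderiv_dir j F (shift g x) * pderiv_dir i (g j) x)))"
        by (rule has_pd_diff[OF bd_comp_has_pd[OF F g'[rule_format]] bd_comp_has_pd[OF F g[rule_format]]])
      also have "(\<lambda>x. (pderiv_dir i F (shift g' x) + (\<Sum>j\<in>UNIV. pderiv_dir j F (shift g' x) * pderiv_dir i (g' j) x))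
         - (pderiv_dir i F (shift g x) + (\<Sum>j\<in>UNIV. pderiv_dir j F (shift g x) * pderiv_dir i (g j) x))) = ?D"
        by (simp add: fun_eq_iff algebra_simps sum.distrib sum_subtractf)
      finally show "has_pd i (\<lambda>x. F (shift g' x) - F (shift g x)) ?D" .
      have "bd p (K * c * (E * d) + ?n * (?K * (K * c * (E * d)) * R + ?K * (?C * (E * c)) * d)) ?D"
        by (intro bd_add[OF diffdF] bd_sum_const bd_add bd_mult[OF diffdF bd_pd[OF g'[rule_format]]] bd_mult[OF compdF pdd])
      then show "bd p (?M * c * d) ?D"
        by (rule bd_mono) (use R mult_nonneg_nonneg[OF nn(3) c0] in \<open>simp add: algebra_simps\<close>)
    qed
  qed
qed

definition Kdiff :: "'n::finite itself \<Rightarrow> nat \<Rightarrow> real \<Rightarrow> real" where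
  "Kdiff _ p R = (SOME K. K \<ge> 0 \<and> (\<forall>(F::real^'n \<Rightarrow> real) c (g::'n \<Rightarrow> real^'n \<Rightarrow> real) g' d.
     bd (Suc p) c F \<longrightarrow> (\<forall>j. bd p R (g j)) \<longrightarrow> (\<forall>j. bd p R (g' j)) \<longrightarrow> lip R (shift g) \<longrightarrow> lip R (shift g') \<longrightarrow>
     (\<forall>j. bd p d (\<lambda>x. g' j x - g j x)) \<longrightarrow> bd p (K * c * d) (\<lambda>x. F (shift g' x) - F (shift g x))))"

lemma Kdiff_nonneg: "Kdiff TYPE('n::finite) p R \<ge> 0"
  and bd_comp_diff: "\<lbrakk>bd (Suc p) c (F::real^'n::finite \<Rightarrow> real); \<forall>j. bd p R (g j); \<forall>j. bd p R (g' j);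
     lip R (shift g); lip R (shift g'); \<forall>j. bd p d (\<lambda>x. g' j x - g j x)\<rbrakk> \<Longrightarrow>
     bd p (Kdiff TYPE('n) p R * c * d) (\<lambda>x. F (shift g' x) - F (shift g x))"
  using someI_ex[OF bd_comp_diff_ex[where ?'n = 'n, of p R]] unfolding Kdiff_def by blast+

text \<open>First-order remainder of \<open>g \<mapsto> F \<circ> (id + g)\<close>; the loss of two derivatives gives a quadratic bound
  that is uniform in \<open>F\<close>.\<close>
definition comp_rem :: "(real^'n::finite \<Rightarrow> real) \<Rightarrow> ('n \<Rightarrow> real^'n \<Rightarrow> real) \<Rightarrow> ('n \<Rightarrow> real^'n \<Rightarrow> real) \<Rightarrow> real^'n \<Rightarrow> real" where
  "comp_rem F g g' x = F (shift g' x) - F (shift g x) - (\<Sum>j\<in>UNIV. pderiv_dir j F (shift g x) * (g' j x - g j x))"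

text \<open>At order 0 the mean value inequality is used along the segment with the linear part
  subtracted, so that the time derivative contains a first difference of a derivative of
  \<open>F\<close>, bounded by \<open>Kdiff\<close>; multiplied by the displacement it is quadratic.
  Higher orders follow from \<open>comp_rem_derivative_eq\<close>.\<close>

lemma bd_comp_rem_ex:
  "\<exists>K\<ge>0. \<forall>(F::real^'n::finite \<Rightarrow> real) c (g::'n \<Rightarrow> real^'n \<Rightarrow> real) g' d.
     bd (Suc (Suc p)) c F \<longrightarrow> (\<forall>j. bd p R (g j)) \<longrightarrow> (\<forall>j. bd p R (g' j)) \<longrightarrow> lip R (shift g) \<longrightarrow> lip R (shift g') \<longrightarrow>
     (\<forall>j. bd p d (\<lambda>x. g' j x - g j x)) \<longrightarrow> bd p (K * c * d * d) (comp_rem F g g')"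
proof (induction p arbitrary: R)
  case 0
  let ?n = "real CARD('n)" and ?K = "Kmul TYPE('n) 0" and ?D = "Kdiff TYPE('n) 0 R"
  show ?case
  proof (intro exI[of _ "?n * ?K * ?D"] conjI allI impI)
    fix F :: "real^'n \<Rightarrow> real" and c d and g g' :: "'n \<Rightarrow> real^'n \<Rightarrow> real"
    assume F: "bd (Suc (Suc 0)) c F" and g: "\<forall>j. bd 0 R (g j)" and g': "\<forall>j. bd 0 R (g' j)"
      and l: "lip R (shift g)" and l': "lip R (shift g')"
      and d: "\<forall>j. bd 0 d (\<lambda>x. g' j x - g j x)"
    have cd: "0 \<le> c" "0 \<le> d" using bd_nonneg[OF F] bd_nonneg[OF d[rule_format]] by auto
    define s where "s = (\<lambda>t. shift (\<lambda>j x. g j x + t * (g' j x - g j x)))"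
    have s_eq: "s t x = shift g x + t *\<^sub>R (\<chi> j. g' j x - g j x)" for t x
      by (simp add: s_def vec_eq_iff)
    define L where "L = (\<lambda>x. \<Sum>j\<in>UNIV. pderiv_dir j F (shift g x) * (g' j x - g j x))"
    let ?u = "\<lambda>t x. F (s t x) - t * L x"
    have "bd 0 (?n * (?K * (?D * c * d) * d)) (\<lambda>x. ?u 1 x - ?u 0 x)"
    proof (rule bd0_mvt[where w = "\<lambda>t x. \<Sum>j\<in>UNIV. (pderiv_dir j F (s t x) - pderiv_dir j F (shift g x)) * (g' j x - g j x)"])
      fix x t
      have "((\<lambda>t. F (s t x)) has_real_derivative (\<Sum>j\<in>UNIV. pderiv_dir j F (s t x) * (g' j x - g j x))) (at t)"
        unfolding s_eq using line_derivative[OF bd_has_pd[OF F] bd_pd_cont[OF F], where v = "\<chi> j. g' j x - g j x"] by simp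
      then have "((\<lambda>t. ?u t x) has_real_derivative (\<Sum>j\<in>UNIV. pderiv_dir j F (s t x) * (g' j x - g j x)) - L x) (at t)"
        by (rule DERIV_diff) (auto intro!: derivative_eq_intros)
      then show "((\<lambda>t. ?u t x) has_real_derivative
          (\<Sum>j\<in>UNIV. (pderiv_dir j F (s t x) - pderiv_dir j F (shift g x)) * (g' j x - g j x))) (at t)"
        by (simp add: L_def sum_subtractf left_diff_distrib)
    next
      fix t :: real assume t: "0 \<le> t" "t \<le> 1"
      have bt: "\<forall>j. bd 0 R (\<lambda>x. g j x + t * (g' j x - g j x))"
        using bd_convex[OF g[rule_format] g'[rule_format] t] by blast
      have dt: "\<forall>j. bd 0 d (\<lambda>x. (g j x + t * (g' j x - g j x)) - g j x)"
      proof
        fix j show "bd 0 d (\<lambda>x. (g j x + t * (g' j x - g j x)) - g j x)"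
          using bd_cmult[OF d[rule_format, of j], of t, THEN bd_mono, of d] t cd by (simp add: mult_left_le_one_le)
      qed
      show "bd 0 (?n * (?K * (?D * c * d) * d))
         (\<lambda>x. \<Sum>j\<in>UNIV. (pderiv_dir j F (s t x) - pderiv_dir j F (shift g x)) * (g' j x - g j x))"
        unfolding s_def
        by (intro bd_sum_const bd_mult[OF bd_comp_diff[OF bd_pd[OF F] g bt l lip_shift_convex[OF l l' t] dt] d[rule_format]])
    next
      have 1: "continuous_on UNIV (\<lambda>x. F (shift g' x))" "continuous_on UNIV (\<lambda>x. F (shift g x))"
        using bd_comp_cont[OF F g'[rule_format]] bd_comp_cont[OF F g[rule_format]] by auto
      have 2: "continuous_on UNIV L"
        unfolding L_def
        by (intro continuous_on_sum continuous_on_mult bd_comp_cont[OF bd_pd[OF F] g[rule_format]] bd_cont[OF d[rule_format]])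
      have "continuous_on UNIV (\<lambda>x. (F (shift g' x) - L x) - F (shift g x))"
        by (intro continuous_on_diff 1 2)
      then show "continuous_on UNIV (\<lambda>x. ?u 1 x - ?u 0 x)"
        by (simp add: s_def)
    qed
    also have "(\<lambda>x. ?u 1 x - ?u 0 x) = comp_rem F g g'"
      by (simp add: s_def comp_rem_def fun_eq_iff L_def)
    finally show "bd 0 (?n * ?K * ?D * c * d * d) (comp_rem F g g')"
      by (simp only: mult.assoc)
  qed (use Kdiff_nonneg[where ?'n = 'n, of 0 R] Kmul_pos[of "TYPE('n)" 0] in simp)
next
  case (Suc p)
  let ?n = "real CARD('n)" and ?K = "Kmul TYPE('n) p"
  define E where "E = 2 * ?n"
  have E: "1 \<le> E" unfolding E_def using zero_less_card_finite[where 'a='n] by linarith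
  have EK: "?K > 0" by (rule Kmul_pos)
  let ?D = "Kdiff TYPE('n) p (E * R)"
  have D: "?D \<ge> 0" by (rule Kdiff_nonneg)
  obtain K where K: "K \<ge> 0" and KI:
    "\<forall>(F::real^'n \<Rightarrow> real) c (g::'n \<Rightarrow> real^'n \<Rightarrow> real) g' d.
     bd (Suc (Suc p)) c F \<longrightarrow> (\<forall>j. bd p (E*R) (g j)) \<longrightarrow> (\<forall>j. bd p (E*R) (g' j)) \<longrightarrow> lip (E*R) (shift g) \<longrightarrow> lip (E*R) (shift g') \<longrightarrow>
     (\<forall>j. bd p d (\<lambda>x. g' j x - g j x)) \<longrightarrow> bd p (K * c * d * d) (comp_rem F g g')"
    using Suc[of "E*R"] by blast
  \<comment> \<open>The summands bound, in this order, the remainder for one derivative of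
    \<open>F\<close>, the two kinds of products, and the supremum of the remainder itself.\<close>
  let ?M = "K * E * E + ?n * (?K * \<bar>R\<bar> * (K * E * E) + ?K * (?D * E * E)) + K * E * E * E"
  have nn: "0 \<le> K * E * E" "0 \<le> ?n * (?K * \<bar>R\<bar> * (K * E * E) + ?K * (?D * E * E))" "0 \<le> K * E * E * E"
    using K E EK D by (auto intro!: add_nonneg_nonneg mult_nonneg_nonneg)
  show ?case
  proof (intro exI[of _ ?M] conjI allI impI)
    show "0 \<le> ?M" using nn by linarith
    fix F :: "real^'n \<Rightarrow> real" and c d and g g' :: "'n \<Rightarrow> real^'n \<Rightarrow> real"
    assume F: "bd (Suc (Suc (Suc p))) c F" and g: "\<forall>j. bd (Suc p) R (g j)" and g': "\<forall>j. bd (Suc p) R (g' j)"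
      and l: "lip R (shift g)" and l': "lip R (shift g')"
      and d: "\<forall>j. bd (Suc p) d (\<lambda>x. g' j x - g j x)"
    have c0: "0 \<le> c * d * d" using bd_nonneg[OF F] bd_nonneg[OF d[rule_format]] by simp
    have R: "R \<ge> 0" using lip_nonneg[OF l] .
    have RE: "R \<le> E * R" using R E by (simp add: mult_le_cancel_right1)
    have L: "lip (E * R) (shift g)" "lip (E * R) (shift g')" using lip_mono[OF l RE] lip_mono[OF l' RE] .
    have G: "\<forall>j. bd p (E * R) (g j)" "\<forall>j. bd p (E * R) (g' j)" "\<forall>j. bd p (E * d) (\<lambda>x. g' j x - g j x)"
      unfolding E_def using bd_embed[OF g[rule_format]] bd_embed[OF g'[rule_format]] bd_embed[OF d[rule_format]] by blast+
    have FE: "bd (Suc (Suc p)) (E * c) F" unfolding E_def by (rule bd_embed[OF F])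
    have remF: "bd p (K * (E * c) * (E * d) * (E * d)) (comp_rem F g g')"
      by (rule KI[rule_format, OF FE]) (use G L in auto)
    have remdF: "bd p (K * c * (E * d) * (E * d)) (comp_rem (pderiv_dir j F) g g')" for j
      by (rule KI[rule_format, OF bd_pd[OF F]]) (use G L in auto)
    have diffdF: "bd p (?D * (E * c) * (E * d)) (\<lambda>x. pderiv_dir j F (shift g' x) - pderiv_dir j F (shift g x))" for j
      unfolding E_def by (rule bd_comp_diff[OF bd_pd[OF bd_embed[OF F]]]) (use G L in \<open>auto simp: E_def\<close>)
    have pdh: "has_pd i (\<lambda>x. g' j x - g j x) (\<lambda>x. pderiv_dir i (g' j) x - pderiv_dir i (g j) x)" for i j
      by (rule has_pd_diff[OF bd_has_pd[OF g'[rule_format]] bd_has_pd[OF g[rule_format]]])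
    have pdd: "bd p d (\<lambda>x. pderiv_dir i (g' j) x - pderiv_dir i (g j) x)" for i j
      using bd_pd[OF d[rule_format], of i j] has_pd_pderiv_dir[OF pdh, of i j] by simp
    have clairaut: "pderiv_dir l (pderiv_dir i F) x = pderiv_dir i (pderiv_dir l F) x" for i l x
      by (rule mixed_partials_commute[OF bd_has_pd[OF F] bd_has_pd[OF bd_pd[OF F]] bd_has_pd[OF F] bd_has_pd[OF bd_pd[OF F]]
          bd_pd_cont[OF bd_pd[OF F]] bd_pd_cont[OF bd_pd[OF F]]])
    show "bd (Suc p) (?M * c * d * d) (comp_rem F g g')"
    proof (rule bd_SucI)
      show "continuous_on UNIV (comp_rem F g g')" by (rule bd_cont[OF remF])
      fix x
      have "\<bar>comp_rem F g g' x\<bar> \<le> (K * E * E * E) * (c * d * d)"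
        using bd_abs[OF remF, of x] by (simp add: mult_ac)
      also have "\<dots> \<le> ?M * (c * d * d)" using nn c0 by (intro mult_right_mono) linarith+
      finally show "\<bar>comp_rem F g g' x\<bar> \<le> ?M * c * d * d" by (simp only: mult.assoc)
    next
      fix i
      let ?P = "\<lambda>x. comp_rem (pderiv_dir i F) g g' x +
         (\<Sum>j\<in>UNIV. pderiv_dir i (g j) x * comp_rem (pderiv_dir j F) g g' x +
           (pderiv_dir j F (shift g' x) - pderiv_dir j F (shift g x)) * (pderiv_dir i (g' j) x - pderiv_dir i (g j) x))"
      let ?Q = "\<lambda>x. ((pderiv_dir i F (shift g' x) + (\<Sum>j\<in>UNIV. pderiv_dir j F (shift g' x) * pderiv_dir i (g' j) x))
         - (pderiv_dir i F (shift g x) + (\<Sum>j\<in>UNIV. pderiv_dir j F (shift g x) * pderiv_dir i (g j) x)))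
         - (\<Sum>j\<in>UNIV. pderiv_dir j F (shift g x) * (pderiv_dir i (g' j) x - pderiv_dir i (g j) x) +
             (pderiv_dir i (pderiv_dir j F) (shift g x) + (\<Sum>l\<in>UNIV. pderiv_dir l (pderiv_dir j F) (shift g x) * pderiv_dir i (g l) x))
              * (g' j x - g j x))"
      have "has_pd i (comp_rem F g g') ?Q"
        unfolding comp_rem_def
        by (intro has_pd_diff[OF has_pd_diff[OF bd_comp_has_pd[OF F g'[rule_format]] bd_comp_has_pd[OF F g[rule_format]]]]
            has_pd_sum has_pd_mult[OF bd_comp_has_pd[OF bd_pd[OF F] g[rule_format]] pdh])
      also have "?Q = ?P"
        unfolding comp_rem_def
        by (rule ext, rule comp_rem_derivative_eq[where D = "\<lambda>l j. pderiv_dir l (pderiv_dir j F) (shift g _)"]) (rule clairaut)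
      finally show "has_pd i (comp_rem F g g') ?P" .
      have "bd p (K * c * (E * d) * (E * d) + ?n * (?K * R * (K * c * (E * d) * (E * d)) + ?K * (?D * (E * c) * (E * d)) * d)) ?P"
        by (intro bd_add[OF remdF] bd_sum_const bd_add bd_mult[OF bd_pd[OF g[rule_format]] remdF] bd_mult[OF diffdF pdd])
      then show "bd p (?M * c * d * d) ?P"
        by (rule bd_mono) (use R mult_nonneg_nonneg[OF nn(3) c0] in \<open>simp add: algebra_simps\<close>)
    qed
  qed
qed

definition Krem :: "'n::finite itself \<Rightarrow> nat \<Rightarrow> real \<Rightarrow> real" where
  "Krem _ p R = (SOME K. K \<ge> 0 \<and> (\<forall>(F::real^'n \<Rightarrow> real) c (g::'n \<Rightarrow> real^'n \<Rightarrow> real) g' d.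
     bd (Suc (Suc p)) c F \<longrightarrow> (\<forall>j. bd p R (g j)) \<longrightarrow> (\<forall>j. bd p R (g' j)) \<longrightarrow> lip R (shift g) \<longrightarrow> lip R (shift g') \<longrightarrow>
     (\<forall>j. bd p d (\<lambda>x. g' j x - g j x)) \<longrightarrow> bd p (K * c * d * d) (comp_rem F g g')))"

lemma Krem_nonneg: "Krem TYPE('n::finite) p R \<ge> 0"
  and bd_comp_rem: "\<lbrakk>bd (Suc (Suc p)) c (F::real^'n::finite \<Rightarrow> real); \<forall>j. bd p R (g j); \<forall>j. bd p R (g' j);
     lip R (shift g); lip R (shift g'); \<forall>j. bd p d (\<lambda>x. g' j x - g j x)\<rbrakk> \<Longrightarrow>
     bd p (Krem TYPE('n) p R * c * d * d) (comp_rem F g g')"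
  using someI_ex[OF bd_comp_rem_ex[where ?'n = 'n, of p R]] unfolding Krem_def by blast+

section \<open>Bounded functions and convergence along filters\<close>

definition Cb :: "nat \<Rightarrow> (real^'n::finite \<Rightarrow> real) \<Rightarrow> bool" where
  "Cb p f \<longleftrightarrow> (\<exists>c. bd p c f)"

lemma CbI: "bd p c f \<Longrightarrow> Cb p f" by (auto simp: Cb_def)

lemma CbE: assumes "Cb p f" obtains c where "bd p c f" "c > 0"
proof -
  from assms obtain c where c: "bd p c f" by (auto simp: Cb_def)
  then have "bd p (c + 1) f" "c + 1 > 0" using bd_nonneg[OF c] by (auto intro: bd_mono)
  then show ?thesis by (rule that)
qed

lemma Cb_family:
  fixes g :: "'i::finite \<Rightarrow> real^'n::finite \<Rightarrow> real"
  assumes "\<And>j. Cb p (g j)"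
  shows "\<exists>c>0. \<forall>j. bd p c (g j)"
proof -
  from assms have "\<forall>j. \<exists>c. bd p c (g j)" by (auto simp: Cb_def)
  then obtain c where c: "\<And>j. bd p (c j) (g j)" by metis
  let ?c = "max 1 (Max (range c))"
  have "c j \<le> ?c" for j by (simp add: le_max_iff_disj)
  then have "\<forall>j. bd p ?c (g j)" by (blast intro: bd_mono[OF c])
  then show ?thesis by (intro exI[of _ ?c]) simp
qed

lemma Cb_add: "Cb p f \<Longrightarrow> Cb p g \<Longrightarrow> Cb p (\<lambda>x. f x + g x)"
  unfolding Cb_def using bd_add by blast

lemma Cb_diff: "Cb p f \<Longrightarrow> Cb p g \<Longrightarrow> Cb p (\<lambda>x. f x - g x)"
  unfolding Cb_def using bd_diff by blast

lemma Cb_cmult: "Cb p f \<Longrightarrow> Cb p (\<lambda>x. a * f x)"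
  unfolding Cb_def using bd_cmult by blast

lemma Cb_mult: "Cb p f \<Longrightarrow> Cb p g \<Longrightarrow> Cb p (\<lambda>x. f x * g x)"
  unfolding Cb_def using bd_mult by blast

lemma Cb_const: "Cb p (\<lambda>x. a)"
  unfolding Cb_def using bd_const by blast

lemma Cb_translate: "Cb p f \<Longrightarrow> Cb p (\<lambda>x. f (x + a))"
  unfolding Cb_def using bd_translate by blast

lemma Cb_pd: "Cb (Suc p) f \<Longrightarrow> Cb p (pderiv_dir i f)"
  unfolding Cb_def using bd_pd by blast

lemma Cb_has_pd: "Cb (Suc p) f \<Longrightarrow> has_pd i f (pderiv_dir i f)"
  unfolding Cb_def using bd_has_pd by blast

lemma Cb_cont: "Cb p f \<Longrightarrow> continuous_on UNIV f"
  unfolding Cb_def using bd_cont by blast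

lemma Cb_embed: "Cb (Suc p) f \<Longrightarrow> Cb p f"
  unfolding Cb_def using bd_embed by blast

lemma Cb_embed_le: "p \<le> q \<Longrightarrow> Cb q f \<Longrightarrow> Cb p f"
  unfolding Cb_def using bd_embed_le by blast

lemma Cb_recip: "Cb p f \<Longrightarrow> \<delta> > 0 \<Longrightarrow> (\<And>x. \<delta> \<le> f x) \<Longrightarrow> Cb p (\<lambda>x. 1 / f x)"
  unfolding Cb_def using bd_recip[of \<delta> p] by blast

lemma pd_add: "Cb (Suc p) f \<Longrightarrow> Cb (Suc q) g \<Longrightarrow>
    pderiv_dir i (\<lambda>x. f x + g x) = (\<lambda>x. pderiv_dir i f x + pderiv_dir i g x)"
  by (intro has_pd_pderiv_dir has_pd_add Cb_has_pd)

lemma pd_diff: "Cb (Suc p) f \<Longrightarrow> Cb (Suc q) g \<Longrightarrow>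
    pderiv_dir i (\<lambda>x. f x - g x) = (\<lambda>x. pderiv_dir i f x - pderiv_dir i g x)"
  by (intro has_pd_pderiv_dir has_pd_diff Cb_has_pd)

lemma pd_cmult: "Cb (Suc p) f \<Longrightarrow> pderiv_dir i (\<lambda>x. a * f x) = (\<lambda>x. a * pderiv_dir i f x)"
  by (intro has_pd_pderiv_dir has_pd_cmult Cb_has_pd)

lemma pd_translate: "Cb (Suc p) f \<Longrightarrow> pderiv_dir i (\<lambda>x. f (x + a)) = (\<lambda>x. pderiv_dir i f (x + a))"
  by (intro has_pd_pderiv_dir has_pd_translate Cb_has_pd)

text \<open>Convergence to zero in the norm of order \<open>p\<close>. A general filter covers both
  uses, sequences of translates and neighbourhoods of a point of the domain.\<close>

definition small :: "nat \<Rightarrow> ('b \<Rightarrow> real^'n::finite \<Rightarrow> real) \<Rightarrow> 'b filter \<Rightarrow> bool" where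
  "small p u Fl \<longleftrightarrow> (\<forall>e>0. eventually (\<lambda>k. bd p e (u k)) Fl)"

lemma smallD: "small p u Fl \<Longrightarrow> e > 0 \<Longrightarrow> eventually (\<lambda>k. bd p e (u k)) Fl"
  by (simp add: small_def)

text \<open>A linear estimate that holds eventually carries smallness over. The sign of
  \<open>K\<close> is left open, so \<open>e\<close> is divided by
  \<open>\<bar>K\<bar> + 1\<close>.\<close>

lemma small_transfer:
  assumes u: "small p u Fl" and ev: "eventually (\<lambda>k. \<forall>e>0. bd p e (u k) \<longrightarrow> bd q (K * e) (w k)) Fl"
  shows "small q w Fl"
  unfolding small_def
proof (intro allI impI)
  fix e :: real assume e: "e > 0"
  have K: "\<bar>K\<bar> + 1 > 0" by simp
  have e': "e / (\<bar>K\<bar> + 1) > 0" using e K by simp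
  have "K * (e / (\<bar>K\<bar> + 1)) \<le> (\<bar>K\<bar> + 1) * (e / (\<bar>K\<bar> + 1))"
    using e' by (intro mult_right_mono) linarith+
  also have "\<dots> = e" using K by simp
  finally have le: "K * (e / (\<bar>K\<bar> + 1)) \<le> e" .
  show "eventually (\<lambda>k. bd q e (w k)) Fl"
    using ev smallD[OF u e']
  proof eventually_elim
    case (elim k)
    then have "bd q (K * (e / (\<bar>K\<bar> + 1))) (w k)" using e' by blast
    then show ?case using le by (rule bd_mono)
  qed
qed

lemma small_add: "small p u Fl \<Longrightarrow> small p w Fl \<Longrightarrow> small p (\<lambda>k x. u k x + w k x) Fl"
  unfolding small_def
proof (intro allI impI)
  fix e :: real assume *: "\<forall>e>0. eventually (\<lambda>k. bd p e (u k)) Fl" "\<forall>e>0. eventually (\<lambda>k. bd p e (w k)) Fl" "e > 0"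
  have h: "e / 2 > 0" using *(3) by simp
  show "eventually (\<lambda>k. bd p e (\<lambda>x. u k x + w k x)) Fl"
    using *(1)[rule_format, OF h] *(2)[rule_format, OF h]
  proof eventually_elim
    case (elim k)
    from bd_add[OF this] show ?case by simp
  qed
qed

lemma small_zero: "small p (\<lambda>k x. 0) Fl"
  by (simp add: small_def bd_zero)

lemma small_minus: "small p u Fl \<Longrightarrow> small p (\<lambda>k x. - u k x) Fl"
  by (rule small_transfer[of p u Fl p 1]) (auto intro!: always_eventually bd_minus)

lemma small_diff: "small p u Fl \<Longrightarrow> small p w Fl \<Longrightarrow> small p (\<lambda>k x. u k x - w k x) Fl"
  using small_add[OF _ small_minus, of p u Fl w] by simp

lemma small_cmult: "small p u Fl \<Longrightarrow> small p (\<lambda>k x. a * u k x) Fl"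
  by (rule small_transfer[of p u Fl p "\<bar>a\<bar>"]) (auto intro!: always_eventually bd_cmult)

lemma small_mult_bounded:
  fixes u :: "'b \<Rightarrow> real^'n::finite \<Rightarrow> real"
  assumes "small p u Fl" "eventually (\<lambda>k. bd p C (a k)) Fl"
  shows "small p (\<lambda>k x. a k x * u k x) Fl"
proof (rule small_transfer[OF assms(1), of p "Kmul TYPE('n) p * C"])
  show "eventually (\<lambda>k. \<forall>e>0. bd p e (u k) \<longrightarrow> bd p (Kmul TYPE('n) p * C * e) (\<lambda>x. a k x * u k x)) Fl"
    using assms(2) by eventually_elim (blast intro: bd_mult)
qed

lemma small_subseq: "small p u Fl \<Longrightarrow> filterlim \<sigma> Fl G \<Longrightarrow> small p (\<lambda>k. u (\<sigma> k)) G"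
  unfolding small_def by (auto intro: eventually_compose_filterlim)

lemma small_cong: "eventually (\<lambda>k. u k = w k) Fl \<Longrightarrow> small p u Fl \<Longrightarrow> small p w Fl"
  by (rule small_transfer[of p u Fl p 1]) (auto elim!: eventually_mono)

lemma small_embed: "small (Suc p) (u :: 'b \<Rightarrow> real^'n::finite \<Rightarrow> real) Fl \<Longrightarrow> small p u Fl"
  by (rule small_transfer[of "Suc p" u Fl p "2 * real CARD('n)"]) (assumption, intro always_eventually allI impI bd_embed)

lemma small_embed_le: "p \<le> q \<Longrightarrow> small q u Fl \<Longrightarrow> small p u Fl"
  by (induction q rule: dec_induct) (auto dest: small_embed)

definition cv :: "nat \<Rightarrow> ('b \<Rightarrow> real^'n::finite \<Rightarrow> real) \<Rightarrow> (real^'n \<Rightarrow> real) \<Rightarrow> 'b filter \<Rightarrow> bool" where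
  "cv p f F Fl \<longleftrightarrow> small p (\<lambda>k x. f k x - F x) Fl"

lemma cv_bounded:
  assumes "cv p f F Fl" "bd p c F"
  shows "eventually (\<lambda>k. bd p (c + 1) (f k)) Fl"
  using smallD[OF assms(1)[unfolded cv_def] zero_less_one]
proof eventually_elim
  case (elim k)
  from bd_add[OF assms(2) elim] show ?case by simp
qed

lemma cv_const: "cv p (\<lambda>k. F) F Fl"
  by (simp add: cv_def small_zero)

lemma cv_embed: "cv (Suc p) f F Fl \<Longrightarrow> cv p f F Fl"
  unfolding cv_def by (rule small_embed)

lemma cv_embed_le: "p \<le> q \<Longrightarrow> cv q f F Fl \<Longrightarrow> cv p f F Fl"
  unfolding cv_def by (rule small_embed_le)

lemma cv_add: "cv p f F Fl \<Longrightarrow> cv p g G Fl \<Longrightarrow> cv p (\<lambda>k x. f k x + g k x) (\<lambda>x. F x + G x) Fl"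
  unfolding cv_def by (drule (1) small_add) (simp add: algebra_simps)

lemma cv_cmult: "cv p f F Fl \<Longrightarrow> cv p (\<lambda>k x. a * f k x) (\<lambda>x. a * F x) Fl"
  unfolding cv_def by (drule small_cmult[of _ _ _ a]) (simp add: algebra_simps)

lemma cv_diff: "cv p f F Fl \<Longrightarrow> cv p g G Fl \<Longrightarrow> cv p (\<lambda>k x. f k x - g k x) (\<lambda>x. F x - G x) Fl"
  unfolding cv_def by (drule (1) small_diff) (simp add: algebra_simps)

lemma cv_mult:
  assumes "cv p f F Fl" "cv p g G Fl" "Cb p F" "Cb p G"
  shows "cv p (\<lambda>k x. f k x * g k x) (\<lambda>x. F x * G x) Fl"
proof -
  obtain c d where c: "bd p c F" and d: "bd p d G" using assms by (auto simp: Cb_def)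
  have "small p (\<lambda>k x. f k x * (g k x - G x) + G x * (f k x - F x)) Fl"
    using assms(1,2) unfolding cv_def
    by (intro small_add small_mult_bounded[OF _ cv_bounded[OF assms(1) c]] small_mult_bounded[where C = d]) (auto simp: d)
  then show ?thesis unfolding cv_def by (simp add: algebra_simps)
qed

lemma cv_pd:
  assumes "cv (Suc p) f F Fl" "Cb (Suc p) F"
  shows "cv p (\<lambda>k. pderiv_dir i (f k)) (pderiv_dir i F) Fl"
  unfolding cv_def
proof (rule small_transfer[OF assms(1)[unfolded cv_def], of p 1], intro always_eventually allI impI)
  fix k and e :: real assume "e > 0" and b: "bd (Suc p) e (\<lambda>x. f k x - F x)"
  have "pderiv_dir i (f k) = pderiv_dir i (\<lambda>x. (f k x - F x) + F x)" by simp
  also have "\<dots> = (\<lambda>x. pderiv_dir i (\<lambda>x. f k x - F x) x + pderiv_dir i F x)"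
    by (rule pd_add[OF CbI[OF b] assms(2)])
  finally have "(\<lambda>x. pderiv_dir i (f k) x - pderiv_dir i F x) = pderiv_dir i (\<lambda>x. f k x - F x)" by simp
  then show "bd p (1 * e) (\<lambda>x. pderiv_dir i (f k) x - pderiv_dir i F x)"
    using bd_pd[OF b, of i] by simp
qed

text \<open>Raises convergence by one order. The derivatives may be given by any formula, which
  suits inverse maps, whose derivatives are expressed through the maps themselves.\<close>

lemma cv_Suc:
  assumes "cv p f F Fl" "\<And>i. cv p (\<lambda>k. f' k i) (F' i) Fl"
    and "eventually (\<lambda>k. \<forall>i. has_pd i (f k) (f' k i)) Fl" "\<And>i. has_pd i F (F' i)"
  shows "cv (Suc p) f F Fl"
  unfolding cv_def small_def
proof (intro allI impI)
  fix e :: real assume e: "e > 0"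
  have 1: "eventually (\<lambda>k. bd p e (\<lambda>x. f k x - F x)) Fl"
    using assms(1) e by (simp add: cv_def small_def)
  have 2: "eventually (\<lambda>k. \<forall>i. bd p e (\<lambda>x. f' k i x - F' i x)) Fl"
    using assms(2) e by (auto simp: cv_def small_def intro: eventually_all_finite)
  show "eventually (\<lambda>k. bd (Suc p) e (\<lambda>x. f k x - F x)) Fl"
    using 1 2 assms(3)
  proof eventually_elim
    case (elim k)
    show ?case
      by (rule bd_SucI[OF bd_cont[OF elim(1)] bd_abs[OF elim(1)] has_pd_diff[OF elim(3)[rule_format] assms(4)] elim(2)[rule_format]])
  qed
qed

text \<open>The difference of the reciprocals is $-(f_k - F)/(f_k F)$; \<open>bd_recip\<close>
  bounds both reciprocals by the same constant because the lower bound is uniform.\<close>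

lemma cv_recip:
  fixes F :: "real^'n::finite \<Rightarrow> real"
  assumes "cv p f F Fl" "Cb p F" "\<delta> > 0" "eventually (\<lambda>k. \<forall>x. \<delta> \<le> f k x) Fl" "\<And>x. \<delta> \<le> F x"
  shows "cv p (\<lambda>k x. 1 / f k x) (\<lambda>x. 1 / F x) Fl"
proof -
  obtain c where c: "bd p c F" using assms by (auto simp: Cb_def)
  obtain K where K: "\<forall>f::real^'n \<Rightarrow> real. bd p (c + 1) f \<longrightarrow> (\<forall>x. \<delta> \<le> f x) \<longrightarrow> bd p K (\<lambda>x. 1 / f x)"
    using bd_recip[OF assms(3)] by blast
  have F: "bd p K (\<lambda>x. 1 / F x)"
    by (rule K[rule_format]) (use c assms(5) in \<open>auto intro: bd_mono\<close>)
  have ev: "eventually (\<lambda>k. bd p K (\<lambda>x. 1 / f k x)) Fl"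
    using cv_bounded[OF assms(1) c] assms(4) by eventually_elim (use K in blast)
  have "eventually (\<lambda>k. bd p (Kmul TYPE('n) p * K * K) (\<lambda>x. - ((1 / f k x) * (1 / F x)))) Fl"
    using ev by eventually_elim (intro bd_minus bd_mult F)
  from small_mult_bounded[OF assms(1)[unfolded cv_def] this]
  have s: "small p (\<lambda>k x. - ((1 / f k x) * (1 / F x)) * (f k x - F x)) Fl" .
  show ?thesis
    unfolding cv_def
  proof (rule small_cong[OF _ s])
    show "eventually (\<lambda>k. (\<lambda>x. - ((1 / f k x) * (1 / F x)) * (f k x - F x)) = (\<lambda>x. 1 / f k x - 1 / F x)) Fl"
      using assms(4)
    proof eventually_elim
      case (elim k)
      have "f k x \<noteq> 0" "F x \<noteq> 0" for x
        using elim[rule_format, of x] assms(5)[of x] assms(3) by linarith+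
      then show ?case by (simp add: fun_eq_iff field_simps)
    qed
  qed
qed

section \<open>Almost periodic functions\<close>

definition AP :: "nat \<Rightarrow> (real^'n::finite \<Rightarrow> real) \<Rightarrow> bool" where
  "AP p f \<longleftrightarrow> Cb p f \<and> (\<forall>s :: nat \<Rightarrow> real^'n. \<exists>\<sigma> G. strict_mono (\<sigma> :: nat \<Rightarrow> nat) \<and> Cb p G \<and>
     cv p (\<lambda>k x. f (x + s (\<sigma> k))) G sequentially)"

lemma AP_Cb: "AP p f \<Longrightarrow> Cb p f" by (simp add: AP_def)

text \<open>Each translate of \<open>G\<close> by \<open>c l\<close> is within
  \<open>1 / Suc l\<close> of the translate of \<open>f\<close> by \<open>s (K l) + c l\<close>;
  precompactness of the translates of \<open>f\<close> along these combined shifts therefore gives a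
  convergent subsequence for \<open>G\<close>.\<close>

lemma AP_limit:
  assumes f: "AP p f" and cvG: "cv p (\<lambda>k x. f (x + s k)) G sequentially" and G: "Cb p G"
  shows "AP p G"
  unfolding AP_def
proof (intro conjI allI G)
  fix c :: "nat \<Rightarrow> real^'a"
  have "\<exists>k. bd p (1 / Suc l) (\<lambda>x. f (x + s k) - G x)" for l
    using smallD[OF cvG[unfolded cv_def], of "1 / Suc l"] by (auto simp: eventually_sequentially simp del: of_nat_Suc)
  then obtain K where K: "\<And>l. bd p (1 / Suc l) (\<lambda>x. f (x + s (K l)) - G x)" by metis
  obtain \<sigma> H where \<sigma>: "strict_mono \<sigma>" and H: "Cb p H"
    and cvH: "cv p (\<lambda>k x. f (x + (s (K (\<sigma> k)) + c (\<sigma> k)))) H sequentially"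
    using f[unfolded AP_def, THEN conjunct2, rule_format, of "\<lambda>l. s (K l) + c l"] by blast
  have "small p (\<lambda>l x. f ((x + c l) + s (K l)) - G (x + c l)) sequentially"
    unfolding small_def
  proof (intro allI impI)
    fix e :: real assume "e > 0"
    then obtain N where N: "1 / Suc N < e" using nat_approx_posE by (metis inverse_eq_divide)
    show "eventually (\<lambda>l. bd p e (\<lambda>x. f ((x + c l) + s (K l)) - G (x + c l))) sequentially"
      using eventually_ge_at_top[of N]
    proof eventually_elim
      case (elim l)
      have "1 / Suc l \<le> 1 / Suc N" using elim by (intro divide_left_mono) auto
      then have "bd p e (\<lambda>x. f (x + s (K l)) - G x)" using N by (intro bd_mono[OF K]) linarith
      from bd_translate[OF this] show ?case .
    qed
  qed
  from small_diff[OF cvH[unfolded cv_def] small_subseq[OF this filterlim_subseq[OF \<sigma>]]]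
  have "small p (\<lambda>k x. (f (x + (s (K (\<sigma> k)) + c (\<sigma> k))) - H x) - (f ((x + c (\<sigma> k)) + s (K (\<sigma> k))) - G (x + c (\<sigma> k)))) sequentially"
    .
  then have "cv p (\<lambda>k x. G (x + c (\<sigma> k))) H sequentially"
    unfolding cv_def by (simp add: algebra_simps)
  with \<sigma> H show "\<exists>\<sigma> H. strict_mono \<sigma> \<and> Cb p H \<and> cv p (\<lambda>k x. G (x + c (\<sigma> k))) H sequentially" by blast
qed

text \<open>Subsequences are extracted successively. The limits are almost periodic by
  \<open>AP_limit\<close>, so they are approximable when they later serve as outer functions of
  compositions.\<close>

lemma AP_common:
  assumes "finite J" "\<And>j. j \<in> J \<Longrightarrow> AP (p j) (f j)"
  shows "\<exists>\<sigma> G. strict_mono (\<sigma> :: nat \<Rightarrow> nat) \<and>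
    (\<forall>j\<in>J. AP (p j) (G j) \<and> cv (p j) (\<lambda>k x. f j (x + s (\<sigma> k))) (G j) sequentially)"
  using assms
proof (induction J rule: finite_induct)
  case empty
  show ?case by (intro exI[of _ id]) (auto simp: strict_mono_def)
next
  case (insert i J)
  then obtain \<sigma> G where \<sigma>: "strict_mono (\<sigma> :: nat \<Rightarrow> nat)"
    and G: "\<forall>j\<in>J. AP (p j) (G j) \<and> cv (p j) (\<lambda>k x. f j (x + s (\<sigma> k))) (G j) sequentially"
    by blast
  have i: "AP (p i) (f i)" using insert.prems by simp
  obtain \<tau> H where \<tau>: "strict_mono (\<tau> :: nat \<Rightarrow> nat)" and H: "Cb (p i) H"
    and cvH: "cv (p i) (\<lambda>k x. f i (x + s (\<sigma> (\<tau> k)))) H sequentially"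
    using i[unfolded AP_def, THEN conjunct2, rule_format, of "\<lambda>k. s (\<sigma> k)"] by blast
  have "strict_mono (\<lambda>k. \<sigma> (\<tau> k))" using \<sigma> \<tau> by (auto simp: strict_mono_def)
  moreover have "AP (p i) H" by (rule AP_limit[OF i cvH H])
  moreover have "cv (p j) (\<lambda>k x. f j (x + s (\<sigma> (\<tau> k)))) (G j) sequentially" if "j \<in> J" for j
    using G[rule_format, OF that] small_subseq[OF _ filterlim_subseq[OF \<tau>]] unfolding cv_def by blast
  ultimately show ?case using G cvH insert.hyps
    by (intro exI[of _ "\<lambda>k. \<sigma> (\<tau> k)"] exI[of _ "G(i := H)"]) auto
qed

text \<open>The scheme for all closure properties: for an operation on finitely many functions it is
  enough to find a limit of the translated result whenever the translated data converge. The limit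
  data may be assumed almost periodic, and each datum may have its own order.\<close>

lemma AP_opI:
  fixes f :: "'i::finite \<Rightarrow> real^'n::finite \<Rightarrow> real"
  assumes "\<And>j. AP (q j) (f j)" "Cb p F"
    and "\<And>s G. (\<And>j. AP (q j) (G j)) \<Longrightarrow> (\<And>j. cv (q j) (\<lambda>k x. f j (x + s k)) (G j) sequentially) \<Longrightarrow>
       \<exists>H. Cb p H \<and> cv p (\<lambda>k x. F (x + s k)) H sequentially"
  shows "AP p F"
  unfolding AP_def
proof (intro conjI allI assms(2))
  fix s :: "nat \<Rightarrow> real^'n"
  obtain \<sigma> G where \<sigma>: "strict_mono (\<sigma> :: nat \<Rightarrow> nat)"
    and "\<forall>j\<in>UNIV. AP (q j) (G j) \<and> cv (q j) (\<lambda>k x. f j (x + s (\<sigma> k))) (G j) sequentially"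
    using AP_common[of UNIV q f s] assms(1) by auto
  then show "\<exists>\<sigma> G. strict_mono \<sigma> \<and> Cb p G \<and> cv p (\<lambda>k x. F (x + s (\<sigma> k))) G sequentially"
    using assms(3)[of G "\<lambda>k. s (\<sigma> k)"] by blast
qed

lemma AP_op1I:
  fixes f :: "real^'n::finite \<Rightarrow> real"
  assumes "AP q f" "Cb p F"
    and "\<And>s G. AP q G \<Longrightarrow> cv q (\<lambda>k x. f (x + s k)) G sequentially \<Longrightarrow>
       \<exists>H. Cb p H \<and> cv p (\<lambda>k x. F (x + s k)) H sequentially"
  shows "AP p F"
proof (rule AP_opI[where f = "\<lambda>j::unit. f" and q = "\<lambda>_. q"])
  show "\<exists>H. Cb p H \<and> cv p (\<lambda>k x. F (x + s k)) H sequentially"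
    if "\<And>j. AP q (G j)" "\<And>j. cv q (\<lambda>k x. f (x + s k)) (G j) sequentially" for s and G :: "unit \<Rightarrow> real^'n \<Rightarrow> real"
    by (rule assms(3)[OF that])
qed (use assms in auto)

lemma AP_op2I:
  fixes f :: "real^'n::finite \<Rightarrow> real"
  assumes "AP q f" "AP q' f'" "Cb p F"
    and "\<And>s G G'. AP q G \<Longrightarrow> AP q' G' \<Longrightarrow> cv q (\<lambda>k x. f (x + s k)) G sequentially \<Longrightarrow>
       cv q' (\<lambda>k x. f' (x + s k)) G' sequentially \<Longrightarrow> \<exists>H. Cb p H \<and> cv p (\<lambda>k x. F (x + s k)) H sequentially"
  shows "AP p F"
proof (rule AP_opI[where f = "\<lambda>j. if j then f else f'" and q = "\<lambda>j. if j then q else q'"])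
  show "\<exists>H. Cb p H \<and> cv p (\<lambda>k x. F (x + s k)) H sequentially"
    if "\<And>j. AP (if j then q else q') (G j)"
      "\<And>j. cv (if j then q else q') (\<lambda>k x. (if j then f else f') (x + s k)) (G j) sequentially"
    for s and G :: "bool \<Rightarrow> real^'n \<Rightarrow> real"
    using assms(4)[of "G True" "G False" s] that(1)[of True] that(1)[of False] that(2)[of True] that(2)[of False] by simp
qed (use assms in auto)

lemma AP_add:
  assumes f: "AP p f" and g: "AP p g"
  shows "AP p (\<lambda>x. f x + g x)"
  by (rule AP_op2I[OF f g Cb_add[OF AP_Cb[OF f] AP_Cb[OF g]]], rule exI, rule conjI[rotated],
      rule cv_add, assumption, assumption, rule Cb_add[OF AP_Cb AP_Cb], assumption, assumption)

lemma AP_cmult: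
  assumes f: "AP p f"
  shows "AP p (\<lambda>x. a * f x)"
  by (rule AP_op1I[OF f Cb_cmult[OF AP_Cb[OF f]]], rule exI, rule conjI[rotated],
      rule cv_cmult, assumption, rule Cb_cmult[OF AP_Cb], assumption)

lemma AP_mult:
  assumes f: "AP p f" and g: "AP p g"
  shows "AP p (\<lambda>x. f x * g x)"
  by (rule AP_op2I[OF f g Cb_mult[OF AP_Cb[OF f] AP_Cb[OF g]]], rule exI, rule conjI[rotated],
      rule cv_mult, assumption, assumption, erule AP_Cb, erule AP_Cb, rule Cb_mult[OF AP_Cb AP_Cb], assumption, assumption)

lemma AP_const: "AP p (\<lambda>x. a)"
  unfolding AP_def using Cb_const cv_const strict_mono_id by blast

lemma AP_embed:
  assumes f: "AP (Suc p) f"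
  shows "AP p f"
  by (rule AP_op1I[OF f Cb_embed[OF AP_Cb[OF f]]], rule exI, rule conjI[rotated],
      erule cv_embed, rule Cb_embed[OF AP_Cb], assumption)

lemma AP_embed_le: "p \<le> q \<Longrightarrow> AP q f \<Longrightarrow> AP p f"
  by (induction q rule: dec_induct) (auto dest: AP_embed)

lemma AP_pd:
  assumes f: "AP (Suc p) f"
  shows "AP p (pderiv_dir i f)"
proof (rule AP_op1I[OF f Cb_pd[OF AP_Cb[OF f]]])
  fix s G assume G: "AP (Suc p) G" "cv (Suc p) (\<lambda>k x. f (x + s k)) G sequentially"
  from cv_pd[OF G(2) AP_Cb[OF G(1)], of i]
  have "cv p (\<lambda>k x. pderiv_dir i f (x + s k)) (pderiv_dir i G) sequentially"
    by (simp add: pd_translate[OF AP_Cb[OF f]])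
  then show "\<exists>H. Cb p H \<and> cv p (\<lambda>k x. pderiv_dir i f (x + s k)) H sequentially"
    using Cb_pd[OF AP_Cb[OF G(1)]] by blast
qed

lemma cv_pointwise:
  assumes "cv p f F sequentially"
  shows "(\<lambda>k. f k x) \<longlonglongrightarrow> F x"
proof (rule LIMSEQ_I)
  fix r :: real assume "r > 0"
  then have "eventually (\<lambda>k. bd p (r/2) (\<lambda>x. f k x - F x)) sequentially"
    using smallD[OF assms[unfolded cv_def], of "r/2"] by simp
  then have "eventually (\<lambda>k. norm (f k x - F x) < r) sequentially"
  proof eventually_elim
    case (elim k)
    then show ?case using bd_abs[OF elim, of x] \<open>r > 0\<close> by simp
  qed
  then show "\<exists>no. \<forall>n\<ge>no. norm (f n x - F x) < r"
    by (simp add: eventually_sequentially)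
qed

lemma AP_recip:
  assumes f: "AP p f" and \<delta>: "\<delta> > 0" "\<And>x. \<delta> \<le> f x"
  shows "AP p (\<lambda>x. 1 / f x)"
proof (rule AP_op1I[OF f Cb_recip[OF AP_Cb[OF f] \<delta>]])
  fix s G assume G: "AP p G" "cv p (\<lambda>k x. f (x + s k)) G sequentially"
  have Gd: "\<delta> \<le> G x" for x
    by (rule LIMSEQ_le_const[OF cv_pointwise[OF G(2)]]) (use \<delta> in auto)
  have "cv p (\<lambda>k x. 1 / f (x + s k)) (\<lambda>x. 1 / G x) sequentially"
    by (rule cv_recip[OF G(2) AP_Cb[OF G(1)] \<delta>(1) _ Gd]) (simp add: \<delta>(2))
  then show "\<exists>H. Cb p H \<and> cv p (\<lambda>k x. 1 / f (x + s k)) H sequentially"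
    using Cb_recip[OF AP_Cb[OF G(1)] \<delta>(1) Gd] by blast
qed

text \<open>Otherwise there are shifts tending to zero whose translates all violate the bound
  \<open>e\<close>. A subsequence of these translates converges in norm by precompactness, and its
  pointwise limit is \<open>f\<close> by continuity, a contradiction.\<close>

lemma AP_translation_continuous:
  assumes f: "AP p f" and e: "e > 0"
  obtains \<delta> where "\<delta> > 0" "\<And>c. norm c < \<delta> \<Longrightarrow> bd p e (\<lambda>x. f (x + c) - f x)"
proof (rule ccontr)
  assume "\<not> thesis"
  then have "\<not> (\<forall>c. norm c < 1 / Suc k \<longrightarrow> bd p e (\<lambda>x. f (x + c) - f x))" for k
    using that[of "1 / Suc k"] by auto
  then have "\<forall>k. \<exists>c. norm c < 1 / Suc k \<and> \<not> bd p e (\<lambda>x. f (x + c) - f x)" by blast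
  then obtain c where c: "\<And>k. norm (c k) < 1 / Suc k" "\<And>k. \<not> bd p e (\<lambda>x. f (x + c k) - f x)" by metis
  obtain \<sigma> G where \<sigma>: "strict_mono \<sigma>" and G: "cv p (\<lambda>k x. f (x + c (\<sigma> k))) G sequentially"
    using f[unfolded AP_def, THEN conjunct2, rule_format, of c] by blast
  have "c \<longlonglongrightarrow> 0"
  proof (rule Lim_null_comparison)
    show "(\<lambda>k. 1 / real (Suc k)) \<longlonglongrightarrow> 0" using LIMSEQ_inverse_real_of_nat by (simp add: inverse_eq_divide)
    show "eventually (\<lambda>k. norm (c k) \<le> 1 / real (Suc k)) sequentially"
      by (intro always_eventually allI less_imp_le c(1))
  qed
  then have c0: "(\<lambda>k. c (\<sigma> k)) \<longlonglongrightarrow> 0" using LIMSEQ_subseq_LIMSEQ[OF _ \<sigma>] by (auto simp: o_def)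
  have "G x = f x" for x
  proof (rule LIMSEQ_unique[OF cv_pointwise[OF G]])
    have "isCont f x" using Cb_cont[OF AP_Cb[OF f]] by (simp add: continuous_on_eq_continuous_at)
    moreover have "(\<lambda>k. x + c (\<sigma> k)) \<longlonglongrightarrow> x" using tendsto_add[OF tendsto_const c0, of x] by simp
    ultimately show "(\<lambda>k. f (x + c (\<sigma> k))) \<longlonglongrightarrow> f x" by (rule isCont_tendsto_compose)
  qed
  then have "small p (\<lambda>k x. f (x + c (\<sigma> k)) - f x) sequentially" using G by (simp add: cv_def)
  from smallD[OF this e] show False using c(2) by simp
qed

end

subsection \<open>Mollification\<close>

text \<open>The derivatives of $e^{-1/t}$ are polynomials in \<open>1/t\<close> times $e^{-1/t}$; carrying the polynomial along
  makes the family of kernels closed under differentiation.\<close>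
definition bump_part :: "real poly \<Rightarrow> real \<Rightarrow> real" where
  "bump_part P t = (if t > 0 then poly P (1 / t) * exp (- (1 / t)) else 0)"

text \<open>With $u = 1/t$ the derivative of $P(u) e^{-u}$ in $t$ is $u^2 (P - P')(u)
  e^{-u}$.\<close>

definition bump_diff :: "real poly \<Rightarrow> real poly" where
  "bump_diff P = monom 1 2 * (P - pderiv P)"

lemma bump_part_tendsto_0: "(bump_part P \<longlongrightarrow> 0) (at 0)"
proof -
  have "((\<lambda>u. \<Sum>i\<le>degree P. coeff P i * (u ^ i / exp u)) \<longlongrightarrow> (\<Sum>i\<le>degree P. coeff P i * 0)) (at_top :: real filter)"
    by (intro tendsto_intros tendsto_power_div_exp_0)
  moreover have "(\<lambda>u. \<Sum>i\<le>degree P. coeff P i * (u ^ i / exp u)) = (\<lambda>u. poly P u * exp (- u))"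
    by (simp add: fun_eq_iff poly_altdef sum_distrib_right exp_minus divide_inverse mult.assoc)
  ultimately have "((\<lambda>u. poly P u * exp (- u)) \<longlongrightarrow> 0) at_top" by simp
  from filterlim_compose[OF this filterlim_inverse_at_top_right]
  have "((\<lambda>t. poly P (inverse t) * exp (- inverse t)) \<longlongrightarrow> 0) (at_right 0)" .
  moreover have "eventually (\<lambda>t. poly P (inverse t) * exp (- inverse t) = bump_part P t) (at_right 0)"
    using eventually_at_right_less[of 0] by eventually_elim (simp add: bump_part_def inverse_eq_divide)
  ultimately have "(bump_part P \<longlongrightarrow> 0) (at_right 0)"
    by (rule Lim_transform_eventually)
  moreover have "(bump_part P \<longlongrightarrow> 0) (at_left 0)"
  proof (rule Lim_transform_eventually[OF tendsto_const])
    show "eventually (\<lambda>t. 0 = bump_part P t) (at_left 0)"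
      using eventually_at_left_real[of "-1" 0] by (auto elim!: eventually_mono simp: bump_part_def)
  qed
  ultimately show ?thesis by (simp add: filterlim_at_split)
qed

lemma bump_part_deriv: "(bump_part P has_real_derivative bump_part (bump_diff P) t) (at t)"
proof (cases t "0 :: real" rule: linorder_cases)
  case less
  have "((\<lambda>_. 0 :: real) has_real_derivative 0) (at t)" by simp
  then have "(bump_part P has_real_derivative 0) (at t)"
    by (rule has_field_derivative_transform_within_open[of _ _ _ "{..<0}"]) (use less in \<open>auto simp: bump_part_def\<close>)
  then show ?thesis using less by (simp add: bump_part_def)
next
  case equal
  \<comment> \<open>Dividing by \<open>h\<close> multiplies the polynomial by its variable, so the
    difference quotient at 0 lies in the same family and tends to 0.\<close>
  have "bump_part P h / h = bump_part (monom 1 1 * P) h" for h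
    by (simp add: bump_part_def poly_monom)
  then have "(\<lambda>h. (bump_part P (0 + h) - bump_part P 0) / h) = bump_part (monom 1 1 * P)"
    by (simp add: fun_eq_iff bump_part_def[of _ 0])
  then show ?thesis
    using bump_part_tendsto_0[of "monom 1 1 * P"] equal by (simp add: DERIV_def bump_part_def[of _ 0])
next
  case greater
  have "((\<lambda>t. poly P (1 / t) * exp (- (1 / t))) has_real_derivative bump_part (bump_diff P) t) (at t)"
    using greater
    by (auto intro!: derivative_eq_intros
        simp: bump_part_def bump_diff_def poly_monom field_simps power2_eq_square)
  then show ?thesis
    by (rule has_field_derivative_transform_within_open[of _ _ _ "{0<..}"]) (use greater in \<open>auto simp: bump_part_def\<close>)
qed

lemma continuous_bump_part: "continuous_on S (bump_part P)"
  by (meson DERIV_isCont bump_part_deriv continuous_at_imp_continuous_on)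

text \<open>A product of one-dimensional kernels on the unit cube; \<open>P i\<close> governs the
  behaviour at the face \<open>t $ i = 0\<close> and \<open>Q i\<close> at the opposite face. With
  two polynomials per coordinate each partial derivative is a difference of two such
  kernels.\<close>

definition bump :: "('n::finite \<Rightarrow> real poly) \<Rightarrow> ('n \<Rightarrow> real poly) \<Rightarrow> real^'n \<Rightarrow> real" where
  "bump P Q t = (\<Prod>i\<in>UNIV. bump_part (P i) (t $ i) * bump_part (Q i) (1 - t $ i))"

lemma continuous_bump: "continuous_on S (bump P Q)"
  unfolding bump_def
  by (intro continuous_on_prod continuous_on_mult continuous_on_compose2[OF continuous_bump_part[of UNIV]] continuous_intros) auto

lemma bump_support: "bump P Q t \<noteq> 0 \<Longrightarrow> t \<in> cbox 0 1"
proof -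
  assume "bump P Q t \<noteq> 0"
  then have "bump_part (P i) (t $ i) * bump_part (Q i) (1 - t $ i) \<noteq> 0" for i
    by (simp add: bump_def)
  then have "0 < t $ i \<and> t $ i < 1" for i
    by (metis bump_part_def diff_gt_0_iff_gt mult_eq_0_iff)
  then show ?thesis by (simp add: mem_box_cart less_imp_le)
qed

lemma has_pd_bump:
  "has_pd j (bump P Q) (\<lambda>t. bump (P(j := bump_diff (P j))) Q t - bump P (Q(j := bump_diff (Q j))) t)"
  unfolding has_pd_def
proof
  fix t :: "real^'a"
  define c where "c = (\<Prod>i\<in>UNIV - {j}. bump_part (P i) (t $ i) * bump_part (Q i) (1 - t $ i))"
  have split: "bump P' Q' t' = bump_part (P' j) (t' $ j) * bump_part (Q' j) (1 - t' $ j) * c"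
    if "\<And>i. i \<noteq> j \<Longrightarrow> P' i = P i" "\<And>i. i \<noteq> j \<Longrightarrow> Q' i = Q i" "\<And>i. i \<noteq> j \<Longrightarrow> t' $ i = t $ i" for P' Q' t'
    unfolding bump_def c_def
    by (subst prod.remove[of UNIV j]) (use that in \<open>auto intro!: prod.cong\<close>)
  have "bump P Q (t + s *\<^sub>R axis j 1) = bump_part (P j) (t $ j + s) * bump_part (Q j) (1 - (t $ j + s)) * c" for s
    by (subst split) (auto simp: axis_def)
  moreover have "((\<lambda>s. bump_part (P j) (t $ j + s) * bump_part (Q j) (1 - (t $ j + s)) * c) has_real_derivative
     (bump_part (bump_diff (P j)) (t $ j) * bump_part (Q j) (1 - t $ j) - bump_part (P j) (t $ j) * bump_part (bump_diff (Q j)) (1 - t $ j)) * c) (at 0)"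
    by (auto intro!: derivative_eq_intros DERIV_chain2[OF bump_part_deriv] simp: algebra_simps)
  moreover have "bump (P(j := bump_diff (P j))) Q t - bump P (Q(j := bump_diff (Q j))) t =
     (bump_part (bump_diff (P j)) (t $ j) * bump_part (Q j) (1 - t $ j) - bump_part (P j) (t $ j) * bump_part (bump_diff (Q j)) (1 - t $ j)) * c"
    by (subst (1 2) split) (auto simp: algebra_simps)
  ultimately show "((\<lambda>s. bump P Q (t + s *\<^sub>R axis j 1)) has_real_derivative
      bump (P(j := bump_diff (P j))) Q t - bump P (Q(j := bump_diff (Q j))) t) (at 0)"
    by simp
qed

text \<open>The scale sits in the argument of \<open>f\<close> and the cube of integration is fixed,
  so derivatives of \<open>f\<close> and norm estimates pass under the integral directly. The kernel
  is not normalised; its mass appears explicitly in the estimates.\<close>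

definition conv :: "real \<Rightarrow> (real^'n::finite \<Rightarrow> real) \<Rightarrow> (real^'n \<Rightarrow> real) \<Rightarrow> real^'n \<Rightarrow> real" where
  "conv \<epsilon> K f x = integral (cbox 0 1) (\<lambda>t. K t * f (x + \<epsilon> *\<^sub>R t))"

lemma conv_integrand_cont:
  fixes K f :: "real^'n::finite \<Rightarrow> real"
  assumes "continuous_on UNIV K" "continuous_on UNIV f"
  shows "continuous_on S (\<lambda>t. K t * f (x + \<epsilon> *\<^sub>R t))"
  by (intro continuous_on_mult continuous_on_subset[OF assms(1)] continuous_on_compose2[OF assms(2)] continuous_intros) auto

lemma conv_integrable:
  fixes K f :: "real^'n::finite \<Rightarrow> real"
  assumes "continuous_on UNIV K" "continuous_on UNIV f"
  shows "(\<lambda>t. K t * f (x + \<epsilon> *\<^sub>R t)) integrable_on cbox a b"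
  by (intro integrable_continuous conv_integrand_cont assms)

lemma conv_continuous:
  fixes K f :: "real^'n::finite \<Rightarrow> real"
  assumes "continuous_on UNIV K" "continuous_on UNIV f"
  shows "continuous_on UNIV (conv \<epsilon> K f)"
proof -
  have "continuous_on (UNIV \<times> cbox 0 1) (\<lambda>(x, t). K t * f (x + \<epsilon> *\<^sub>R t))"
    unfolding split_beta
    by (intro continuous_on_mult continuous_on_compose2[OF assms(1)] continuous_on_compose2[OF assms(2)] continuous_intros) auto
  from integral_continuous_on_param[OF this] show ?thesis unfolding conv_def .
qed

lemma conv_bounded:
  fixes K f :: "real^'n::finite \<Rightarrow> real"
  assumes K: "continuous_on UNIV K" and f: "continuous_on UNIV f" and c: "\<And>t. t \<in> cbox 0 1 \<Longrightarrow> \<bar>f (x + \<epsilon> *\<^sub>R t)\<bar> \<le> c"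
  shows "\<bar>conv \<epsilon> K f x\<bar> \<le> c * integral (cbox 0 1) (\<lambda>t. \<bar>K t\<bar>)"
proof -
  have "norm (conv \<epsilon> K f x) \<le> integral (cbox 0 1) (\<lambda>t. c * \<bar>K t\<bar>)"
    unfolding conv_def
  proof (rule integral_norm_bound_integral)
    show "(\<lambda>t. K t * f (x + \<epsilon> *\<^sub>R t)) integrable_on cbox 0 1" by (rule conv_integrable[OF K f])
    show "(\<lambda>t. c * \<bar>K t\<bar>) integrable_on cbox 0 1"
      by (intro integrable_continuous continuous_on_mult continuous_on_const continuous_on_rabs continuous_on_subset[OF K]) auto
    show "norm (K t * f (x + \<epsilon> *\<^sub>R t)) \<le> c * \<bar>K t\<bar>" if "t \<in> cbox 0 1" for t
      using mult_left_mono[OF c[OF that], of "\<bar>K t\<bar>"] by (simp add: abs_mult mult.commute)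
  qed
  then show ?thesis by simp
qed

lemma has_pd_conv:
  fixes K f :: "real^'n::finite \<Rightarrow> real"
  assumes K: "continuous_on UNIV K" and f: "continuous_on UNIV f" and f': "has_pd i f f'" "continuous_on UNIV f'"
  shows "has_pd i (conv \<epsilon> K f) (conv \<epsilon> K f')"
  unfolding has_pd_def
proof
  fix x :: "real^'n"
  have "((\<lambda>s. integral (cbox 0 1) (\<lambda>t. K t * f ((x + \<epsilon> *\<^sub>R t) + s *\<^sub>R axis i 1))) has_field_derivative
     integral (cbox 0 1) (\<lambda>t. K t * f' ((x + \<epsilon> *\<^sub>R t) + 0 *\<^sub>R axis i 1))) (at 0 within UNIV)"
  proof (rule leibniz_rule_field_derivative[where fx = "\<lambda>s t. K t * f' ((x + \<epsilon> *\<^sub>R t) + s *\<^sub>R axis i 1)"])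
    show "((\<lambda>s. K t * f ((x + \<epsilon> *\<^sub>R t) + s *\<^sub>R axis i 1)) has_field_derivative K t * f' ((x + \<epsilon> *\<^sub>R t) + s *\<^sub>R axis i 1)) (at s within UNIV)" for s t
      by (intro DERIV_cmult) (use has_pd_line[OF f'(1)] in simp)
    show "(\<lambda>t. K t * f ((x + \<epsilon> *\<^sub>R t) + s *\<^sub>R axis i 1)) integrable_on cbox 0 1" for s
      using conv_integrable[OF K f, of "x + s *\<^sub>R axis i 1"] by (simp add: algebra_simps)
    show "continuous_on (UNIV \<times> cbox 0 1) (\<lambda>(s, t). K t * f' (x + \<epsilon> *\<^sub>R t + s *\<^sub>R axis i 1))"
      unfolding split_beta
      by (intro continuous_on_mult continuous_on_compose2[OF K] continuous_on_compose2[OF f'(2)] continuous_intros) auto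
  qed auto
  then show "((\<lambda>t. conv \<epsilon> K f (x + t *\<^sub>R axis i 1)) has_real_derivative conv \<epsilon> K f' x) (at 0)"
    by (simp add: conv_def algebra_simps)
qed

text \<open>For \<open>f\<close> merely continuous the derivative must fall on the kernel: moving
  \<open>x\<close> by \<open>s\<close> along an axis is undone by translating the kernel by
  \<open>s / \<epsilon>\<close>, whence the factor \<open>- (1 / \<epsilon>)\<close>.\<close>

lemma has_pd_conv_kernel:
  assumes K: "continuous_on UNIV K" "\<And>t. K t \<noteq> 0 \<Longrightarrow> t \<in> cbox 0 1"
    and K': "has_pd i K K'" "continuous_on UNIV K'" "\<And>t. K' t \<noteq> 0 \<Longrightarrow> t \<in> cbox 0 1"
    and f: "continuous_on UNIV f" and \<epsilon>: "\<epsilon> > 0"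
  shows "has_pd i (conv \<epsilon> K f) (\<lambda>x. - (1 / \<epsilon>) * conv \<epsilon> K' f x)"
  unfolding has_pd_def
proof
  fix x :: "real^'a"
  let ?e = "axis i 1 :: real^'a"
  \<comment> \<open>For \<open>\<bar>s\<bar> \<le> \<epsilon>\<close> the kernel moves by at most 1
    along one axis, so all translated cubes lie in this box and the integral is differentiated over
    a domain independent of \<open>s\<close>.\<close>
  let ?B = "cbox (-1) 2 :: (real^'a) set"
  have ext: "(h has_integral I) (cbox 0 1) \<Longrightarrow> (\<And>t. h t \<noteq> 0 \<Longrightarrow> t \<in> cbox 0 1) \<Longrightarrow> \<forall>j. \<bar>c $ j\<bar> \<le> 1 \<Longrightarrow>
     ((\<lambda>t. h (t - c)) has_integral I) ?B" for h :: "real^'a \<Rightarrow> real" and I c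
  proof -
    assume h: "(h has_integral I) (cbox 0 1)" "\<And>t. h t \<noteq> 0 \<Longrightarrow> t \<in> cbox 0 1" and c: "\<forall>j. \<bar>c $ j\<bar> \<le> 1"
    have "(h has_integral I) (cbox (- 1 - c) (2 - c))"
    proof (rule has_integral_on_superset[OF h(1)])
      show "cbox 0 1 \<subseteq> cbox (- 1 - c) (2 - c)"
      proof
        fix t :: "real^'a" assume t: "t \<in> cbox 0 1"
        show "t \<in> cbox (- 1 - c) (2 - c)"
          unfolding mem_box_cart
        proof
          fix j
          have "0 \<le> t $ j" "t $ j \<le> 1" "\<bar>c $ j\<bar> \<le> 1" using t c by (auto simp: mem_box_cart)
          then show "(- 1 - c) $ j \<le> t $ j \<and> t $ j \<le> (2 - c) $ j" by auto
        qed
      qed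
    qed (use h(2) in blast)
    from has_integral_affinity'[OF this, of 1 "- c"] show ?thesis by simp
  qed
  have shift: "conv \<epsilon> K f (x + s *\<^sub>R ?e) = integral ?B (\<lambda>t. K (t - (s / \<epsilon>) *\<^sub>R ?e) * f (x + \<epsilon> *\<^sub>R t))"
    if "s \<in> {-\<epsilon>..\<epsilon>}" for s
  proof -
    have "((\<lambda>t. K t * f ((x + s *\<^sub>R ?e) + \<epsilon> *\<^sub>R t)) has_integral conv \<epsilon> K f (x + s *\<^sub>R ?e)) (cbox 0 1)"
      unfolding conv_def by (intro integrable_integral conv_integrable K f)
    then have "((\<lambda>t. K (t - (s / \<epsilon>) *\<^sub>R ?e) * f ((x + s *\<^sub>R ?e) + \<epsilon> *\<^sub>R (t - (s / \<epsilon>) *\<^sub>R ?e))) has_integral conv \<epsilon> K f (x + s *\<^sub>R ?e)) ?B"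
      by (rule ext) (use K(2) that \<epsilon> in \<open>auto simp: axis_def abs_le_iff field_simps\<close>)
    moreover have "(x + s *\<^sub>R ?e) + \<epsilon> *\<^sub>R (t - (s / \<epsilon>) *\<^sub>R ?e) = x + \<epsilon> *\<^sub>R t" for t
      using \<epsilon> by (simp add: algebra_simps)
    ultimately show ?thesis by (simp add: integral_unique)
  qed
  have "((\<lambda>s. integral ?B (\<lambda>t. K (t - (s / \<epsilon>) *\<^sub>R ?e) * f (x + \<epsilon> *\<^sub>R t))) has_field_derivative
     integral ?B (\<lambda>t. (- (1 / \<epsilon>) * K' (t - (0 / \<epsilon>) *\<^sub>R ?e)) * f (x + \<epsilon> *\<^sub>R t))) (at 0 within {-\<epsilon>..\<epsilon>})"
  proof (rule leibniz_rule_field_derivative[where fx = "\<lambda>s t. (- (1 / \<epsilon>) * K' (t - (s / \<epsilon>) *\<^sub>R ?e)) * f (x + \<epsilon> *\<^sub>R t)"])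
    fix s t
    have "((\<lambda>s. K (t + s *\<^sub>R ?e)) has_real_derivative K' (t + (- (s / \<epsilon>)) *\<^sub>R ?e)) (at (- (s / \<epsilon>)))"
      by (rule has_pd_line[OF K'(1)])
    moreover have "((\<lambda>s. - (s / \<epsilon>)) has_real_derivative - (1 / \<epsilon>)) (at s within {-\<epsilon>..\<epsilon>})"
      using \<epsilon> by (auto intro!: derivative_eq_intros)
    ultimately have "((\<lambda>s. K (t + (- (s / \<epsilon>)) *\<^sub>R ?e)) has_real_derivative K' (t + (- (s / \<epsilon>)) *\<^sub>R ?e) * - (1 / \<epsilon>)) (at s within {-\<epsilon>..\<epsilon>})"
      by (rule DERIV_chain2)
    then have "((\<lambda>s. K (t - (s / \<epsilon>) *\<^sub>R ?e)) has_real_derivative - (1 / \<epsilon>) * K' (t - (s / \<epsilon>) *\<^sub>R ?e)) (at s within {-\<epsilon>..\<epsilon>})"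
      by (simp add: mult.commute)
    then show "((\<lambda>s. K (t - (s / \<epsilon>) *\<^sub>R ?e) * f (x + \<epsilon> *\<^sub>R t)) has_field_derivative
        (- (1 / \<epsilon>) * K' (t - (s / \<epsilon>) *\<^sub>R ?e)) * f (x + \<epsilon> *\<^sub>R t)) (at s within {-\<epsilon>..\<epsilon>})"
      by (rule DERIV_cmult_right)
  next
    fix s
    show "(\<lambda>t. K (t - (s / \<epsilon>) *\<^sub>R ?e) * f (x + \<epsilon> *\<^sub>R t)) integrable_on ?B"
      by (intro integrable_continuous continuous_on_mult continuous_on_compose2[OF K(1)] continuous_on_compose2[OF f] continuous_intros) (use \<epsilon> in auto)
  next
    show "continuous_on ({-\<epsilon>..\<epsilon>} \<times> ?B) (\<lambda>(s, t). - (1 / \<epsilon>) * K' (t - (s / \<epsilon>) *\<^sub>R ?e) * f (x + \<epsilon> *\<^sub>R t))"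
      unfolding split_beta
      by (intro continuous_on_mult continuous_on_compose2[OF K'(2)] continuous_on_compose2[OF f] continuous_intros) (use \<epsilon> in auto)
  qed (use \<epsilon> in auto)
  moreover have "integral ?B (\<lambda>t. (- (1 / \<epsilon>) * K' (t - (0 / \<epsilon>) *\<^sub>R ?e)) * f (x + \<epsilon> *\<^sub>R t)) = - (1 / \<epsilon>) * conv \<epsilon> K' f x"
  proof -
    have "((\<lambda>t. K' t * f (x + \<epsilon> *\<^sub>R t)) has_integral conv \<epsilon> K' f x) (cbox 0 1)"
      unfolding conv_def by (intro integrable_integral conv_integrable K' f)
    then have "((\<lambda>t. K' (t - 0) * f (x + \<epsilon> *\<^sub>R (t - 0))) has_integral conv \<epsilon> K' f x) ?B"
      by (rule ext) (use K'(3) in auto)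
    from integral_unique[OF has_integral_mult_right[OF this, of "- (1 / \<epsilon>)"]]
    have "integral ?B (\<lambda>t. - (1 / \<epsilon>) * (K' (t - 0) * f (x + \<epsilon> *\<^sub>R (t - 0)))) = - (1 / \<epsilon>) * conv \<epsilon> K' f x" .
    moreover have "(\<lambda>t. - (1 / \<epsilon>) * (K' (t - 0) * f (x + \<epsilon> *\<^sub>R (t - 0)))) =
        (\<lambda>t. (- (1 / \<epsilon>) * K' (t - (0 / \<epsilon>) *\<^sub>R ?e)) * f (x + \<epsilon> *\<^sub>R t))"
      by (simp add: fun_eq_iff)
    ultimately show ?thesis by (simp only:)
  qed
  ultimately have "((\<lambda>s. integral ?B (\<lambda>t. K (t - (s / \<epsilon>) *\<^sub>R ?e) * f (x + \<epsilon> *\<^sub>R t))) has_field_derivative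
     - (1 / \<epsilon>) * conv \<epsilon> K' f x) (at 0 within {-\<epsilon>..\<epsilon>})" by (simp only:)
  then have "((\<lambda>s. conv \<epsilon> K f (x + s *\<^sub>R ?e)) has_field_derivative - (1 / \<epsilon>) * conv \<epsilon> K' f x) (at 0 within {-\<epsilon>..\<epsilon>})"
    by (rule has_field_derivative_transform_within[where d = 1]) (use shift \<epsilon> in auto)
  then show "((\<lambda>s. conv \<epsilon> K f (x + s *\<^sub>R ?e)) has_real_derivative - (1 / \<epsilon>) * conv \<epsilon> K' f x) (at 0)"
    using at_within_interior[of 0 "{-\<epsilon>..\<epsilon>}"] \<epsilon> by simp
qed

lemma conv_kernel_diff:
  fixes K f :: "real^'n::finite \<Rightarrow> real"
  assumes "continuous_on UNIV K" "continuous_on UNIV K'" "continuous_on UNIV f"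
  shows "conv \<epsilon> (\<lambda>t. K t - K' t) f x = conv \<epsilon> K f x - conv \<epsilon> K' f x"
  unfolding conv_def left_diff_distrib
  by (intro integral_diff conv_integrable assms)

lemma conv_recenter:
  fixes K f :: "real^'n::finite \<Rightarrow> real"
  assumes "continuous_on UNIV K" "continuous_on UNIV f"
  shows "conv \<epsilon> K f x - f x * integral (cbox 0 1) K = integral (cbox 0 1) (\<lambda>t. K t * (f (x + \<epsilon> *\<^sub>R t) - f x))"
proof -
  have "integral (cbox 0 1) (\<lambda>t. K t * f (x + \<epsilon> *\<^sub>R t) - K t * f x) =
     integral (cbox 0 1) (\<lambda>t. K t * f (x + \<epsilon> *\<^sub>R t)) - integral (cbox 0 1) (\<lambda>t. K t * f x)"
    by (intro integral_diff conv_integrable assms integrable_continuous continuous_on_mult continuous_on_const continuous_on_subset[OF assms(1)]) auto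
  then show ?thesis
    by (simp add: conv_def right_diff_distrib mult.commute)
qed

lemma bump1_integral_pos: "integral (cbox 0 1) (bump (\<lambda>_. 1) (\<lambda>_. 1) :: real^'n::finite \<Rightarrow> real) > 0"
proof -
  let ?K = "bump (\<lambda>_. 1) (\<lambda>_. 1) :: real^'n::finite \<Rightarrow> real"
  have nn: "?K t \<ge> 0" for t
    unfolding bump_def by (intro prod_nonneg ballI mult_nonneg_nonneg) (auto simp: bump_part_def)
  have "integral (cbox 0 1) ?K \<noteq> 0"
  proof
    assume "integral (cbox 0 1) ?K = 0"
    then have "(?K has_integral 0) (cbox 0 1)"
      by (metis continuous_bump integrable_continuous integrable_integral)
    moreover have "box (0 :: real^'n) 1 \<noteq> {}" by (simp add: interval_ne_empty_cart)
    ultimately have "?K (\<chi> i. 1 / 2) = 0"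
      by (intro has_integral_0_cbox_imp_0[OF continuous_bump nn]) (auto simp: mem_box_cart)
    moreover have "?K (\<chi> i. 1 / 2) > 0"
      unfolding bump_def by (intro prod_pos ballI) (auto simp: bump_part_def)
    ultimately show False by simp
  qed
  moreover have "integral (cbox 0 1) ?K \<ge> 0"
    by (intro integral_nonneg integrable_continuous continuous_bump nn)
  ultimately show ?thesis by linarith
qed

context hoelder
begin

text \<open>Unlike \<open>bd_embed\<close> this asks of the derivatives only continuity and a bound,
  so it can start inductions in which their Hoelder continuity is not yet known.\<close>

lemma bd0_of_C1:
  fixes f :: "real^'n::finite \<Rightarrow> real"
  assumes "\<And>x. \<bar>f x\<bar> \<le> c" "\<And>i. has_pd i f (f' i)" "\<And>i. continuous_on UNIV (f' i)" "\<And>i x. \<bar>f' i x\<bar> \<le> c"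
    "continuous_on UNIV f"
  shows "Cb 0 f"
proof -
  define n where "n = real CARD('n)"
  have n: "n \<ge> 1" by (simp add: n_def Suc_leI)
  have c: "c \<ge> 0" using assms(1)[of 0] by linarith
  have nc: "c \<le> 2 * n * c" using n c by (simp add: mult_le_cancel_right1)
  have "\<bar>f x - f y\<bar> \<le> 2 * n * c * norm (x - y) powr \<gamma>" for x y
  proof (cases "norm (x - y) \<le> 1")
    case True
    have "\<bar>f x - f y\<bar> \<le> n * c * norm (x - y)" using C1_lipschitz[OF assms(2-4)] by (simp add: n_def)
    also have "\<dots> \<le> (2 * n * c) * norm (x - y) powr \<gamma>"
      using n c True by (intro mult_mono powr_ge_self) auto
    finally show ?thesis .
  next
    case False
    have "\<bar>f x - f y\<bar> \<le> 2 * c * 1" using assms(1)[of x] assms(1)[of y] by linarith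
    also have "\<dots> \<le> (2 * n * c) * norm (x - y) powr \<gamma>"
      using n c False by (intro mult_mono powr_ge_one) (auto simp: mult_le_cancel_right1)
    finally show ?thesis .
  qed
  moreover have "\<bar>f x\<bar> \<le> 2 * n * c" for x using assms(1)[of x] nc by linarith
  ultimately have "bd 0 (2 * n * c) f" using assms(5) by simp
  then show ?thesis by (rule CbI)
qed

lemma Cb_SucI:
  fixes f :: "real^'n::finite \<Rightarrow> real"
  assumes "\<And>x. \<bar>f x\<bar> \<le> c" "continuous_on UNIV f" "\<And>i. has_pd i f (f' i)" "\<And>i. Cb p (f' i)"
  shows "Cb (Suc p) f"
proof -
  obtain d where d: "\<forall>i. bd p d (f' i)" using Cb_family[of p f', OF assms(4)] by blast
  have "bd (Suc p) (max c d) f"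
  proof (rule bd_SucI[OF assms(2) _ assms(3)])
    show "\<bar>f x\<bar> \<le> max c d" for x using assms(1)[of x] by simp
    show "bd p (max c d) (f' i)" for i by (rule bd_mono[OF d[rule_format]]) simp
  qed
  then show ?thesis by (rule CbI)
qed

text \<open>The induction runs over all polynomials at once: each derivative is a multiple of a
  difference of two convolutions with kernels of the same family, and every convolution is bounded
  by the bound of \<open>f\<close> times the integral of the absolute kernel.\<close>

lemma conv_bump_smooth:
  fixes f :: "real^'n::finite \<Rightarrow> real"
  assumes f: "continuous_on UNIV f" "\<And>x. \<bar>f x\<bar> \<le> c" and \<epsilon>: "\<epsilon> > 0"
  shows "Cb q (conv \<epsilon> (bump P Q) f)"
proof -
  note cont = continuous_bump[of UNIV]
  have pd: "has_pd i (conv \<epsilon> (bump P Q) f)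
     (\<lambda>x. - (1 / \<epsilon>) * (conv \<epsilon> (bump (P(i := bump_diff (P i))) Q) f x - conv \<epsilon> (bump P (Q(i := bump_diff (Q i)))) f x))"
    for P Q i
  proof -
    have "has_pd i (conv \<epsilon> (bump P Q) f)
       (\<lambda>x. - (1 / \<epsilon>) * conv \<epsilon> (\<lambda>t. bump (P(i := bump_diff (P i))) Q t - bump P (Q(i := bump_diff (Q i))) t) f x)"
    proof (rule has_pd_conv_kernel[OF cont bump_support has_pd_bump _ _ f(1) \<epsilon>])
      show "continuous_on UNIV (\<lambda>t. bump (P(i := bump_diff (P i))) Q t - bump P (Q(i := bump_diff (Q i))) t)"
        by (intro continuous_on_diff cont)
      show "t \<in> cbox 0 1" if "bump (P(i := bump_diff (P i))) Q t - bump P (Q(i := bump_diff (Q i))) t \<noteq> 0" for t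
        using that bump_support by (metis diff_zero)
    qed
    then show ?thesis by (simp add: conv_kernel_diff[OF cont cont f(1)])
  qed
  have b: "\<exists>d. \<forall>x. \<bar>conv \<epsilon> (bump P Q) f x\<bar> \<le> d" for P Q
    using conv_bounded[OF cont f(1) f(2)] by blast
  show ?thesis
  proof (induction q arbitrary: P Q)
    case 0
    let ?g = "\<lambda>i x. - (1 / \<epsilon>) * (conv \<epsilon> (bump (P(i := bump_diff (P i))) Q) f x - conv \<epsilon> (bump P (Q(i := bump_diff (Q i)))) f x)"
    have "\<exists>d. \<forall>x. \<bar>?g i x\<bar> \<le> d" for i
    proof -
      obtain d1 d2 where d: "\<And>x. \<bar>conv \<epsilon> (bump (P(i := bump_diff (P i))) Q) f x\<bar> \<le> d1"
        "\<And>x. \<bar>conv \<epsilon> (bump P (Q(i := bump_diff (Q i)))) f x\<bar> \<le> d2" using b by meson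
      have "\<bar>?g i x\<bar> \<le> \<bar>1 / \<epsilon>\<bar> * (d1 + d2)" for x
        unfolding abs_mult using d(1)[of x] d(2)[of x] by (intro mult_mono) (auto simp del: abs_divide)
      then show ?thesis by blast
    qed
    then obtain d where d: "\<And>i x. \<bar>?g i x\<bar> \<le> d i" by metis
    obtain d' where d': "\<And>x. \<bar>conv \<epsilon> (bump P Q) f x\<bar> \<le> d'" using b by blast
    let ?c = "max d' (Max (range d))"
    show ?case
    proof (rule bd0_of_C1[where f' = ?g and c = ?c])
      show "\<bar>conv \<epsilon> (bump P Q) f x\<bar> \<le> ?c" for x using d'[of x] by simp
      show "\<bar>?g i x\<bar> \<le> ?c" for i x by (rule order_trans[OF d]) (simp add: le_max_iff_disj)
      show "continuous_on UNIV (?g i)" for i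
        by (intro continuous_on_mult continuous_on_const continuous_on_diff conv_continuous cont f(1))
    qed (rule pd conv_continuous cont f(1))+
  next
    case (Suc q)
    obtain d where d: "\<And>x. \<bar>conv \<epsilon> (bump P Q) f x\<bar> \<le> d" using b by blast
    show ?case
      by (rule Cb_SucI[OF d conv_continuous[OF cont f(1)] pd]) (intro Cb_cmult Cb_diff Suc)
  qed
qed

text \<open>After subtracting \<open>f\<close> times the mass, the convolution is an integral of the
  increments \<open>f (x + \<epsilon> *\<^sub>R t) - f x\<close> against \<open>K\<close>, each of
  norm at most \<open>e\<close>, so the integral of \<open>\<bar>K t\<bar>\<close> is the only
  factor lost. Convolution commutes with partial derivatives, which reduces higher orders to lower
  ones.\<close>

lemma bd_conv_diff:
  fixes f :: "real^'n::finite \<Rightarrow> real"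
  assumes K: "continuous_on UNIV K" and \<epsilon>: "\<epsilon> > 0"
  shows "Cb p f \<Longrightarrow> (\<And>t. t \<in> cbox 0 1 \<Longrightarrow> bd p e (\<lambda>x. f (x + \<epsilon> *\<^sub>R t) - f x)) \<Longrightarrow>
     bd p (e * integral (cbox 0 1) (\<lambda>t. \<bar>K t\<bar>)) (\<lambda>x. conv \<epsilon> K f x - f x * integral (cbox 0 1) K)"
proof (induction p arbitrary: f)
  case 0
  let ?I = "integral (cbox 0 1) (\<lambda>t. \<bar>K t\<bar>)"
  note f = Cb_cont[OF 0(1)]
  have K2: "(\<lambda>t. c * \<bar>K t\<bar>) integrable_on cbox 0 1" for c
    by (intro integrable_continuous continuous_on_mult continuous_on_const continuous_on_rabs continuous_on_subset[OF K]) auto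
  have int: "(\<lambda>t. K t * (f (x + \<epsilon> *\<^sub>R t) - f x)) integrable_on cbox 0 1" for x
    by (intro integrable_continuous continuous_on_mult continuous_on_diff continuous_on_const continuous_on_subset[OF K]
        continuous_on_compose2[OF f] continuous_intros) auto
  have bound: "norm (integral (cbox 0 1) h) \<le> c * ?I"
    if "h integrable_on cbox 0 1" "\<And>t. t \<in> cbox 0 1 \<Longrightarrow> norm (h t) \<le> c * \<bar>K t\<bar>" for h :: "real^'n \<Rightarrow> real" and c
  proof -
    have "norm (integral (cbox 0 1) h) \<le> integral (cbox 0 1) (\<lambda>t. c * \<bar>K t\<bar>)"
      by (rule integral_norm_bound_integral[OF that(1) K2]) (rule that(2))
    then show ?thesis by simp
  qed
  show ?case
    unfolding bd.simps conv_recenter[OF K f]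
  proof (intro conjI allI)
    have "continuous_on UNIV (\<lambda>x. conv \<epsilon> K f x - f x * integral (cbox 0 1) K)"
      by (intro continuous_on_diff conv_continuous K f continuous_on_mult continuous_on_const)
    then show "continuous_on UNIV (\<lambda>x. integral (cbox 0 1) (\<lambda>t. K t * (f (x + \<epsilon> *\<^sub>R t) - f x)))"
      by (simp only: conv_recenter[OF K f])
    fix x y
    show "\<bar>integral (cbox 0 1) (\<lambda>t. K t * (f (x + \<epsilon> *\<^sub>R t) - f x))\<bar> \<le> e * ?I"
    proof (rule bound[OF int, unfolded real_norm_def])
      fix t :: "real^'n" assume t: "t \<in> cbox 0 1"
      show "\<bar>K t * (f (x + \<epsilon> *\<^sub>R t) - f x)\<bar> \<le> e * \<bar>K t\<bar>"
        using mult_left_mono[OF bd_abs[OF 0(2)[OF t], of x], of "\<bar>K t\<bar>"] by (simp add: abs_mult mult.commute)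
    qed
    have "\<bar>integral (cbox 0 1) (\<lambda>t. K t * (f (x + \<epsilon> *\<^sub>R t) - f x)) - integral (cbox 0 1) (\<lambda>t. K t * (f (y + \<epsilon> *\<^sub>R t) - f y))\<bar>
      = norm (integral (cbox 0 1) (\<lambda>t. K t * (f (x + \<epsilon> *\<^sub>R t) - f x) - K t * (f (y + \<epsilon> *\<^sub>R t) - f y)))"
      by (simp add: integral_diff[OF int int])
    also have "\<dots> \<le> (e * norm (x - y) powr \<gamma>) * ?I"
    proof (rule bound)
      show "(\<lambda>t. K t * (f (x + \<epsilon> *\<^sub>R t) - f x) - K t * (f (y + \<epsilon> *\<^sub>R t) - f y)) integrable_on cbox 0 1"
        by (intro integrable_diff int)
      fix t :: "real^'n" assume "t \<in> cbox 0 1"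
      from bd0_hoelder[OF 0(2)[OF this], of x y]
      have "\<bar>K t\<bar> * \<bar>(f (x + \<epsilon> *\<^sub>R t) - f x) - (f (y + \<epsilon> *\<^sub>R t) - f y)\<bar> \<le> \<bar>K t\<bar> * (e * norm (x - y) powr \<gamma>)"
        by (intro mult_left_mono) auto
      then show "norm (K t * (f (x + \<epsilon> *\<^sub>R t) - f x) - K t * (f (y + \<epsilon> *\<^sub>R t) - f y)) \<le> e * norm (x - y) powr \<gamma> * \<bar>K t\<bar>"
        by (simp add: right_diff_distrib[symmetric] abs_mult mult.commute)
    qed
    finally show "\<bar>integral (cbox 0 1) (\<lambda>t. K t * (f (x + \<epsilon> *\<^sub>R t) - f x)) - integral (cbox 0 1) (\<lambda>t. K t * (f (y + \<epsilon> *\<^sub>R t) - f y))\<bar>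
       \<le> e * ?I * norm (x - y) powr \<gamma>" by (simp add: mult_ac)
  qed
next
  case (Suc p)
  let ?I = "integral (cbox 0 1) (\<lambda>t. \<bar>K t\<bar>)"
  note f = Cb_cont[OF Suc.prems(1)]
  have 0: "\<bar>f (x + \<epsilon> *\<^sub>R t) - f x\<bar> \<le> e" if "t \<in> cbox 0 1" for x t
    by (rule bd_abs[OF Suc.prems(2)[OF that]])
  show ?case
  proof (rule bd_SucI)
    show "continuous_on UNIV (\<lambda>x. conv \<epsilon> K f x - f x * integral (cbox 0 1) K)"
      by (intro continuous_on_diff conv_continuous K f continuous_on_mult continuous_on_const)
    fix x
    have "norm (integral (cbox 0 1) (\<lambda>t. K t * (f (x + \<epsilon> *\<^sub>R t) - f x))) \<le> integral (cbox 0 1) (\<lambda>t. e * \<bar>K t\<bar>)"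
    proof (rule integral_norm_bound_integral)
      show "(\<lambda>t. K t * (f (x + \<epsilon> *\<^sub>R t) - f x)) integrable_on cbox 0 1"
        by (intro integrable_continuous continuous_on_mult continuous_on_diff continuous_on_const continuous_on_subset[OF K]
            continuous_on_compose2[OF f] continuous_intros) auto
      show "(\<lambda>t. e * \<bar>K t\<bar>) integrable_on cbox 0 1"
        by (intro integrable_continuous continuous_on_mult continuous_on_const continuous_on_rabs continuous_on_subset[OF K]) auto
      show "norm (K t * (f (x + \<epsilon> *\<^sub>R t) - f x)) \<le> e * \<bar>K t\<bar>" if "t \<in> cbox 0 1" for t
        using mult_left_mono[OF 0[OF that, of x], of "\<bar>K t\<bar>"] by (simp add: abs_mult mult.commute)
    qed
    then show "\<bar>conv \<epsilon> K f x - f x * integral (cbox 0 1) K\<bar> \<le> e * ?I"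
      by (simp add: conv_recenter[OF K f])
  next
    fix i
    have "has_pd i (\<lambda>x. conv \<epsilon> K f x - integral (cbox 0 1) K * f x)
       (\<lambda>x. conv \<epsilon> K (pderiv_dir i f) x - integral (cbox 0 1) K * pderiv_dir i f x)"
      by (intro has_pd_diff has_pd_cmult has_pd_conv K f Cb_has_pd[OF Suc.prems(1)] Cb_cont[OF Cb_pd[OF Suc.prems(1)]])
    then show "has_pd i (\<lambda>x. conv \<epsilon> K f x - f x * integral (cbox 0 1) K)
       (\<lambda>x. conv \<epsilon> K (pderiv_dir i f) x - pderiv_dir i f x * integral (cbox 0 1) K)"
      by (simp add: mult.commute)
    show "bd p (e * ?I) (\<lambda>x. conv \<epsilon> K (pderiv_dir i f) x - pderiv_dir i f x * integral (cbox 0 1) K)"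
    proof (rule Suc.IH[OF Cb_pd[OF Suc.prems(1)]])
      fix t :: "real^'n" assume "t \<in> cbox 0 1"
      from bd_pd[OF Suc.prems(2)[OF this], of i]
      show "bd p e (\<lambda>x. pderiv_dir i f (x + \<epsilon> *\<^sub>R t) - pderiv_dir i f x)"
        by (simp add: pd_diff[OF Cb_translate[OF Suc.prems(1)] Suc.prems(1)] pd_translate[OF Suc.prems(1)])
    qed
  qed
qed

text \<open>The scalar form of membership in the little Hoelder space. The estimates
  \<open>approx_comp\<close> and \<open>approx_comp_rem\<close> rest on this property and not on
  compactness of translates.\<close>

definition approx :: "nat \<Rightarrow> (real^'n::finite \<Rightarrow> real) \<Rightarrow> bool" where
  "approx p F \<longleftrightarrow> (\<forall>e>0. \<exists>H. (\<forall>q. Cb q H) \<and> bd p e (\<lambda>x. F x - H x))"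

lemma AP_approx:
  fixes F :: "real^'n::finite \<Rightarrow> real"
  assumes F: "AP p F"
  shows "approx p F"
  unfolding approx_def
proof (intro allI impI)
  fix e :: real assume e: "e > 0"
  let ?K = "bump (\<lambda>_. 1) (\<lambda>_. 1) :: real^'n \<Rightarrow> real"
  define I where "I = integral (cbox 0 1) ?K"
  have I: "I > 0" unfolding I_def by (rule bump1_integral_pos)
  have "?K t \<ge> 0" for t
    unfolding bump_def by (intro prod_nonneg ballI mult_nonneg_nonneg) (auto simp: bump_part_def)
  then have absK: "(\<lambda>t. \<bar>?K t\<bar>) = ?K" by simp
  obtain \<delta> where \<delta>: "\<delta> > 0" "\<And>c. norm c < \<delta> \<Longrightarrow> bd p e (\<lambda>x. F (x + c) - F x)"
    using AP_translation_continuous[OF F e] by blast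
  define n where "n = real CARD('n)"
  have n: "n > 0" by (simp add: n_def)
  \<comment> \<open>On the unit cube \<open>norm t \<le> n\<close>, so this factor keeps all shifts
    \<open>\<epsilon> *\<^sub>R t\<close> strictly below \<open>\<delta>\<close> in norm.\<close>
  define \<epsilon> where "\<epsilon> = \<delta> / (2 * n)"
  have \<epsilon>: "\<epsilon> > 0" using \<delta> n by (simp add: \<epsilon>_def)
  have nt: "norm (\<epsilon> *\<^sub>R t) < \<delta>" if "t \<in> cbox 0 1" for t :: "real^'n"
  proof -
    have "norm t \<le> (\<Sum>i\<in>UNIV. \<bar>t $ i\<bar>)" by (rule norm_le_l1_cart)
    also have "\<dots> \<le> (\<Sum>i\<in>(UNIV :: 'n set). 1)"
      using that by (intro sum_mono) (auto simp: mem_box_cart)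
    finally have "norm t \<le> n" by (simp add: n_def)
    then have "\<epsilon> * norm t \<le> \<epsilon> * n" using \<epsilon> by simp
    also have "\<dots> < \<delta>" using \<delta> n by (simp add: \<epsilon>_def)
    finally show ?thesis using \<epsilon> by simp
  qed
  obtain c where c: "bd p c F" using AP_Cb[OF F] by (auto simp: Cb_def)
  define H where "H = (\<lambda>x. (1 / I) * conv \<epsilon> ?K F x)"
  have "Cb q H" for q
    unfolding H_def by (intro Cb_cmult conv_bump_smooth[OF bd_cont[OF c] bd_abs[OF c] \<epsilon>])
  moreover have "bd p (e * I) (\<lambda>x. conv \<epsilon> ?K F x - F x * I)"
    using bd_conv_diff[OF continuous_bump \<epsilon> AP_Cb[OF F] \<delta>(2)[OF nt], of "\<lambda>_. 1" "\<lambda>_. 1"] unfolding absK I_def .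
  from bd_cmult[OF this, of "- (1 / I)"] have "bd p e (\<lambda>x. - (1 / I) * (conv \<epsilon> ?K F x - F x * I))"
    using I by simp
  moreover have "(\<lambda>x. - (1 / I) * (conv \<epsilon> ?K F x - F x * I)) = (\<lambda>x. F x - H x)"
    using I by (simp add: fun_eq_iff H_def field_simps)
  ultimately show "\<exists>H. (\<forall>q. Cb q H) \<and> bd p e (\<lambda>x. F x - H x)" by metis
qed

end

section \<open>Composition with an approximable outer function\<close>

lemma mult_half_div: "(X::real) > 0 \<Longrightarrow> X * (e / (2 * X)) = e / 2"
  by simp

lemma norm_vec_le_sum: "norm ((\<chi> j. f j) :: real^'n::finite) \<le> (\<Sum>j\<in>UNIV. \<bar>f j\<bar>)"
  using norm_le_l1_cart[of "(\<chi> j. f j) :: real^'n"] by simp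

lemma lip_shift:
  fixes g :: "'n::finite \<Rightarrow> real^'n \<Rightarrow> real"
  assumes "\<And>j x y. \<bar>g j x - g j y\<bar> \<le> L * norm (x - y)"
  shows "lip (1 + real CARD('n) * L) (shift g)"
  unfolding lip_def
proof (intro allI)
  fix x y
  have "shift g x - shift g y = (x - y) + (\<chi> j. g j x - g j y)" by (simp add: vec_eq_iff)
  then have "norm (shift g x - shift g y) \<le> norm (x - y) + norm (\<chi> j. g j x - g j y)"
    by (simp add: norm_triangle_ineq)
  also have "norm (\<chi> j. g j x - g j y) \<le> (\<Sum>j\<in>UNIV. \<bar>g j x - g j y\<bar>)" by (rule norm_vec_le_sum)
  also have "\<dots> \<le> (\<Sum>j\<in>(UNIV :: 'n set). L * norm (x - y))" by (intro sum_mono assms)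
  finally show "norm (shift g x - shift g y) \<le> (1 + real CARD('n) * L) * norm (x - y)"
    by (simp add: algebra_simps)
qed

context hoelder
begin

text \<open>One number bounds both the displacement and the Lipschitz constant of the map, which is
  the form in which \<open>bd_compI\<close> and its relatives ask for a single radius
  \<open>R\<close>.\<close>

lemma bd_lip_shift:
  fixes g :: "'n::finite \<Rightarrow> real^'n \<Rightarrow> real"
  assumes g: "\<forall>j. bd p R (g j)" and p: "1 \<le> p"
  shows "\<forall>j. bd p (1 + real CARD('n) * (real CARD('n) * R)) (g j)"
    and "lip (1 + real CARD('n) * (real CARD('n) * R)) (shift g)"
proof -
  let ?n = "real CARD('n)"
  have R: "R \<ge> 0" using bd_nonneg[OF g[rule_format]] .
  have n: "1 \<le> ?n" by (simp add: Suc_leI)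
  have "R \<le> ?n * R" using R n by (simp add: mult_le_cancel_right1)
  also have "\<dots> \<le> ?n * (?n * R)" using \<open>R \<le> ?n * R\<close> by (intro mult_left_mono) auto
  finally have "R \<le> 1 + ?n * (?n * R)" by simp
  then show "\<forall>j. bd p (1 + ?n * (?n * R)) (g j)" by (blast intro: bd_mono[OF g[rule_format]])
  obtain q where q: "p = Suc q" using p by (cases p) auto
  show "lip (1 + ?n * (?n * R)) (shift g)"
    by (rule lip_shift) (rule bd_lipschitz[OF g[rule_format, unfolded q]])
qed

text \<open>\<open>F\<close> is replaced by a smooth \<open>H\<close>: the two composites of
  \<open>F - H\<close> are small uniformly in the inner maps, and for \<open>H\<close> the Lipschitz
  estimate applies. The admissible \<open>d\<close> depends on \<open>F\<close>, \<open>e\<close>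
  and \<open>R\<close>, but not on the inner maps.\<close>

lemma approx_comp:
  fixes F :: "real^'n::finite \<Rightarrow> real"
  assumes F: "approx p F" and e: "e > 0"
  shows "\<exists>d>0. \<forall>(g::'n \<Rightarrow> real^'n \<Rightarrow> real) g'. (\<forall>j. bd p R (g j)) \<longrightarrow> (\<forall>j. bd p R (g' j)) \<longrightarrow> lip R (shift g) \<longrightarrow>
    lip R (shift g') \<longrightarrow> (\<forall>j. bd p d (\<lambda>x. g' j x - g j x)) \<longrightarrow> bd p e (\<lambda>x. F (shift g' x) - F (shift g x))"
proof -
  let ?C = "Kcomp TYPE('n) p R" and ?D = "Kdiff TYPE('n) p R"
  have C: "?C \<ge> 1" by (rule Kcomp_ge)
  have D: "?D \<ge> 0" by (rule Kdiff_nonneg)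
  \<comment> \<open>The two composites of \<open>F - H\<close> together cost \<open>e / 2\<close>;
    \<open>d\<close> is chosen to spend the other half.\<close>
  define e1 where "e1 = e / (4 * ?C)"
  have e1: "e1 > 0" using e C by (simp add: e1_def)
  obtain H where Hs: "\<forall>q. Cb q H" and HF: "bd p e1 (\<lambda>x. F x - H x)" using F e1 unfolding approx_def by blast
  obtain c where c: "bd (Suc p) c H" "c > 0" using CbE[OF Hs[rule_format]] by blast
  define d where "d = e / (2 * (?D * c + 1))"
  have Dc: "?D * c + 1 > 0" using D c by (simp add: add_nonneg_pos)
  have d: "d > 0" using e Dc by (simp add: d_def)
  show ?thesis
  proof (intro exI[of _ d] conjI d allI impI)
    fix g g' :: "'n \<Rightarrow> real^'n \<Rightarrow> real"
    assume g: "\<forall>j. bd p R (g j)" "\<forall>j. bd p R (g' j)" "lip R (shift g)" "lip R (shift g')"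
      and dd: "\<forall>j. bd p d (\<lambda>x. g' j x - g j x)"
    have "bd p ((?C * e1 + ?C * e1) + ?D * c * d)
       (\<lambda>x. ((F (shift g' x) - H (shift g' x)) - (F (shift g x) - H (shift g x))) + (H (shift g' x) - H (shift g x)))"
      by (rule bd_add[OF bd_diff[OF bd_compI[OF HF g(2,4)] bd_compI[OF HF g(1,3)]] bd_comp_diff[OF c(1) g dd]])
    moreover have "(?C * e1 + ?C * e1) + ?D * c * d \<le> e"
    proof -
      have "?C * e1 + ?C * e1 = e / 2" using C by (simp add: e1_def field_simps)
      moreover have "?D * c * d \<le> (?D * c + 1) * d" using d by simp
      moreover have "(?D * c + 1) * d = e / 2" by (simp only: d_def mult_half_div[OF Dc])
      ultimately show ?thesis by linarith
    qed
    ultimately show "bd p e (\<lambda>x. F (shift g' x) - F (shift g x))" using bd_mono by fastforce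
  qed
qed

text \<open>Joint continuity: the outer functions are exchanged along the moving inner map, by a
  bound uniform in that map, and then the inner map is exchanged under the limit \<open>F\<close>.
  For this reason approximability is asked of the limit.\<close>

lemma cv_comp:
  fixes F :: "real^'n::finite \<Rightarrow> real"
  assumes f: "cv p f F Fl" and F: "approx p F"
    and g: "\<And>j. cv p (\<lambda>k. g k j) (G j) Fl" and G: "\<And>j. Cb p (G j)"
    and l: "eventually (\<lambda>k. lip L (shift (g k))) Fl" and lG: "lip L (shift G)"
  shows "cv p (\<lambda>k x. f k (shift (g k) x)) (\<lambda>x. F (shift G x)) Fl"
proof -
  obtain c where c: "\<forall>j. bd p c (G j)" using Cb_family[of p G, OF G] by blast
  define R where "R = max (c + 1) L"
  have R: "c + 1 \<le> R" "L \<le> R" "c \<le> R" by (auto simp: R_def)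
  have "eventually (\<lambda>k. \<forall>j. bd p (c + 1) (g k j)) Fl"
    by (intro eventually_all_finite cv_bounded[OF g c[rule_format]])
  then have evg: "eventually (\<lambda>k. \<forall>j. bd p R (g k j)) Fl"
    by eventually_elim (blast intro: bd_mono[OF _ R(1)])
  have evl: "eventually (\<lambda>k. lip R (shift (g k))) Fl"
    using l by eventually_elim (rule lip_mono[OF _ R(2)])
  have GR: "\<forall>j. bd p R (G j)" using c by (blast intro: bd_mono[OF _ R(3)])
  have lGR: "lip R (shift G)" using lG by (rule lip_mono[OF _ R(2)])
  have 1: "small p (\<lambda>k x. f k (shift (g k) x) - F (shift (g k) x)) Fl"
  proof (rule small_transfer[OF f[unfolded cv_def]])
    show "eventually (\<lambda>k. \<forall>e>0. bd p e (\<lambda>x. f k x - F x) \<longrightarrow>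
        bd p (Kcomp TYPE('n) p R * e) (\<lambda>x. f k (shift (g k) x) - F (shift (g k) x))) Fl"
      using evg evl
    proof eventually_elim
      case (elim k)
      show ?case by (intro allI impI) (rule bd_compI[of p _ "\<lambda>x. f k x - F x", OF _ elim])
    qed
  qed
  have 2: "small p (\<lambda>k x. F (shift (g k) x) - F (shift G x)) Fl"
    unfolding small_def
  proof (intro allI impI)
    fix e :: real assume "e > 0"
    from approx_comp[OF F this, of R] obtain d where d: "d > 0"
      and dP: "\<forall>(g::'n \<Rightarrow> real^'n \<Rightarrow> real) g'. (\<forall>j. bd p R (g j)) \<longrightarrow> (\<forall>j. bd p R (g' j)) \<longrightarrow> lip R (shift g) \<longrightarrow>
    lip R (shift g') \<longrightarrow> (\<forall>j. bd p d (\<lambda>x. g' j x - g j x)) \<longrightarrow> bd p e (\<lambda>x. F (shift g' x) - F (shift g x))" by blast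
    have "eventually (\<lambda>k. \<forall>j. bd p d (\<lambda>x. g k j x - G j x)) Fl"
      by (intro eventually_all_finite smallD[OF g[unfolded cv_def] d])
    then show "eventually (\<lambda>k. bd p e (\<lambda>x. F (shift (g k) x) - F (shift G x))) Fl"
      using evg evl
      by eventually_elim (rule dP[rule_format, of G], use GR lGR in auto)
  qed
  from small_add[OF 1 2] show ?thesis by (simp add: cv_def)
qed

lemma Cb_comp:
  fixes F :: "real^'n::finite \<Rightarrow> real"
  assumes "Cb p F" "\<And>j. Cb p (g j)" "lip L (shift g)"
  shows "Cb p (\<lambda>x. F (shift g x))"
proof -
  obtain c where c: "bd p c F" using assms by (auto simp: Cb_def)
  obtain d where d: "\<forall>j. bd p d (g j)" using Cb_family[of p g, OF assms(2)] by blast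
  have "\<forall>j. bd p (max d L) (g j)" using d by (blast intro: bd_mono[OF _ max.cobounded1])
  from bd_compI[OF c this lip_mono[OF assms(3) max.cobounded2]] show ?thesis by (rule CbI)
qed

text \<open>Because of the identity part, a translate of a composite is the composite of the
  translated outer function with the translated displacement.\<close>

lemma shift_translate: "shift (\<lambda>j x. g j (x + s)) x + s = shift g (x + s)"
  by (simp add: vec_eq_iff)

text \<open>Translates of the composite are composites of translates by
  \<open>shift_translate\<close>, and along a common subsequence they converge by
  \<open>cv_comp\<close>. The order \<open>1 \<le> q\<close> provides the uniform Lipschitz bound
  for the translated inner maps.\<close>

lemma AP_comp:
  fixes F :: "real^'n::finite \<Rightarrow> real"
  assumes F: "AP p F" and g: "\<And>j. AP q (g j)" and pq: "p \<le> q" "1 \<le> q"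
  shows "AP p (\<lambda>x. F (shift g x))"
proof -
  let ?r = "\<lambda>R. 1 + real CARD('n) * (real CARD('n) * R)"
  show ?thesis
  \<comment> \<open>\<open>None\<close> carries the outer function and \<open>Some j\<close> the
    displacements, so that one subsequence serves all of them.\<close>
  proof (rule AP_opI[where f = "case_option F g" and q = "case_option p (\<lambda>_. q)"])
    show "AP (case j of None \<Rightarrow> p | Some _ \<Rightarrow> q) (case j of None \<Rightarrow> F | Some j \<Rightarrow> g j)" for j
      using F g by (cases j) auto
    obtain R where R: "\<forall>j. bd q R (g j)" using Cb_family[of q g, OF AP_Cb[OF g]] by blast
    show "Cb p (\<lambda>x. F (shift g x))"
      by (rule Cb_comp[OF AP_Cb[OF F] Cb_embed_le[OF pq(1) AP_Cb[OF g]] bd_lip_shift(2)[OF R pq(2)]])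
    fix s :: "nat \<Rightarrow> real^'n" and G :: "'n option \<Rightarrow> real^'n \<Rightarrow> real"
    assume G: "\<And>j. AP (case j of None \<Rightarrow> p | Some _ \<Rightarrow> q) (G j)"
      and cG: "\<And>j. cv (case j of None \<Rightarrow> p | Some _ \<Rightarrow> q) (\<lambda>k x. (case j of None \<Rightarrow> F | Some j \<Rightarrow> g j) (x + s k)) (G j) sequentially"
    have G0: "AP p (G None)" and G1: "\<And>j. AP q (G (Some j))" using G[of None] G[of "Some _"] by auto
    have c0: "cv p (\<lambda>k x. F (x + s k)) (G None) sequentially" using cG[of None] by simp
    have c1: "cv q (\<lambda>k x. g j (x + s k)) (G (Some j)) sequentially" for j using cG[of "Some j"] by simp
    obtain R' where R': "\<forall>j. bd q R' (G (Some j))" using Cb_family[of q "\<lambda>j. G (Some j)", OF AP_Cb[OF G1]] by blast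
    let ?L = "max (?r R) (?r R')"
    have lk: "lip ?L (shift (\<lambda>j x. g j (x + s k)))" for k
      by (rule lip_mono[OF bd_lip_shift(2)[OF _ pq(2)] max.cobounded1]) (intro allI bd_translate R[rule_format])
    have lG: "lip ?L (shift (\<lambda>j. G (Some j)))"
      by (rule lip_mono[OF bd_lip_shift(2)[OF R' pq(2)] max.cobounded2])
    have "cv p (\<lambda>k x. F (shift (\<lambda>j x. g j (x + s k)) x + s k)) (\<lambda>x. G None (shift (\<lambda>j. G (Some j)) x)) sequentially"
      by (rule cv_comp[where f = "\<lambda>k x. F (x + s k)", OF c0 AP_approx[OF G0] cv_embed_le[OF pq(1) c1]
          Cb_embed_le[OF pq(1) AP_Cb[OF G1]] _ lG]) (simp add: lk)
    moreover have "Cb p (\<lambda>x. G None (shift (\<lambda>j. G (Some j)) x))"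
      by (rule Cb_comp[OF AP_Cb[OF G0] Cb_embed_le[OF pq(1) AP_Cb[OF G1]] lG])
    ultimately show "\<exists>H. Cb p H \<and> cv p (\<lambda>k x. F (shift g (x + s k))) H sequentially"
      by (auto simp: shift_translate)
  qed
qed

lemma comp_rem_diff:
  assumes "Cb (Suc p) F" "Cb (Suc q) H"
  shows "comp_rem F g g' x = comp_rem (\<lambda>x. F x - H x) g g' x + comp_rem H g g' x"
  unfolding comp_rem_def pd_diff[OF assms]
  by (simp add: left_diff_distrib sum_subtractf)

text \<open>A crude bound, linear instead of quadratic in \<open>d\<close>, but with a single spare
  derivative; it is applied to the small difference between \<open>F\<close> and a smooth
  approximation.\<close>

lemma bd_comp_rem1:
  fixes F :: "real^'n::finite \<Rightarrow> real"
  assumes F: "bd (Suc p) c F" and g: "\<forall>j. bd p R (g j)" "\<forall>j. bd p R (g' j)" "lip R (shift g)" "lip R (shift g')"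
    and d: "\<forall>j. bd p d (\<lambda>x. g' j x - g j x)"
  shows "bd p ((Kdiff TYPE('n) p R + real CARD('n) * (Kmul TYPE('n) p * Kcomp TYPE('n) p R)) * c * d) (comp_rem F g g')"
proof -
  have "bd p (Kdiff TYPE('n) p R * c * d + real CARD('n) * (Kmul TYPE('n) p * (Kcomp TYPE('n) p R * c) * d)) (comp_rem F g g')"
    unfolding comp_rem_def
    by (intro bd_diff[OF bd_comp_diff[OF F g d]] bd_sum_const bd_mult[OF bd_compI[OF bd_pd[OF F] g(1,3)] d[rule_format]])
  then show ?thesis by (simp add: algebra_simps)
qed

text \<open>Splitting \<open>F\<close> into \<open>F - H\<close> and a smooth \<open>H\<close> gives
  an error of size \<open>e1 * d\<close> from the crude bound and one of size \<open>d * d\<close>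
  from the quadratic bound, and \<open>d \<le> \<delta>\<close> makes the latter small relative to
  \<open>d\<close>. This is differentiability with the loss of a single derivative, uniform in the
  inner maps.\<close>

lemma approx_comp_rem:
  fixes F :: "real^'n::finite \<Rightarrow> real"
  assumes F: "approx (Suc p) F" "Cb (Suc p) F" and e: "e > 0"
  shows "\<exists>\<delta>>0. \<forall>(g::'n \<Rightarrow> real^'n \<Rightarrow> real) g' d. (\<forall>j. bd p R (g j)) \<longrightarrow> (\<forall>j. bd p R (g' j)) \<longrightarrow> lip R (shift g) \<longrightarrow>
    lip R (shift g') \<longrightarrow> (\<forall>j. bd p d (\<lambda>x. g' j x - g j x)) \<longrightarrow> d \<le> \<delta> \<longrightarrow> bd p (e * d) (comp_rem F g g')"
proof -
  let ?A = "Kdiff TYPE('n) p R + real CARD('n) * (Kmul TYPE('n) p * Kcomp TYPE('n) p R)"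
  let ?K = "Krem TYPE('n) p R"
  have A: "?A \<ge> 0"
    using Kdiff_nonneg[where ?'n = 'n, of p R] Kmul_pos[of "TYPE('n)" p] Kcomp_ge[where ?'n = 'n, of p R]
    by (intro add_nonneg_nonneg mult_nonneg_nonneg) auto
  have K: "?K \<ge> 0" by (rule Krem_nonneg)
  define e1 where "e1 = e / (2 * (?A + 1))"
  have e1: "e1 > 0" using e A by (simp add: e1_def)
  obtain H where Hs: "\<forall>q. Cb q H" and HF: "bd (Suc p) e1 (\<lambda>x. F x - H x)" using F e1 unfolding approx_def by blast
  obtain c where c: "bd (Suc (Suc p)) c H" "c > 0" using CbE[OF Hs[rule_format]] by blast
  define \<delta> where "\<delta> = e / (2 * (?K * c + 1))"
  have Kc: "?K * c + 1 > 0" using K c by (simp add: add_nonneg_pos)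
  have \<delta>: "\<delta> > 0" using e Kc by (simp add: \<delta>_def)
  show ?thesis
  proof (intro exI[of _ \<delta>] conjI \<delta> allI impI)
    fix g g' :: "'n \<Rightarrow> real^'n \<Rightarrow> real" and d
    assume g: "\<forall>j. bd p R (g j)" "\<forall>j. bd p R (g' j)" "lip R (shift g)" "lip R (shift g')"
      and dd: "\<forall>j. bd p d (\<lambda>x. g' j x - g j x)" and "d \<le> \<delta>"
    have d0: "d \<ge> 0" using bd_nonneg[OF dd[rule_format]] .
    have "bd p (?A * e1 * d + ?K * c * d * d) (\<lambda>x. comp_rem (\<lambda>x. F x - H x) g g' x + comp_rem H g g' x)"
      by (rule bd_add[OF bd_comp_rem1[OF HF g dd] bd_comp_rem[OF c(1) g dd]])
    moreover have "?A * e1 * d + ?K * c * d * d \<le> e * d"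
    proof -
      have "?A * e1 \<le> (?A + 1) * e1" using e1 by simp
      also have "\<dots> = e / 2" unfolding e1_def by (rule mult_half_div) (use A in linarith)
      finally have 1: "?A * e1 \<le> e / 2" .
      have "?K * c * d \<le> ?K * c * \<delta>" using K c \<open>d \<le> \<delta>\<close> by (intro mult_left_mono) auto
      also have "\<dots> \<le> (?K * c + 1) * \<delta>" using \<delta> by simp
      also have "\<dots> = e / 2" by (simp only: \<delta>_def mult_half_div[OF Kc])
      finally have "?A * e1 + ?K * c * d \<le> e" using 1 by linarith
      from mult_right_mono[OF this d0] show ?thesis by (simp add: algebra_simps)
    qed
    ultimately have "bd p (e * d) (\<lambda>x. comp_rem (\<lambda>x. F x - H x) g g' x + comp_rem H g g' x)" by (rule bd_mono)
    then show "bd p (e * d) (comp_rem F g g')"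
      using comp_rem_diff[OF F(2) Hs[rule_format], symmetric] by simp
  qed
qed

end

subsection \<open>Differentiable families of multilinear maps\<close>

text \<open>The source space is abstract because inversion uses one function space and composition a
  product of two; the target is always the Hoelder scale of the ambient locale, treated by
  components.\<close>

locale cr_domain = hoelder +
  fixes VA :: "'a::real_vector set" and NA :: "'a \<Rightarrow> real" and U :: "'a set"
  assumes VA: "subspace VA" and NA: "\<And>x. x \<in> VA \<Longrightarrow> 0 \<le> NA x" and U: "U \<subseteq> VA"
begin

text \<open>Neighbourhoods of \<open>x\<close> relative to \<open>U\<close> in the distance given by
  \<open>NA\<close>; the filter is built by hand because the norm lives on a carrier set and not on
  the type.\<close>

definition nb :: "'a \<Rightarrow> 'a filter" where
  "nb x = Abs_filter (\<lambda>P. \<exists>d>0. \<forall>y\<in>U. NA (y - x) < d \<longrightarrow> P y)"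

lemma eventually_nb: "eventually P (nb x) \<longleftrightarrow> (\<exists>d>0. \<forall>y\<in>U. NA (y - x) < d \<longrightarrow> P y)"
  unfolding nb_def
proof (rule eventually_Abs_filter, rule is_filter.intro)
  show "\<exists>d>0. \<forall>y\<in>U. NA (y - x) < d \<longrightarrow> True" by (auto intro: exI[of _ 1])
  fix P Q :: "'a \<Rightarrow> bool"
  assume "\<exists>d>0. \<forall>y\<in>U. NA (y - x) < d \<longrightarrow> P y" "\<exists>d>0. \<forall>y\<in>U. NA (y - x) < d \<longrightarrow> Q y"
  then obtain d d' where d: "d > 0" "d' > 0" "\<forall>y\<in>U. NA (y - x) < d \<longrightarrow> P y" "\<forall>y\<in>U. NA (y - x) < d' \<longrightarrow> Q y"
    by blast
  show "\<exists>d>0. \<forall>y\<in>U. NA (y - x) < d \<longrightarrow> P y \<and> Q y"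
    by (rule exI[of _ "min d d'"]) (use d in auto)
next
  fix P Q :: "'a \<Rightarrow> bool"
  assume "\<forall>x. P x \<longrightarrow> Q x" "\<exists>d>0. \<forall>y\<in>U. NA (y - x) < d \<longrightarrow> P y"
  then show "\<exists>d>0. \<forall>y\<in>U. NA (y - x) < d \<longrightarrow> Q y" by blast
qed

lemma eventually_nb_U: "eventually (\<lambda>y. y \<in> U) (nb x)"
  unfolding eventually_nb by (auto intro: exI[of _ 1])

lemma diff_VA: "x \<in> U \<Longrightarrow> y \<in> U \<Longrightarrow> y - x \<in> VA"
  using U VA subspace_diff by blast

lemma eventually_nb_NA: "x \<in> U \<Longrightarrow> eventually (\<lambda>y. 0 \<le> NA (y - x)) (nb x)"
  using eventually_nb_U by eventually_elim (intro NA diff_VA)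

text \<open>An operator norm bound. The slots form an arbitrary set of numbers, so products can take
  disjoint slots and derivatives a fresh one without renumbering.\<close>

definition bnd :: "nat set \<Rightarrow> nat \<Rightarrow> real \<Rightarrow> ((nat \<Rightarrow> 'a) \<Rightarrow> real^'n::finite \<Rightarrow> real) \<Rightarrow> bool" where
  "bnd A p c M \<longleftrightarrow> (\<forall>h. (\<forall>i\<in>A. h i \<in> VA) \<longrightarrow> bd p (c * (\<Prod>i\<in>A. NA (h i))) (M h))"

lemma bndD: "bnd A p c M \<Longrightarrow> (\<And>i. i \<in> A \<Longrightarrow> h i \<in> VA) \<Longrightarrow> bd p (c * (\<Prod>i\<in>A. NA (h i))) (M h)"
  by (simp add: bnd_def)

lemma prod_NA_nonneg: "(\<And>i. i \<in> A \<Longrightarrow> h i \<in> VA) \<Longrightarrow> 0 \<le> (\<Prod>i\<in>A. NA (h i))"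
  by (intro prod_nonneg ballI NA) auto

lemma bnd_mono: "bnd A p c M \<Longrightarrow> c \<le> d \<Longrightarrow> bnd A p d M"
  unfolding bnd_def
proof (intro allI impI)
  fix h assume "\<forall>h. (\<forall>i\<in>A. h i \<in> VA) \<longrightarrow> bd p (c * (\<Prod>i\<in>A. NA (h i))) (M h)" "c \<le> d" and h: "\<forall>i\<in>A. h i \<in> VA"
  then have "bd p (c * (\<Prod>i\<in>A. NA (h i))) (M h)" by blast
  then show "bd p (d * (\<Prod>i\<in>A. NA (h i))) (M h)"
    by (rule bd_mono) (intro mult_right_mono \<open>c \<le> d\<close> prod_NA_nonneg h[rule_format])
qed

lemma bnd_transfer:
  assumes "bnd A p c M" and "\<And>h c. bd p c (M h) \<Longrightarrow> bd q (K * c) (M' h)"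
  shows "bnd A q (K * c) M'"
  unfolding bnd_def
proof (intro allI impI)
  fix h assume "\<forall>i\<in>A. h i \<in> VA"
  then have "bd p (c * (\<Prod>i\<in>A. NA (h i))) (M h)" using bndD[OF assms(1)] by blast
  from assms(2)[OF this] show "bd q (K * c * (\<Prod>i\<in>A. NA (h i))) (M' h)" by (simp add: mult.assoc)
qed

lemma bnd_add:
  assumes "bnd A p c M" "bnd A p d M'"
  shows "bnd A p (c + d) (\<lambda>h t. M h t + M' h t)"
  unfolding bnd_def
proof (intro allI impI)
  fix h assume "\<forall>i\<in>A. h i \<in> VA"
  then have "bd p (c * (\<Prod>i\<in>A. NA (h i))) (M h)" "bd p (d * (\<Prod>i\<in>A. NA (h i))) (M' h)"
    using bndD[OF assms(1)] bndD[OF assms(2)] by blast+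
  from bd_add[OF this] show "bd p ((c + d) * (\<Prod>i\<in>A. NA (h i))) (\<lambda>t. M h t + M' h t)"
    by (simp add: distrib_right)
qed

lemma bnd_zero: "0 \<le> c \<Longrightarrow> bnd A p c (\<lambda>h t. 0)"
  unfolding bnd_def by (intro allI impI bd_zero mult_nonneg_nonneg prod_NA_nonneg) auto

lemma bnd_mult:
  fixes M :: "(nat \<Rightarrow> 'a) \<Rightarrow> real^'n::finite \<Rightarrow> real"
  assumes "bnd A p c M" "bnd B p d M'" and AB: "finite A" "finite B" "A \<inter> B = {}"
  shows "bnd (A \<union> B) p (Kmul TYPE('n) p * c * d) (\<lambda>h t. M h t * M' h t)"
  unfolding bnd_def
proof (intro allI impI)
  fix h assume h: "\<forall>i\<in>A \<union> B. h i \<in> VA"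
  have "bd p (c * (\<Prod>i\<in>A. NA (h i))) (M h)" "bd p (d * (\<Prod>i\<in>B. NA (h i))) (M' h)"
    using bndD[OF assms(1)] bndD[OF assms(2)] h by blast+
  from bd_mult[OF this] show "bd p (Kmul TYPE('n) p * c * d * (\<Prod>i\<in>A \<union> B. NA (h i))) (\<lambda>t. M h t * M' h t)"
    by (simp add: prod.union_disjoint[OF AB] mult_ac)
qed

text \<open>Freezing one slot turns a bound on a derivative into a bound proportional to the size of
  the direction.\<close>

lemma bnd_slot:
  assumes "bnd (insert a A) p C M" "a \<notin> A" "finite A" "u \<in> VA"
  shows "bnd A p (C * NA u) (\<lambda>h. M (h(a := u)))"
  unfolding bnd_def
proof (intro allI impI)
  fix h assume h: "\<forall>i\<in>A. h i \<in> VA"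
  have "bd p (C * (\<Prod>i\<in>insert a A. NA ((h(a := u)) i))) (M (h(a := u)))"
    by (rule bndD[OF assms(1)]) (use h assms(4) in auto)
  moreover have "(\<Prod>i\<in>insert a A. NA ((h(a := u)) i)) = NA u * (\<Prod>i\<in>A. NA ((h(a := u)) i))"
    using assms(2,3) by simp
  moreover have "(\<Prod>i\<in>A. NA ((h(a := u)) i)) = (\<Prod>i\<in>A. NA (h i))"
    using assms(2) by (intro prod.cong) auto
  ultimately show "bd p (C * NA u * (\<Prod>i\<in>A. NA (h i))) (M (h(a := u)))" by (simp add: mult.assoc)
qed

lemma bnd_empty: "bnd {} p c (\<lambda>h. f) \<longleftrightarrow> bd p c f"
  by (simp add: bnd_def)

text \<open>Little-o of the weight \<open>w\<close>, uniformly over the slots: the weight 1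
  expresses continuity, the weight \<open>NA (y - x)\<close> differentiability.\<close>

definition sml :: "('a \<Rightarrow> real) \<Rightarrow> nat set \<Rightarrow> nat \<Rightarrow> 'a filter \<Rightarrow> ('a \<Rightarrow> (nat \<Rightarrow> 'a) \<Rightarrow> real^'n::finite \<Rightarrow> real) \<Rightarrow> bool" where
  "sml w A p Fl M \<longleftrightarrow> (\<forall>e>0. eventually (\<lambda>y. bnd A p (e * w y) (M y)) Fl)"

lemma smlD: "sml w A p Fl M \<Longrightarrow> e > 0 \<Longrightarrow> eventually (\<lambda>y. bnd A p (e * w y) (M y)) Fl"
  by (simp add: sml_def)

lemma sml_I:
  assumes P: "\<And>e. e > 0 \<Longrightarrow> eventually (P e) Fl"
    and imp: "eventually (\<lambda>y. \<forall>e>0. P e y \<longrightarrow> bnd A p (K * e * w y) (M y)) Fl"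
    and w: "eventually (\<lambda>y. 0 \<le> w y) Fl"
  shows "sml w A p Fl M"
  unfolding sml_def
proof (intro allI impI)
  fix e :: real assume e: "e > 0"
  have K: "\<bar>K\<bar> + 1 > 0" by simp
  have e': "e / (\<bar>K\<bar> + 1) > 0" using e K by simp
  have "K * (e / (\<bar>K\<bar> + 1)) \<le> (\<bar>K\<bar> + 1) * (e / (\<bar>K\<bar> + 1))"
    using e' by (intro mult_right_mono) linarith+
  also have "\<dots> = e" using K by simp
  finally have le: "K * (e / (\<bar>K\<bar> + 1)) \<le> e" .
  show "eventually (\<lambda>y. bnd A p (e * w y) (M y)) Fl"
    using P[OF e'] imp w
  proof eventually_elim
    case (elim y)
    then have "bnd A p (K * (e / (\<bar>K\<bar> + 1)) * w y) (M y)" using e' by blast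
    then show ?case by (rule bnd_mono) (intro mult_right_mono le elim(3))
  qed
qed

lemma sml_add:
  assumes "sml w A p Fl M" "sml w A p Fl M'"
  shows "sml w A p Fl (\<lambda>y h t. M y h t + M' y h t)"
  unfolding sml_def
proof (intro allI impI)
  fix e :: real assume "e > 0"
  then have h: "e / 2 > 0" by simp
  show "eventually (\<lambda>y. bnd A p (e * w y) (\<lambda>h t. M y h t + M' y h t)) Fl"
    using smlD[OF assms(1) h] smlD[OF assms(2) h]
  proof eventually_elim
    case (elim y)
    from bnd_add[OF elim] show ?case by (simp add: algebra_simps)
  qed
qed

lemma sml_zero: "eventually (\<lambda>y. 0 \<le> w y) Fl \<Longrightarrow> sml w A p Fl (\<lambda>y h t. 0)"
  unfolding sml_def by (auto elim!: eventually_mono intro!: bnd_zero mult_nonneg_nonneg)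

lemma sml_sum:
  assumes "\<And>j. j \<in> S \<Longrightarrow> sml w A p Fl (M j)" "eventually (\<lambda>y. 0 \<le> w y) Fl"
  shows "sml w A p Fl (\<lambda>y h t. \<Sum>j\<in>S. M j y h t)"
  using assms
proof (induction S rule: infinite_finite_induct)
  case (insert j S)
  have "sml w A p Fl (\<lambda>y h t. M j y h t + (\<Sum>j\<in>S. M j y h t))"
    by (rule sml_add[OF insert.prems(1) insert.IH[OF insert.prems(1) insert.prems(2)]]) auto
  with insert.hyps show ?case by simp
qed (simp_all add: sml_zero)

text \<open>Little-o of \<open>w\<close> times a quantity bounded by a multiple of \<open>v\<close>
  is little-o of the product; this one rule treats all products in the remainders below.\<close>

lemma sml_mult_left:
  fixes M :: "'a \<Rightarrow> (nat \<Rightarrow> 'a) \<Rightarrow> real^'n::finite \<Rightarrow> real"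
  assumes "sml w A p Fl M" "eventually (\<lambda>y. bnd B p (C * v y) (N y)) Fl"
    and AB: "finite A" "finite B" "A \<inter> B = {}" and w: "eventually (\<lambda>y. 0 \<le> w y * v y) Fl"
  shows "sml (\<lambda>y. w y * v y) (A \<union> B) p Fl (\<lambda>y h t. M y h t * N y h t)"
proof (rule sml_I[OF smlD[OF assms(1)] _ w, where K = "Kmul TYPE('n) p * C"])
  show "eventually (\<lambda>y. \<forall>e>0. bnd A p (e * w y) (M y) \<longrightarrow>
      bnd (A \<union> B) p (Kmul TYPE('n) p * C * e * (w y * v y)) (\<lambda>h t. M y h t * N y h t)) Fl"
    using assms(2)
  proof (eventually_elim, intro allI impI)
    fix y and e :: real assume N: "bnd B p (C * v y) (N y)" and M: "bnd A p (e * w y) (M y)"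
    from bnd_mult[OF M N AB]
    show "bnd (A \<union> B) p (Kmul TYPE('n) p * C * e * (w y * v y)) (\<lambda>h t. M y h t * N y h t)" by (simp add: mult_ac)
  qed
qed simp

definition mlin :: "nat set \<Rightarrow> nat \<Rightarrow> ((nat \<Rightarrow> 'a) \<Rightarrow> real^'n::finite \<Rightarrow> real) \<Rightarrow> bool" where
  "mlin A p M \<longleftrightarrow> finite A \<and> (\<forall>h h'. (\<forall>i\<in>A. h i = h' i) \<longrightarrow> M h = M h') \<and>
     (\<forall>h. (\<forall>i\<in>A. h i \<in> VA) \<longrightarrow> AP p (M h)) \<and>
     (\<forall>h i u v t. i \<in> A \<longrightarrow> (\<forall>j\<in>A. h j \<in> VA) \<longrightarrow> u \<in> VA \<longrightarrow> v \<in> VA \<longrightarrow>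
        M (h(i := u + v)) t = M (h(i := u)) t + M (h(i := v)) t) \<and>
     (\<forall>h i u c t. i \<in> A \<longrightarrow> (\<forall>j\<in>A. h j \<in> VA) \<longrightarrow> u \<in> VA \<longrightarrow> M (h(i := c *\<^sub>R u)) t = c * M (h(i := u)) t) \<and>
     (\<exists>C. bnd A p C M)"

lemma mlin_finite: "mlin A p M \<Longrightarrow> finite A"
  and mlin_dep: "mlin A p M \<Longrightarrow> (\<And>i. i \<in> A \<Longrightarrow> h i = h' i) \<Longrightarrow> M h = M h'"
  and mlin_AP: "mlin A p M \<Longrightarrow> (\<And>i. i \<in> A \<Longrightarrow> h i \<in> VA) \<Longrightarrow> AP p (M h)"
  and mlin_add_slot: "mlin A p M \<Longrightarrow> i \<in> A \<Longrightarrow> (\<And>j. j \<in> A \<Longrightarrow> h j \<in> VA) \<Longrightarrow> u \<in> VA \<Longrightarrow> v \<in> VA \<Longrightarrow>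
        M (h(i := u + v)) t = M (h(i := u)) t + M (h(i := v)) t"
  and mlin_scale_slot: "mlin A p M \<Longrightarrow> i \<in> A \<Longrightarrow> (\<And>j. j \<in> A \<Longrightarrow> h j \<in> VA) \<Longrightarrow> u \<in> VA \<Longrightarrow>
        M (h(i := c *\<^sub>R u)) t = c * M (h(i := u)) t"
  and mlin_bnd: "mlin A p M \<Longrightarrow> \<exists>C. bnd A p C M"
  unfolding mlin_def by blast+

lemma mlin_I:
  assumes "finite A" "\<And>h h'. (\<And>i. i \<in> A \<Longrightarrow> h i = h' i) \<Longrightarrow> M h = M h'"
    "\<And>h. (\<And>i. i \<in> A \<Longrightarrow> h i \<in> VA) \<Longrightarrow> AP p (M h)"
    "\<And>h i u v t. i \<in> A \<Longrightarrow> (\<And>j. j \<in> A \<Longrightarrow> h j \<in> VA) \<Longrightarrow> u \<in> VA \<Longrightarrow> v \<in> VA \<Longrightarrow>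
        M (h(i := u + v)) t = M (h(i := u)) t + M (h(i := v)) t"
    "\<And>h i u c t. i \<in> A \<Longrightarrow> (\<And>j. j \<in> A \<Longrightarrow> h j \<in> VA) \<Longrightarrow> u \<in> VA \<Longrightarrow> M (h(i := c *\<^sub>R u)) t = c * M (h(i := u)) t"
    "bnd A p C M"
  shows "mlin A p M"
  unfolding mlin_def using assms by blast

lemma mlin_upd: "mlin A p M \<Longrightarrow> a \<notin> A \<Longrightarrow> M (h(a := u)) = M h"
  by (rule mlin_dep) auto

lemma mlin_bnd_pos: assumes "mlin A p M" obtains C where "bnd A p C M" "C > 0"
proof -
  obtain C where C: "bnd A p C M" using mlin_bnd[OF assms] by blast
  have "bnd A p (max C 1) M" by (rule bnd_mono[OF C]) simp
  then show ?thesis by (rule that) simp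
qed

lemma mlin_add:
  assumes "mlin A p M" "mlin A p M'"
  shows "mlin A p (\<lambda>h t. M h t + M' h t)"
proof -
  obtain C C' where C: "bnd A p C M" "bnd A p C' M'" using mlin_bnd assms by blast
  show ?thesis
  proof (rule mlin_I[OF _ _ _ _ _ bnd_add[OF C]])
    show "(\<lambda>t. M h t + M' h t) = (\<lambda>t. M h' t + M' h' t)" if "\<And>i. i \<in> A \<Longrightarrow> h i = h' i" for h h'
      using mlin_dep[OF assms(1) that] mlin_dep[OF assms(2) that] by simp
    show "AP p (\<lambda>t. M h t + M' h t)" if "\<And>i. i \<in> A \<Longrightarrow> h i \<in> VA" for h
      by (rule AP_add[OF mlin_AP[OF assms(1) that] mlin_AP[OF assms(2) that]])
  qed (use mlin_finite[OF assms(1)] in \<open>simp_all add: mlin_add_slot[OF assms(1)] mlin_add_slot[OF assms(2)]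
        mlin_scale_slot[OF assms(1)] mlin_scale_slot[OF assms(2)] algebra_simps\<close>)
qed

lemma mlin_zero: "finite A \<Longrightarrow> mlin A p (\<lambda>h t. 0)"
  by (rule mlin_I[where C = 0]) (auto intro: AP_const bnd_zero)

lemma mlin_mult:
  assumes M: "mlin A p M" and N: "mlin B p N" and AB: "A \<inter> B = {}"
  shows "mlin (A \<union> B) p (\<lambda>h t. M h t * N h t)"
proof -
  obtain C C' where C: "bnd A p C M" "bnd B p C' N" using mlin_bnd M N by blast
  note fin = mlin_finite[OF M] mlin_finite[OF N]
  show ?thesis
  proof (rule mlin_I[OF _ _ _ _ _ bnd_mult[OF C fin AB]])
    show "(\<lambda>t. M h t * N h t) = (\<lambda>t. M h' t * N h' t)" if "\<And>i. i \<in> A \<union> B \<Longrightarrow> h i = h' i" for h h'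
    proof -
      have "M h = M h'" "N h = N h'" by (rule mlin_dep[OF M] mlin_dep[OF N]; simp add: that)+
      then show ?thesis by simp
    qed
    show "AP p (\<lambda>t. M h t * N h t)" if "\<And>i. i \<in> A \<union> B \<Longrightarrow> h i \<in> VA" for h
      by (intro AP_mult mlin_AP[OF M] mlin_AP[OF N]) (auto simp: that)
  next
    fix h i u v t assume i: "i \<in> A \<union> B" and h: "\<And>j. j \<in> A \<union> B \<Longrightarrow> h j \<in> VA" and u: "u \<in> VA" and v: "v \<in> VA"
    consider "i \<in> A" "i \<notin> B" | "i \<in> B" "i \<notin> A" using i AB by blast
    then show "M (h(i := u + v)) t * N (h(i := u + v)) t = M (h(i := u)) t * N (h(i := u)) t + M (h(i := v)) t * N (h(i := v)) t"
    proof cases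
      case 1
      then show ?thesis using mlin_add_slot[OF M 1(1) _ u v, of h t] h by (simp add: mlin_upd[OF N] distrib_right)
    next
      case 2
      then show ?thesis using mlin_add_slot[OF N 2(1) _ u v, of h t] h by (simp add: mlin_upd[OF M] distrib_left)
    qed
  next
    fix h i u c t assume i: "i \<in> A \<union> B" and h: "\<And>j. j \<in> A \<union> B \<Longrightarrow> h j \<in> VA" and u: "u \<in> VA"
    consider "i \<in> A" "i \<notin> B" | "i \<in> B" "i \<notin> A" using i AB by blast
    then show "M (h(i := c *\<^sub>R u)) t * N (h(i := c *\<^sub>R u)) t = c * (M (h(i := u)) t * N (h(i := u)) t)"
    proof cases
      case 1
      then show ?thesis using mlin_scale_slot[OF M 1(1) _ u, of h c t] h by (simp add: mlin_upd[OF N])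
    next
      case 2
      then show ?thesis using mlin_scale_slot[OF N 2(1) _ u, of h c t] h by (simp add: mlin_upd[OF M])
    qed
  qed (use fin in auto)
qed

text \<open>Linearity is asked on \<open>Cb p\<close> only, because \<open>pderiv_dir\<close> is not
  additive on functions that fail to be differentiable.\<close>

definition lin_op :: "nat \<Rightarrow> nat \<Rightarrow> real \<Rightarrow> ((real^'n::finite \<Rightarrow> real) \<Rightarrow> real^'n \<Rightarrow> real) \<Rightarrow> bool" where
  "lin_op p q K L \<longleftrightarrow> (\<forall>f. AP p f \<longrightarrow> AP q (L f)) \<and> (\<forall>f c. bd p c f \<longrightarrow> bd q (K * c) (L f)) \<and>
     (\<forall>f g t. Cb p f \<longrightarrow> Cb p g \<longrightarrow> L (\<lambda>t. f t + g t) t = L f t + L g t) \<and>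
     (\<forall>f c t. Cb p f \<longrightarrow> L (\<lambda>t. c * f t) t = c * L f t)"

lemma lin_op_AP: "lin_op p q K L \<Longrightarrow> AP p f \<Longrightarrow> AP q (L f)"
  and lin_op_bd: "lin_op p q K L \<Longrightarrow> bd p c f \<Longrightarrow> bd q (K * c) (L f)"
  and lin_op_add: "lin_op p q K L \<Longrightarrow> Cb p f \<Longrightarrow> Cb p g \<Longrightarrow> L (\<lambda>t. f t + g t) = (\<lambda>t. L f t + L g t)"
  and lin_op_scale: "lin_op p q K L \<Longrightarrow> Cb p f \<Longrightarrow> L (\<lambda>t. c * f t) = (\<lambda>t. c * L f t)"
  unfolding lin_op_def by blast+

lemma lin_op_diff: "lin_op p q K L \<Longrightarrow> Cb p f \<Longrightarrow> Cb p g \<Longrightarrow> L (\<lambda>t. f t - g t) = (\<lambda>t. L f t - L g t)"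
  using lin_op_add[of p q K L f "\<lambda>t. (-1) * g t"] lin_op_scale[of p q K L g "-1"] Cb_cmult[of p g "-1"] by simp

lemma mlin_lin_op:
  assumes L: "lin_op p q K L" and M: "mlin A p M"
  shows "mlin A q (\<lambda>h. L (M h))"
proof -
  obtain C where C: "bnd A p C M" using mlin_bnd M by blast
  show ?thesis
  proof (rule mlin_I[OF mlin_finite[OF M] _ _ _ _ bnd_transfer[OF C lin_op_bd[OF L]]])
    show "L (M h) = L (M h')" if "\<And>i. i \<in> A \<Longrightarrow> h i = h' i" for h h'
      using mlin_dep[OF M that] by simp
    show "AP q (L (M h))" if "\<And>i. i \<in> A \<Longrightarrow> h i \<in> VA" for h
      by (rule lin_op_AP[OF L mlin_AP[OF M that]])
    fix h i u v and c t assume i: "i \<in> A" and h: "\<And>j. j \<in> A \<Longrightarrow> h j \<in> VA" and u: "u \<in> VA"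
    have Cu: "Cb p (M (h(i := w)))" if "w \<in> VA" for w
      by (rule AP_Cb[OF mlin_AP[OF M]]) (use h that in auto)
    have "M (h(i := c *\<^sub>R u)) = (\<lambda>t. c * M (h(i := u)) t)" by (rule ext, rule mlin_scale_slot[OF M i _ u], rule h)
    then show "L (M (h(i := c *\<^sub>R u))) t = c * L (M (h(i := u))) t" by (simp add: lin_op_scale[OF L Cu[OF u]])
    assume v: "v \<in> VA"
    have "M (h(i := u + v)) = (\<lambda>t. M (h(i := u)) t + M (h(i := v)) t)" by (rule ext, rule mlin_add_slot[OF M i _ u v], rule h)
    then show "L (M (h(i := u + v))) t = L (M (h(i := u))) t + L (M (h(i := v))) t"
      by (simp add: lin_op_add[OF L Cu[OF u] Cu[OF v]])
  qed
qed

lemma lin_op_embed: "lin_op (Suc p) p (2 * real CARD('n::finite)) (\<lambda>f::real^'n \<Rightarrow> real. f)"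
  unfolding lin_op_def using AP_embed bd_embed by blast

lemma lin_op_pd: "lin_op (Suc p) p 1 (\<lambda>f. pderiv_dir i f)"
proof -
  have "bd p (1 * c) (pderiv_dir i f)" if "bd (Suc p) c f" for c f using bd_pd[OF that] by simp
  then show ?thesis unfolding lin_op_def using AP_pd pd_add pd_cmult by metis
qed

lemma lin_op_cmult: "lin_op p p \<bar>a\<bar> (\<lambda>f t. a * f t)"
  unfolding lin_op_def using AP_cmult bd_cmult by (auto simp: algebra_simps)

definition dr :: "nat set \<Rightarrow> nat \<Rightarrow> 'a \<Rightarrow> ('a \<Rightarrow> (nat \<Rightarrow> 'a) \<Rightarrow> real^'n::finite \<Rightarrow> real) \<Rightarrow>
    ('a \<Rightarrow> (nat \<Rightarrow> 'a) \<Rightarrow> real^'n \<Rightarrow> real) \<Rightarrow> nat \<Rightarrow> bool" where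
  "dr A p x T T' a \<longleftrightarrow> sml (\<lambda>y. NA (y - x)) A p (nb x) (\<lambda>y h t. T y h t - T x h t - T' x (h(a := y - x)) t)"

definition ct :: "nat set \<Rightarrow> nat \<Rightarrow> 'a \<Rightarrow> ('a \<Rightarrow> (nat \<Rightarrow> 'a) \<Rightarrow> real^'n::finite \<Rightarrow> real) \<Rightarrow> bool" where
  "ct A p x T \<longleftrightarrow> sml (\<lambda>y. 1) A p (nb x) (\<lambda>y h t. T y h t - T x h t)"

text \<open>\<open>Sm r A p T\<close>: the map \<open>T\<close> from \<open>U\<close> to the multilinear maps in the slots \<open>A\<close> with values in
  $C^{p+\gamma}_{ap}$ is $C^r$; its derivative takes the direction in a fresh slot.\<close>
primrec Sm :: "nat \<Rightarrow> nat set \<Rightarrow> nat \<Rightarrow> ('a \<Rightarrow> (nat \<Rightarrow> 'a) \<Rightarrow> real^'n::finite \<Rightarrow> real) \<Rightarrow> bool" where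
  "Sm 0 A p T \<longleftrightarrow> (\<forall>x\<in>U. mlin A p (T x) \<and> ct A p x T)"
| "Sm (Suc r) A p T \<longleftrightarrow> (\<forall>x\<in>U. mlin A p (T x) \<and> ct A p x T) \<and>
     (\<forall>a. a \<notin> A \<longrightarrow> (\<exists>T'. Sm r (insert a A) p T' \<and> (\<forall>x\<in>U. dr A p x T T' a)))"

lemma Sm_mlin: "Sm r A p T \<Longrightarrow> x \<in> U \<Longrightarrow> mlin A p (T x)"
  by (cases r) auto

lemma Sm_ct: "Sm r A p T \<Longrightarrow> x \<in> U \<Longrightarrow> ct A p x T"
  by (cases r) auto

lemma Sm_0: "Sm r A p T \<Longrightarrow> Sm 0 A p T"
  by (cases r) auto

lemma Sm_SucI: "Sm 0 A p T \<Longrightarrow> (\<And>a. a \<notin> A \<Longrightarrow> \<exists>T'. Sm r (insert a A) p T' \<and> (\<forall>x\<in>U. dr A p x T T' a)) \<Longrightarrow> Sm (Suc r) A p T"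
  by simp

lemma Sm_SucD: assumes "Sm (Suc r) A p T" "a \<notin> A"
  obtains T' where "Sm r (insert a A) p T'" "\<And>x. x \<in> U \<Longrightarrow> dr A p x T T' a"
  using assms by auto

lemma Sm_SucD_ex: "Sm (Suc r) A p T \<Longrightarrow> a \<notin> A \<Longrightarrow> \<exists>T'. Sm r (insert a A) p T' \<and> (\<forall>x\<in>U. dr A p x T T' a)"
  by simp

lemma Sm_mono: "Sm (Suc r) A p T \<Longrightarrow> Sm r A p T"
proof (induction r arbitrary: A T)
  case 0
  then show ?case by (rule Sm_0)
next
  case (Suc r)
  show ?case
  proof (rule Sm_SucI[OF Sm_0[OF Suc.prems]])
    fix a assume "a \<notin> A"
    then obtain T' where "Sm (Suc r) (insert a A) p T'" "\<And>x. x \<in> U \<Longrightarrow> dr A p x T T' a"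
      using Sm_SucD[OF Suc.prems] by blast
    then show "\<exists>T'. Sm r (insert a A) p T' \<and> (\<forall>x\<in>U. dr A p x T T' a)" using Suc.IH by blast
  qed
qed

text \<open>The derivative at \<open>x\<close> contributes a bounded multiple of
  \<open>NA (y - x)\<close>, and near \<open>x\<close> the remainder contributes at most one more
  such term.\<close>

lemma dr_O:
  assumes T': "mlin (insert a A) p (T' x)" and dr: "dr A p x T T' a" and a: "a \<notin> A" and x: "x \<in> U"
  obtains C where "C > 0" "eventually (\<lambda>y. bnd A p (C * NA (y - x)) (\<lambda>h t. T y h t - T x h t)) (nb x)"
proof -
  obtain C where C: "bnd (insert a A) p C (T' x)" "C > 0" using mlin_bnd_pos[OF T'] by blast
  have fin: "finite A" using mlin_finite[OF T'] by simp
  have "eventually (\<lambda>y. bnd A p ((1 + C) * NA (y - x)) (\<lambda>h t. T y h t - T x h t)) (nb x)"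
    using smlD[OF dr[unfolded dr_def] zero_less_one] eventually_nb_U
  proof eventually_elim
    case (elim y)
    from bnd_add[OF elim(1) bnd_slot[OF C(1) a fin diff_VA[OF x elim(2)]]]
    show ?case by (simp add: distrib_right)
  qed
  then show ?thesis using C(2) by (intro that[of "1 + C"]) auto
qed

section \<open>Sums, linear operators, products and reciprocals of families\<close>

lemma Sm_add:
  "Sm r A p T \<Longrightarrow> Sm r A p S \<Longrightarrow> Sm r A p (\<lambda>x h t. T x h t + S x h t)"
proof (induction r arbitrary: A T S)
  case 0
  have "ct A p x (\<lambda>x h t. T x h t + S x h t)" if "x \<in> U" for x
    using sml_add[OF Sm_ct[OF 0(1) that, unfolded ct_def] Sm_ct[OF 0(2) that, unfolded ct_def]]
    by (simp add: ct_def algebra_simps)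
  then show ?case using mlin_add[OF Sm_mlin[OF 0(1)] Sm_mlin[OF 0(2)]] by simp
next
  case (Suc r)
  have base: "Sm 0 A p (\<lambda>x h t. T x h t + S x h t)"
  proof -
    have "ct A p x (\<lambda>x h t. T x h t + S x h t)" if "x \<in> U" for x
      using sml_add[OF Sm_ct[OF Suc.prems(1) that, unfolded ct_def] Sm_ct[OF Suc.prems(2) that, unfolded ct_def]]
      by (simp add: ct_def algebra_simps)
    then show ?thesis using mlin_add[OF Sm_mlin[OF Suc.prems(1)] Sm_mlin[OF Suc.prems(2)]] by simp
  qed
  show ?case
  proof (rule Sm_SucI[OF base])
    fix a assume a: "a \<notin> A"
    obtain T' where T': "Sm r (insert a A) p T'" "\<And>x. x \<in> U \<Longrightarrow> dr A p x T T' a"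
      using Sm_SucD[OF Suc.prems(1) a] by blast
    obtain S' where S': "Sm r (insert a A) p S'" "\<And>x. x \<in> U \<Longrightarrow> dr A p x S S' a"
      using Sm_SucD[OF Suc.prems(2) a] by blast
    have "dr A p x (\<lambda>x h t. T x h t + S x h t) (\<lambda>x h t. T' x h t + S' x h t) a" if "x \<in> U" for x
      using sml_add[OF T'(2)[OF that, unfolded dr_def] S'(2)[OF that, unfolded dr_def]]
      by (simp add: dr_def algebra_simps)
    with Suc.IH[OF T'(1) S'(1)] show "\<exists>T'. Sm r (insert a A) p T' \<and> (\<forall>x\<in>U. dr A p x (\<lambda>x h t. T x h t + S x h t) T' a)"
      by blast
  qed
qed

text \<open>A bounded linear operator maps a remainder to the remainder of the image and multiplies
  bounds by at most \<open>K\<close>, so it can be applied to all derivatives of the family.\<close>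

lemma Sm_lin_op:
  assumes L: "lin_op p q K L"
  shows "Sm r A p T \<Longrightarrow> Sm r A q (\<lambda>x h. L (T x h))"
proof (induction r arbitrary: A T)
  have base: "Sm 0 A q (\<lambda>x h. L (T x h))" if T: "Sm 0 A p T" for A T
  proof -
    have "ct A q x (\<lambda>x h. L (T x h))" if x: "x \<in> U" for x
      unfolding ct_def
    proof (rule sml_I[OF smlD[OF Sm_ct[OF T x, unfolded ct_def]], where K = K])
      show "eventually (\<lambda>y. \<forall>e>0. bnd A p (e * 1) (\<lambda>h t. T y h t - T x h t) \<longrightarrow>
          bnd A q (K * e * 1) (\<lambda>h t. L (T y h) t - L (T x h) t)) (nb x)"
        using eventually_nb_U
      proof (eventually_elim, intro allI impI)
        fix y e assume y: "y \<in> U" and e: "bnd A p (e * 1) (\<lambda>h t. T y h t - T x h t)"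
        show "bnd A q (K * e * 1) (\<lambda>h t. L (T y h) t - L (T x h) t)"
          unfolding bnd_def
        proof (intro allI impI)
          fix h assume h: "\<forall>i\<in>A. h i \<in> VA"
          have "Cb p (T z h)" if "z \<in> U" for z
            by (rule AP_Cb[OF mlin_AP[OF Sm_mlin[OF T that]]]) (use h in auto)
          then have "(\<lambda>t. L (T y h) t - L (T x h) t) = L (\<lambda>t. T y h t - T x h t)"
            using lin_op_diff[OF L] x y by metis
          then show "bd q (K * e * 1 * (\<Prod>i\<in>A. NA (h i))) (\<lambda>t. L (T y h) t - L (T x h) t)"
            using lin_op_bd[OF L bndD[OF e, of h]] h by (simp add: mult.assoc)
        qed
      qed
    qed simp_all
    then show ?thesis using mlin_lin_op[OF L Sm_mlin[OF T]] by simp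
  qed
  {
    case 0
    then show ?case by (rule base)
  next
    case (Suc r)
    show ?case
    proof (rule Sm_SucI[OF base[OF Sm_0[OF Suc.prems]]])
      fix a assume a: "a \<notin> A"
      obtain T' where T': "Sm r (insert a A) p T'" "\<And>x. x \<in> U \<Longrightarrow> dr A p x T T' a"
        using Sm_SucD[OF Suc.prems(1) a] by blast
      have "dr A q x (\<lambda>x h. L (T x h)) (\<lambda>x h. L (T' x h)) a" if x: "x \<in> U" for x
        unfolding dr_def
      proof (rule sml_I[OF smlD[OF T'(2)[OF x, unfolded dr_def]], where K = K])
        show "eventually (\<lambda>y. \<forall>e>0. bnd A p (e * NA (y - x)) (\<lambda>h t. T y h t - T x h t - T' x (h(a := y - x)) t) \<longrightarrow>
            bnd A q (K * e * NA (y - x)) (\<lambda>h t. L (T y h) t - L (T x h) t - L (T' x (h(a := y - x))) t)) (nb x)"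
          using eventually_nb_U
        proof (eventually_elim, intro allI impI)
          fix y e assume y: "y \<in> U" and e: "bnd A p (e * NA (y - x)) (\<lambda>h t. T y h t - T x h t - T' x (h(a := y - x)) t)"
          show "bnd A q (K * e * NA (y - x)) (\<lambda>h t. L (T y h) t - L (T x h) t - L (T' x (h(a := y - x))) t)"
            unfolding bnd_def
          proof (intro allI impI)
            fix h assume h: "\<forall>i\<in>A. h i \<in> VA"
            have C: "Cb p (T z h)" if "z \<in> U" for z
              by (rule AP_Cb[OF mlin_AP[OF Sm_mlin[OF Suc.prems that]]]) (use h in auto)
            have C': "Cb p (T' x (h(a := y - x)))"
              by (rule AP_Cb[OF mlin_AP[OF Sm_mlin[OF T'(1) x]]]) (use h diff_VA[OF x y] in auto)
            have "(\<lambda>t. L (T y h) t - L (T x h) t - L (T' x (h(a := y - x))) t) = L (\<lambda>t. T y h t - T x h t - T' x (h(a := y - x)) t)"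
              by (simp add: lin_op_diff[OF L Cb_diff[OF C[OF y] C[OF x]] C'] lin_op_diff[OF L C[OF y] C[OF x]])
            then show "bd q (K * e * NA (y - x) * (\<Prod>i\<in>A. NA (h i))) (\<lambda>t. L (T y h) t - L (T x h) t - L (T' x (h(a := y - x))) t)"
              using lin_op_bd[OF L bndD[OF e, of h]] h by (simp add: mult.assoc)
          qed
        qed
      qed (simp_all add: eventually_nb_NA[OF x])
      with Suc.IH[OF T'(1)] show "\<exists>T'. Sm r (insert a A) q T' \<and> (\<forall>x\<in>U. dr A q x (\<lambda>x h. L (T x h)) T' a)"
        by blast
    qed
  }
qed

lemmas Sm_embed = Sm_lin_op[OF lin_op_embed]
lemmas Sm_pd = Sm_lin_op[OF lin_op_pd]
lemmas Sm_cmult = Sm_lin_op[OF lin_op_cmult]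

lemma Sm_embed_le: "p \<le> q \<Longrightarrow> Sm r A q T \<Longrightarrow> Sm r A p T"
  by (induction q rule: dec_induct) (auto dest: Sm_embed simp del: Sm.simps)

lemma Sm_zero: "finite A \<Longrightarrow> Sm r A p (\<lambda>x h (t :: real^'n::finite). 0)"
proof (induction r arbitrary: A)
  case (Suc r)
  have "Sm r (insert a A) p (\<lambda>x h (t :: real^'n). 0)" for a by (rule Suc.IH) (use Suc.prems in simp)
  then show ?case using Suc.prems
    by (auto simp: ct_def dr_def mlin_zero intro!: sml_zero exI[of _ "\<lambda>x h t. 0"] eventually_nb_NA)
qed (auto simp: ct_def mlin_zero intro!: sml_zero)

lemma Sm_const: "mlin A p M \<Longrightarrow> Sm r A p (\<lambda>x. M)"
proof (cases r)
  case (Suc q)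
  assume M: "mlin A p M"
  have "Sm q (insert a A) p (\<lambda>x h t. 0)" for a by (rule Sm_zero) (use mlin_finite[OF M] in simp)
  then show ?thesis using M unfolding Suc
    by (auto simp: ct_def dr_def intro!: sml_zero exI[of _ "\<lambda>x h t. 0"] eventually_nb_NA)
qed (auto simp: ct_def intro!: sml_zero)

lemma Sm_sum: "(\<And>j. j \<in> S \<Longrightarrow> Sm r A p (T j)) \<Longrightarrow> finite A \<Longrightarrow> Sm r A p (\<lambda>x h t. \<Sum>j\<in>S. T j x h t)"
proof (induction S rule: infinite_finite_induct)
  case (insert j S)
  have "Sm r A p (\<lambda>x h t. T j x h t + (\<Sum>j\<in>S. T j x h t))"
    by (rule Sm_add[OF insert.prems(1) insert.IH[OF insert.prems]]) auto
  with insert.hyps show ?case by simp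
qed (simp_all add: Sm_zero del: Sm.simps)

lemma mlin_coord:
  assumes "\<And>v. v \<in> VA \<Longrightarrow> AP p (l v)" "\<And>v. v \<in> VA \<Longrightarrow> bd p (C * NA v) (l v)"
    "\<And>u v t. l (u + v) t = l u t + l v t" "\<And>c u t. l (c *\<^sub>R u) t = c * l u t"
  shows "mlin {a} p (\<lambda>h. l (h a))"
  by (rule mlin_I[where C = C]) (use assms in \<open>auto simp: bnd_def\<close>)

text \<open>A bounded linear map has a derivative independent of the point and a vanishing
  remainder. The coordinates of the source space enter the later constructions through this
  lemma.\<close>

lemma Sm_coord:
  fixes l :: "'a \<Rightarrow> real^'n::finite \<Rightarrow> real"
  assumes l: "\<And>v. v \<in> VA \<Longrightarrow> AP p (l v)" "\<And>v. v \<in> VA \<Longrightarrow> bd p (C * NA v) (l v)"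
    "\<And>u v t. l (u + v) t = l u t + l v t" "\<And>c u t. l (c *\<^sub>R u) t = c * l u t" and C: "C > 0"
  shows "Sm r {} p (\<lambda>x h. l x)"
proof -
  have diff: "l (y - x) = (\<lambda>t. l y t - l x t)" for x y
    using l(3)[of "y - x" x] by (simp add: fun_eq_iff)
  have base: "Sm 0 {} p (\<lambda>x h. l x)"
    unfolding Sm.simps
  proof (intro ballI conjI)
    fix x assume x: "x \<in> U"
    then have xV: "x \<in> VA" using U by blast
    show "mlin {} p (\<lambda>h. l x)"
      by (rule mlin_I[where C = "C * NA x"]) (use l xV in \<open>auto simp: bnd_def\<close>)
    show "ct {} p x (\<lambda>x h. l x)"
      unfolding ct_def
    proof (rule sml_I[where K = C and P = "\<lambda>e y. NA (y - x) < e"])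
      show "eventually (\<lambda>y. \<forall>e>0. NA (y - x) < e \<longrightarrow> bnd {} p (C * e * 1) (\<lambda>h t. l y t - l x t)) (nb x)"
        using eventually_nb_U
      proof (eventually_elim, intro allI impI)
        fix y e assume y: "y \<in> U" and e: "0 < e" "NA (y - x) < e"
        have b: "bd p (C * NA (y - x)) (\<lambda>t. l y t - l x t)"
          using l(2)[OF diff_VA[OF x y]] by (simp only: diff)
        show "bnd {} p (C * e * 1) (\<lambda>h t. l y t - l x t)"
          unfolding bnd_empty by (rule bd_mono[OF b]) (use C e in simp)
      qed
    qed (auto simp: eventually_nb)
  qed
  have "\<exists>T'. Sm q {a} p T' \<and> (\<forall>x\<in>U. dr {} p x (\<lambda>x h. l x) T' a)" for q a
  proof (intro exI[of _ "\<lambda>x h. l (h a)"] conjI ballI)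
    show "Sm q {a} p (\<lambda>x h. l (h a))" by (rule Sm_const[OF mlin_coord[OF l]])
    show "dr {} p x (\<lambda>x h. l x) (\<lambda>x h. l (h a)) a" if "x \<in> U" for x
      using sml_zero[OF eventually_nb_NA[OF that]] by (simp add: dr_def diff)
  qed
  with base show ?thesis by (cases r) auto
qed

text \<open>Leibniz' rule; disjoint slots make the product multilinear, and each of the two terms of
  the derivative has the new slot in one factor only.\<close>

lemma Sm_mult:
  fixes T S :: "'a \<Rightarrow> (nat \<Rightarrow> 'a) \<Rightarrow> real^'n::finite \<Rightarrow> real"
  shows "Sm r A p T \<Longrightarrow> Sm r B p S \<Longrightarrow> A \<inter> B = {} \<Longrightarrow> Sm r (A \<union> B) p (\<lambda>x h t. T x h t * S x h t)"
proof (induction r arbitrary: A B T S)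
  have base: "Sm 0 (A \<union> B) p (\<lambda>x h t. T x h t * S x h t)"
    if T: "Sm 0 A p T" and S: "Sm 0 B p S" and AB: "A \<inter> B = {}"
    for A B and T S :: "'a \<Rightarrow> (nat \<Rightarrow> 'a) \<Rightarrow> real^'n::finite \<Rightarrow> real"
  proof -
    have "ct (A \<union> B) p x (\<lambda>x h t. T x h t * S x h t)" if x: "x \<in> U" for x
    proof -
      let ?DT = "\<lambda>y h t. T y h t - T x h t" and ?DS = "\<lambda>y h t. S y h t - S x h t"
      note fin = mlin_finite[OF Sm_mlin[OF T x]] mlin_finite[OF Sm_mlin[OF S x]]
      have BA: "B \<inter> A = {}" using AB by blast
      obtain C where C: "bnd A p C (T x)" using mlin_bnd[OF Sm_mlin[OF T x]] by blast
      obtain C' where C': "bnd B p C' (S x)" using mlin_bnd[OF Sm_mlin[OF S x]] by blast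
      note cT = Sm_ct[OF T x, unfolded ct_def] and cS = Sm_ct[OF S x, unfolded ct_def]
      have "sml (\<lambda>y. 1 * 1) (A \<union> B) p (nb x) (\<lambda>y h t. ?DT y h t * S x h t)"
        by (rule sml_mult_left[OF cT _ fin AB, where C = C']) (simp_all add: C')
      moreover have "sml (\<lambda>y. 1 * 1) (B \<union> A) p (nb x) (\<lambda>y h t. ?DS y h t * T x h t)"
        by (rule sml_mult_left[OF cS _ fin(2,1) BA, where C = C]) (simp_all add: C)
      moreover have "sml (\<lambda>y. 1 * 1) (A \<union> B) p (nb x) (\<lambda>y h t. ?DT y h t * ?DS y h t)"
        by (rule sml_mult_left[OF cT smlD[OF cS zero_less_one] fin AB]) simp
      ultimately have "sml (\<lambda>y. 1 * 1) (A \<union> B) p (nb x)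
          (\<lambda>y h t. (?DT y h t * S x h t + ?DS y h t * T x h t) + ?DT y h t * ?DS y h t)"
        unfolding Un_commute[of B A] by (intro sml_add)
      then show ?thesis by (simp add: ct_def algebra_simps)
    qed
    then show ?thesis using mlin_mult[OF Sm_mlin[OF T] Sm_mlin[OF S] AB] by simp
  qed
  {
    case 0
    then show ?case by (rule base)
  next
    case (Suc r)
    note T = Suc.prems(1) and S = Suc.prems(2) and AB = Suc.prems(3)
    show ?case
    proof (rule Sm_SucI[OF base[OF Sm_0[OF T] Sm_0[OF S] AB]])
      fix a assume a: "a \<notin> A \<union> B"
      then have aA: "a \<notin> A" and aB: "a \<notin> B" by auto
      have BA: "B \<inter> A = {}" using AB by blast
      obtain T' where T': "Sm r (insert a A) p T'" "\<And>x. x \<in> U \<Longrightarrow> dr A p x T T' a"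
        using Sm_SucD[OF T aA] by blast
      obtain S' where S': "Sm r (insert a B) p S'" "\<And>x. x \<in> U \<Longrightarrow> dr B p x S S' a"
        using Sm_SucD[OF S aB] by blast
      let ?P = "\<lambda>x h t. T' x h t * S x h t + T x h t * S' x h t"
      have "Sm r (insert a A \<union> B) p (\<lambda>x h t. T' x h t * S x h t)"
        by (rule Suc.IH[OF T'(1) Sm_mono[OF S]]) (use AB aB in auto)
      moreover have "Sm r (A \<union> insert a B) p (\<lambda>x h t. T x h t * S' x h t)"
        by (rule Suc.IH[OF Sm_mono[OF T] S'(1)]) (use AB aA in auto)
      ultimately have P: "Sm r (insert a (A \<union> B)) p ?P" unfolding Un_insert_left Un_insert_right by (rule Sm_add)
      have "dr (A \<union> B) p x (\<lambda>x h t. T x h t * S x h t) ?P a" if x: "x \<in> U" for x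
      proof -
        let ?DT = "\<lambda>y h t. T y h t - T x h t" and ?DS = "\<lambda>y h t. S y h t - S x h t"
        let ?RT = "\<lambda>y h t. T y h t - T x h t - T' x (h(a := y - x)) t"
          and ?RS = "\<lambda>y h t. S y h t - S x h t - S' x (h(a := y - x)) t"
        note fin = mlin_finite[OF Sm_mlin[OF T x]] mlin_finite[OF Sm_mlin[OF S x]]
        obtain C where C: "bnd A p C (T x)" using mlin_bnd[OF Sm_mlin[OF T x]] by blast
        obtain C' where C': "bnd B p C' (S x)" using mlin_bnd[OF Sm_mlin[OF S x]] by blast
        obtain C'' where C'': "C'' > 0" "eventually (\<lambda>y. bnd A p (C'' * NA (y - x)) (?DT y)) (nb x)"
          using dr_O[OF Sm_mlin[OF T'(1) x] T'(2)[OF x] aA x] by blast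
        note rT = T'(2)[OF x, unfolded dr_def] and rS = S'(2)[OF x, unfolded dr_def] and cS = Sm_ct[OF S x, unfolded ct_def]
        note w = eventually_nb_NA[OF x]
        have "sml (\<lambda>y. NA (y - x) * 1) (A \<union> B) p (nb x) (\<lambda>y h t. ?RT y h t * S x h t)"
          by (rule sml_mult_left[OF rT _ fin AB, where C = C']) (simp_all add: C' w)
        moreover have "sml (\<lambda>y. NA (y - x) * 1) (B \<union> A) p (nb x) (\<lambda>y h t. ?RS y h t * T x h t)"
          by (rule sml_mult_left[OF rS _ fin(2,1) BA, where C = C]) (simp_all add: C w)
        moreover have "sml (\<lambda>y. 1 * NA (y - x)) (B \<union> A) p (nb x) (\<lambda>y h t. ?DS y h t * ?DT y h t)"
          by (rule sml_mult_left[OF cS C''(2) fin(2,1) BA]) (simp add: w)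
        \<comment> \<open>The remainder of the product: each remainder times the other factor at
          \<open>x\<close>, plus the product of the increments, of which one tends to 0 and the
          other is bounded by a multiple of \<open>NA (y - x)\<close>.\<close>
        ultimately have s: "sml (\<lambda>y. NA (y - x)) (A \<union> B) p (nb x)
            (\<lambda>y h t. (?RT y h t * S x h t + ?RS y h t * T x h t) + ?DS y h t * ?DT y h t)"
          unfolding Un_commute[of B A] mult_1_right mult_1_left by (intro sml_add)
        have uT: "T x (h(a := y - x)) = T x h" and uS: "S x (h(a := y - x)) = S x h" for y h
          by (rule mlin_upd[OF Sm_mlin[OF T x] aA] mlin_upd[OF Sm_mlin[OF S x] aB])+
        show ?thesis
          using s unfolding dr_def uT uS by (simp add: algebra_simps)
      qed
      with P show "\<exists>T'. Sm r (insert a (A \<union> B)) p T' \<and> (\<forall>x\<in>U. dr (A \<union> B) p x (\<lambda>x h t. T x h t * S x h t) T' a)"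
        by blast
    qed
  }
qed

lemma mlin_empty: "mlin {} p (\<lambda>h. f) \<longleftrightarrow> AP p f"
proof
  show "mlin {} p (\<lambda>h. f) \<Longrightarrow> AP p f" by (simp add: mlin_def)
  assume f: "AP p f"
  obtain c where "bd p c f" using AP_Cb[OF f] by (auto simp: Cb_def)
  then show "mlin {} p (\<lambda>h. f)" by (intro mlin_I[where C = c]) (auto simp: f bnd_empty)
qed

lemma ct_empty: "ct {} p x (\<lambda>x h. T x) \<longleftrightarrow> cv p T (T x) (nb x)"
  by (simp add: ct_def sml_def cv_def small_def bnd_empty)

lemma Sm0_empty: "Sm 0 {} p (\<lambda>x h. T x) \<longleftrightarrow> (\<forall>x\<in>U. AP p (T x) \<and> cv p T (T x) (nb x))"
  by (simp add: mlin_empty ct_empty)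

text \<open>The derivative $-T'/T^2$ contains the reciprocal itself, which with one order of
  smoothness less is covered by the induction hypothesis.\<close>

lemma Sm_recip:
  fixes T :: "'a \<Rightarrow> real^'n::finite \<Rightarrow> real"
  shows "Sm r {} p (\<lambda>x h. T x) \<Longrightarrow> (\<And>x. x \<in> U \<Longrightarrow> \<exists>\<delta>>0. \<forall>t. \<delta> \<le> T x t) \<Longrightarrow> Sm r {} p (\<lambda>x h t. 1 / T x t)"
proof (induction r)
  have base: "Sm 0 {} p (\<lambda>x h t. 1 / T x t)"
    if T: "Sm 0 {} p (\<lambda>x h. T x)" and pos: "\<And>x. x \<in> U \<Longrightarrow> \<exists>\<delta>>0. \<forall>t. \<delta> \<le> T x t"
    unfolding Sm0_empty
  proof (intro ballI conjI)
    fix x assume x: "x \<in> U"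
    obtain \<delta> where \<delta>: "\<delta> > 0" "\<And>t. \<delta> \<le> T x t" using pos[OF x] by blast
    have apT: "AP p (T x)" and cvT: "cv p T (T x) (nb x)" using T[unfolded Sm0_empty] x by auto
    show "AP p (\<lambda>t. 1 / T x t)" by (rule AP_recip[OF apT \<delta>])
    have "eventually (\<lambda>y. bd p (\<delta> / 2) (\<lambda>t. T y t - T x t)) (nb x)"
      using smallD[OF cvT[unfolded cv_def], of "\<delta> / 2"] \<delta>(1) by simp
    then have "eventually (\<lambda>y. \<forall>t. \<delta> / 2 \<le> T y t) (nb x)"
    proof (eventually_elim, intro allI)
      fix y t assume "bd p (\<delta> / 2) (\<lambda>t. T y t - T x t)"
      from bd_abs[OF this, of t] \<delta>(2)[of t] show "\<delta> / 2 \<le> T y t" by linarith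
    qed
    moreover have "\<delta> / 2 \<le> T x t" for t using \<delta>(1) \<delta>(2)[of t] by linarith
    ultimately show "cv p (\<lambda>x t. 1 / T x t) (\<lambda>t. 1 / T x t) (nb x)"
      by (intro cv_recip[OF cvT AP_Cb[OF apT], of "\<delta> / 2"]) (use \<delta>(1) in auto)
  qed
  {
    case 0
    then show ?case by (rule base)
  next
    case (Suc r)
    note T = Suc.prems(1) and pos = Suc.prems(2)
    have q: "Sm r {} p (\<lambda>x h t. 1 / T x t)" by (rule Suc.IH[OF Sm_mono[OF T] pos])
    have q0: "Sm 0 {} p (\<lambda>x h t. 1 / T x t)" by (rule base[OF Sm_0[OF T] pos])
    show ?case
    proof (rule Sm_SucI[OF q0])
      fix a :: nat
      obtain T' where T': "Sm r {a} p T'" "\<And>x. x \<in> U \<Longrightarrow> dr {} p x (\<lambda>x h. T x) T' a"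
        using Sm_SucD[OF T, of a] by blast
      let ?P = "\<lambda>x h t. (-1) * (((1 / T x t) * (1 / T x t)) * T' x h t)"
      have P: "Sm r {a} p ?P"
        using Sm_cmult[OF Sm_mult[OF Sm_mult[OF q q] T'(1)], of "-1"] by simp
      have "dr {} p x (\<lambda>x h t. 1 / T x t) ?P a" if x: "x \<in> U" for x
      proof -
        let ?R = "\<lambda>y h t. T y t - T x t - T' x (h(a := y - x)) t"
        let ?q = "\<lambda>x h t. 1 / T x t"
        note w = eventually_nb_NA[OF x]
        obtain C where C: "C > 0" "eventually (\<lambda>y. bnd {} p (C * NA (y - x)) (\<lambda>h t. T y t - T x t)) (nb x)"
          using dr_O[OF Sm_mlin[OF T'(1) x] T'(2)[OF x] _ x] by blast
        obtain c where c: "bnd {} p c (?q x)" using mlin_bnd[OF Sm_mlin[OF q0 x]] by blast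
        have evq: "eventually (\<lambda>y. bnd {} p (c + 1 * 1) (?q y)) (nb x)"
          using smlD[OF Sm_ct[OF q0 x, unfolded ct_def] zero_less_one]
        proof eventually_elim
          case (elim y)
          from bnd_add[OF c elim] show ?case by simp
        qed
        have "bnd ({} \<union> {}) p (Kmul TYPE('n) p * c * c) (\<lambda>h t. ?q x h t * ?q x h t)"
          by (rule bnd_mult[OF c c]) auto
        then have c2: "bnd {} p (Kmul TYPE('n) p * c * c) (\<lambda>h t. ?q x h t * ?q x h t)" by simp
        have "bnd {} p (Kmul TYPE('n) p * c * c) (\<lambda>h t. - (?q x h t * ?q x h t))"
          using c2[unfolded bnd_empty] unfolding bnd_empty by (rule bd_minus)
        then have "sml (\<lambda>y. NA (y - x) * 1) ({} \<union> {}) p (nb x) (\<lambda>y h t. ?R y h t * - (?q x h t * ?q x h t))"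
          by (intro sml_mult_left[OF T'(2)[OF x, unfolded dr_def], where C = "Kmul TYPE('n) p * c * c"]) (auto simp: w)
        then have s1: "sml (\<lambda>y. NA (y - x)) {} p (nb x) (\<lambda>y h t. ?R y h t * - (?q x h t * ?q x h t))" by simp
        define K where "K = Kmul TYPE('n) p * (Kmul TYPE('n) p * (Kmul TYPE('n) p * c * c) * (c + 1)) * C"
        have "eventually (\<lambda>y. bnd {} p (K * NA (y - x)) (\<lambda>h t. ?q x h t * ?q x h t * ?q y h t * (T y t - T x t))) (nb x)"
          using evq C(2)
        proof eventually_elim
          case (elim y)
          have "bnd ({} \<union> {} \<union> {}) p (Kmul TYPE('n) p * (Kmul TYPE('n) p * (Kmul TYPE('n) p * c * c) * (c + 1 * 1)) * (C * NA (y - x)))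
             (\<lambda>h t. ?q x h t * ?q x h t * ?q y h t * (T y t - T x t))"
            by (intro bnd_mult[OF bnd_mult[OF c2 elim(1)] elim(2)]) auto
          then show ?case by (simp add: K_def mult.assoc)
        qed
        from sml_mult_left[OF Sm_ct[OF T x, unfolded ct_def] this]
        have "sml (\<lambda>y. 1 * NA (y - x)) ({} \<union> {}) p (nb x)
            (\<lambda>y h t. (T y t - T x t) * (?q x h t * ?q x h t * ?q y h t * (T y t - T x t)))" by (simp add: w)
        then have s2: "sml (\<lambda>y. NA (y - x)) {} p (nb x)
            (\<lambda>y h t. (T y t - T x t) * (?q x h t * ?q x h t * ?q y h t * (T y t - T x t)))" by simp
        have nz: "T y t \<noteq> 0" if "y \<in> U" for y t using pos[OF that] by (metis not_le)
        \<comment> \<open>The remainder of the reciprocal equals $-R/T_x^2 + (T_y - T_x)^2/(T_x^2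
          T_y)$ with $R$ the remainder of $T$; in the second term one increment tends to 0 and the
          other is bounded by a multiple of \<open>NA (y - x)\<close>.\<close>
        have eq: "(\<lambda>h t. ?R y h t * - (?q x h t * ?q x h t) + (T y t - T x t) * (?q x h t * ?q x h t * ?q y h t * (T y t - T x t)))
           = (\<lambda>h t. 1 / T y t - 1 / T x t - ?P x (h(a := y - x)) t)" if y: "y \<in> U" for y
        proof (intro ext)
          fix h t
          have "T y t \<noteq> 0" "T x t \<noteq> 0" using nz x y by auto
          then show "?R y h t * - (?q x h t * ?q x h t) + (T y t - T x t) * (?q x h t * ?q x h t * ?q y h t * (T y t - T x t))
             = 1 / T y t - 1 / T x t - ?P x (h(a := y - x)) t"
            by (simp add: field_simps)
        qed
        show ?thesis
          unfolding dr_def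
        proof (rule sml_I[OF smlD[OF sml_add[OF s1 s2]] _ w, where K = 1])
          show "eventually (\<lambda>y. \<forall>e>0. bnd {} p (e * NA (y - x))
              (\<lambda>h t. ?R y h t * - (?q x h t * ?q x h t) + (T y t - T x t) * (?q x h t * ?q x h t * ?q y h t * (T y t - T x t))) \<longrightarrow>
              bnd {} p (1 * e * NA (y - x)) (\<lambda>h t. 1 / T y t - 1 / T x t - ?P x (h(a := y - x)) t)) (nb x)"
            using eventually_nb_U by eventually_elim (simp only: eq mult_1_left, blast)
        qed simp
      qed
      with P show "\<exists>T'. Sm r {a} p T' \<and> (\<forall>x\<in>U. dr {} p x (\<lambda>x h t. 1 / T x t) T' a)" by blast
    qed
  }
qed

text \<open>Finiteness of the slot set is read off at a point of \<open>U\<close>, so an empty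
  domain has to be treated apart.\<close>

lemma Sm_trivial:
  assumes "\<And>x. x \<notin> U"
  shows "Sm r A p T"
  by (induction r arbitrary: A T) (simp_all add: Ball_def assms)

section \<open>Composition of families with moving inner maps\<close>

lemma mlin_comp:
  fixes g :: "'n::finite \<Rightarrow> real^'n \<Rightarrow> real"
  assumes M: "mlin A p M" and g: "\<And>j. AP p (g j)" and p: "1 \<le> p"
  shows "mlin A p (\<lambda>h t. M h (shift g t))"
proof -
  obtain C where C: "bnd A p C M" using mlin_bnd[OF M] by blast
  obtain c where c: "\<forall>j. bd p c (g j)" using Cb_family[of p g, OF AP_Cb[OF g]] by blast
  show ?thesis
  proof (rule mlin_I[OF mlin_finite[OF M] _ _ _ _ bnd_transfer[OF C bd_compI[OF _ bd_lip_shift[OF c p]]]])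
    show "(\<lambda>t. M h (shift g t)) = (\<lambda>t. M h' (shift g t))" if "\<And>i. i \<in> A \<Longrightarrow> h i = h' i" for h h'
      using mlin_dep[OF M that] by simp
    show "AP p (\<lambda>t. M h (shift g t))" if "\<And>i. i \<in> A \<Longrightarrow> h i \<in> VA" for h
      by (rule AP_comp[OF mlin_AP[OF M that] g order_refl p])
    show "M (h(i := u + v)) (shift g t) = M (h(i := u)) (shift g t) + M (h(i := v)) (shift g t)"
      if "i \<in> A" "\<And>j. j \<in> A \<Longrightarrow> h j \<in> VA" "u \<in> VA" "v \<in> VA" for h i u v t
      by (rule mlin_add_slot[OF M that])
    show "M (h(i := c *\<^sub>R u)) (shift g t) = c * M (h(i := u)) (shift g t)"
      if "i \<in> A" "\<And>j. j \<in> A \<Longrightarrow> h j \<in> VA" "u \<in> VA" for h i u c t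
      by (rule mlin_scale_slot[OF M that])
  qed
qed

lemma inner_bounds:
  fixes g :: "'n::finite \<Rightarrow> 'a \<Rightarrow> real^'n \<Rightarrow> real"
  assumes g: "\<And>j. Sm 0 {} p (\<lambda>x h. g j x)" and p: "1 \<le> p" and x: "x \<in> U"
  obtains R where "\<forall>j. bd p R (g j x)" "lip R (shift (\<lambda>j. g j x))"
    "eventually (\<lambda>y. (\<forall>j. bd p R (g j y)) \<and> lip R (shift (\<lambda>j. g j y))) (nb x)"
proof -
  have ap: "AP p (g j x)" and cvg: "cv p (g j) (g j x) (nb x)" for j
    using g[unfolded Sm0_empty] x by auto
  obtain c where c: "\<forall>j. bd p c (g j x)" using Cb_family[of p "\<lambda>j. g j x", OF AP_Cb[OF ap]] by blast
  have c1: "\<forall>j. bd p (c + 1) (g j x)" using c by (blast intro: bd_mono[of p c _ "c + 1"] less_imp_le less_add_one)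
  have "eventually (\<lambda>y. \<forall>j. bd p (c + 1) (g j y)) (nb x)"
    by (intro eventually_all_finite cv_bounded[OF cvg c[rule_format]])
  then have "eventually (\<lambda>y. (\<forall>j. bd p (1 + real CARD('n) * (real CARD('n) * (c + 1))) (g j y)) \<and>
      lip (1 + real CARD('n) * (real CARD('n) * (c + 1))) (shift (\<lambda>j. g j y))) (nb x)"
    by eventually_elim (rule conjI, erule bd_lip_shift(1)[OF _ p], erule bd_lip_shift(2)[OF _ p])
  with bd_lip_shift[OF c1 p] show ?thesis by (rule that)
qed

text \<open>Without slots there is one outer function, and approximation by a smooth one suffices.
  With slots no single approximation serves all arguments, so the Lipschitz estimate is used
  instead, whose bound is linear in that of \<open>M h\<close>.\<close>

lemma inner_ct:
  fixes g :: "'n::finite \<Rightarrow> 'a \<Rightarrow> real^'n \<Rightarrow> real"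
  assumes M: "mlin A (p + (if A = {} then 0 else 1)) M"
    and g: "\<And>j. Sm 0 {} p (\<lambda>x h. g j x)" and p: "1 \<le> p" and x: "x \<in> U"
  shows "sml (\<lambda>y. 1) A p (nb x) (\<lambda>y h t. M h (shift (\<lambda>j. g j y) t) - M h (shift (\<lambda>j. g j x) t))"
proof -
  obtain R where R: "\<forall>j. bd p R (g j x)" "lip R (shift (\<lambda>j. g j x))"
    and evR: "eventually (\<lambda>y. (\<forall>j. bd p R (g j y)) \<and> lip R (shift (\<lambda>j. g j y))) (nb x)"
    using inner_bounds[where g = g, OF g p x] by blast
  have cvg: "cv p (g j) (g j x) (nb x)" for j using g[unfolded Sm0_empty] x by auto
  have evd: "eventually (\<lambda>y. \<forall>j. bd p e (\<lambda>t. g j y t - g j x t)) (nb x)" if "e > 0" for e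
    by (intro eventually_all_finite smallD[OF cvg[unfolded cv_def] that])
  show ?thesis
  proof (cases "A = {}")
    case True
    have F: "AP p (M h)" for h using mlin_AP[OF M] True by simp
    \<comment> \<open>With no slots \<open>M\<close> ignores its argument, so the zero family stands
      for all of them in the choice of \<open>d\<close>.\<close>
    have dep: "M h = M h'" for h h' using mlin_dep[OF M] True by blast
    show ?thesis
      unfolding sml_def
    proof (intro allI impI)
      fix e :: real assume e: "e > 0"
      obtain d where d: "d > 0" and dP: "\<forall>(g::'n \<Rightarrow> real^'n \<Rightarrow> real) g'. (\<forall>j. bd p R (g j)) \<longrightarrow> (\<forall>j. bd p R (g' j)) \<longrightarrow> lip R (shift g) \<longrightarrow>
        lip R (shift g') \<longrightarrow> (\<forall>j. bd p d (\<lambda>x. g' j x - g j x)) \<longrightarrow>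
        bd p e (\<lambda>x. M (\<lambda>_. 0) (shift g' x) - M (\<lambda>_. 0) (shift g x))"
        using approx_comp[OF AP_approx[OF F[of "\<lambda>_. 0"]] e, of R] by blast
      show "eventually (\<lambda>y. bnd A p (e * 1) (\<lambda>h t. M h (shift (\<lambda>j. g j y) t) - M h (shift (\<lambda>j. g j x) t))) (nb x)"
        using evR evd[OF d]
      proof eventually_elim
        case (elim y)
        have b: "bd p e (\<lambda>t. M (\<lambda>_. 0) (shift (\<lambda>j. g j y) t) - M (\<lambda>_. 0) (shift (\<lambda>j. g j x) t))"
          by (rule dP[rule_format]) (use R elim in auto)
        show ?case
          unfolding bnd_def True
        proof (intro allI impI)
          fix h
          show "bd p (e * 1 * (\<Prod>i\<in>{}. NA (h i))) (\<lambda>t. M h (shift (\<lambda>j. g j y) t) - M h (shift (\<lambda>j. g j x) t))"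
            unfolding dep[of h "\<lambda>_. 0"] using b by simp
        qed
      qed
    qed
  next
    case False
    then obtain C where C: "bnd A (Suc p) C M" using mlin_bnd[OF M] by auto
    show ?thesis
    proof (rule sml_I[OF evd, where K = "Kdiff TYPE('n) p R * C"])
      show "eventually (\<lambda>y. \<forall>e>0. (\<forall>j. bd p e (\<lambda>t. g j y t - g j x t)) \<longrightarrow>
          bnd A p (Kdiff TYPE('n) p R * C * e * 1) (\<lambda>h t. M h (shift (\<lambda>j. g j y) t) - M h (shift (\<lambda>j. g j x) t))) (nb x)"
        using evR
      proof (eventually_elim, intro allI impI)
        fix y and e :: real assume y: "(\<forall>j. bd p R (g j y)) \<and> lip R (shift (\<lambda>j. g j y))" and e: "e > 0"
          and d: "\<forall>j. bd p e (\<lambda>t. g j y t - g j x t)"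
        show "bnd A p (Kdiff TYPE('n) p R * C * e * 1) (\<lambda>h t. M h (shift (\<lambda>j. g j y) t) - M h (shift (\<lambda>j. g j x) t))"
          unfolding bnd_def
        proof (intro allI impI)
          fix h assume "\<forall>i\<in>A. h i \<in> VA"
          then have "bd (Suc p) (C * (\<Prod>i\<in>A. NA (h i))) (M h)" using bndD[OF C] by blast
          from bd_comp_diff[OF this R(1) _ R(2) _ d] y
          show "bd p (Kdiff TYPE('n) p R * C * e * 1 * (\<Prod>i\<in>A. NA (h i)))
             (\<lambda>t. M h (shift (\<lambda>j. g j y) t) - M h (shift (\<lambda>j. g j x) t))"
            by (simp add: mult_ac)
        qed
      qed
    qed simp_all
  qed
qed

text \<open>The same case distinction for the first-order remainder. The hypothesis on
  \<open>g\<close> bounds its increment by a multiple of \<open>NA (y - x)\<close>; the composition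
  remainder is little-o of that increment in the first case and quadratic in it in the
  second.\<close>

lemma inner_rem:
  fixes g :: "'n::finite \<Rightarrow> 'a \<Rightarrow> real^'n \<Rightarrow> real"
  assumes M: "mlin A (Suc p + (if A = {} then 0 else 1)) M"
    and g: "\<And>j. Sm 0 {} p (\<lambda>x h. g j x)" and p: "1 \<le> p" and x: "x \<in> U"
    and O: "\<And>j. \<exists>C>0. eventually (\<lambda>y. bd p (C * NA (y - x)) (\<lambda>t. g j y t - g j x t)) (nb x)"
  shows "sml (\<lambda>y. NA (y - x)) A p (nb x) (\<lambda>y h. comp_rem (M h) (\<lambda>j. g j x) (\<lambda>j. g j y))"
proof -
  obtain R where R: "\<forall>j. bd p R (g j x)" "lip R (shift (\<lambda>j. g j x))"
    and evR: "eventually (\<lambda>y. (\<forall>j. bd p R (g j y)) \<and> lip R (shift (\<lambda>j. g j y))) (nb x)"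
    using inner_bounds[where g = g, OF g p x] by blast
  have "\<forall>j. \<exists>C. C > 0 \<and> eventually (\<lambda>y. bd p (C * NA (y - x)) (\<lambda>t. g j y t - g j x t)) (nb x)"
    by (intro allI O)
  from choice[OF this] obtain C
    where C0: "\<forall>j. C j > 0 \<and> eventually (\<lambda>y. bd p (C j * NA (y - x)) (\<lambda>t. g j y t - g j x t)) (nb x)" ..
  note C = C0[rule_format, THEN conjunct1] C0[rule_format, THEN conjunct2]
  define L where "L = Max (range C)"
  have CL: "C j \<le> L" for j by (simp add: L_def)
  then have L: "L > 0" using C(1) less_le_trans by blast
  have evL: "eventually (\<lambda>y. \<forall>j. bd p (L * NA (y - x)) (\<lambda>t. g j y t - g j x t)) (nb x)"
  proof (intro eventually_all_finite)
    fix j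
    show "eventually (\<lambda>y. bd p (L * NA (y - x)) (\<lambda>t. g j y t - g j x t)) (nb x)"
      using C(2)[of j] eventually_nb_NA[OF x]
      by eventually_elim (rule bd_mono, assumption, rule mult_right_mono[OF CL])
  qed
  have evs: "eventually (\<lambda>y. L * NA (y - x) \<le> \<delta>) (nb x)" if "\<delta> > 0" for \<delta>
    unfolding eventually_nb
    by (rule exI[of _ "\<delta> / L"]) (use that L in \<open>auto simp: field_simps less_imp_le\<close>)
  show ?thesis
  proof (cases "A = {}")
    case True
    have F: "AP (Suc p) (M h)" for h using mlin_AP[OF M] True by simp
    have dep: "M h = M h'" for h h' using mlin_dep[OF M] True by blast
    show ?thesis
      unfolding sml_def
    proof (intro allI impI)
      fix e :: real assume e: "e > 0"
      then have eL: "e / L > 0" using L by simp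
      obtain d where d: "d > 0" and dP: "\<forall>(g::'n \<Rightarrow> real^'n \<Rightarrow> real) g' \<delta>. (\<forall>j. bd p R (g j)) \<longrightarrow> (\<forall>j. bd p R (g' j)) \<longrightarrow> lip R (shift g) \<longrightarrow>
        lip R (shift g') \<longrightarrow> (\<forall>j. bd p \<delta> (\<lambda>x. g' j x - g j x)) \<longrightarrow> \<delta> \<le> d \<longrightarrow>
        bd p (e / L * \<delta>) (comp_rem (M (\<lambda>_. 0)) g g')"
        using approx_comp_rem[OF AP_approx[OF F[of "\<lambda>_. 0"]] AP_Cb[OF F[of "\<lambda>_. 0"]] eL, of R] by blast
      show "eventually (\<lambda>y. bnd A p (e * NA (y - x)) (\<lambda>h. comp_rem (M h) (\<lambda>j. g j x) (\<lambda>j. g j y))) (nb x)"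
        using evR evL evs[OF d]
      proof eventually_elim
        case (elim y)
        have "bd p (e / L * (L * NA (y - x))) (comp_rem (M (\<lambda>_. 0)) (\<lambda>j. g j x) (\<lambda>j. g j y))"
          by (rule dP[rule_format]) (use R elim in auto)
        then have b: "bd p (e * NA (y - x)) (comp_rem (M (\<lambda>_. 0)) (\<lambda>j. g j x) (\<lambda>j. g j y))" using L by simp
        show ?case
          unfolding bnd_def True
        proof (intro allI impI)
          fix h
          show "bd p (e * NA (y - x) * (\<Prod>i\<in>{}. NA (h i))) (comp_rem (M h) (\<lambda>j. g j x) (\<lambda>j. g j y))"
            unfolding dep[of h "\<lambda>_. 0"] using b by simp
        qed
      qed
    qed
  next
    case False
    then obtain c where c: "bnd A (Suc (Suc p)) c M" using mlin_bnd[OF M] by auto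
    show ?thesis
    proof (rule sml_I[OF evs, where K = "Krem TYPE('n) p R * c * L"])
      show "eventually (\<lambda>y. \<forall>e>0. L * NA (y - x) \<le> e \<longrightarrow>
          bnd A p (Krem TYPE('n) p R * c * L * e * NA (y - x)) (\<lambda>h. comp_rem (M h) (\<lambda>j. g j x) (\<lambda>j. g j y))) (nb x)"
        using evR evL eventually_nb_NA[OF x]
      proof (eventually_elim, intro allI impI)
        fix y and e :: real assume y: "(\<forall>j. bd p R (g j y)) \<and> lip R (shift (\<lambda>j. g j y))" and e: "e > 0"
          and d: "\<forall>j. bd p (L * NA (y - x)) (\<lambda>t. g j y t - g j x t)" and le: "L * NA (y - x) \<le> e" and nn: "0 \<le> NA (y - x)"
        show "bnd A p (Krem TYPE('n) p R * c * L * e * NA (y - x)) (\<lambda>h. comp_rem (M h) (\<lambda>j. g j x) (\<lambda>j. g j y))"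
          unfolding bnd_def
        proof (intro allI impI)
          fix h assume "\<forall>i\<in>A. h i \<in> VA"
          then have b: "bd (Suc (Suc p)) (c * (\<Prod>i\<in>A. NA (h i))) (M h)" using bndD[OF c] by blast
          let ?c = "c * (\<Prod>i\<in>A. NA (h i))" and ?K = "Krem TYPE('n) p R"
          have "bd p (?K * ?c * (L * NA (y - x)) * (L * NA (y - x))) (comp_rem (M h) (\<lambda>j. g j x) (\<lambda>j. g j y))"
            by (rule bd_comp_rem[OF b R(1) _ R(2) _ d]) (use y in auto)
          moreover have "?K * ?c * (L * NA (y - x)) * (L * NA (y - x)) \<le> ?K * ?c * (L * NA (y - x)) * e"
            by (rule mult_left_mono[OF le mult_nonneg_nonneg[OF mult_nonneg_nonneg[OF Krem_nonneg bd_nonneg[OF b]]]])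
              (use L nn in simp)
          ultimately have "bd p (?K * ?c * (L * NA (y - x)) * e) (comp_rem (M h) (\<lambda>j. g j x) (\<lambda>j. g j y))" by (rule bd_mono)
          then show "bd p (Krem TYPE('n) p R * c * L * e * NA (y - x) * (\<Prod>i\<in>A. NA (h i)))
             (comp_rem (M h) (\<lambda>j. g j x) (\<lambda>j. g j y))"
            by (simp add: mult_ac)
        qed
      qed
    qed (simp_all add: eventually_nb_NA[OF x])
  qed
qed

lemma dr_embed:
  fixes T :: "'a \<Rightarrow> (nat \<Rightarrow> 'a) \<Rightarrow> real^'n::finite \<Rightarrow> real"
  assumes "p \<le> q" "dr A q x T T' a" "x \<in> U"
  shows "dr A p x T T' a"
  unfolding dr_def
proof (rule sml_I[OF smlD[OF assms(2)[unfolded dr_def]], where K = "(2 * real CARD('n)) ^ (q - p)"])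
  show "eventually (\<lambda>y. \<forall>e>0. bnd A q (e * NA (y - x)) (\<lambda>h t. T y h t - T x h t - T' x (h(a := y - x)) t) \<longrightarrow>
      bnd A p ((2 * real CARD('n)) ^ (q - p) * e * NA (y - x)) (\<lambda>h t. T y h t - T x h t - T' x (h(a := y - x)) t)) (nb x)"
    by (intro always_eventually allI impI)
      (simp only: mult.assoc, rule bnd_transfer, assumption, rule bd_embed_le[OF assms(1)])
qed (simp_all add: eventually_nb_NA[OF assms(3)])

text \<open>The derivative of \<open>x \<mapsto> T x \<circ> \<psi> x\<close> contains \<open>T' x (\<dots>, h) \<circ> \<psi> x\<close>, which is only continuous in the
  operator norm if one more derivative is available; this is the extra order required when there are slots.\<close>
lemma Sm_comp:
  fixes T :: "'a \<Rightarrow> (nat \<Rightarrow> 'a) \<Rightarrow> real^'n::finite \<Rightarrow> real"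
  assumes p: "1 \<le> p"
  shows "Sm r A (p + r + (if A = {} then 0 else 1)) T \<Longrightarrow> (\<And>j. Sm r {} p (\<lambda>x h. g j x)) \<Longrightarrow>
    Sm r A p (\<lambda>x h t. T x h (shift (\<lambda>j. g j x) t))"
proof (induction r arbitrary: A T)
  have base: "Sm 0 A p (\<lambda>x h t. T x h (shift (\<lambda>j. g j x) t))"
    if T: "Sm 0 A (p + (if A = {} then 0 else 1)) T" and g: "\<And>j. Sm 0 {} p (\<lambda>x h. g j x)"
    for A and T :: "'a \<Rightarrow> (nat \<Rightarrow> 'a) \<Rightarrow> real^'n::finite \<Rightarrow> real"
  proof -
    have Tp: "Sm 0 A p T" by (rule Sm_embed_le[OF _ T]) simp
    have gAP: "AP p (g j x)" if "x \<in> U" for j x using g[unfolded Sm0_empty] that by auto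
    have "ct A p x (\<lambda>x h t. T x h (shift (\<lambda>j. g j x) t))" if x: "x \<in> U" for x
    proof -
      obtain R where R: "\<forall>j. bd p R (g j x)" "lip R (shift (\<lambda>j. g j x))"
        and evR: "eventually (\<lambda>y. (\<forall>j. bd p R (g j y)) \<and> lip R (shift (\<lambda>j. g j y))) (nb x)"
        using inner_bounds[where g = g, OF g p x] by blast
      have "sml (\<lambda>y. 1) A p (nb x) (\<lambda>y h t. T y h (shift (\<lambda>j. g j y) t) - T x h (shift (\<lambda>j. g j y) t))"
      proof (rule sml_I[OF smlD[OF Sm_ct[OF Tp x, unfolded ct_def]], where K = "Kcomp TYPE('n) p R"])
        show "eventually (\<lambda>y. \<forall>e>0. bnd A p (e * 1) (\<lambda>h t. T y h t - T x h t) \<longrightarrow>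
            bnd A p (Kcomp TYPE('n) p R * e * 1) (\<lambda>h t. T y h (shift (\<lambda>j. g j y) t) - T x h (shift (\<lambda>j. g j y) t))) (nb x)"
          using evR
        proof (eventually_elim, intro allI impI)
          fix y e assume y: "(\<forall>j. bd p R (g j y)) \<and> lip R (shift (\<lambda>j. g j y))"
            and e: "bnd A p (e * 1) (\<lambda>h t. T y h t - T x h t)"
          have "bnd A p (Kcomp TYPE('n) p R * (e * 1)) (\<lambda>h t. T y h (shift (\<lambda>j. g j y) t) - T x h (shift (\<lambda>j. g j y) t))"
            by (rule bnd_transfer[OF e], rule bd_compI[where F = "\<lambda>t. T y _ t - T x _ t"]) (use y in auto)
          then show "bnd A p (Kcomp TYPE('n) p R * e * 1) (\<lambda>h t. T y h (shift (\<lambda>j. g j y) t) - T x h (shift (\<lambda>j. g j y) t))"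
            by simp
        qed
      qed simp_all
      \<comment> \<open>The outer family is changed first, along the moving inner map, and then the
        inner map under the fixed outer function.\<close>
      from sml_add[OF this inner_ct[where g = g, OF Sm_mlin[OF T x] g p x]] show ?thesis by (simp add: ct_def)
    qed
    then show ?thesis using mlin_comp[OF Sm_mlin[OF Tp] gAP p] by simp
  qed
  {
    case 0
    then show ?case using base[of A T] by simp
  next
    case (Suc r)
    let ?i = "if A = {} then 0 else 1 :: nat"
    note T = Suc.prems(1) and g = Suc.prems(2)
    have g0: "Sm 0 {} p (\<lambda>x h. g j x)" for j by (rule Sm_0[OF g])
    have T0: "Sm 0 A (p + ?i) T" by (rule Sm_embed_le[OF _ Sm_0[OF T]]) simp
    show ?case
    proof (rule Sm_SucI[OF base[OF T0 g0]])
      fix a assume a: "a \<notin> A"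
      from Sm_SucD_ex[OF T a] obtain T'
        where T'0: "Sm r (insert a A) (p + Suc r + ?i) T' \<and> (\<forall>x\<in>U. dr A (p + Suc r + ?i) x T T' a)" ..
      have T': "Sm r (insert a A) (p + Suc r + ?i) T'" "x \<in> U \<Longrightarrow> dr A (p + Suc r + ?i) x T T' a" for x
        using T'0[THEN conjunct1] T'0[THEN conjunct2, THEN bspec] by this
      have "\<exists>G'. Sm r {a} p G' \<and> (\<forall>x\<in>U. dr {} p x (\<lambda>x h. g j x) G' a)" for j
        by (rule Sm_SucD_ex[OF g, of a j]) simp
      then have "\<forall>j. \<exists>G'. Sm r {a} p G' \<and> (\<forall>x\<in>U. dr {} p x (\<lambda>x h. g j x) G' a)" by (rule allI)
      from choice[OF this] obtain G' where G'0: "\<forall>j. Sm r {a} p (G' j) \<and> (\<forall>x\<in>U. dr {} p x (\<lambda>x h. g j x) (G' j) a)" ..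
      have G': "Sm r {a} p (G' j)" "x \<in> U \<Longrightarrow> dr {} p x (\<lambda>x h. g j x) (G' j) a" for j x
        using G'0[rule_format, THEN conjunct1] G'0[rule_format, THEN conjunct2, THEN bspec] by this
      \<comment> \<open>The chain rule: the new slot \<open>a\<close> occurs either in the
        derivative of the outer family or in that of one inner component.\<close>
      let ?P = "\<lambda>x h t. T' x h (shift (\<lambda>j. g j x) t) +
         (\<Sum>j\<in>UNIV. pderiv_dir j (T x h) (shift (\<lambda>j. g j x) t) * G' j x h t)"
      have g': "Sm r {} p (\<lambda>x h. g j x)" for j by (rule Sm_mono[OF g])
      \<comment> \<open>\<open>T'\<close> certainly has a slot and needs order
        \<open>p + r + 1\<close>, which is what \<open>p + Suc r\<close> provides even if
        \<open>A\<close> is empty.\<close>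
      have T1: "Sm r (insert a A) (p + r + (if insert a A = {} then 0 else 1)) T'"
        by (rule Sm_embed_le[OF _ T'(1)]) simp
      have dT: "Sm r A (p + r + ?i) (\<lambda>x h. pderiv_dir j (T x h))" for j
        by (rule Sm_pd) (rule Sm_mono, use T in \<open>simp del: Sm.simps\<close>)
      have P2: "Sm r (A \<union> {a}) p (\<lambda>x h t. pderiv_dir j (T x h) (shift (\<lambda>j. g j x) t) * G' j x h t)" for j
        by (rule Sm_mult[OF Suc.IH[OF dT g'] G'(1)]) (use a in auto)
      have finA: "finite A" if "x \<in> U" for x using mlin_finite[OF Sm_mlin[OF T that]] .
      have P: "Sm r (insert a A) p ?P"
      proof (cases "U = {}")
        case True
        show ?thesis by (rule Sm_trivial) (simp add: True)
      next
        case False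
        then have "finite (A \<union> {a})" using finA by auto
        from Sm_sum[of UNIV r "A \<union> {a}" p, OF P2 this] have "Sm r (insert a A) p
          (\<lambda>x h t. \<Sum>j\<in>UNIV. pderiv_dir j (T x h) (shift (\<lambda>j. g j x) t) * G' j x h t)" by simp
        from Sm_add[OF Suc.IH[OF T1 g'] this] show ?thesis .
      qed
      have "dr A p x (\<lambda>x h t. T x h (shift (\<lambda>j. g j x) t)) ?P a" if x: "x \<in> U" for x
      proof -
        note w = eventually_nb_NA[OF x]
        obtain R where R: "\<forall>j. bd p R (g j x)" "lip R (shift (\<lambda>j. g j x))"
          and evR: "eventually (\<lambda>y. (\<forall>j. bd p R (g j y)) \<and> lip R (shift (\<lambda>j. g j y))) (nb x)"
          using inner_bounds[where g = g, OF g0 p x] by blast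
        have drp: "dr A p x T T' a" by (rule dr_embed[OF _ T'(2)[OF x] x]) simp
        have s1: "sml (\<lambda>y. NA (y - x)) A p (nb x) (\<lambda>y h t. T y h (shift (\<lambda>j. g j y) t) - T x h (shift (\<lambda>j. g j y) t)
            - T' x (h(a := y - x)) (shift (\<lambda>j. g j y) t))"
        proof (rule sml_I[OF smlD[OF drp[unfolded dr_def]] _ w, where K = "Kcomp TYPE('n) p R"])
          show "eventually (\<lambda>y. \<forall>e>0. bnd A p (e * NA (y - x)) (\<lambda>h t. T y h t - T x h t - T' x (h(a := y - x)) t) \<longrightarrow>
              bnd A p (Kcomp TYPE('n) p R * e * NA (y - x)) (\<lambda>h t. T y h (shift (\<lambda>j. g j y) t) - T x h (shift (\<lambda>j. g j y) t)
            - T' x (h(a := y - x)) (shift (\<lambda>j. g j y) t))) (nb x)"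
            using evR
          proof (eventually_elim, intro allI impI)
            fix y e assume y: "(\<forall>j. bd p R (g j y)) \<and> lip R (shift (\<lambda>j. g j y))"
              and e: "bnd A p (e * NA (y - x)) (\<lambda>h t. T y h t - T x h t - T' x (h(a := y - x)) t)"
            have "bnd A p (Kcomp TYPE('n) p R * (e * NA (y - x))) (\<lambda>h t. T y h (shift (\<lambda>j. g j y) t) - T x h (shift (\<lambda>j. g j y) t)
              - T' x (h(a := y - x)) (shift (\<lambda>j. g j y) t))"
              by (rule bnd_transfer[OF e], rule bd_compI[where F = "\<lambda>t. T y _ t - T x _ t - T' x _ t"]) (use y in auto)
            then show "bnd A p (Kcomp TYPE('n) p R * e * NA (y - x)) (\<lambda>h t. T y h (shift (\<lambda>j. g j y) t) - T x h (shift (\<lambda>j. g j y) t)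
              - T' x (h(a := y - x)) (shift (\<lambda>j. g j y) t))"
              by (simp add: mult.assoc)
          qed
        qed simp
        have T1x: "mlin (insert a A) (p + (if insert a A = {} then 0 else 1)) (T' x)"
          by (rule Sm_mlin[OF Sm_embed_le[OF _ T'(1)] x]) simp
        have s2: "sml (\<lambda>y. NA (y - x)) A p (nb x) (\<lambda>y h t. T' x (h(a := y - x)) (shift (\<lambda>j. g j y) t)
            - T' x (h(a := y - x)) (shift (\<lambda>j. g j x) t))"
        proof (rule sml_I[OF smlD[OF inner_ct[where g = g, OF T1x g0 p x]] _ w, where K = 1])
          show "eventually (\<lambda>y. \<forall>e>0. bnd (insert a A) p (e * 1) (\<lambda>h t. T' x h (shift (\<lambda>j. g j y) t) - T' x h (shift (\<lambda>j. g j x) t)) \<longrightarrow>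
             bnd A p (1 * e * NA (y - x)) (\<lambda>h t. T' x (h(a := y - x)) (shift (\<lambda>j. g j y) t)
              - T' x (h(a := y - x)) (shift (\<lambda>j. g j x) t))) (nb x)"
            using eventually_nb_U
          proof (eventually_elim, intro allI impI)
            fix y e assume y: "y \<in> U" and e: "bnd (insert a A) p (e * 1) (\<lambda>h t. T' x h (shift (\<lambda>j. g j y) t) - T' x h (shift (\<lambda>j. g j x) t))"
            from bnd_slot[OF e a finA[OF x] diff_VA[OF x y]]
            show "bnd A p (1 * e * NA (y - x)) (\<lambda>h t. T' x (h(a := y - x)) (shift (\<lambda>j. g j y) t)
              - T' x (h(a := y - x)) (shift (\<lambda>j. g j x) t))" by simp
          qed
        qed simp
        have Mx: "mlin A (Suc p + ?i) (T x)"
          by (rule Sm_mlin[OF Sm_embed_le[OF _ Sm_0[OF T]] x]) simp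
        have s3: "sml (\<lambda>y. NA (y - x)) A p (nb x) (\<lambda>y h. comp_rem (T x h) (\<lambda>j. g j x) (\<lambda>j. g j y))"
        proof (rule inner_rem[where g = g, OF Mx g0 p x])
          fix j
          obtain C where C: "C > 0" "eventually (\<lambda>y. bnd {} p (C * NA (y - x)) (\<lambda>h t. g j y t - g j x t)) (nb x)"
            using dr_O[OF Sm_mlin[OF G'(1) x] G'(2)[OF x] _ x, of j] by blast
          then show "\<exists>C>0. eventually (\<lambda>y. bd p (C * NA (y - x)) (\<lambda>t. g j y t - g j x t)) (nb x)"
            unfolding bnd_empty by blast
        qed
        have s4: "sml (\<lambda>y. NA (y - x)) A p (nb x) (\<lambda>y h t. (g j y t - g j x t - G' j x (h(a := y - x)) t) *
            pderiv_dir j (T x h) (shift (\<lambda>j. g j x) t))" for j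
        proof -
          have "Sm 0 A (p + ?i) (\<lambda>x h. pderiv_dir j (T x h))" by (rule Sm_embed_le[OF _ Sm_0[OF dT]]) simp
          from Sm_mlin[OF base[OF this g0] x]
          obtain C where C: "bnd A p C (\<lambda>h t. pderiv_dir j (T x h) (shift (\<lambda>j. g j x) t))" using mlin_bnd by blast
          have "sml (\<lambda>y. NA (y - x) * 1) ({} \<union> A) p (nb x) (\<lambda>y h t. (g j y t - g j x t - G' j x (h(a := y - x)) t) *
            pderiv_dir j (T x h) (shift (\<lambda>j. g j x) t))"
            by (rule sml_mult_left[OF G'(2)[OF x, unfolded dr_def], where C = C]) (use C finA[OF x] w in auto)
          then show ?thesis by simp
        qed
        have s4': "sml (\<lambda>y. NA (y - x)) A p (nb x) (\<lambda>y h t. \<Sum>j\<in>UNIV. (g j y t - g j x t - G' j x (h(a := y - x)) t) *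
            pderiv_dir j (T x h) (shift (\<lambda>j. g j x) t))"
          by (rule sml_sum[OF s4 w])
        have uT: "T x (h(a := y - x)) = T x h" for y h
          by (rule mlin_upd[OF Sm_mlin[OF T x] a])
        \<comment> \<open>The remainder splits into four: that of \<open>T\<close> along the moving
          map, the change of \<open>T' x\<close> between the two inner maps, the Taylor remainder of
          composition for the fixed \<open>T x\<close>, and the remainders of the inner components
          multiplied by the derivatives of \<open>T x\<close>.\<close>
        show ?thesis
          using sml_add[OF sml_add[OF s1 s2] sml_add[OF s3 s4']]
          unfolding dr_def uT comp_rem_def
          by (simp add: algebra_simps sum.distrib sum_subtractf)
      qed
      with P show "\<exists>T'. Sm r (insert a A) p T' \<and> (\<forall>x\<in>U. dr A p x (\<lambda>x h t. T x h (shift (\<lambda>j. g j x) t)) T' a)" by blast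
    qed
  }
qed

end

subsection \<open>Bijectivity\<close>

text \<open>Bounded distance from the identity keeps the preimages of a convergent sequence bounded,
  and a convergent subsequence of them supplies a preimage of the limit.\<close>

lemma proper_closed_image:
  fixes \<phi> :: "'a::euclidean_space \<Rightarrow> 'a"
  assumes cont: "continuous_on UNIV \<phi>" and near: "\<And>x. norm (\<phi> x - x) \<le> C" and S: "closed S"
  shows "closed (\<phi> ` S)"
  unfolding closed_sequential_limits
proof (intro allI impI, elim conjE)
  fix y l assume y: "\<forall>n. y n \<in> \<phi> ` S" and l: "y \<longlonglongrightarrow> l"
  then have "\<forall>n. \<exists>x. x \<in> S \<and> y n = \<phi> x" by blast
  from choice[OF this] obtain x where "\<forall>n. x n \<in> S \<and> y n = \<phi> (x n)" ..
  then have x: "x n \<in> S" "y n = \<phi> (x n)" for n by auto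
  have "bounded (range y)" using l by (rule convergent_imp_bounded)
  then obtain B where B: "\<And>n. norm (y n) \<le> B" by (auto simp: bounded_iff)
  have xB: "x n \<in> cball 0 (B + C)" for n
  proof -
    have "norm (x n) \<le> norm (y n) + norm (\<phi> (x n) - x n)"
      using norm_triangle_sub[of "x n" "\<phi> (x n)"] x(2)[of n] by (simp add: norm_minus_commute)
    then show ?thesis using B[of n] near[of "x n"] by simp
  qed
  have "compact (cball (0::'a) (B + C))" by simp
  from this[unfolded compact_def, rule_format, of x, OF xB]
  obtain z and r :: "nat \<Rightarrow> nat" where z: "strict_mono r" "(x \<circ> r) \<longlonglongrightarrow> z" by blast
  have "z \<in> S" using closed_sequentially[OF S _ z(2)] x(1) by simp
  have "isCont \<phi> z" using cont by (simp add: continuous_on_eq_continuous_at)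
  from isCont_tendsto_compose[OF this z(2)] have "(\<lambda>n. \<phi> ((x \<circ> r) n)) \<longlonglongrightarrow> \<phi> z" .
  moreover have "(\<lambda>n. \<phi> ((x \<circ> r) n)) = y \<circ> r" by (simp add: fun_eq_iff x(2))
  ultimately have "l = \<phi> z" using LIMSEQ_unique[OF LIMSEQ_subseq_LIMSEQ[OF l z(1)]] by simp
  with \<open>z \<in> S\<close> show "l \<in> \<phi> ` S" by blast
qed

text \<open>One radius for a whole finite fibre: within the radii of local injectivity, and at most
  half of each mutual distance, so that the balls are disjoint.\<close>

lemma finite_separation:
  fixes F :: "'a::metric_space set"
  assumes "finite F" "\<And>x. x \<in> F \<Longrightarrow> r x > 0"
  shows "\<exists>\<rho>::real. \<rho> > 0 \<and> (\<forall>x\<in>F. \<rho> \<le> r x) \<and> (\<forall>x\<in>F. \<forall>z\<in>F. x \<noteq> z \<longrightarrow> 2 * \<rho> \<le> dist x z)"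
proof -
  let ?R = "insert 1 (r ` F \<union> (\<lambda>(x, z). dist x z / 2) ` {(x, z) \<in> F \<times> F. x \<noteq> z})"
  have "finite {(x, z) \<in> F \<times> F. x \<noteq> z}"
    by (rule finite_subset[of _ "F \<times> F"]) (use assms(1) in auto)
  then have fin: "finite ?R" using assms(1) by simp
  have le: "Min ?R \<le> t" if "t \<in> ?R" for t using fin that by (rule Min_le)
  show ?thesis
  proof (intro exI[of _ "Min ?R"] conjI ballI impI)
    show "Min ?R > 0" using fin assms(2) by (subst Min_gr_iff) auto
    show "Min ?R \<le> r x" if "x \<in> F" for x using that by (intro le) auto
    show "2 * Min ?R \<le> dist x z" if "x \<in> F" "z \<in> F" "x \<noteq> z" for x z
    proof -
      have "Min ?R \<le> dist x z / 2" using that by (intro le) force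
      then show ?thesis by simp
    qed
  qed
qed

text \<open>A locally injective map at bounded distance from the identity is proper, hence a covering of
  the simply connected space; two points of one fibre are joined by a segment whose image is a
  contractible loop.\<close>
lemma locally_injective_proper_bij:
  fixes \<phi> :: "'a::euclidean_space \<Rightarrow> 'a"
  assumes cont: "continuous_on UNIV \<phi>" and near: "\<And>x. norm (\<phi> x - x) \<le> C"
    and inj: "\<And>x. \<exists>r>0. inj_on \<phi> (ball x r)"
  shows "bij \<phi>"
proof -
  note cont' = continuous_on_subset[OF cont subset_UNIV]
  have opn: "open (\<phi> ` S)" if "open S" "inj_on \<phi> S" for S
    by (rule invariance_of_domain[OF cont' that])
  have "open (range \<phi>)"
    unfolding open_subopen[of "range \<phi>"]
  proof
    fix y assume "y \<in> range \<phi>"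
    then obtain x where x: "y = \<phi> x" by blast
    obtain r where r: "r > 0" "inj_on \<phi> (ball x r)" using inj by blast
    show "\<exists>T. open T \<and> y \<in> T \<and> T \<subseteq> range \<phi>"
      by (rule exI[of _ "\<phi> ` ball x r"]) (use r opn[OF open_ball] x in auto)
  qed
  moreover have "closed (range \<phi>)" by (rule proper_closed_image[OF cont near closed_UNIV])
  ultimately have surj: "range \<phi> = UNIV"
    using connected_UNIV[where 'a = 'a, unfolded connected_clopen] by fastforce
  have cov: "covering_space UNIV \<phi> UNIV"
  proof
    fix y :: 'a
    define F where "F = \<phi> -` {y}"
    have "closed F" unfolding F_def using continuous_closed_vimage[of "{y}" \<phi>] cont
      by (simp add: continuous_on_eq_continuous_at)
    moreover have "F \<subseteq> cball y C"
      using near by (auto simp: F_def dist_norm)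
    ultimately have cF: "compact F" by (meson bounded_cball bounded_subset compact_eq_bounded_closed)
    \<comment> \<open>The fibre is compact, and local injectivity forbids accumulation points in
      it.\<close>
    have finF: "finite F"
    proof (rule ccontr)
      assume "infinite F"
      then obtain x where x: "x \<in> F" "x islimpt F"
        using cF unfolding compact_eq_Bolzano_Weierstrass by blast
      obtain r where r: "r > 0" "inj_on \<phi> (ball x r)" using inj by blast
      obtain z where "z \<in> F" "z \<noteq> x" "dist z x < r"
        using x(2) r(1) unfolding islimpt_approachable by blast
      then show False using r x(1) by (auto simp: F_def inj_on_def dist_commute)
    qed
    from choice[OF allI[OF inj]] obtain r where "\<forall>x. r x > 0 \<and> inj_on \<phi> (ball x (r x))" ..
    then have r: "r x > 0" "inj_on \<phi> (ball x (r x))" for x by auto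
    from finite_separation[of F r, OF finF r(1)] obtain \<rho> :: real
      where \<rho>0: "\<rho> > 0 \<and> (\<forall>x\<in>F. \<rho> \<le> r x) \<and> (\<forall>x\<in>F. \<forall>z\<in>F. x \<noteq> z \<longrightarrow> 2 * \<rho> \<le> dist x z)" ..
    then have \<rho>: "\<rho> > 0" "\<And>x. x \<in> F \<Longrightarrow> \<rho> \<le> r x" "\<And>x z. x \<in> F \<Longrightarrow> z \<in> F \<Longrightarrow> x \<noteq> z \<Longrightarrow> 2 * \<rho> \<le> dist x z"
      by simp_all
    define W where "W x = ball x \<rho>" for x :: 'a
    have Winj: "inj_on \<phi> (W x)" if "x \<in> F" for x
      using inj_on_subset[OF r(2)[of x]] \<rho>(2)[OF that] by (simp add: W_def subset_ball)
    have Wdis: "W x \<inter> W z = {}" if "x \<in> F" "z \<in> F" "x \<noteq> z" for x z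
      using disjoint_ballI[of \<rho> \<rho> x z] \<rho>(3)[OF that] by (simp add: W_def)
    \<comment> \<open>Removing the image of the closed set \<open>K\<close> excludes far preimages:
      every point of the neighbourhood \<open>T\<close> has its whole fibre inside the balls
      \<open>W x\<close>, with exactly one preimage in each.\<close>
    define K where "K = - (\<Union>x\<in>F. W x)"
    have "closed K" unfolding K_def W_def by auto
    then have cK: "closed (\<phi> ` K)" by (rule proper_closed_image[OF cont near])
    define T where "T = (\<Inter>x\<in>F. \<phi> ` W x) - \<phi> ` K"
    have "open (\<Inter>x\<in>F. \<phi> ` W x)"
      by (intro open_INT finF ballI invariance_of_domain[OF cont' _ Winj]) (simp add: W_def)
    then have oT: "open T" unfolding T_def using cK by (intro open_Diff)
    have yT: "y \<in> T"
    proof -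
      have "y \<in> \<phi> ` W x" if "x \<in> F" for x
        using that \<rho>(1) by (auto simp: F_def W_def intro!: image_eqI[of y \<phi> x])
      moreover have "y \<notin> \<phi> ` K"
      proof
        assume "y \<in> \<phi> ` K"
        then obtain k where "k \<in> K" "k \<in> F" by (auto simp: F_def)
        then show False using \<rho>(1) by (auto simp: K_def W_def)
      qed
      ultimately show ?thesis by (simp add: T_def)
    qed
    define v where "v = (\<lambda>x. W x \<inter> \<phi> -` T) ` F"
    have oV: "open (W x \<inter> \<phi> -` T)" for x
      using continuous_open_vimage[OF oT, of \<phi>] cont by (simp add: W_def open_Int continuous_on_eq_continuous_at)
    show "\<exists>T. y \<in> T \<and> openin (top_of_set UNIV) T \<and>
        (\<exists>v. \<Union> v = UNIV \<inter> \<phi> -` T \<and> (\<forall>u\<in>v. openin (top_of_set UNIV) u) \<and> pairwise disjnt v \<and>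
          (\<forall>u\<in>v. \<exists>q. homeomorphism u T \<phi> q))"
    proof (intro exI[of _ T] conjI exI[of _ v] yT)
      show "openin (top_of_set UNIV) T" using oT by simp
      show "\<Union> v = UNIV \<inter> \<phi> -` T"
      proof
        show "UNIV \<inter> \<phi> -` T \<subseteq> \<Union> v"
        proof
          fix x assume "x \<in> UNIV \<inter> \<phi> -` T"
          then have "x \<notin> K" "\<phi> x \<in> T" by (auto simp: T_def)
          then show "x \<in> \<Union> v" by (auto simp: v_def K_def)
        qed
      qed (auto simp: v_def)
      show "\<forall>u\<in>v. openin (top_of_set UNIV) u" using oV by (auto simp: v_def)
      show "pairwise disjnt v"
        unfolding v_def pairwise_image by (rule pairwiseI) (use Wdis in \<open>auto simp: disjnt_def\<close>)
      show "\<forall>u\<in>v. \<exists>q. homeomorphism u T \<phi> q"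
      proof
        fix u assume "u \<in> v"
        then obtain x where x: "x \<in> F" "u = W x \<inter> \<phi> -` T" by (auto simp: v_def)
        have "\<phi> ` u = T"
        proof
          show "T \<subseteq> \<phi> ` u"
          proof
            fix t assume t: "t \<in> T"
            then have "t \<in> \<phi> ` W x" using x(1) by (auto simp: T_def)
            then show "t \<in> \<phi> ` u" using t x(2) by auto
          qed
        qed (auto simp: x(2))
        moreover have "inj_on \<phi> u" using inj_on_subset[OF Winj[OF x(1)]] x(2) by blast
        moreover have "open u" using oV x(2) by simp
        ultimately show "\<exists>q. homeomorphism u T \<phi> q"
          using invariance_of_domain_homeomorphism[of u \<phi>] cont' by (metis order_refl)
      qed
    qed
  qed (use cont surj in auto)
  have "inj \<phi>"
  proof
    fix a b assume ab: "\<phi> a = \<phi> b"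
    have p: "path (\<phi> \<circ> linepath a b)" by (intro path_continuous_image cont') simp
    have h: "homotopic_paths UNIV (\<phi> \<circ> linepath a b) (linepath (\<phi> a) (\<phi> a))"
      by (rule homotopic_paths_linear) (use p ab in \<open>auto simp: pathstart_compose pathfinish_compose\<close>)
    have lr: "linepath c c t = c" for c :: 'a and t by (simp add: linepath_refl)
    have "pathfinish (linepath a b) = pathfinish (linepath a a)"
      by (rule covering_space_monodromy[OF cov p _ _ _ h]) (simp_all add: lr)
    then show "a = b" by simp
  qed
  with surj show ?thesis by (simp add: bij_def)
qed

subsection \<open>The Jacobian matrix and its inverse\<close>

definition Jm :: "('n::finite \<Rightarrow> real^'n \<Rightarrow> real) \<Rightarrow> real^'n \<Rightarrow> real^'n^'n" where
  "Jm f x = (\<chi> i j. (if i = j then 1 else 0) + pderiv_dir j (f i) x)"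

text \<open>Cramer's rule, so that the entries are visibly polynomials in the derivatives over the determinant.\<close>
definition Minv :: "('n::finite \<Rightarrow> real^'n \<Rightarrow> real) \<Rightarrow> 'n \<Rightarrow> 'n \<Rightarrow> real^'n \<Rightarrow> real" where
  "Minv f k l x = det (\<chi> i j. if j = k then (if i = l then 1 else 0) else
     (if i = j then 1 else 0) + pderiv_dir j (f i) x) * (1 / det (Jm f x))"

lemma Minv_right:
  assumes "det (Jm f x) \<noteq> 0"
  shows "Jm f x ** (\<chi> k l. Minv f k l x) = mat 1"
proof -
  have "Jm f x *v (\<chi> k. Minv f k l x) = axis l 1" for l
  proof -
    have "(\<chi> k. Minv f k l x) = (\<chi> k. det (\<chi> i j. if j = k then axis l 1 $ i else Jm f x $ i $ j) / det (Jm f x))"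
      by (simp add: vec_eq_iff Minv_def Jm_def axis_def cong: if_cong)
    then show ?thesis using cramer[OF assms] by blast
  qed
  then have "(Jm f x *v (\<chi> k. Minv f k l x)) $ i = mat 1 $ i $ l" for i l
    by (simp add: axis_def mat_def)
  then show ?thesis by (simp add: vec_eq_iff matrix_matrix_mult_def matrix_vector_mult_def)
qed

lemma Minv_left:
  assumes "det (Jm f x) \<noteq> 0"
  shows "(\<chi> k l. Minv f k l x) ** Jm f x = mat 1"
  using Minv_right[OF assms] matrix_left_right_inverse by blast

text \<open>The unit matrix is split off because the increment \<open>v\<close> of an inverse
  displacement satisfies its expanded equation in this form.\<close>

lemma Minv_solve:
  assumes "det (Jm f x) \<noteq> 0" "\<And>i. v i + (\<Sum>j\<in>UNIV. pderiv_dir j (f i) x * v j) = b i"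
  shows "v k = (\<Sum>l\<in>UNIV. Minv f k l x * b l)"
proof -
  have "(Jm f x *v (\<chi> j. v j)) $ i = b i" for i
  proof -
    have "(Jm f x *v (\<chi> j. v j)) $ i = (\<Sum>j\<in>UNIV. (if i = j then v j else 0) + pderiv_dir j (f i) x * v j)"
      by (auto simp: matrix_vector_mult_def Jm_def distrib_right intro!: sum.cong)
    also have "\<dots> = b i" using assms(2)[of i] by (simp add: sum.distrib)
    finally show ?thesis .
  qed
  then have "Jm f x *v (\<chi> j. v j) = (\<chi> i. b i)" by (simp add: vec_eq_iff)
  then have "(\<chi> k l. Minv f k l x) *v (Jm f x *v (\<chi> j. v j)) = (\<chi> k l. Minv f k l x) *v (\<chi> i. b i)" by simp
  then have "(\<chi> j. v j) = (\<chi> k l. Minv f k l x) *v (\<chi> i. b i)"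
    by (simp add: matrix_vector_mul_assoc Minv_left[OF assms(1)])
  then have "(\<chi> j. v j) $ k = ((\<chi> k l. Minv f k l x) *v (\<chi> i. b i)) $ k" by simp
  then show ?thesis by (simp add: matrix_vector_mult_def)
qed

text \<open>By the permutation expansion. The abstract \<open>P\<close> lets one proof serve almost
  periodicity, convergence and smoothness of families.\<close>

lemma det_closed:
  fixes P :: "('b \<Rightarrow> real) \<Rightarrow> bool" and a :: "'n::finite \<Rightarrow> 'n \<Rightarrow> 'b \<Rightarrow> real"
  assumes const: "\<And>c. P (\<lambda>x. c)" and add: "\<And>f g. P f \<Longrightarrow> P g \<Longrightarrow> P (\<lambda>x. f x + g x)"
    and mult: "\<And>f g. P f \<Longrightarrow> P g \<Longrightarrow> P (\<lambda>x. f x * g x)" and a: "\<And>i j. P (a i j)"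
  shows "P (\<lambda>x. det (\<chi> i j. a i j x))"
proof -
  have prod: "P (\<lambda>x. \<Prod>i\<in>S. h i x)" if "\<And>i. P (h i)" for S and h :: "'n \<Rightarrow> 'b \<Rightarrow> real"
    by (induction S rule: infinite_finite_induct) (auto intro: const mult that)
  have sum: "P (\<lambda>x. \<Sum>i\<in>S. h i x)" if "\<And>i. P (h i)" for S and h :: "('n \<Rightarrow> 'n) \<Rightarrow> 'b \<Rightarrow> real"
    by (induction S rule: infinite_finite_induct) (auto intro: const add that)
  have "P (\<lambda>x. \<Sum>p | p permutes UNIV. of_int (sign p) * (\<Prod>i\<in>UNIV. a i (p i) x))"
    by (intro sum mult const prod a)
  then show ?thesis by (simp add: det_def)
qed

lemma shift_has_derivative:
  assumes f: "\<And>i j. has_pd i (f j) (pderiv_dir i (f j))" "\<And>i j. continuous_on UNIV (pderiv_dir i (f j))"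
  shows "(shift f has_derivative (\<lambda>h. Jm f x *v h)) (at x)"
proof -
  have "((\<lambda>x. \<chi> j. f j x) has_derivative (\<lambda>h. \<chi> j. \<Sum>i\<in>UNIV. h $ i * pderiv_dir i (f j) x)) (at x)"
  proof (subst has_derivative_componentwise_within, intro ballI)
    fix b :: "real^'a" assume "b \<in> Basis"
    then obtain j where b: "b = axis j 1" by (auto simp: Basis_vec_def)
    show "((\<lambda>x. (\<chi> j. f j x) \<bullet> b) has_derivative (\<lambda>h. (\<chi> j. \<Sum>i\<in>UNIV. h $ i * pderiv_dir i (f j) x) \<bullet> b)) (at x)"
      using C1_has_derivative[OF f(1) f(2), of j x] by (simp add: b inner_axis)
  qed
  then have "(shift f has_derivative (\<lambda>h. h + (\<chi> j. \<Sum>i\<in>UNIV. h $ i * pderiv_dir i (f j) x))) (at x)"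
    unfolding shift_def[abs_def] by (intro has_derivative_add has_derivative_ident)
  moreover have "h + (\<chi> j. \<Sum>i\<in>UNIV. h $ i * pderiv_dir i (f j) x) = Jm f x *v h" for h
  proof -
    have "(\<Sum>j\<in>UNIV. ((if i = j then 1 else 0) + pderiv_dir j (f i) x) * h $ j)
        = (\<Sum>j\<in>UNIV. (if i = j then h $ j else 0) + h $ j * pderiv_dir j (f i) x)" for i
      by (intro sum.cong) (auto simp: algebra_simps)
    then show ?thesis by (simp add: vec_eq_iff matrix_vector_mult_def Jm_def sum.distrib)
  qed
  ultimately show ?thesis by simp
qed

text \<open>Local injectivity is the inverse function theorem with the Cramer inverse as left
  inverse of the differential; the bound on \<open>f\<close> gives the bounded distance from the
  identity.\<close>

lemma shift_bij:
  fixes f :: "'n::finite \<Rightarrow> real^'n \<Rightarrow> real"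
  assumes f: "\<And>i j. has_pd i (f j) (pderiv_dir i (f j))" "\<And>i j. continuous_on UNIV (pderiv_dir i (f j))"
    and b: "\<And>j x. \<bar>f j x\<bar> \<le> c" and det: "\<And>x. det (Jm f x) \<noteq> 0"
  shows "bij (shift f)"
proof (rule locally_injective_proper_bij)
  note D = shift_has_derivative[OF f]
  show "continuous_on UNIV (shift f)"
    using D by (meson continuous_at_imp_continuous_on has_derivative_continuous)
  show "norm (shift f x - x) \<le> (\<Sum>j\<in>(UNIV :: 'n set). c)" for x
  proof -
    have "norm (shift f x - x) \<le> (\<Sum>j\<in>UNIV. \<bar>f j x\<bar>)" using norm_vec_le_sum[of "\<lambda>j. f j x"] by (simp add: shift_def)
    also have "\<dots> \<le> (\<Sum>j\<in>(UNIV :: 'n set). c)" by (intro sum_mono b)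
    finally show ?thesis .
  qed
  fix x :: "real^'n"
  let ?M = "\<chi> k l. Minv f k l x"
  have "\<exists>d>0. \<forall>z. dist x z < d \<longrightarrow> onorm (\<lambda>v. Jm f z *v v - Jm f x *v v) < e" if e: "e > 0" for e :: real
  proof -
    define n where "n = real CARD('n)"
    have n: "n > 0" by (simp add: n_def)
    \<comment> \<open>A matrix whose \<open>n * n\<close> entries are at most \<open>e'\<close> in
      absolute value has operator norm at most \<open>n * n * e'\<close>, here half of
      \<open>e\<close>.\<close>
    define e' where "e' = e / (2 * (n * n))"
    have e': "e' > 0" using e n by (simp add: e'_def)
    have "eventually (\<lambda>z. \<forall>i j. \<bar>pderiv_dir i (f j) z - pderiv_dir i (f j) x\<bar> < e') (nhds x)"
    proof (intro eventually_all_finite)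
      fix i j
      have "isCont (pderiv_dir i (f j)) x" using f(2) by (simp add: continuous_on_eq_continuous_at)
      then have "(pderiv_dir i (f j) \<longlongrightarrow> pderiv_dir i (f j) x) (nhds x)" by (simp add: isCont_def tendsto_at_iff_tendsto_nhds)
      from tendstoD[OF this e'] show "eventually (\<lambda>z. \<bar>pderiv_dir i (f j) z - pderiv_dir i (f j) x\<bar> < e') (nhds x)"
        by (simp add: dist_real_def)
    qed
    then obtain d where d: "d > 0" "\<And>z i j. dist z x < d \<Longrightarrow> \<bar>pderiv_dir i (f j) z - pderiv_dir i (f j) x\<bar> < e'"
      unfolding eventually_nhds_metric by blast
    show ?thesis
    proof (intro exI[of _ d] conjI d(1) allI impI)
      fix z assume z: "dist x z < d"
      have "onorm (\<lambda>v. Jm f z *v v - Jm f x *v v) \<le> n * n * e'"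
      proof (rule onorm_le)
        fix v :: "real^'n"
        have "Jm f z *v v - Jm f x *v v = (\<chi> i. \<Sum>j\<in>UNIV. (pderiv_dir j (f i) z - pderiv_dir j (f i) x) * v $ j)"
          by (simp add: vec_eq_iff matrix_vector_mult_def Jm_def sum_subtractf[symmetric] algebra_simps)
        then have "norm (Jm f z *v v - Jm f x *v v) \<le> (\<Sum>i\<in>UNIV. \<bar>\<Sum>j\<in>UNIV. (pderiv_dir j (f i) z - pderiv_dir j (f i) x) * v $ j\<bar>)"
          by (simp add: norm_vec_le_sum)
        also have "\<dots> \<le> (\<Sum>i\<in>(UNIV :: 'n set). \<Sum>j\<in>(UNIV :: 'n set). e' * norm v)"
        proof (intro sum_mono)
          fix i :: 'n
          have "\<bar>\<Sum>j\<in>UNIV. (pderiv_dir j (f i) z - pderiv_dir j (f i) x) * v $ j\<bar>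
              \<le> (\<Sum>j\<in>UNIV. \<bar>(pderiv_dir j (f i) z - pderiv_dir j (f i) x) * v $ j\<bar>)" by (rule sum_abs)
          also have "\<dots> \<le> (\<Sum>j\<in>(UNIV :: 'n set). e' * norm v)"
            unfolding abs_mult using d(2)[of z] z e'
            by (intro sum_mono mult_mono component_le_norm_cart) (auto simp: dist_commute less_imp_le)
          finally show "\<bar>\<Sum>j\<in>UNIV. (pderiv_dir j (f i) z - pderiv_dir j (f i) x) * v $ j\<bar> \<le> (\<Sum>j\<in>(UNIV :: 'n set). e' * norm v)" .
        qed
        also have "\<dots> = n * n * e' * norm v" by (simp add: n_def)
        finally show "norm (Jm f z *v v - Jm f x *v v) \<le> n * n * e' * norm v" .
      qed
      also have "\<dots> = e / 2" using n by (simp add: e'_def)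
      also have "\<dots> < e" using e by simp
      finally show "onorm (\<lambda>v. Jm f z *v v - Jm f x *v v) < e" .
    qed
  qed
  then obtain r where "r > 0" "inj_on (shift f) (ball x r)"
    using has_derivative_locally_injective[where f = "shift f" and f' = "\<lambda>z v. Jm f z *v v" and g' = "\<lambda>v. ?M *v v" and a = x and S = UNIV]
      D Minv_left[OF det[of x]]
    by (auto simp: fun_eq_iff matrix_vector_mul_assoc)
  then show "\<exists>r>0. inj_on (shift f) (ball x r)" by blast
qed

section \<open>The displacement of the inverse map\<close>

definition inv_disp :: "('n::finite \<Rightarrow> real^'n \<Rightarrow> real) \<Rightarrow> 'n \<Rightarrow> real^'n \<Rightarrow> real" where
  "inv_disp f j y = inv (shift f) y $ j - y $ j"

lemma shift_inv_disp: "shift (inv_disp f) = inv (shift f)"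
  by (simp add: fun_eq_iff vec_eq_iff inv_disp_def)

context hoelder
begin

text \<open>If every bound \<open>d\<close> improves to \<open>a + d / 2\<close>, the least bound is
  at most \<open>2 * a\<close>; it is a bound by \<open>bd_closed\<close>. The improvement is
  assumed below \<open>d0\<close> only, the range in which a nonlinear remainder is
  controlled.\<close>

lemma bd_absorb:
  fixes v :: "'i::finite \<Rightarrow> real^'n::finite \<Rightarrow> real"
  assumes v: "\<forall>j. bd p d0 (v j)"
    and step: "\<And>d. d \<le> d0 \<Longrightarrow> \<forall>j. bd p d (v j) \<Longrightarrow> \<forall>j. bd p (a + d / 2) (v j)"
  shows "\<forall>j. bd p (2 * a) (v j)"
proof -
  let ?S = "{d. \<forall>j. bd p d (v j)}"
  have d0: "d0 \<in> ?S" using v by simp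
  then have ne: "?S \<noteq> {}" by blast
  have bb: "bdd_below ?S" using bd_nonneg by (auto intro!: bdd_belowI[of _ 0])
  have I: "bd p (Inf ?S) (v j)" for j
  proof (rule bd_closed)
    fix e :: real assume "e > 0"
    then obtain d where d: "d \<in> ?S" "d < Inf ?S + e"
      using cInf_lessD[OF ne, of "Inf ?S + e"] by auto
    from d(1) have "bd p d (v j)" by simp
    then show "bd p (Inf ?S + e) (v j)" by (rule bd_mono) (use d(2) in simp)
  qed
  have "\<forall>j. bd p (a + Inf ?S / 2) (v j)"
    by (rule step) (use I cInf_lower[OF d0 bb] in auto)
  then have "Inf ?S \<le> a + Inf ?S / 2" using bb by (intro cInf_lower) auto
  then have "Inf ?S \<le> 2 * a" by simp
  then show ?thesis by (blast intro: bd_mono[OF I])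
qed

text \<open>Interpolation: an increment of \<open>v\<close> is written as its power
  \<open>1 - \<gamma>\<close>, small because \<open>v\<close> is small, times its power
  \<open>\<gamma>\<close>, controlled by the Lipschitz bound.\<close>

lemma bd0_interp:
  fixes \<Lambda> e :: real
  assumes \<Lambda>: "\<Lambda> \<ge> 0" and e: "e > 0"
  shows "\<exists>s>0. \<forall>v::real^'n::finite \<Rightarrow> real. continuous_on UNIV v \<longrightarrow> (\<forall>x. \<bar>v x\<bar> \<le> s) \<longrightarrow>
    (\<forall>x y. \<bar>v x - v y\<bar> \<le> \<Lambda> * norm (x - y)) \<longrightarrow> bd 0 e v"
proof -
  define c where "c = e / (\<Lambda> powr \<gamma> + 1)"
  have L1: "\<Lambda> powr \<gamma> + 1 > 0" by (rule add_nonneg_pos) auto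
  have c: "c > 0" using e L1 by (simp add: c_def)
  have g1: "1 - \<gamma> > 0" using \<gamma> by simp
  \<comment> \<open>At most half of \<open>c powr (1 / (1 - \<gamma>))\<close>, because the
    oscillation of \<open>v\<close> may reach \<open>2 * s\<close>; the minimum with
    \<open>e\<close> takes care of the supremum.\<close>
  define s where "s = min e (c powr (1 / (1 - \<gamma>)) / 2)"
  have s: "s > 0" using e c by (simp add: s_def)
  have s2: "(2 * s) powr (1 - \<gamma>) \<le> c"
  proof -
    have "2 * s \<le> c powr (1 / (1 - \<gamma>))" by (simp add: s_def)
    then have "(2 * s) powr (1 - \<gamma>) \<le> (c powr (1 / (1 - \<gamma>))) powr (1 - \<gamma>)" using s g1 by (intro powr_mono2) auto
    also have "\<dots> = c" using g1 c by (simp add: powr_powr)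
    finally show ?thesis .
  qed
  show ?thesis
  proof (intro exI[of _ s] conjI s allI impI)
    fix v :: "real^'n \<Rightarrow> real"
    assume cont: "continuous_on UNIV v" and vs: "\<forall>x. \<bar>v x\<bar> \<le> s" and vL: "\<forall>x y. \<bar>v x - v y\<bar> \<le> \<Lambda> * norm (x - y)"
    have "\<bar>v x - v y\<bar> \<le> e * norm (x - y) powr \<gamma>" for x y
    proof (cases "v x = v y")
      case False
      let ?d = "\<bar>v x - v y\<bar>"
      have d: "?d > 0" using False by simp
      have "?d = ?d powr (1 - \<gamma>) * ?d powr \<gamma>" using d by (simp add: powr_add[symmetric])
      also have "\<dots> \<le> (2 * s) powr (1 - \<gamma>) * (\<Lambda> * norm (x - y)) powr \<gamma>"
      proof (intro mult_mono powr_mono2)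
        show "?d \<le> 2 * s" using vs[rule_format, of x] vs[rule_format, of y] by linarith
        show "?d \<le> \<Lambda> * norm (x - y)" using vL by blast
      qed (use g1 \<gamma> in auto)
      also have "\<dots> \<le> c * (\<Lambda> powr \<gamma> * norm (x - y) powr \<gamma>)"
        using s2 \<Lambda> c by (intro mult_mono) (auto simp: powr_mult)
      also have "\<dots> \<le> c * ((\<Lambda> powr \<gamma> + 1) * norm (x - y) powr \<gamma>)"
        using c by (intro mult_left_mono mult_right_mono) auto
      also have "\<dots> = e * norm (x - y) powr \<gamma>" using L1 by (simp add: c_def)
      finally show ?thesis .
    qed (use e in simp)
    moreover have "\<bar>v x\<bar> \<le> e" for x using vs[rule_format, of x] by (simp add: s_def)
    ultimately show "bd 0 e v" using cont by simp
  qed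
qed

lemma cv_det:
  fixes a :: "'n::finite \<Rightarrow> 'n \<Rightarrow> 'k \<Rightarrow> real^'n \<Rightarrow> real"
  assumes a: "\<And>i j. cv q (a i j) (A i j) Fl" and A: "\<And>i j. Cb q (A i j)"
  shows "cv q (\<lambda>k t. det (\<chi> i j. a i j k t)) (\<lambda>t. det (\<chi> i j. A i j t)) Fl"
    and "Cb q (\<lambda>t. det (\<chi> i j. A i j t))"
proof -
  \<comment> \<open>One function of \<open>Some k\<close> for the approximants and
    \<open>None\<close> for the limit encodes a convergent family, so that \<open>det_closed\<close>
    yields convergence and boundedness together.\<close>
  define P where "P = (\<lambda>F :: 'k option \<times> (real^'n) \<Rightarrow> real.
    cv q (\<lambda>k t. F (Some k, t)) (\<lambda>t. F (None, t)) Fl \<and> Cb q (\<lambda>t. F (None, t)))"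
  have "P (\<lambda>x. det (\<chi> i j. case x of (None, t) \<Rightarrow> A i j t | (Some k, t) \<Rightarrow> a i j k t))"
  proof (rule det_closed)
    show "P (\<lambda>x. c)" for c by (simp add: P_def cv_const Cb_const)
    show "P (\<lambda>x. f x + g x)" if "P f" "P g" for f g
      using that unfolding P_def by (intro conjI cv_add Cb_add) auto
    show "P (\<lambda>x. f x * g x)" if "P f" "P g" for f g
      using that unfolding P_def by (intro conjI cv_mult Cb_mult) auto
    show "P (\<lambda>x. case x of (None, t) \<Rightarrow> A i j t | (Some k, t) \<Rightarrow> a i j k t)" for i j
      using a[of i j] A[of i j] by (simp add: P_def)
  qed
  then show "cv q (\<lambda>k t. det (\<chi> i j. a i j k t)) (\<lambda>t. det (\<chi> i j. A i j t)) Fl"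
    "Cb q (\<lambda>t. det (\<chi> i j. A i j t))"
    by (simp_all add: P_def)
qed

lemma AP_det:
  fixes A :: "'n::finite \<Rightarrow> 'n \<Rightarrow> real^'n \<Rightarrow> real"
  assumes "\<And>i j. AP q (A i j)"
  shows "AP q (\<lambda>t. det (\<chi> i j. A i j t))"
  by (rule det_closed[where P = "AP q"]) (fact AP_const AP_add AP_mult assms)+

text \<open>Displacements of the almost periodic diffeomorphisms of order $q + 1 + \gamma$.\<close>
definition dif :: "nat \<Rightarrow> real \<Rightarrow> ('n::finite \<Rightarrow> real^'n \<Rightarrow> real) \<Rightarrow> bool" where
  "dif q \<delta> f \<longleftrightarrow> (\<forall>j. AP (Suc q) (f j)) \<and> \<delta> > 0 \<and> (\<forall>x. \<delta> \<le> det (Jm f x))"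

lemma dif_AP: "dif q \<delta> f \<Longrightarrow> AP (Suc q) (f j)" by (simp add: dif_def)

lemma dif_pos: "dif q \<delta> f \<Longrightarrow> 0 < \<delta>" by (simp add: dif_def)

lemma dif_det: "dif q \<delta> f \<Longrightarrow> \<delta> \<le> det (Jm f x)" by (simp add: dif_def)

lemma dif_det_nz: "dif q \<delta> f \<Longrightarrow> det (Jm f x) \<noteq> 0"
  using dif_pos[of q \<delta> f] dif_det[of q \<delta> f x] by linarith

lemma AP_Jm_entry: "AP (Suc q) (f i) \<Longrightarrow> AP q (\<lambda>x. (if i = j then 1 else 0) + pderiv_dir j (f i) x)"
  by (intro AP_add AP_const AP_pd)

lemma AP_det_Jm: "(\<And>i. AP (Suc q) (f i)) \<Longrightarrow> AP q (\<lambda>x. det (Jm f x))"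
  unfolding Jm_def by (intro AP_det AP_Jm_entry)

lemma AP_Minv:
  assumes f: "dif q \<delta> f" shows "AP q (Minv f k l)"
proof -
  have "AP q (\<lambda>x. if j = k then (if i = l then 1 else 0) else (if i = j then 1 else 0) + pderiv_dir j (f i) x)" for i j
  proof (cases "j = k")
    case False
    with AP_Jm_entry[where f = f and i = i and j = j, OF dif_AP[OF f]] show ?thesis by (simp only: if_False)
  qed (simp add: AP_const)
  then show ?thesis
    unfolding Minv_def
    by (intro AP_mult AP_det AP_recip[OF AP_det_Jm[OF dif_AP[OF f]] dif_pos[OF f] dif_det[OF f]])
qed

lemma cv_Jm_entry:
  assumes "cv (Suc q) (\<lambda>y. f y i) (F i) Fl" "Cb (Suc q) (F i)"
  shows "cv q (\<lambda>y x. (if i = j then 1 else 0) + pderiv_dir j (f y i) x) (\<lambda>x. (if i = j then 1 else 0) + pderiv_dir j (F i) x) Fl"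
  by (intro cv_add cv_const cv_pd assms)

lemma Cb_Jm_entry: "Cb (Suc q) (F i) \<Longrightarrow> Cb q (\<lambda>x. (if i = j then 1 else 0) + pderiv_dir j (F i) x)"
  by (intro Cb_add Cb_const Cb_pd)

lemma cv_det_Jm:
  assumes "\<And>i. cv (Suc q) (\<lambda>y. f y i) (F i) Fl" "\<And>i. Cb (Suc q) (F i)"
  shows "cv q (\<lambda>y x. det (Jm (f y) x)) (\<lambda>x. det (Jm F x)) Fl"
  unfolding Jm_def by (intro cv_det cv_Jm_entry Cb_Jm_entry assms)

lemma cv_Minv:
  assumes f: "\<And>i. cv (Suc q) (\<lambda>y. f y i) (F i) Fl" and ev: "eventually (\<lambda>y. dif q \<delta> (f y)) Fl" and F: "dif q \<delta> F"
  shows "cv q (\<lambda>y. Minv (f y) k l) (Minv F k l) Fl"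
proof -
  note CF = AP_Cb[OF dif_AP[OF F]]
  have CD: "Cb q (\<lambda>x. det (Jm F x))" by (rule AP_Cb[OF AP_det_Jm[OF dif_AP[OF F]]])
  have a: "cv q (\<lambda>y x. if j = k then (if i = l then 1 else 0) else (if i = j then 1 else 0) + pderiv_dir j (f y i) x)
     (\<lambda>x. if j = k then (if i = l then 1 else 0) else (if i = j then 1 else 0) + pderiv_dir j (F i) x) Fl" for i j
  proof (cases "j = k")
    case False
    with cv_Jm_entry[where f = f and F = F and i = i and j = j, OF f CF] show ?thesis by (simp only: if_False)
  qed (simp add: cv_const)
  have b: "Cb q (\<lambda>x. if j = k then (if i = l then 1 else 0) else (if i = j then 1 else 0) + pderiv_dir j (F i) x)" for i j
  proof (cases "j = k")
    case False
    with Cb_Jm_entry[where F = F and i = i and j = j, OF CF] show ?thesis by (simp only: if_False)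
  qed (simp add: Cb_const)
  note 1 = a b
  have 2: "cv q (\<lambda>y x. 1 / det (Jm (f y) x)) (\<lambda>x. 1 / det (Jm F x)) Fl"
    by (rule cv_recip[OF cv_det_Jm[OF f CF] CD dif_pos[OF F] _ dif_det[OF F]])
      (use ev in \<open>eventually_elim, simp add: dif_def\<close>)
  show ?thesis
    unfolding Minv_def
    by (rule cv_mult[OF cv_det(1)[OF 1] 2 cv_det(2)[OF 1] Cb_recip[OF CD dif_pos[OF F] dif_det[OF F]]])
qed

lemma dif_bij: assumes f: "dif q \<delta> f" shows "bij (shift f)"
proof -
  obtain c where c: "\<forall>j. bd (Suc q) c (f j)" using Cb_family[of "Suc q" f, OF AP_Cb[OF dif_AP[OF f]]] by blast
  show ?thesis
    by (rule shift_bij[OF bd_has_pd[OF c[rule_format]] bd_pd_cont[OF c[rule_format]] bd_abs[OF c[rule_format]] dif_det_nz[OF f]])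
qed

lemma inv_disp_right: "dif q \<delta> f \<Longrightarrow> shift f (shift (inv_disp f) y) = y"
  using dif_bij[of q \<delta> f] by (simp add: shift_inv_disp bij_is_surj surj_f_inv_f)

lemma inv_disp_left: "dif q \<delta> f \<Longrightarrow> shift (inv_disp f) (shift f y) = y"
  using dif_bij[of q \<delta> f] by (simp add: shift_inv_disp bij_is_inj inv_f_f)

lemma inv_disp_eq: "dif q \<delta> f \<Longrightarrow> inv_disp f j y = - f j (shift (inv_disp f) y)"
  using inv_disp_right[of q \<delta> f y, THEN arg_cong, of "\<lambda>v. v $ j"] by simp

text \<open>By invariance of domain. Continuity comes first because the differential of the inverse
  is computed from it, and the Lipschitz bound from the differential.\<close>

lemma inv_cont:
  assumes f: "dif q \<delta> f" shows "continuous_on UNIV (shift (inv_disp f))"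
proof -
  have cf: "continuous_on UNIV (shift f)"
    by (rule continuous_shift) (rule Cb_cont[OF AP_Cb[OF dif_AP[OF f]]])
  have inj: "inj (shift f)" using dif_bij[OF f] by (rule bij_is_inj)
  obtain g where g: "homeomorphism UNIV (range (shift f)) (shift f) g"
    using invariance_of_domain_homeomorphism[OF open_UNIV cf _ inj] by auto
  have "g (shift f x) = x" for x using g by (simp add: homeomorphism_def)
  then have "g y = shift (inv_disp f) y" for y
    by (metis inv_disp_right[OF f])
  moreover have "range (shift f) = UNIV" using dif_bij[OF f] by (rule bij_is_surj)
  ultimately show ?thesis using g by (simp add: homeomorphism_def)
qed

text \<open>The differential of the inverse is the inverse Jacobian at the preimage; the unit matrix
  is subtracted because the displacement and not the map is differentiated.\<close>

lemma inv_disp_has_pd: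
  assumes f: "dif q \<delta> f"
  shows "has_pd i (inv_disp f j) (\<lambda>y. Minv f j i (shift (inv_disp f) y) - (if i = j then 1 else 0))"
proof (rule has_pd_of_has_derivative[where f' = "\<lambda>i y. Minv f j i (shift (inv_disp f) y) - (if i = j then 1 else 0)"])
  fix y
  let ?x = "shift (inv_disp f) y"
  let ?M = "\<chi> k l. Minv f k l ?x"
  note C = AP_Cb[OF dif_AP[OF f]]
  have "(shift (inv_disp f) has_derivative (\<lambda>h. ?M *v h)) (at y)"
  proof (rule has_derivative_inverse_basic[where f = "shift f" and f' = "\<lambda>h. Jm f ?x *v h" and T = UNIV])
    show "(shift f has_derivative (\<lambda>h. Jm f ?x *v h)) (at ?x)"
      by (rule shift_has_derivative[OF Cb_has_pd[OF C] Cb_cont[OF Cb_pd[OF C]]])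
    show "(\<lambda>h. ?M *v h) \<circ> (\<lambda>h. Jm f ?x *v h) = id"
      by (simp add: fun_eq_iff matrix_vector_mul_assoc Minv_left[OF dif_det_nz[OF f]])
    show "isCont (shift (inv_disp f)) y" using inv_cont[OF f] by (simp add: continuous_on_eq_continuous_at)
  qed (use inv_disp_right[OF f] in auto)
  then have "((\<lambda>y. shift (inv_disp f) y $ j - y $ j) has_derivative (\<lambda>h. (?M *v h) $ j - h $ j)) (at y)"
    by (intro has_derivative_diff bounded_linear.has_derivative[OF bounded_linear_vec_nth] has_derivative_ident)
  moreover have "(?M *v h) $ j - h $ j = (\<Sum>i\<in>UNIV. h $ i * (Minv f j i ?x - (if i = j then 1 else 0)))" for h
  proof -
    have "(\<Sum>i\<in>UNIV. h $ i * (Minv f j i ?x - (if i = j then 1 else 0))) = (\<Sum>i\<in>UNIV. Minv f j i ?x * h $ i - (if i = j then h $ i else 0))"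
      by (intro sum.cong) (auto simp: algebra_simps)
    then show ?thesis by (simp add: matrix_vector_mult_def sum_subtractf)
  qed
  moreover have "(\<lambda>y. shift (inv_disp f) y $ j - y $ j) = inv_disp f j" by simp
  ultimately show "(inv_disp f j has_derivative (\<lambda>h. \<Sum>i\<in>UNIV. h $ i * (Minv f j i ?x - (if i = j then 1 else 0)))) (at y)"
    by simp
qed

lemma Minv_inv_cont: "dif q \<delta> f \<Longrightarrow> continuous_on UNIV (\<lambda>y. Minv f j i (shift (inv_disp f) y) - (if i = j then 1 else 0))"
  by (intro continuous_on_diff continuous_on_const continuous_on_compose2[OF Cb_cont[OF AP_Cb[OF AP_Minv]] inv_cont]) auto

lemma inv_disp_pd_bound:
  fixes f :: "'n::finite \<Rightarrow> real^'n \<Rightarrow> real"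
  assumes "\<forall>k l. bd p m (Minv f k l)"
  shows "\<bar>Minv f j i z - (if i = j then 1 else 0)\<bar> \<le> m + 1"
  using bd_abs[OF assms[rule_format, of j i], of z] by auto

text \<open>The constant depends on \<open>f\<close> only through the bound \<open>m\<close> for the
  inverse Jacobian, so it is locally uniform in \<open>f\<close>; the added 1 accounts for the
  subtracted unit matrix.\<close>

lemma inv_disp_lipschitz:
  fixes f :: "'n::finite \<Rightarrow> real^'n \<Rightarrow> real"
  assumes f: "dif q \<delta> f" and m: "\<forall>k l. bd p m (Minv f k l)"
  shows "\<bar>inv_disp f j x - inv_disp f j y\<bar> \<le> real CARD('n) * (m + 1) * norm (x - y)"
  by (rule C1_lipschitz[OF inv_disp_has_pd[OF f] Minv_inv_cont[OF f] inv_disp_pd_bound[OF m]])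

lemma inv_lip:
  fixes f :: "'n::finite \<Rightarrow> real^'n \<Rightarrow> real"
  assumes f: "dif q \<delta> f" and m: "\<forall>k l. bd p m (Minv f k l)"
  shows "lip (1 + real CARD('n) * (real CARD('n) * (m + 1))) (shift (inv_disp f))"
  by (rule lip_shift) (rule inv_disp_lipschitz[OF f m])

lemma Minv_bound:
  assumes f: "dif q \<delta> f"
  shows "\<exists>m>0. \<forall>k l. bd q m (Minv f k l)"
  using Cb_family[of q "\<lambda>p. Minv f (fst p) (snd p)", OF AP_Cb[OF AP_Minv[OF f]]] by auto

text \<open>Bootstrapping: the derivatives of the inverse displacement are entries of the inverse
  Jacobian composed with the inverse map, up to constants. Order \<open>p\<close> of the
  displacement thus gives order \<open>p\<close> of its derivatives as long as
  \<open>p \<le> q\<close>.\<close>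

lemma inv_disp_Cb:
  assumes f: "dif q \<delta> f"
  shows "p \<le> Suc q \<Longrightarrow> Cb p (inv_disp f j)"
proof (induction p arbitrary: j)
  obtain c where c: "\<forall>j. bd (Suc q) c (f j)" using Cb_family[of "Suc q" f, OF AP_Cb[OF dif_AP[OF f]]] by blast
  have b: "\<bar>inv_disp f j y\<bar> \<le> c" for j y
    by (subst inv_disp_eq[OF f]) (simp add: bd_abs[OF c[rule_format]])
  from Minv_bound[OF f] obtain m where m: "\<forall>k l. bd q m (Minv f k l)" by blast
  have cont: "continuous_on UNIV (inv_disp f j)" for j
  proof -
    have "continuous_on UNIV (\<lambda>y. - f j (shift (inv_disp f) y))"
      by (intro continuous_on_minus continuous_on_compose2[OF bd_cont[OF c[rule_format]] inv_cont[OF f]]) auto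
    moreover have "inv_disp f j = (\<lambda>y. - f j (shift (inv_disp f) y))" by (rule ext) (rule inv_disp_eq[OF f])
    ultimately show ?thesis by (subst \<open>inv_disp f j = _\<close>)
  qed
  {
    case 0
    show ?case
    proof (rule bd0_of_C1[OF _ inv_disp_has_pd[OF f] Minv_inv_cont[OF f] _ cont, where c = "max c (m + 1)"])
      show "\<bar>inv_disp f j x\<bar> \<le> max c (m + 1)" for x using b[of j x] by simp
      show "\<bar>Minv f j i (shift (inv_disp f) x) - (if i = j then 1 else 0)\<bar> \<le> max c (m + 1)" for i x
        by (rule order_trans[OF inv_disp_pd_bound[OF m]]) simp
    qed
  next
    case (Suc p)
    then have IH: "Cb p (inv_disp f j)" for j by simp
    show ?case
    proof (rule Cb_SucI[OF b cont inv_disp_has_pd[OF f]])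
      show "Cb p (\<lambda>y. Minv f j i (shift (inv_disp f) y) - (if i = j then 1 else 0))" for i
        by (intro Cb_diff Cb_const Cb_comp[OF Cb_embed_le[OF _ AP_Cb[OF AP_Minv[OF f]]] IH inv_lip[OF f m]])
          (use Suc.prems in simp)
    qed
  }
qed

text \<open>The same bootstrap for convergence. At order 0 the two inverses are compared in the
  supremum norm through the Lipschitz inverse of \<open>shift F\<close>, and
  \<open>bd0_interp\<close> upgrades this by the Lipschitz bounds common to all \<open>f y\<close>
  near the limit.\<close>

lemma inv_disp_cv:
  fixes F :: "'n::finite \<Rightarrow> real^'n \<Rightarrow> real"
  assumes f: "\<And>i. cv (Suc q) (\<lambda>y. f y i) (F i) Fl" and ev: "eventually (\<lambda>y. dif q \<delta> (f y)) Fl" and F: "dif q \<delta> F"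
  shows "p \<le> Suc q \<Longrightarrow> cv p (\<lambda>y. inv_disp (f y) j) (inv_disp F j) Fl"
proof (induction p arbitrary: j)
  let ?n = "real CARD('n)"
  from Minv_bound[OF F] obtain m where m0: "m > 0" "\<forall>k l. bd q m (Minv F k l)" by blast
  have m1: "\<forall>k l. bd q (m + 1) (Minv F k l)" using m0 by (blast intro: bd_mono less_imp_le less_add_one)
  have cM: "cv q (\<lambda>y. Minv (f y) k l) (Minv F k l) Fl" for k l by (rule cv_Minv[OF f ev F])
  have evm: "eventually (\<lambda>y. \<forall>k l. bd q (m + 1) (Minv (f y) k l)) Fl"
    by (intro eventually_all_finite cv_bounded[OF cM m0(2)[rule_format]])
  \<comment> \<open>In \<open>m + 1 + 1\<close> the first unit covers the inverse Jacobians of the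
    nearby \<open>f y\<close>, the second the unit matrix subtracted in the derivative of the
    displacement.\<close>
  let ?L = "1 + ?n * (?n * (m + 1 + 1))"
  have lF: "lip ?L (shift (inv_disp F))" by (rule inv_lip[OF F m1])
  have evl: "eventually (\<lambda>y. lip ?L (shift (inv_disp (f y)))) Fl"
    using ev evm by eventually_elim (rule inv_lip)
  have L: "?L > 0" using m0(1) by (intro add_pos_nonneg mult_nonneg_nonneg) auto
  have n1: "?n \<ge> 1" by (simp add: Suc_leI)
  {
    case 0
    let ?\<Lambda> = "2 * (?n * (m + 1 + 1))"
    have \<Lambda>: "?\<Lambda> \<ge> 0" using m0(1) by simp
    show ?case
      unfolding cv_def small_def
    proof (intro allI impI)
      fix e :: real assume e: "e > 0"
      from bd0_interp[OF \<Lambda> e] obtain s where s: "s > 0"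
        and sP: "\<forall>v::real^'n \<Rightarrow> real. continuous_on UNIV v \<longrightarrow> (\<forall>x. \<bar>v x\<bar> \<le> s) \<longrightarrow>
          (\<forall>x y. \<bar>v x - v y\<bar> \<le> ?\<Lambda> * norm (x - y)) \<longrightarrow> bd 0 e v" by blast
      define s' where "s' = s / (?L * ?n)"
      have s': "s' > 0" using s L n1 by (simp add: s'_def)
      have "eventually (\<lambda>y. \<forall>i. bd (Suc q) s' (\<lambda>x. f y i x - F i x)) Fl"
        by (intro eventually_all_finite smallD[OF f[unfolded cv_def] s'])
      then show "eventually (\<lambda>y. bd 0 e (\<lambda>x. inv_disp (f y) j x - inv_disp F j x)) Fl"
        using ev evm
      proof eventually_elim
        case (elim y)
        show ?case
        proof (rule sP[rule_format])
          show "continuous_on UNIV (\<lambda>x. inv_disp (f y) j x - inv_disp F j x)"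
            by (intro continuous_on_diff Cb_cont[OF inv_disp_Cb[OF elim(2), of 0]] Cb_cont[OF inv_disp_Cb[OF F, of 0]]) auto
          fix x
          let ?a = "shift (inv_disp (f y)) x" and ?b = "shift (inv_disp F) x"
          have "inv_disp (f y) j x - inv_disp F j x = (?a - ?b) $ j" by simp
          also have "\<bar>\<dots>\<bar> \<le> norm (?a - ?b)" by (rule component_le_norm_cart)
          \<comment> \<open>Writing \<open>?a\<close> as the inverse of \<open>shift F\<close> at
            its image moves the comparison to \<open>shift F ?a - x\<close>, which is the difference
            of \<open>F\<close> and \<open>f y\<close> evaluated at \<open>?a\<close>.\<close>
          also have "?a - ?b = shift (inv_disp F) (shift F ?a) - shift (inv_disp F) x" by (simp add: inv_disp_left[OF F])
          also have "norm \<dots> \<le> ?L * norm (shift F ?a - x)" using lF by (simp add: lip_def)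
          also have "shift F ?a - x = (\<chi> i. F i ?a - f y i ?a)"
          proof -
            have "shift F ?a - shift (f y) ?a = (\<chi> i. F i ?a - f y i ?a)" by (simp add: vec_eq_iff)
            then show ?thesis by (simp only: inv_disp_right[OF elim(2)])
          qed
          also have "norm \<dots> \<le> (\<Sum>i\<in>UNIV. \<bar>F i ?a - f y i ?a\<bar>)" by (rule norm_vec_le_sum)
          also have "\<dots> \<le> (\<Sum>i\<in>(UNIV::'n set). s')"
            using bd_abs[OF elim(1)[rule_format], of _ ?a] by (intro sum_mono) (simp add: abs_minus_commute)
          also have "?L * \<dots> = s" using L n1 by (simp add: s'_def)
          finally show "\<bar>inv_disp (f y) j x - inv_disp F j x\<bar> \<le> s" using L by (simp add: mult_left_mono)
        next
          fix x z
          have "\<bar>inv_disp (f y) j x - inv_disp (f y) j z\<bar> \<le> ?n * (m + 1 + 1) * norm (x - z)"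
            by (rule inv_disp_lipschitz[OF elim(2,3)])
          moreover have "\<bar>inv_disp F j x - inv_disp F j z\<bar> \<le> ?n * (m + 1 + 1) * norm (x - z)"
            by (rule inv_disp_lipschitz[OF F m1])
          ultimately show "\<bar>inv_disp (f y) j x - inv_disp F j x - (inv_disp (f y) j z - inv_disp F j z)\<bar> \<le> ?\<Lambda> * norm (x - z)"
            by linarith
        qed
      qed
    qed
  next
    case (Suc p)
    then have IH: "cv p (\<lambda>y. inv_disp (f y) j) (inv_disp F j) Fl" for j by simp
    have pq: "p \<le> q" using Suc.prems by simp
    show ?case
    proof (rule cv_Suc[OF IH _ _ inv_disp_has_pd[OF F]])
      show "eventually (\<lambda>y. \<forall>i. has_pd i (inv_disp (f y) j) (\<lambda>x. Minv (f y) j i (shift (inv_disp (f y)) x) - (if i = j then 1 else 0))) Fl"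
        using ev by eventually_elim (intro allI inv_disp_has_pd)
      show "cv p (\<lambda>y x. Minv (f y) j i (shift (inv_disp (f y)) x) - (if i = j then 1 else 0))
          (\<lambda>x. Minv F j i (shift (inv_disp F) x) - (if i = j then 1 else 0)) Fl" for i
        by (intro cv_diff cv_const cv_comp[OF cv_embed_le[OF pq cM] AP_approx[OF AP_embed_le[OF pq AP_Minv[OF F]]] IH
            inv_disp_Cb[OF F] evl lF]) (use Suc.prems in simp)
    qed
  }
qed

lemma Jm_translate:
  assumes "\<And>i. Cb (Suc q) (f i)"
  shows "Jm (\<lambda>j x. f j (x + s)) x = Jm f (x + s)"
  by (simp add: Jm_def pd_translate[OF assms])

lemma AP_translate: assumes f: "AP p f" shows "AP p (\<lambda>x. f (x + a))"
  by (rule AP_limit[OF f, of "\<lambda>_. a"]) (simp_all add: cv_const Cb_translate[OF AP_Cb[OF f]])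

lemma dif_translate:
  assumes f: "dif q \<delta> f"
  shows "dif q \<delta> (\<lambda>j x. f j (x + s))"
  unfolding dif_def Jm_translate[of q f, OF AP_Cb[OF dif_AP[OF f]]]
  using AP_translate[OF dif_AP[OF f]] dif_pos[OF f] dif_det[OF f] by blast

text \<open>Translating \<open>f\<close> conjugates the map \<open>id + f\<close> by a translation,
  and inversion respects conjugation.\<close>

lemma inv_disp_translate:
  assumes f: "dif q \<delta> f"
  shows "inv_disp (\<lambda>j x. f j (x + s)) j y = inv_disp f j (y + s)"
proof -
  let ?fs = "\<lambda>j x. f j (x + s)"
  have "shift ?fs (shift (inv_disp f) (y + s) - s) = y"
  proof -
    have "shift ?fs z + s = shift f (z + s)" for z by (rule shift_translate)
    from this[of "shift (inv_disp f) (y + s) - s"] show ?thesis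
      by (simp add: inv_disp_right[OF f])
  qed
  then have "shift (inv_disp ?fs) y = shift (inv_disp f) (y + s) - s"
    by (metis inv_disp_left[OF dif_translate[OF f]])
  then have "shift (inv_disp ?fs) y $ j = (shift (inv_disp f) (y + s) - s) $ j" by simp
  then show ?thesis by simp
qed

text \<open>Translates of the inverse displacement are inverse displacements of translates. The
  lower bound \<open>\<delta>\<close> survives in the limit \<open>G\<close>, so \<open>G\<close> is
  admissible and \<open>inv_disp_cv\<close> identifies the limit.\<close>

lemma inv_disp_AP:
  fixes f :: "'n::finite \<Rightarrow> real^'n \<Rightarrow> real"
  assumes f: "dif q \<delta> f"
  shows "AP (Suc q) (inv_disp f j)"
proof (rule AP_opI[where f = f and q = "\<lambda>_. Suc q"])
  show "AP (Suc q) (f j)" for j by (rule dif_AP[OF f])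
  show "Cb (Suc q) (inv_disp f j)" by (rule inv_disp_Cb[OF f order_refl])
  fix s :: "nat \<Rightarrow> real^'n" and G :: "'n \<Rightarrow> real^'n \<Rightarrow> real"
  assume G: "\<And>j. AP (Suc q) (G j)" and cG: "\<And>j. cv (Suc q) (\<lambda>k x. f j (x + s k)) (G j) sequentially"
  have cD: "cv q (\<lambda>k x. det (Jm (\<lambda>j x. f j (x + s k)) x)) (\<lambda>x. det (Jm G x)) sequentially"
    by (rule cv_det_Jm[OF cG AP_Cb[OF G]])
  have "\<delta> \<le> det (Jm G x)" for x
    by (rule LIMSEQ_le_const[OF cv_pointwise[OF cD]]) (use dif_det[OF dif_translate[OF f]] in blast)
  then have dG: "dif q \<delta> G" using G dif_pos[OF f] by (simp add: dif_def)
  have "cv (Suc q) (\<lambda>k. inv_disp (\<lambda>j x. f j (x + s k)) j) (inv_disp G j) sequentially"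
    by (rule inv_disp_cv[OF cG _ dG order_refl]) (simp add: dif_translate[OF f])
  then have "cv (Suc q) (\<lambda>k x. inv_disp f j (x + s k)) (inv_disp G j) sequentially"
    by (simp add: inv_disp_translate[OF f, abs_def])
  then show "\<exists>H. Cb (Suc q) H \<and> cv (Suc q) (\<lambda>k x. inv_disp f j (x + s k)) H sequentially"
    using inv_disp_Cb[OF dG order_refl] by blast
qed

end

section \<open>Smoothness of inversion\<close>

context cr_domain
begin

lemma Sm_det:
  fixes A :: "'n::finite \<Rightarrow> 'n \<Rightarrow> 'a \<Rightarrow> real^'n \<Rightarrow> real"
  assumes "\<And>i j. Sm r {} p (\<lambda>x h. A i j x)"
  shows "Sm r {} p (\<lambda>x h t. det (\<chi> i j. A i j x t))"
proof -
  define P where "P = (\<lambda>F :: 'a \<times> (real^'n) \<Rightarrow> real. Sm r {} p (\<lambda>x h t. F (x, t)))"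
  have "P (\<lambda>x. det (\<chi> i j. A i j (fst x) (snd x)))"
  proof (rule det_closed)
    show "P (\<lambda>x. c)" for c unfolding P_def by (rule Sm_const) (simp add: mlin_empty AP_const)
    show "P (\<lambda>x. f x + g x)" if "P f" "P g" for f g
      using that unfolding P_def by (rule Sm_add)
    show "P (\<lambda>x. f x * g x)" if "P f" "P g" for f g
      using Sm_mult[OF that[unfolded P_def]] unfolding P_def by simp
    show "P (\<lambda>x. A i j (fst x) (snd x))" for i j
      using assms[of i j] by (simp add: P_def)
  qed
  then show ?thesis by (simp add: P_def)
qed

lemma Sm_Jm_entry:
  assumes "Sm r {} (Suc p) (\<lambda>x h. f x i)"
  shows "Sm r {} p (\<lambda>x h t. (if i = j then 1 else 0) + pderiv_dir j (f x i) t)"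
  by (intro Sm_add Sm_const Sm_pd assms) (simp add: mlin_empty AP_const)

lemma Sm_det_Jm:
  assumes "\<And>i. Sm r {} (Suc p) (\<lambda>x h. f x i)"
  shows "Sm r {} p (\<lambda>x h t. det (Jm (f x) t))"
  unfolding Jm_def by (rule Sm_det) (rule Sm_Jm_entry[OF assms])

lemma Sm_Minv:
  assumes f: "\<And>i. Sm r {} (Suc p) (\<lambda>x h. f x i)"
    and det: "\<And>x. x \<in> U \<Longrightarrow> \<exists>\<delta>>0. \<forall>t. \<delta> \<le> det (Jm (f x) t)"
  shows "Sm r {} p (\<lambda>x h. Minv (f x) k l)"
proof -
  have e: "Sm r {} p (\<lambda>x h t. if j = k then (if i = l then 1 else 0) else (if i = j then 1 else 0) + pderiv_dir j (f x i) t)" for i j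
  proof (cases "j = k")
    case True
    have "Sm r {} p (\<lambda>x h t. if i = l then 1 else 0)" by (rule Sm_const) (simp add: mlin_empty AP_const)
    then show ?thesis by (simp only: True if_True simp_thms)
  next
    case False
    with Sm_Jm_entry[where f = f and i = i and j = j, OF f] show ?thesis by (simp only: if_False)
  qed
  have "Sm r ({} \<union> {}) p (\<lambda>x h t. det (\<chi> i j. if j = k then (if i = l then 1 else 0) else
     (if i = j then 1 else 0) + pderiv_dir j (f x i) t) * (1 / det (Jm (f x) t)))"
    by (rule Sm_mult[OF Sm_det[OF e] Sm_recip[OF Sm_det_Jm[OF f] det]]) auto
  then show ?thesis by (simp add: Minv_def[abs_def])
qed

text \<open>The family \<open>f\<close> is linear in the parameter, as the chart is. The derivative
  is again built from the inverse Jacobian and the inverse map, so an induction on \<open>s\<close>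
  applies; the values keep the order \<open>Suc q\<close> while the \<open>r\<close> extra orders of
  \<open>f\<close> pay for the differentiations.\<close>

lemma Sm_inv_disp:
  fixes f :: "'a \<Rightarrow> 'n::finite \<Rightarrow> real^'n \<Rightarrow> real"
  assumes fAP: "\<And>j v. v \<in> VA \<Longrightarrow> AP (Suc q + r) (f v j)"
    and fbd: "\<And>j v. v \<in> VA \<Longrightarrow> bd (Suc q + r) (C * NA v) (f v j)"
    and fadd: "\<And>j u v t. f (u + v) j t = f u j t + f v j t"
    and fscale: "\<And>j c u t. f (c *\<^sub>R u) j t = c * f u j t"
    and C: "C > 0"
    and det: "\<And>x. x \<in> U \<Longrightarrow> \<exists>\<delta>>0. \<forall>t. \<delta> \<le> det (Jm (f x) t)"
  shows "s \<le> r \<Longrightarrow> Sm s {} (Suc q) (\<lambda>x h. inv_disp (f x) j)"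
proof (induction s arbitrary: j)
  let ?k = "Suc q"
  let ?g = "\<lambda>j x. inv_disp (f x) j"
  have fS: "Sm s {} (?k + r) (\<lambda>x h. f x j)" for s j
    by (rule Sm_coord[where C = C]) (use fAP fbd fadd fscale C in auto)
  have fSk: "Sm s {} ?k (\<lambda>x h. f x j)" for s j
    by (rule Sm_embed_le[OF _ fS]) simp
  have fml: "mlin {a} (?k + r) (\<lambda>h. f (h a) j)" for a j
    by (rule mlin_coord[where C = C]) (use fAP fbd fadd fscale in auto)
  have fsub: "f (y - x) j t = f y j t - f x j t" for x y j t
    using fadd[of "y - x" x j t] by simp
  have cvf: "cv ?k (\<lambda>y. f y j) (f x j) (nb x)" if "x \<in> U" for x j
    using fSk[of 0 j, unfolded Sm0_empty] that by blast
  have fAPk: "AP ?k (f x j)" if "x \<in> U" for x j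
    using fSk[of 0 j, unfolded Sm0_empty] that by blast
  have dif: "\<exists>\<delta>. dif q \<delta> (f x) \<and> eventually (\<lambda>y. dif q \<delta> (f y)) (nb x)" if x: "x \<in> U" for x
  proof -
    from det[OF x] obtain \<delta> where \<delta>: "\<delta> > 0" "\<forall>t. \<delta> \<le> det (Jm (f x) t)" by blast
    have h: "\<delta> / 2 > 0" using \<delta> by simp
    have "cv q (\<lambda>y t. det (Jm (f y) t)) (\<lambda>t. det (Jm (f x) t)) (nb x)"
      by (rule cv_det_Jm[OF cvf[OF x] AP_Cb[OF fAPk[OF x]]])
    from smallD[OF this[unfolded cv_def] h]
    have "eventually (\<lambda>y. dif q (\<delta> / 2) (f y)) (nb x)"
      using eventually_nb_U
    proof eventually_elim
      case (elim y)
      have "\<delta> / 2 \<le> det (Jm (f y) t)" for t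
        using bd_abs[OF elim(1), of t] \<delta>(2)[rule_format, of t] by linarith
      then show ?case using fAPk[OF elim(2)] h by (simp add: dif_def)
    qed
    moreover have "\<delta> / 2 \<le> det (Jm (f x) t)" for t using \<delta>(2)[rule_format, of t] h by linarith
    then have "dif q (\<delta> / 2) (f x)" using fAPk[OF x] h by (simp add: dif_def)
    ultimately show ?thesis by blast
  qed
  have g0: "Sm 0 {} ?k (\<lambda>x h. ?g j x)" for j
    unfolding Sm0_empty
  proof
    fix x assume x: "x \<in> U"
    from dif[OF x] obtain \<delta> where \<delta>: "dif q \<delta> (f x)" "eventually (\<lambda>y. dif q \<delta> (f y)) (nb x)" by blast
    show "AP ?k (inv_disp (f x) j) \<and> cv ?k (?g j) (?g j x) (nb x)"
      using inv_disp_AP[OF \<delta>(1)] inv_disp_cv[where f = f, OF cvf[OF x] \<delta>(2,1) order_refl] by blast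
  qed
  {
    case 0
    show ?case by (rule g0)
  next
    case (Suc s)
    then have IH: "Sm s {} ?k (\<lambda>x h. ?g j x)" for j by simp
    have sr: "s \<le> r" "Suc s \<le> r" using Suc.prems by auto
    \<comment> \<open>The inverse Jacobian loses one order, and \<open>Suc s \<le> r\<close> leaves
      \<open>?k + s\<close>, enough for composition without slots.\<close>
    have M1: "Sm s {} (?k + s) (\<lambda>x h. Minv (f x) j l)" for j l
      by (rule Sm_Minv[OF Sm_embed_le[OF _ fS] det]) (use sr in auto)
    have Mc: "Sm s {} ?k (\<lambda>x h t. Minv (f x) j l (shift (inv_disp (f x)) t))" for j l
      using Sm_comp[of ?k s "{}" "\<lambda>x h. Minv (f x) j l" ?g] M1 IH by (simp del: Sm.simps)
    show ?case
    proof (rule Sm_SucI[OF g0])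
      fix a :: nat
      let ?G = "\<lambda>x h t. \<Sum>l\<in>UNIV. (-1) * (Minv (f x) j l (shift (inv_disp (f x)) t) * f (h a) l (shift (inv_disp (f x)) t))"
      \<comment> \<open>The direction \<open>h a\<close> occupies a slot, so composition needs one
        order more, still within \<open>?k + r\<close>.\<close>
      have "Sm s {a} (?k + s + 1) (\<lambda>x h. f (h a) l)" for l
        by (rule Sm_embed_le[OF _ Sm_const[OF fml]]) (use sr in auto)
      then have fc: "Sm s {a} ?k (\<lambda>x h t. f (h a) l (shift (inv_disp (f x)) t))" for l
        using Sm_comp[of ?k s "{a}" "\<lambda>x h. f (h a) l" ?g] IH by (simp del: Sm.simps)
      have "Sm s ({} \<union> {a}) ?k (\<lambda>x h t. Minv (f x) j l (shift (inv_disp (f x)) t) * f (h a) l (shift (inv_disp (f x)) t))" for l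
        by (rule Sm_mult[OF Mc fc]) simp
      then have "Sm s {a} ?k (\<lambda>x h t. Minv (f x) j l (shift (inv_disp (f x)) t) * f (h a) l (shift (inv_disp (f x)) t))" for l
        by (simp del: Sm.simps)
      then have G: "Sm s {a} ?k ?G" by (intro Sm_sum Sm_cmult) auto
      have "dr {} ?k x (\<lambda>x h. ?g j x) ?G a" if x: "x \<in> U" for x
      proof -
        note w = eventually_nb_NA[OF x]
        let ?n = "real CARD('n)" and ?Km = "Kmul TYPE('n) ?k"
        let ?psi = "shift (inv_disp (f x))"
        let ?v = "\<lambda>y j t. ?g j y t - ?g j x t"
        let ?E = "\<lambda>y l. comp_rem (f x l) (inv_disp (f x)) (inv_disp (f y))"
        obtain \<delta> where dfx: "dif q \<delta> (f x)" using dif[OF x] by blast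
        have k1: "1 \<le> ?k" by simp
        obtain R where R: "\<forall>j. bd ?k R (?g j x)" "lip R (shift (\<lambda>j. ?g j x))"
          and evR: "eventually (\<lambda>y. (\<forall>j. bd ?k R (?g j y)) \<and> lip R (shift (\<lambda>j. ?g j y))) (nb x)"
          using inner_bounds[where g = ?g, OF g0 k1 x] by blast
        have "AP ?k (\<lambda>t. Minv (f x) j l (?psi t))" for j l
          using Sm_mlin[OF Mc x] by (simp only: mlin_empty)
        then have "\<exists>m>0. \<forall>p. bd ?k m (\<lambda>t. Minv (f x) (fst p) (snd p) (?psi t))"
          by (intro Cb_family AP_Cb)
        then obtain m where m: "m > 0" "\<And>j l. bd ?k m (\<lambda>t. Minv (f x) j l (?psi t))" by auto
        \<comment> \<open>The equations of the two inverse displacements are subtracted and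
          \<open>f x\<close> is expanded to first order along the inverse maps. This gives $(I +
          df_x) v = -f_{y-x} - E$, with $f_{y-x}$ taken along the inverse map for \<open>y\<close>;
          the matrix is then inverted.\<close>
        have v_eq: "?v y j t = (\<Sum>l\<in>UNIV. Minv (f x) j l (?psi t) * (- f (y - x) l (shift (inv_disp (f y)) t) - ?E y l t))"
          if y: "y \<in> U" for y j t
        proof (rule Minv_solve[where v = "\<lambda>j. ?v y j t"])
          show "det (Jm (f x) (?psi t)) \<noteq> 0" by (rule dif_det_nz[OF dfx])
          obtain \<delta>' where dfy: "dif q \<delta>' (f y)" using dif[OF y] by blast
          fix i
          have "inv_disp (f y) i t = - f y i (shift (inv_disp (f y)) t)" "inv_disp (f x) i t = - f x i (?psi t)"
            by (rule inv_disp_eq[OF dfy] inv_disp_eq[OF dfx])+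
          then show "?v y i t + (\<Sum>j\<in>UNIV. pderiv_dir j (f x i) (?psi t) * ?v y j t)
              = - f (y - x) i (shift (inv_disp (f y)) t) - ?E y i t"
            by (simp add: comp_rem_def fsub)
        qed
        define C1 where "C1 = (2 * ?n) ^ (?k + r - ?k) * C"
        have C1: "C1 > 0" using C by (simp add: C1_def)
        have fu: "bd ?k (C1 * NA u) (f u l)" if "u \<in> VA" for u l
          using bd_embed_le[OF _ fbd[OF that], of ?k l] by (simp add: C1_def mult.assoc)
        \<comment> \<open>Makes the contribution of the remainder \<open>?E\<close> exactly half of
          the current bound on \<open>?v\<close>, as \<open>bd_absorb\<close> requires.\<close>
        define e1 where "e1 = 1 / (2 * (?n * (?Km * m)))"
        have nKm: "?n * (?Km * m) > 0" using m(1) Kmul_pos[of "TYPE('n)" ?k] by simp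
        have e1: "e1 > 0" using nKm by (simp add: e1_def)
        have fx1: "AP (Suc ?k) (f x l)" for l
          using Sm0_empty[of "Suc ?k" "\<lambda>x. f x l"] Sm_embed_le[OF _ fS[of 0 l], of "Suc ?k"] sr x by auto
        have "\<exists>\<delta>>0. \<forall>(g::'n \<Rightarrow> real^'n \<Rightarrow> real) g' d. (\<forall>j. bd ?k R (g j)) \<longrightarrow> (\<forall>j. bd ?k R (g' j)) \<longrightarrow> lip R (shift g) \<longrightarrow>
          lip R (shift g') \<longrightarrow> (\<forall>j. bd ?k d (\<lambda>x. g' j x - g j x)) \<longrightarrow> d \<le> \<delta> \<longrightarrow> bd ?k (e1 * d) (comp_rem (f x l) g g')" for l
          by (rule approx_comp_rem[OF AP_approx[OF fx1] AP_Cb[OF fx1] e1])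
        then have "\<forall>l. \<exists>\<delta>>0. \<forall>(g::'n \<Rightarrow> real^'n \<Rightarrow> real) g' d. (\<forall>j. bd ?k R (g j)) \<longrightarrow> (\<forall>j. bd ?k R (g' j)) \<longrightarrow> lip R (shift g) \<longrightarrow>
          lip R (shift g') \<longrightarrow> (\<forall>j. bd ?k d (\<lambda>x. g' j x - g j x)) \<longrightarrow> d \<le> \<delta> \<longrightarrow> bd ?k (e1 * d) (comp_rem (f x l) g g')" ..
        from choice[OF this] obtain D where D0: "\<forall>l. D l > 0 \<and> (\<forall>(g::'n \<Rightarrow> real^'n \<Rightarrow> real) g' d. (\<forall>j. bd ?k R (g j)) \<longrightarrow> (\<forall>j. bd ?k R (g' j)) \<longrightarrow> lip R (shift g) \<longrightarrow>
          lip R (shift g') \<longrightarrow> (\<forall>j. bd ?k d (\<lambda>x. g' j x - g j x)) \<longrightarrow> d \<le> D l \<longrightarrow> bd ?k (e1 * d) (comp_rem (f x l) g g'))" ..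
        note D = D0[rule_format, THEN conjunct1] D0[rule_format, THEN conjunct2, rule_format]
        define d0 where "d0 = Min (range D)"
        have d0: "d0 > 0" "\<And>l. d0 \<le> D l" using D(1) by (auto simp: d0_def)
        have cvg: "cv ?k (?g j) (?g j x) (nb x)" for j using g0[unfolded Sm0_empty] x by blast
        have evd: "eventually (\<lambda>y. \<forall>j. bd ?k d0 (?v y j)) (nb x)"
          by (intro eventually_all_finite smallD[OF cvg[unfolded cv_def] d0(1)])
        define a0 where "a0 = ?n * (?Km * m) * (Kcomp TYPE('n) ?k R * C1)"
        have a0: "a0 > 0" using nKm C1 Kcomp_ge[where ?'n = 'n, of ?k R] by (simp add: a0_def)
        \<comment> \<open>Continuity of inversion supplies the a priori bound \<open>d0\<close>;
          absorption turns it into a bound proportional to \<open>NA (y - x)\<close>, which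
          \<open>inner_rem\<close> has as its hypothesis.\<close>
        have evO: "eventually (\<lambda>y. \<forall>j. bd ?k (2 * (a0 * NA (y - x))) (?v y j)) (nb x)"
          using evd evR eventually_nb_U
        proof eventually_elim
          case (elim y)
          note uV = diff_VA[OF x elim(3)]
          show ?case
          proof (rule bd_absorb[OF elim(1)])
            fix d assume d: "d \<le> d0" "\<forall>j. bd ?k d (?v y j)"
            have E: "bd ?k (e1 * d) (?E y l)" for l
              by (rule D(2)) (use R elim(2) d order_trans[OF d(1) d0(2)] in auto)
            have W: "bd ?k (Kcomp TYPE('n) ?k R * (C1 * NA (y - x))) (\<lambda>t. f (y - x) l (shift (inv_disp (f y)) t))" for l
              by (rule bd_compI[OF fu[OF uV]]) (use elim(2) in auto)
            have "bd ?k (?n * (?Km * m * (Kcomp TYPE('n) ?k R * (C1 * NA (y - x)) + e1 * d))) (?v y j)" for j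
              unfolding v_eq[OF elim(3)] by (intro bd_sum_const bd_mult[OF m(2) bd_diff[OF bd_minus[OF W] E]])
            moreover have "?n * (?Km * m * (Kcomp TYPE('n) ?k R * (C1 * NA (y - x)) + e1 * d)) = a0 * NA (y - x) + d / 2"
            proof -
              have "?n * (?Km * m) * e1 = 1 / 2" unfolding e1_def using mult_half_div[OF nKm, of 1] by simp
              then have "?n * (?Km * m) * e1 * d = d / 2" by simp
              then show ?thesis by (simp add: a0_def algebra_simps)
            qed
            ultimately show "\<forall>j. bd ?k (a0 * NA (y - x) + d / 2) (?v y j)" by simp
          qed
        qed
        have O: "\<exists>C>0. eventually (\<lambda>y. bd ?k (C * NA (y - x)) (?v y j)) (nb x)" for j
          by (rule exI[of _ "2 * a0"], rule conjI, use a0 in simp, use evO in \<open>eventually_elim, simp only: mult.assoc\<close>)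
        have mx: "mlin {} (Suc ?k + (if {} = ({} :: nat set) then 0 else 1)) (\<lambda>h. f x l)" for l
          by (simp add: mlin_empty fx1)
        have sE: "sml (\<lambda>y. NA (y - x)) {} ?k (nb x) (\<lambda>y h. ?E y l)" for l
          using inner_rem[where g = ?g, OF mx g0 k1 x O, of l] by simp
        have ma: "mlin {a} (?k + (if {a} = {} then 0 else 1)) (\<lambda>h. f (h a) l)" for l
          using Sm_mlin[OF Sm_embed_le[OF _ Sm_const[OF fml[of a l]], of "Suc ?k" 0] x] sr by simp
        \<comment> \<open>Replacing the inverse for \<open>y\<close> by that for \<open>x\<close> in
          the main term costs little-o of \<open>NA (y - x)\<close>: composition is continuous in
          operator norm on the slot, and the slot holds \<open>y - x\<close>.\<close>
        have sW: "sml (\<lambda>y. NA (y - x)) {} ?k (nb x) (\<lambda>y h t. f (y - x) l (shift (inv_disp (f y)) t) - f (y - x) l (?psi t))" for l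
        proof (rule sml_I[OF smlD[OF inner_ct[where g = ?g, OF ma[of l] g0 k1 x]] _ w, where K = 1])
          show "eventually (\<lambda>y. \<forall>e>0. bnd {a} ?k (e * 1) (\<lambda>h t. f (h a) l (shift (\<lambda>j. ?g j y) t) - f (h a) l (shift (\<lambda>j. ?g j x) t)) \<longrightarrow>
              bnd {} ?k (1 * e * NA (y - x)) (\<lambda>h t. f (y - x) l (shift (inv_disp (f y)) t) - f (y - x) l (?psi t))) (nb x)"
            using eventually_nb_U
          proof (eventually_elim, intro allI impI)
            fix y e assume y: "y \<in> U" and e: "bnd {a} ?k (e * 1) (\<lambda>h t. f (h a) l (shift (\<lambda>j. ?g j y) t) - f (h a) l (shift (\<lambda>j. ?g j x) t))"
            from bnd_slot[OF e _ _ diff_VA[OF x y]]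
            show "bnd {} ?k (1 * e * NA (y - x)) (\<lambda>h t. f (y - x) l (shift (inv_disp (f y)) t) - f (y - x) l (?psi t))" by simp
          qed
        qed simp
        have "sml (\<lambda>y. NA (y - x) * 1) ({} \<union> {}) ?k (nb x) (\<lambda>y h t.
            ((f (y - x) l (shift (inv_disp (f y)) t) - f (y - x) l (?psi t)) + ?E y l t) * - Minv (f x) j l (?psi t))" for l
        proof (rule sml_mult_left[OF sml_add[OF sW sE], where C = m])
          have "bnd {} ?k (m * 1) (\<lambda>h t. - Minv (f x) j l (?psi t))" unfolding bnd_empty using bd_minus[OF m(2)] by simp
          then show "eventually (\<lambda>y. bnd {} ?k (m * 1) (\<lambda>h t. - Minv (f x) j l (?psi t))) (nb x)" by simp
        qed (use w in auto)
        then have "sml (\<lambda>y. NA (y - x)) {} ?k (nb x) (\<lambda>y h t.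
            ((f (y - x) l (shift (inv_disp (f y)) t) - f (y - x) l (?psi t)) + ?E y l t) * - Minv (f x) j l (?psi t))" for l
          by simp
        then have S: "sml (\<lambda>y. NA (y - x)) {} ?k (nb x) (\<lambda>y h t. \<Sum>l\<in>UNIV.
            ((f (y - x) l (shift (inv_disp (f y)) t) - f (y - x) l (?psi t)) + ?E y l t) * - Minv (f x) j l (?psi t))"
          by (intro sml_sum w)
        have eq: "(\<lambda>h t. ?g j y t - ?g j x t - ?G x (h(a := y - x)) t) = (\<lambda>h t. \<Sum>l\<in>UNIV.
            ((f (y - x) l (shift (inv_disp (f y)) t) - f (y - x) l (?psi t)) + ?E y l t) * - Minv (f x) j l (?psi t))"
          if y: "y \<in> U" for y
        proof (intro ext)
          fix h :: "nat \<Rightarrow> 'a" and t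
          show "?g j y t - ?g j x t - ?G x (h(a := y - x)) t = (\<Sum>l\<in>UNIV.
            ((f (y - x) l (shift (inv_disp (f y)) t) - f (y - x) l (?psi t)) + ?E y l t) * - Minv (f x) j l (?psi t))"
            unfolding v_eq[OF y] sum_subtractf[symmetric] by (intro sum.cong) (auto simp: algebra_simps)
        qed
        show ?thesis
          unfolding dr_def
        proof (rule sml_I[OF smlD[OF S] _ w, where K = 1])
          show "eventually (\<lambda>y. \<forall>e>0. bnd {} ?k (e * NA (y - x)) (\<lambda>h t. \<Sum>l\<in>UNIV.
            ((f (y - x) l (shift (inv_disp (f y)) t) - f (y - x) l (?psi t)) + ?E y l t) * - Minv (f x) j l (?psi t)) \<longrightarrow>
            bnd {} ?k (1 * e * NA (y - x)) (\<lambda>h t. ?g j y t - ?g j x t - ?G x (h(a := y - x)) t)) (nb x)"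
            using eventually_nb_U by eventually_elim (simp only: eq mult_1_left, blast)
        qed simp
      qed
      with G show "\<exists>T'. Sm s {a} ?k T' \<and> (\<forall>x\<in>U. dr {} ?k x (\<lambda>x h. ?g j x) T' a)" by blast
    qed
  }
qed

end

subsection \<open>Comparison with the Hoelder norms\<close>

text \<open>\<open>pd\<close> applies the head of the list last, whereas the recursion of
  \<open>bd\<close> takes the innermost derivative first; inductions on the order therefore split
  index lists at their end.\<close>

lemma pd_snoc: "pd (is @ [i]) g = pd is (pderiv_dir i g)"
  by (induction "is") auto

lemma Ck_b_has_pd:
  "Ck_b k g \<longleftrightarrow> (\<forall>is i. length is < k \<longrightarrow> has_pd i (pd is g) (pd (i # is) g)) \<and>
     (\<forall>is. length is \<le> k \<longrightarrow> continuous_on UNIV (pd is g) \<and> bounded (range (pd is g)))"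
  unfolding Ck_b_def has_pd_def by blast

lemma Ck_b_Suc:
  "Ck_b (Suc k) g \<longleftrightarrow> continuous_on UNIV g \<and> bounded (range g) \<and>
     (\<forall>i. has_pd i g (pderiv_dir i g) \<and> Ck_b k (pderiv_dir i g))"
proof
  assume g: "Ck_b (Suc k) g"
  show "continuous_on UNIV g \<and> bounded (range g) \<and> (\<forall>i. has_pd i g (pderiv_dir i g) \<and> Ck_b k (pderiv_dir i g))"
  proof (intro conjI allI)
    show "continuous_on UNIV g" "bounded (range g)"
      using g[unfolded Ck_b_has_pd, THEN conjunct2, rule_format, of "[]"] by auto
    fix i
    show "has_pd i g (pderiv_dir i g)"
      using g[unfolded Ck_b_has_pd, THEN conjunct1, rule_format, of "[]" i] by simp
    show "Ck_b k (pderiv_dir i g)"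
      unfolding Ck_b_has_pd
    proof (intro conjI allI impI)
      fix js :: "'a list" and l assume "length js < k"
      then show "has_pd l (pd js (pderiv_dir i g)) (pd (l # js) (pderiv_dir i g))"
        using g[unfolded Ck_b_has_pd, THEN conjunct1, rule_format, of "js @ [i]" l] by (simp add: pd_snoc)
    next
      fix js :: "'a list" assume "length js \<le> k"
      then have "length (js @ [i]) \<le> Suc k" by simp
      from g[unfolded Ck_b_has_pd, THEN conjunct2, rule_format, OF this]
      show "continuous_on UNIV (pd js (pderiv_dir i g))" "bounded (range (pd js (pderiv_dir i g)))"
        by (simp_all add: pd_snoc)
    qed
  qed
next
  assume g: "continuous_on UNIV g \<and> bounded (range g) \<and> (\<forall>i. has_pd i g (pderiv_dir i g) \<and> Ck_b k (pderiv_dir i g))"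
  then have gi: "has_pd i g (pderiv_dir i g)" "Ck_b k (pderiv_dir i g)" for i by auto
  show "Ck_b (Suc k) g"
    unfolding Ck_b_has_pd
  proof (intro conjI allI impI)
    fix js :: "'a list" and l assume js: "length js < Suc k"
    show "has_pd l (pd js g) (pd (l # js) g)"
    proof (cases js rule: rev_cases)
      case Nil then show ?thesis using gi by simp
    next
      case (snoc ks i)
      then have "length ks < k" using js by simp
      from gi(2)[unfolded Ck_b_has_pd, THEN conjunct1, rule_format, OF this, of l i]
      show ?thesis by (simp add: snoc pd_snoc)
    qed
  next
    fix js :: "'a list" assume js: "length js \<le> Suc k"
    have "continuous_on UNIV (pd js g) \<and> bounded (range (pd js g))"
    proof (cases js rule: rev_cases)
      case Nil then show ?thesis using g by simp
    next
      case (snoc ks i)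
      then have "length ks \<le> k" using js by simp
      from gi(2)[unfolded Ck_b_has_pd, THEN conjunct2, rule_format, OF this, of i]
      show ?thesis by (simp add: snoc pd_snoc)
    qed
    then show "continuous_on UNIV (pd js g)" "bounded (range (pd js g))" by auto
  qed
qed

context hoelder
begin

lemma bd_iff:
  "bd p c g \<longleftrightarrow> Ck_b p g \<and> (\<forall>is. length is \<le> p \<longrightarrow> (\<forall>x. \<bar>pd is g x\<bar> \<le> c)) \<and>
     (\<forall>is. length is = p \<longrightarrow> (\<forall>x y. \<bar>pd is g x - pd is g y\<bar> \<le> c * norm (x - y) powr \<gamma>))"
proof (induction p arbitrary: g)
  case 0
  have "Ck_b 0 g \<longleftrightarrow> continuous_on UNIV g \<and> bounded (range g)" by (simp add: Ck_b_def)
  moreover have "bounded (range g)" if "\<forall>x. \<bar>g x\<bar> \<le> c" using that by (auto simp: bounded_iff)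
  ultimately show ?case by auto
next
  case (Suc p)
  have *: "(\<forall>is :: 'a list. length is \<le> Suc p \<longrightarrow> P is) \<longleftrightarrow> P [] \<and> (\<forall>i is. length is \<le> p \<longrightarrow> P (is @ [i]))" for P
  proof
    assume r: "P [] \<and> (\<forall>i is. length is \<le> p \<longrightarrow> P (is @ [i]))"
    show "\<forall>is :: 'a list. length is \<le> Suc p \<longrightarrow> P is"
    proof (intro allI impI)
      fix js :: "'a list" assume "length js \<le> Suc p" then show "P js"
        using r by (cases js rule: rev_cases) auto
    qed
  qed auto
  have **: "(\<forall>is :: 'a list. length is = Suc p \<longrightarrow> P is) \<longleftrightarrow> (\<forall>i is. length is = p \<longrightarrow> P (is @ [i]))" for P
  proof
    assume r: "\<forall>i is. length is = p \<longrightarrow> P (is @ [i])"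
    show "\<forall>is :: 'a list. length is = Suc p \<longrightarrow> P is"
    proof (intro allI impI)
      fix js :: "'a list" assume "length js = Suc p" then show "P js"
        using r by (cases js rule: rev_cases) auto
    qed
  qed auto
  have "bounded (range g)" if "\<forall>x. \<bar>g x\<bar> \<le> c" using that by (auto simp: bounded_iff)
  then show ?case
    unfolding Ck_b_Suc * ** bd.simps Suc.IH pd_snoc by (auto simp del: bd.simps)
qed

text \<open>Relates the real exponent to an integer order and the fixed \<gamma>; \<open>m\<close>
  and \<open>m + r\<close> have the same fractional part, so one instance of the locale serves
  both.\<close>

definition hoelder_order :: "real \<Rightarrow> nat \<Rightarrow> bool" where
  "hoelder_order \<mu> p \<longleftrightarrow> hk \<mu> = p \<and> hgam \<mu> = \<gamma>"

lemma Cm_b_iff: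
  fixes g :: "real^'n::finite \<Rightarrow> real"
  assumes o: "hoelder_order \<mu> p"
  shows "Cm_b \<mu> g \<longleftrightarrow> Cb p g"
proof
  assume "Cb p g"
  then obtain c where c: "bd p c g" by (auto simp: Cb_def)
  then show "Cm_b \<mu> g"
    using o unfolding Cm_b_def hoelder_order_def bd_iff by blast
next
  assume g: "Cm_b \<mu> g"
  then have Ck: "Ck_b p g" using o by (simp add: Cm_b_def hoelder_order_def)
  have fin: "finite {is :: 'n list. length is \<le> p}" using finite_lists_length_le[of "UNIV :: 'n set" p] by simp
  have "\<forall>is\<in>{is :: 'n list. length is \<le> p}. \<exists>c. \<forall>x. \<bar>pd is g x\<bar> \<le> c"
    using Ck unfolding Ck_b_def bounded_iff by auto
  from bchoice[OF this] obtain b where b: "\<forall>is\<in>{is :: 'n list. length is \<le> p}. \<forall>x. \<bar>pd is g x\<bar> \<le> b is" ..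
  define B where "B = Max (b ` {is. length is \<le> p})"
  have bB: "\<bar>pd is g x\<bar> \<le> B" if "length is \<le> p" for "is" x
  proof -
    have "\<bar>pd is g x\<bar> \<le> b is" using b that by blast
    also have "\<dots> \<le> B" unfolding B_def using fin that by (intro Max_ge) auto
    finally show ?thesis .
  qed
  have "\<exists>C. \<forall>is x y. length is = p \<longrightarrow> \<bar>pd is g x - pd is g y\<bar> \<le> C * norm (x - y) powr \<gamma>"
  proof (cases "\<gamma> > 0")
    case True
    then show ?thesis using g o by (simp add: Cm_b_def hoelder_order_def)
  next
    case False
    then have \<gamma>0: "\<gamma> = 0" using \<gamma> by simp
    show ?thesis
    \<comment> \<open>For exponent 0 the power is 1 at distinct points and 0 at equal ones, so the
      clause is a bound on the oscillation.\<close>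
    proof (intro exI[of _ "2 * B"] allI impI)
      fix js :: "'n list" and x y assume js: "length js = p"
      show "\<bar>pd js g x - pd js g y\<bar> \<le> 2 * B * norm (x - y) powr \<gamma>"
        using bB[of js x] bB[of js y] js by (cases "x = y") (simp_all add: \<gamma>0)
    qed
  qed
  then obtain C where C: "\<And>is x y. length is = p \<Longrightarrow> \<bar>pd is g x - pd is g y\<bar> \<le> C * norm (x - y) powr \<gamma>" by blast
  have "bd p (max B C) g"
    unfolding bd_iff
  proof (intro conjI allI impI Ck)
    show "\<bar>pd js g x\<bar> \<le> max B C" if "length js \<le> p" for js x using bB[OF that, of x] by simp
    show "\<bar>pd js g x - pd js g y\<bar> \<le> max B C * norm (x - y) powr \<gamma>" if "length js = p" for js x y
      by (rule order_trans[OF C[OF that]]) (simp add: mult_right_mono)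
  qed
  then show "Cb p g" by (rule CbI)
qed

text \<open>The norm is a sum of two parts, each at most \<open>c\<close>. Together with
  \<open>bd_Cm_norm\<close> this makes the predicate and the norm equivalent up to factors
  2.\<close>

lemma Cm_norm_le:
  fixes g :: "real^'n::finite \<Rightarrow> real"
  assumes o: "hoelder_order \<mu> p" and b: "bd p c g"
  shows "Cm_norm \<mu> g \<le> 2 * c"
proof -
  have o': "hk \<mu> = p" "hgam \<mu> = \<gamma>" using o by (simp_all add: hoelder_order_def)
  note B = b[unfolded bd_iff, THEN conjunct2]
  have c: "c \<ge> 0" by (rule bd_nonneg[OF b])
  have "(SUP x. \<bar>pd is g x\<bar>) \<le> c" if "length is \<le> p" for "is" :: "'n list"
    using B that by (intro cSUP_least) auto
  note s = this
  have 1: "ck_norm p g \<le> c"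
    unfolding ck_norm_def
  proof (rule cSUP_least)
    show "{is :: 'n list. length is \<le> p} \<noteq> {}" by (auto intro: exI[of _ "[]"])
    show "(SUP x. \<bar>pd is g x\<bar>) \<le> c" if "is \<in> {is. length is \<le> p}" for "is" by (rule s) (use that in simp)
  qed
  have 2: "hoelder_semi p \<gamma> g \<le> c"
    unfolding hoelder_semi_def
  proof (rule cSup_least)
    \<comment> \<open>Two distinct points exist, so the supremum in the seminorm is over a nonempty
      set.\<close>
    have "(axis undefined 1 :: real^'n) \<noteq> 0" by (simp add: axis_eq_0_iff)
    then have "\<bar>pd (replicate p undefined) g (axis undefined 1) - pd (replicate p undefined) g 0\<bar> / norm (axis undefined 1 - (0 :: real^'n)) powr \<gamma>
        \<in> {\<bar>pd is g x - pd is g y\<bar> / norm (x - y) powr \<gamma> | is x y. length is = p \<and> x \<noteq> y}"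
      by (intro CollectI exI[of _ "replicate p undefined"] exI[of _ "axis undefined 1"] exI[of _ 0]) simp
    then show "{\<bar>pd is g x - pd is g y\<bar> / norm (x - y) powr \<gamma> | is x y. length is = p \<and> x \<noteq> y} \<noteq> {}" by blast
    fix v assume "v \<in> {\<bar>pd is g x - pd is g y\<bar> / norm (x - y) powr \<gamma> | is x y. length is = p \<and> x \<noteq> y}"
    then obtain "is" x y where v: "v = \<bar>pd is g x - pd is g y\<bar> / norm (x - y) powr \<gamma>" "length is = p" "x \<noteq> y" by blast
    have "norm (x - y) powr \<gamma> > 0" using v(3) by simp
    then show "v \<le> c" using B v by (simp add: divide_le_eq)
  qed
  show ?thesis using 1 2 c by (simp add: Cm_norm_def o')
qed

text \<open>The factor 2 is owed to integral exponents: the norm then has no Hoelder part, while the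
  oscillation clause of \<open>bd\<close> is bounded by twice the supremum.\<close>

lemma bd_Cm_norm:
  fixes g :: "real^'n::finite \<Rightarrow> real"
  assumes o: "hoelder_order \<mu> p" and g: "Cb p g"
  shows "bd p (2 * Cm_norm \<mu> g) g"
proof -
  have o': "hk \<mu> = p" "hgam \<mu> = \<gamma>" using o by (simp_all add: hoelder_order_def)
  obtain c where c: "bd p c g" using g by (auto simp: Cb_def)
  note B = c[unfolded bd_iff, THEN conjunct2]
  have inner: "\<bar>pd is g x\<bar> \<le> (SUP x. \<bar>pd is g x\<bar>)" if "length is \<le> p" for "is" x
    by (rule cSUP_upper) (use B that in \<open>auto intro!: bdd_aboveI[of _ c]\<close>)
  have outer: "(SUP x. \<bar>pd is g x\<bar>) \<le> ck_norm p g" if "length is \<le> p" for "is"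
    unfolding ck_norm_def
  proof (rule cSUP_upper)
    show "bdd_above ((\<lambda>is. SUP x. \<bar>pd is g x\<bar>) ` {is. length is \<le> p})"
    proof (rule bdd_aboveI)
      fix v assume "v \<in> (\<lambda>is. SUP x. \<bar>pd is g x\<bar>) ` {is. length is \<le> p}"
      then obtain "is" where "v = (SUP x. \<bar>pd is g x\<bar>)" "length is \<le> p" by blast
      then show "v \<le> c" using B by (auto intro!: cSUP_least)
    qed
  qed (use that in simp)
  have 1: "\<bar>pd is g x\<bar> \<le> ck_norm p g" if "length is \<le> p" for "is" x
    using inner[OF that, of x] outer[OF that] by linarith
  have nn: "0 \<le> ck_norm p g" using 1[of "[]" 0] by simp
  define H where "H = (if \<gamma> = 0 then 0 else hoelder_semi p \<gamma> g)"
  have N: "Cm_norm \<mu> g = ck_norm p g + H" by (simp add: Cm_norm_def o' H_def)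
  have hs: "\<bar>pd is g x - pd is g y\<bar> / norm (x - y) powr \<gamma> \<le> hoelder_semi p \<gamma> g" if "length is = p" "x \<noteq> y" for "is" x y
    unfolding hoelder_semi_def
  proof (rule cSup_upper)
    show "bdd_above {\<bar>pd is g x - pd is g y\<bar> / norm (x - y) powr \<gamma> | is x y. length is = p \<and> x \<noteq> y}"
    proof (rule bdd_aboveI)
      fix v assume "v \<in> {\<bar>pd is g x - pd is g y\<bar> / norm (x - y) powr \<gamma> | is x y. length is = p \<and> x \<noteq> y}"
      then obtain "is" x y where v: "v = \<bar>pd is g x - pd is g y\<bar> / norm (x - y) powr \<gamma>" "length is = p" "x \<noteq> y" by blast
      have "norm (x - y) powr \<gamma> > 0" using v(3) by simp
      then show "v \<le> c" using B v by (simp add: divide_le_eq)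
    qed
  qed (use that in blast)
  have "0 \<le> hoelder_semi p \<gamma> g"
  proof -
    have "(axis undefined 1 :: real^'n) \<noteq> 0" by (simp add: axis_eq_0_iff)
    from order_trans[OF _ hs[of "replicate p undefined", OF _ this]] show ?thesis by simp
  qed
  then have H: "0 \<le> H" by (simp add: H_def)
  show ?thesis
    unfolding bd_iff
  proof (intro conjI allI impI)
    show "Ck_b p g" using c by (simp add: bd_iff)
    show "\<bar>pd is g x\<bar> \<le> 2 * Cm_norm \<mu> g" if "length is \<le> p" for "is" x
      using 1[OF that, of x] nn H by (simp add: N)
    show "\<bar>pd is g x - pd is g y\<bar> \<le> 2 * Cm_norm \<mu> g * norm (x - y) powr \<gamma>" if len: "length is = p" for "is" x y
    proof (cases "x = y")
      case False
      then have pos: "norm (x - y) powr \<gamma> > 0" by simp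
      show ?thesis
      proof (cases "\<gamma> = 0")
        case True
        have "\<bar>pd is g x - pd is g y\<bar> \<le> 2 * ck_norm p g" using 1[of "is" x] 1[of "is" y] len by simp
        then show ?thesis using False H by (simp add: N True)
      next
        case False
        have "\<bar>pd is g x - pd is g y\<bar> \<le> H * norm (x - y) powr \<gamma>"
          using hs[OF len \<open>x \<noteq> y\<close>] pos False by (simp add: H_def divide_le_eq)
        also have "\<dots> \<le> 2 * Cm_norm \<mu> g * norm (x - y) powr \<gamma>"
          using nn H by (intro mult_right_mono) (simp_all add: N)
        finally show ?thesis .
      qed
    qed simp
  qed
qed

abbreviation cmp :: "(real^'n::finite \<Rightarrow> real^'n) \<Rightarrow> 'n \<Rightarrow> real^'n \<Rightarrow> real" where
  "cmp f \<equiv> \<lambda>j x. f x $ j"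

lemma Cmv_b_iff: "hoelder_order \<mu> p \<Longrightarrow> Cmv_b \<mu> f \<longleftrightarrow> (\<forall>j. Cb p (cmp f j))"
  by (simp add: Cmv_b_def Cm_b_iff)

lemma Cmv_norm_le:
  assumes o: "hoelder_order \<mu> p" and b: "\<And>j. bd p c (cmp f j)"
  shows "Cmv_norm \<mu> f \<le> 2 * c"
  unfolding Cmv_norm_def using Cm_norm_le[OF o b] by simp

lemma bd_Cmv_norm:
  assumes o: "hoelder_order \<mu> p" and f: "\<And>j. Cb p (cmp f j)"
  shows "bd p (2 * Cmv_norm \<mu> f) (cmp f j)"
proof (rule bd_mono[OF bd_Cm_norm[OF o f]])
  have "Cm_norm \<mu> (cmp f j) \<le> Cmv_norm \<mu> f" unfolding Cmv_norm_def by (intro Max_ge) auto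
  then show "2 * Cm_norm \<mu> (cmp f j) \<le> 2 * Cmv_norm \<mu> f" by simp
qed

lemma Cmv_norm_nonneg: "hoelder_order \<mu> p \<Longrightarrow> (\<And>j. Cb p (cmp f j)) \<Longrightarrow> 0 \<le> Cmv_norm \<mu> f"
  using bd_nonneg[OF bd_Cmv_norm] by fastforce

text \<open>From the components to the vector a common subsequence is needed, which
  \<open>AP_common\<close> provides; in the other direction one component is read off.\<close>

lemma Cmv_ap_iff:
  fixes f :: "real^'n::finite \<Rightarrow> real^'n"
  assumes o: "hoelder_order \<mu> p"
  shows "f \<in> Cmv_ap \<mu> \<longleftrightarrow> (\<forall>j. AP p (cmp f j))"
proof
  assume f: "f \<in> Cmv_ap \<mu>"
  then have Cf: "\<forall>j. Cb p (cmp f j)" by (simp add: Cmv_ap_def Cmv_b_iff[OF o])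
  show "\<forall>j. AP p (cmp f j)"
    unfolding AP_def
  proof (intro allI conjI Cf[rule_format])
    fix j and s :: "nat \<Rightarrow> real^'n"
    from f obtain \<sigma> g where \<sigma>: "strict_mono \<sigma>" and g: "Cmv_b \<mu> g"
      and lim: "(\<lambda>k. Cmv_norm \<mu> (\<lambda>x. f (x + s (\<sigma> k)) - g x)) \<longlonglongrightarrow> 0"
      unfolding Cmv_ap_def by blast
    have Cg: "Cb p (cmp g j)" for j using g by (simp add: Cmv_b_iff[OF o])
    have Cd: "Cb p (cmp (\<lambda>x. f (x + s (\<sigma> k)) - g x) j)" for k j
      using Cb_diff[OF Cb_translate[OF Cf[rule_format, of j], of "s (\<sigma> k)"] Cg[of j]] by simp
    have "cv p (\<lambda>k x. f (x + s (\<sigma> k)) $ j) (cmp g j) sequentially"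
      unfolding cv_def small_def
    proof (intro allI impI)
      fix e :: real assume e: "e > 0"
      then have "eventually (\<lambda>k. Cmv_norm \<mu> (\<lambda>x. f (x + s (\<sigma> k)) - g x) < e / 2) sequentially"
        using order_tendstoD(2)[OF lim, of "e / 2"] by simp
      then show "eventually (\<lambda>k. bd p e (\<lambda>x. f (x + s (\<sigma> k)) $ j - g x $ j)) sequentially"
      proof eventually_elim
        case (elim k)
        have "bd p (2 * Cmv_norm \<mu> (\<lambda>x. f (x + s (\<sigma> k)) - g x)) (cmp (\<lambda>x. f (x + s (\<sigma> k)) - g x) j)"
          by (rule bd_Cmv_norm[OF o Cd])
        then have "bd p e (cmp (\<lambda>x. f (x + s (\<sigma> k)) - g x) j)" by (rule bd_mono) (use elim in simp)
        then show ?case by simp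
      qed
    qed
    with \<sigma> Cg show "\<exists>\<sigma> G. strict_mono \<sigma> \<and> Cb p G \<and> cv p (\<lambda>k x. f (x + s (\<sigma> k)) $ j) G sequentially" by blast
  qed
next
  assume f: "\<forall>j. AP p (cmp f j)"
  show "f \<in> Cmv_ap \<mu>"
    unfolding Cmv_ap_def
  proof (intro CollectI conjI allI)
    show "Cmv_b \<mu> f" using AP_Cb[OF f[rule_format]] by (simp add: Cmv_b_iff[OF o])
    fix s :: "nat \<Rightarrow> real^'n"
    from AP_common[of UNIV "\<lambda>_. p" "cmp f" s] f obtain \<sigma> G where \<sigma>: "strict_mono (\<sigma> :: nat \<Rightarrow> nat)"
      and G: "\<forall>j. AP p (G j) \<and> cv p (\<lambda>k x. f (x + s (\<sigma> k)) $ j) (G j) sequentially" by auto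
    define g where "g = (\<lambda>x. (\<chi> j. G j x) :: real^'n)"
    have g: "Cmv_b \<mu> g" using AP_Cb[OF G[rule_format, THEN conjunct1]] by (simp add: Cmv_b_iff[OF o] g_def)
    have Cd: "Cb p (cmp (\<lambda>x. f (x + s (\<sigma> k)) - g x) j)" for k j
      using Cb_diff[OF Cb_translate[OF AP_Cb[OF f[rule_format, of j]], of "s (\<sigma> k)"] AP_Cb[OF G[rule_format, of j, THEN conjunct1]]]
      by (simp add: g_def)
    have "(\<lambda>k. Cmv_norm \<mu> (\<lambda>x. f (x + s (\<sigma> k)) - g x)) \<longlonglongrightarrow> 0"
    proof (rule order_tendstoI)
      fix a :: real assume "a < 0"
      then show "eventually (\<lambda>k. a < Cmv_norm \<mu> (\<lambda>x. f (x + s (\<sigma> k)) - g x)) sequentially"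
        using Cmv_norm_nonneg[OF o Cd] by (intro always_eventually allI) (rule less_le_trans)
    next
      fix a :: real assume a: "0 < a"
      then have a4: "a / 4 > 0" by simp
      have "eventually (\<lambda>k. \<forall>j. bd p (a / 4) (\<lambda>x. f (x + s (\<sigma> k)) $ j - G j x)) sequentially"
        by (intro eventually_all_finite smallD[OF _ a4]) (use G in \<open>simp add: cv_def\<close>)
      then show "eventually (\<lambda>k. Cmv_norm \<mu> (\<lambda>x. f (x + s (\<sigma> k)) - g x) < a) sequentially"
      proof eventually_elim
        case (elim k)
        have "Cmv_norm \<mu> (\<lambda>x. f (x + s (\<sigma> k)) - g x) \<le> 2 * (a / 4)"
          by (rule Cmv_norm_le[OF o]) (use elim in \<open>simp add: g_def\<close>)
        then show ?case using a by simp
      qed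
    qed
    with \<sigma> g show "\<exists>\<sigma> g. strict_mono \<sigma> \<and> Cmv_b \<mu> g \<and> (\<lambda>k. Cmv_norm \<mu> (\<lambda>x. f (x + s (\<sigma> k)) - g x)) \<longlonglongrightarrow> 0"
      by blast
  qed
qed

text \<open>Each component is mollified. The exponents in \<open>Cinfv_b\<close> are integers with
  vanishing fractional part, so they impose no Hoelder condition on the approximants.\<close>

lemma Cmv_ap_subset_cmv_b:
  fixes f :: "real^'n::finite \<Rightarrow> real^'n"
  assumes o: "hoelder_order \<mu> p" and f: "f \<in> Cmv_ap \<mu>"
  shows "f \<in> cmv_b \<mu>"
  unfolding cmv_b_def
proof (intro CollectI conjI allI impI)
  show "Cmv_b \<mu> f" using f by (simp add: Cmv_ap_def)
  fix e :: real assume e: "e > 0"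
  have "\<forall>j. \<exists>H. (\<forall>q. Cb q H) \<and> bd p (e / 4) (\<lambda>x. f x $ j - H x)"
  proof
    fix j
    have "AP p (cmp f j)" using f by (simp add: Cmv_ap_iff[OF o])
    from AP_approx[OF this, unfolded approx_def, rule_format, of "e / 4"] e
    show "\<exists>H. (\<forall>q. Cb q H) \<and> bd p (e / 4) (\<lambda>x. f x $ j - H x)" by simp
  qed
  from choice[OF this] obtain H where H: "\<forall>j. (\<forall>q. Cb q (H j)) \<and> bd p (e / 4) (\<lambda>x. f x $ j - H j x)" ..
  define g where "g = (\<lambda>x. (\<chi> j. H j x) :: real^'n)"
  have "Cinfv_b g"
    unfolding Cinfv_b_def Cmv_b_def Cm_b_def
  proof (intro allI conjI impI)
    fix k j
    have "Cb k (H j)" using H by blast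
    then show "Ck_b (hk (real k)) (cmp g j)" by (auto simp: Cb_def bd_iff hk_def g_def)
    show "\<exists>C. \<forall>is x y. length is = hk (real k) \<longrightarrow> \<bar>pd is (cmp g j) x - pd is (cmp g j) y\<bar> \<le> C * norm (x - y) powr hgam (real k)"
      if "0 < hgam (real k)" using that by (simp add: hgam_def)
  qed
  moreover have "Cmv_norm \<mu> (\<lambda>x. f x - g x) \<le> 2 * (e / 4)"
    by (rule Cmv_norm_le[OF o]) (use H in \<open>simp add: g_def\<close>)
  ultimately show "\<exists>g. Cinfv_b g \<and> Cmv_norm \<mu> (\<lambda>x. f x - g x) < e" using e by (intro exI[of _ g]) auto
qed

lemma subspace_Cmv_ap: assumes o: "hoelder_order \<mu> p" shows "subspace (Cmv_ap \<mu> :: (real^'n::finite \<Rightarrow> real^'n) set)"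
  unfolding subspace_def
proof (intro conjI ballI allI)
  show "0 \<in> (Cmv_ap \<mu> :: (real^'n \<Rightarrow> real^'n) set)" by (simp add: Cmv_ap_iff[OF o] AP_const)
  fix f assume f: "f \<in> (Cmv_ap \<mu> :: (real^'n \<Rightarrow> real^'n) set)"
  then have fj: "AP p (cmp f j)" for j by (simp add: Cmv_ap_iff[OF o])
  show "c *\<^sub>R f \<in> Cmv_ap \<mu>" for c
    unfolding Cmv_ap_iff[OF o]
  proof
    show "AP p (cmp (c *\<^sub>R f) j)" for j using AP_cmult[OF fj[of j], of c] by (simp add: scaleR_fun_def)
  qed
  fix g assume "g \<in> (Cmv_ap \<mu> :: (real^'n \<Rightarrow> real^'n) set)"
  then have gj: "AP p (cmp g j)" for j by (simp add: Cmv_ap_iff[OF o])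
  show "f + g \<in> Cmv_ap \<mu>"
    unfolding Cmv_ap_iff[OF o]
  proof
    show "AP p (cmp (f + g) j)" for j using AP_add[OF fj[of j] gj[of j]] by (simp add: plus_fun_def)
  qed
qed

end

subsection \<open>From differentiable families to the definition of $C^r$ maps\<close>

context cr_domain
begin

text \<open>The fresh slot is always the next number, so the \<open>i\<close>-th derivative occupies
  the slots below \<open>k + i\<close> and its successor takes the new direction in slot
  \<open>k + i\<close>; for \<open>k = 0\<close> this is the convention of
  \<open>is_Cr\<close>.\<close>

lemma Sm_tower:
  "Sm r {..<k} p T \<Longrightarrow> \<exists>D. D 0 = T \<and>
     (\<forall>i\<le>r. \<forall>x\<in>U. mlin {..<k + i} p (D i x) \<and> ct {..<k + i} p x (D i)) \<and>
     (\<forall>i<r. \<forall>x\<in>U. dr {..<k + i} p x (D i) (D (Suc i)) (k + i))"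
proof (induction r arbitrary: k T)
  case 0
  show ?case by (rule exI[of _ "\<lambda>_. T"]) (use Sm_mlin[OF 0] Sm_ct[OF 0] in simp)
next
  case (Suc r)
  have "k \<notin> {..<k}" by simp
  from Sm_SucD_ex[OF Suc.prems this] obtain T' where T': "Sm r {..<Suc k} p T'" "\<forall>x\<in>U. dr {..<k} p x T T' k"
    by (auto simp: lessThan_Suc simp del: Sm.simps)
  from Suc.IH[OF T'(1)] obtain D where D: "D 0 = T'"
    "\<forall>i\<le>r. \<forall>x\<in>U. mlin {..<Suc k + i} p (D i x) \<and> ct {..<Suc k + i} p x (D i)"
    "\<forall>i<r. \<forall>x\<in>U. dr {..<Suc k + i} p x (D i) (D (Suc i)) (Suc k + i)" by blast
  show ?case
  proof (intro exI[of _ "\<lambda>i. case i of 0 \<Rightarrow> T | Suc i \<Rightarrow> D i"] conjI allI impI ballI)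
    fix i x assume i: "i \<le> Suc r" and x: "x \<in> U"
    show "mlin {..<k + i} p ((case i of 0 \<Rightarrow> T | Suc i \<Rightarrow> D i) x)"
      using i x D(2) Sm_mlin[OF Suc.prems x] by (cases i) auto
    show "ct {..<k + i} p x (case i of 0 \<Rightarrow> T | Suc i \<Rightarrow> D i)"
      using i x D(2) Sm_ct[OF Suc.prems x] by (cases i) auto
  next
    fix i x assume i: "i < Suc r" and x: "x \<in> U"
    show "dr {..<k + i} p x (case i of 0 \<Rightarrow> T | Suc i \<Rightarrow> D i) (case Suc i of 0 \<Rightarrow> T | Suc i \<Rightarrow> D i) (k + i)"
      using i x D(1,3) T'(2) by (cases i) auto
  qed simp
qed

text \<open>The condition \<open>NA 0 \<le> 1\<close> puts the zero family into the unit ball, so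
  the supremum is over a nonempty set; the factor 2 comes from \<open>Cmv_norm_le\<close>.\<close>

lemma ml_norm_le:
  fixes M :: "(nat \<Rightarrow> 'a) \<Rightarrow> real^'n::finite \<Rightarrow> real^'n"
  assumes o: "hoelder_order \<mu> p" and NA0: "NA 0 \<le> 1" and c: "c \<ge> 0" and M: "\<And>j. bnd {..<k} p c (\<lambda>h t. M h t $ j)"
  shows "ml_norm k VA NA (Cmv_norm \<mu>) M \<le> 2 * c"
  unfolding ml_norm_def
proof (rule cSup_least)
  have "Cmv_norm \<mu> (M (\<lambda>_. 0)) \<in> {Cmv_norm \<mu> (M h) |h. \<forall>i<k. h i \<in> VA \<and> NA (h i) \<le> 1}"
    using subspace_0[OF VA] NA0 by (intro CollectI exI[of _ "\<lambda>_. 0"]) simp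
  then show "{Cmv_norm \<mu> (M h) |h. \<forall>i<k. h i \<in> VA \<and> NA (h i) \<le> 1} \<noteq> {}" by blast
  fix v assume "v \<in> {Cmv_norm \<mu> (M h) |h. \<forall>i<k. h i \<in> VA \<and> NA (h i) \<le> 1}"
  then obtain h where v: "v = Cmv_norm \<mu> (M h)" and h: "\<forall>i<k. h i \<in> VA \<and> NA (h i) \<le> 1" by blast
  have "(\<Prod>i<k. NA (h i)) \<le> 1" by (rule prod_le_1) (use h NA in auto)
  then have le: "c * (\<Prod>i<k. NA (h i)) \<le> c" using c mult_left_mono[of "\<Prod>i<k. NA (h i)" 1 c] by simp
  have "bd p c (\<lambda>t. M h t $ j)" for j
    by (rule bd_mono[OF bndD[OF M] le]) (use h in auto)
  then show "v \<le> 2 * c" unfolding v by (rule Cmv_norm_le[OF o])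
qed

text \<open>The components have separate towers of derivatives, which are assembled into
  vector-valued multilinear maps; since there are finitely many components, neighbourhoods and
  constants can be chosen in common.\<close>

lemma is_Cr_of_Sm:
  fixes G :: "'n::finite \<Rightarrow> 'a \<Rightarrow> real^'n \<Rightarrow> real"
  assumes o: "hoelder_order \<mu> p" and NA0: "NA 0 \<le> 1" and op: "norm_open VA NA U"
    and G: "\<And>j. Sm r {} p (\<lambda>x h. G j x)"
    and F: "\<And>x t j. x \<in> U \<Longrightarrow> F x t $ j = G j x t"
  shows "is_Cr r VA NA (Cmv_ap \<mu>) (Cmv_norm \<mu>) U F"
proof -
  have "\<forall>j. \<exists>D. D 0 = (\<lambda>x h. G j x) \<and>
     (\<forall>i\<le>r. \<forall>x\<in>U. mlin {..<i} p (D i x) \<and> ct {..<i} p x (D i)) \<and>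
     (\<forall>i<r. \<forall>x\<in>U. dr {..<i} p x (D i) (D (Suc i)) i)"
  proof
    fix j
    have "Sm r {..<0} p (\<lambda>x h. G j x)" using G[of j] by (simp only: lessThan_0)
    from Sm_tower[OF this] show "\<exists>D. D 0 = (\<lambda>x h. G j x) \<and>
     (\<forall>i\<le>r. \<forall>x\<in>U. mlin {..<i} p (D i x) \<and> ct {..<i} p x (D i)) \<and>
     (\<forall>i<r. \<forall>x\<in>U. dr {..<i} p x (D i) (D (Suc i)) i)" by (simp only: add_0)
  qed
  from choice[OF this] obtain D where D: "\<forall>j. D j 0 = (\<lambda>x h. G j x) \<and>
     (\<forall>i\<le>r. \<forall>x\<in>U. mlin {..<i} p (D j i x) \<and> ct {..<i} p x (D j i)) \<and>
     (\<forall>i<r. \<forall>x\<in>U. dr {..<i} p x (D j i) (D j (Suc i)) i)" ..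
  have D0: "D j 0 x h = G j x" for j x h using D by simp
  have Dm: "mlin {..<i} p (D j i x)" and Dc: "ct {..<i} p x (D j i)" if "i \<le> r" "x \<in> U" for i j x using D that by auto
  have Dd: "dr {..<i} p x (D j i) (D j (Suc i)) i" if "i < r" "x \<in> U" for i j x using D that by auto
  define E where "E = (\<lambda>i x h t. (\<chi> j. D j i x h t) :: real^'n)"
  show ?thesis
    unfolding is_Cr_def
  proof (intro conjI op exI[of _ E] ballI allI impI)
    fix x assume x: "x \<in> U"
    have AP: "AP p (G j x)" for j using Sm_mlin[OF G x] by (simp only: mlin_empty)
    have Fx: "F x = (\<lambda>t. \<chi> j. G j x t)" by (simp add: fun_eq_iff vec_eq_iff F[OF x])
    show "F x \<in> Cmv_ap \<mu>" unfolding Cmv_ap_iff[OF o] Fx using AP by simp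
    show "E 0 x h = F x" for h by (simp add: E_def D0 Fx)
  next
    fix i x assume i: "i \<le> r" and x: "x \<in> U"
    note m = Dm[OF i x]
    show "ml_bounded i VA NA (Cmv_ap \<mu>) (Cmv_norm \<mu>) (E i x)"
      unfolding ml_bounded_def
    proof (intro conjI allI impI)
      fix h h' :: "nat \<Rightarrow> 'a" assume "\<forall>j<i. h j = h' j"
      then have "D j i x h = D j i x h'" for j by (intro mlin_dep[OF m]) simp
      then show "E i x h = E i x h'" by (simp add: E_def)
    next
      fix h :: "nat \<Rightarrow> 'a" assume "\<forall>j<i. h j \<in> VA"
      then have "AP p (D j i x h)" for j by (intro mlin_AP[OF m]) simp
      then show "E i x h \<in> Cmv_ap \<mu>" by (simp add: Cmv_ap_iff[OF o] E_def)
    next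
      fix h :: "nat \<Rightarrow> 'a" and l u v and c :: real
      assume l: "l < i" and h: "\<forall>j<i. h j \<in> VA" and u: "u \<in> VA" and v: "v \<in> VA"
      have "D j i x (h(l := u + v)) t = D j i x (h(l := u)) t + D j i x (h(l := v)) t" for j t
        by (rule mlin_add_slot[OF m _ _ u v]) (use l h in auto)
      then show "E i x (h(l := u + v)) = E i x (h(l := u)) + E i x (h(l := v))"
        by (simp add: E_def fun_eq_iff vec_eq_iff)
      have "D j i x (h(l := c *\<^sub>R u)) t = c * D j i x (h(l := u)) t" for j t
        by (rule mlin_scale_slot[OF m _ _ u]) (use l h in auto)
      then show "E i x (h(l := c *\<^sub>R u)) = c *\<^sub>R E i x (h(l := u))"
        by (simp add: E_def fun_eq_iff vec_eq_iff scaleR_fun_def)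
    next
      have "\<forall>j. \<exists>C. bnd {..<i} p C (D j i x)" using mlin_bnd[OF m] by blast
      from choice[OF this] obtain C where C: "\<forall>j. bnd {..<i} p (C j) (D j i x)" ..
      define L where "L = Max (range C)"
      have L: "bnd {..<i} p L (D j i x)" for j
        by (rule bnd_mono[OF C[rule_format]]) (simp add: L_def)
      show "\<exists>C. \<forall>h. (\<forall>j<i. h j \<in> VA) \<longrightarrow> Cmv_norm \<mu> (E i x h) \<le> C * (\<Prod>j<i. NA (h j))"
      proof (intro exI[of _ "2 * L"] allI impI)
        fix h assume h: "\<forall>j<i. h j \<in> VA"
        have "Cmv_norm \<mu> (E i x h) \<le> 2 * (L * (\<Prod>j<i. NA (h j)))"
        proof (rule Cmv_norm_le[OF o])
          fix j
          have "bd p (L * (\<Prod>j<i. NA (h j))) (D j i x h)" by (rule bndD[OF L]) (use h in auto)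
          then show "bd p (L * (\<Prod>j<i. NA (h j))) (\<lambda>t. E i x h t $ j)" by (simp add: E_def)
        qed
        then show "Cmv_norm \<mu> (E i x h) \<le> 2 * L * (\<Prod>j<i. NA (h j))" by simp
      qed
    qed
  next
    fix i x and e :: real assume i: "i < r" and x: "x \<in> U" and e: "e > 0"
    \<comment> \<open>Half of \<open>e\<close>, because \<open>ml_norm_le\<close> doubles the
      bound.\<close>
    then have e2: "e / 2 > 0" by simp
    have "eventually (\<lambda>y. \<forall>j. bnd {..<i} p (e / 2 * NA (y - x)) (\<lambda>h t. D j i y h t - D j i x h t - D j (Suc i) x (h(i := y - x)) t)) (nb x)"
      by (intro eventually_all_finite smlD[OF Dd[OF i x, unfolded dr_def] e2])
    then obtain d where d: "d > 0" and dP: "\<And>y. y \<in> U \<Longrightarrow> NA (y - x) < d \<Longrightarrow>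
        \<forall>j. bnd {..<i} p (e / 2 * NA (y - x)) (\<lambda>h t. D j i y h t - D j i x h t - D j (Suc i) x (h(i := y - x)) t)"
      unfolding eventually_nb by blast
    show "\<exists>d>0. \<forall>y\<in>U. NA (y - x) < d \<longrightarrow>
        ml_norm i VA NA (Cmv_norm \<mu>) (\<lambda>h. E i y h - E i x h - E (Suc i) x (h(i := y - x))) \<le> e * NA (y - x)"
    proof (intro exI[of _ d] conjI d ballI impI)
      fix y assume y: "y \<in> U" and lt: "NA (y - x) < d"
      have "ml_norm i VA NA (Cmv_norm \<mu>) (\<lambda>h. E i y h - E i x h - E (Suc i) x (h(i := y - x))) \<le> 2 * (e / 2 * NA (y - x))"
      proof (rule ml_norm_le[OF o NA0])
        show "0 \<le> e / 2 * NA (y - x)" using e2 NA[OF diff_VA[OF x y]] by simp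
        show "bnd {..<i} p (e / 2 * NA (y - x)) (\<lambda>h t. (E i y h - E i x h - E (Suc i) x (h(i := y - x))) t $ j)" for j
          using dP[OF y lt, rule_format, of j] by (simp add: E_def)
      qed
      then show "ml_norm i VA NA (Cmv_norm \<mu>) (\<lambda>h. E i y h - E i x h - E (Suc i) x (h(i := y - x))) \<le> e * NA (y - x)" by simp
    qed
  next
    fix i x and e :: real assume i: "i \<le> r" and x: "x \<in> U" and e: "e > 0"
    \<comment> \<open>A quarter of \<open>e\<close>, because the bound is doubled and the inequality
      to be shown is strict.\<close>
    then have e4: "e / 4 > 0" by simp
    have "eventually (\<lambda>y. \<forall>j. bnd {..<i} p (e / 4 * 1) (\<lambda>h t. D j i y h t - D j i x h t)) (nb x)"
      by (intro eventually_all_finite smlD[OF Dc[OF i x, unfolded ct_def] e4])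
    then obtain d where d: "d > 0" and dP: "\<And>y. y \<in> U \<Longrightarrow> NA (y - x) < d \<Longrightarrow>
        \<forall>j. bnd {..<i} p (e / 4 * 1) (\<lambda>h t. D j i y h t - D j i x h t)"
      unfolding eventually_nb by blast
    show "\<exists>d>0. \<forall>y\<in>U. NA (y - x) < d \<longrightarrow> ml_norm i VA NA (Cmv_norm \<mu>) (\<lambda>h. E i y h - E i x h) < e"
    proof (intro exI[of _ d] conjI d ballI impI)
      fix y assume y: "y \<in> U" and lt: "NA (y - x) < d"
      have "ml_norm i VA NA (Cmv_norm \<mu>) (\<lambda>h. E i y h - E i x h) \<le> 2 * (e / 4)"
      proof (rule ml_norm_le[OF o NA0])
        show "0 \<le> e / 4" using e4 by simp
        show "bnd {..<i} p (e / 4) (\<lambda>h t. (E i y h - E i x h) t $ j)" for j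
          using dP[OF y lt, rule_format, of j] by (simp add: E_def)
      qed
      then show "ml_norm i VA NA (Cmv_norm \<mu>) (\<lambda>h. E i y h - E i x h) < e" using e by simp
    qed
  qed
qed

end

subsection \<open>Almost periodic diffeomorphisms\<close>

lemma shift_cmp: "shift (\<lambda>j x. f x $ j) = (\<lambda>x. x + f x)"
  by (simp add: fun_eq_iff vec_eq_iff)

lemma shift_chart: "shift (\<lambda>j x. chart \<phi> x $ j) = \<phi>"
  by (simp add: vec_eq_iff fun_eq_iff chart_def)

lemma jac_Jm: "mat 1 + jac f x = Jm (\<lambda>j x. f x $ j) x"
  by (simp add: vec_eq_iff mat_def jac_def Jm_def)

lemma Diff_ap_iff:
  "\<phi> \<in> Diff_ap \<mu> \<longleftrightarrow> chart \<phi> \<in> Cmv_ap \<mu> \<and> (\<exists>c>0. \<forall>x. c \<le> det (Jm (\<lambda>j x. chart \<phi> x $ j) x))"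
  by (simp add: Diff_ap_def jac_Jm)

lemma chart_Diff_ap:
  "chart ` Diff_ap \<mu> = {f \<in> Cmv_ap \<mu>. \<exists>c>0. \<forall>x. c \<le> det (Jm (\<lambda>j x. f x $ j) x)}"
proof (intro equalityI subsetI)
  fix f assume f: "f \<in> {f \<in> Cmv_ap \<mu>. \<exists>c>0. \<forall>x. c \<le> det (Jm (\<lambda>j x. f x $ j) x)}"
  have "chart (\<lambda>x. x + f x) = f" by (simp add: chart_def)
  with f show "f \<in> chart ` Diff_ap \<mu>"
    by (intro image_eqI[of _ _ "\<lambda>x. x + f x"]) (simp_all add: Diff_ap_iff)
qed (auto simp: Diff_ap_iff)

context hoelder
begin

lemma Jm_comp:
  assumes f: "\<And>j. Cb (Suc p) (f j)" and g: "\<And>j. Cb (Suc q) (g j)"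
  shows "Jm (\<lambda>j x. g j x + f j (shift g x)) x = Jm f (shift g x) ** Jm g x"
proof -
  have "pderiv_dir i (\<lambda>x. g j x + f j (shift g x)) = (\<lambda>x. pderiv_dir i (g j) x +
     (pderiv_dir i (f j) (shift g x) + (\<Sum>l\<in>UNIV. pderiv_dir l (f j) (shift g x) * pderiv_dir i (g l) x)))" for i j
    by (intro has_pd_pderiv_dir has_pd_add has_pd_comp_shift Cb_has_pd[OF f] Cb_has_pd[OF g] Cb_cont[OF Cb_pd[OF f]])
  moreover have "(\<Sum>l\<in>UNIV. ((if j = l then 1 else 0) + pderiv_dir l (f j) (shift g x)) * ((if l = i then 1 else 0) + pderiv_dir i (g l) x))
    = (if j = i then 1 else 0) + (pderiv_dir i (g j) x +
     (pderiv_dir i (f j) (shift g x) + (\<Sum>l\<in>UNIV. pderiv_dir l (f j) (shift g x) * pderiv_dir i (g l) x)))" for i j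
  proof -
    have "(\<Sum>l\<in>UNIV. ((if j = l then 1 else 0) + pderiv_dir l (f j) (shift g x)) * ((if l = i then 1 else 0) + pderiv_dir i (g l) x))
      = (\<Sum>l\<in>UNIV. (if j = l then (if l = i then 1 else 0) + pderiv_dir i (g l) x else 0) +
         ((if l = i then pderiv_dir l (f j) (shift g x) else 0) + pderiv_dir l (f j) (shift g x) * pderiv_dir i (g l) x))"
      by (intro sum.cong) (auto simp: algebra_simps)
    then show ?thesis by (simp add: sum.distrib)
  qed
  ultimately show ?thesis by (simp add: vec_eq_iff matrix_matrix_mult_def Jm_def)
qed

lemma Jm_inv_disp:
  assumes f: "dif q \<delta> f"
  shows "Jm (inv_disp f) y = (\<chi> k l. Minv f k l (shift (inv_disp f) y))"
proof -
  have "pderiv_dir i (inv_disp f j) = (\<lambda>y. Minv f j i (shift (inv_disp f) y) - (if i = j then 1 else 0))" for i j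
    by (rule has_pd_pderiv_dir[OF inv_disp_has_pd[OF f]])
  then show ?thesis by (simp add: vec_eq_iff Jm_def)
qed

text \<open>The Jacobian determinant of the inverse is the reciprocal of that of
  \<open>shift f\<close> at the preimage, and an upper bound \<open>c\<close> for the latter gives
  the lower bound \<open>1 / c\<close>.\<close>

lemma dif_inv_disp:
  fixes f :: "'n::finite \<Rightarrow> real^'n \<Rightarrow> real"
  assumes f: "dif q \<delta> f"
  shows "\<exists>\<delta>'. dif q \<delta>' (inv_disp f)"
proof -
  obtain c where c: "bd q c (\<lambda>x. det (Jm f x))" "c > 0"
    by (rule CbE[OF AP_Cb[OF AP_det_Jm[OF dif_AP[OF f]]]])
  have "1 / c \<le> det (Jm (inv_disp f) y)" for y
  proof -
    let ?x = "shift (inv_disp f) y"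
    have "det (\<chi> k l. Minv f k l ?x) * det (Jm f ?x) = 1"
      using arg_cong[OF Minv_left[OF dif_det_nz[OF f]], of det] by (simp add: det_mul)
    then have "det (Jm (inv_disp f) y) = 1 / det (Jm f ?x)"
      using dif_det_nz[OF f, of ?x] by (simp add: Jm_inv_disp[OF f] field_simps)
    moreover have "det (Jm f ?x) > 0" using dif_det[OF f, of ?x] dif_pos[OF f] by linarith
    moreover have "det (Jm f ?x) \<le> c" using bd_abs[OF c(1), of ?x] by linarith
    ultimately show ?thesis using c(2) by (simp add: frac_le)
  qed
  then have "dif q (1 / c) (inv_disp f)" unfolding dif_def using c(2) inv_disp_AP[OF f] by (intro conjI allI) simp_all
  then show ?thesis by (rule exI)
qed

lemma dif_comp:
  assumes f: "dif q \<delta> f" and g: "dif q \<epsilon> g"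
  shows "dif q (\<delta> * \<epsilon>) (\<lambda>j x. g j x + f j (shift g x))"
  unfolding dif_def
proof (intro conjI allI)
  show "AP (Suc q) (\<lambda>x. g j x + f j (shift g x))" for j
    by (intro AP_add dif_AP[OF g] AP_comp[OF dif_AP[OF f] dif_AP[OF g]]) auto
  show "0 < \<delta> * \<epsilon>" using dif_pos[OF f] dif_pos[OF g] by simp
  fix x
  have "\<delta> * \<epsilon> \<le> det (Jm f (shift g x)) * det (Jm g x)"
    using dif_pos[OF f] dif_pos[OF g] dif_det[OF f, of "shift g x"] dif_det[OF g, of x] by (intro mult_mono) auto
  then show "\<delta> * \<epsilon> \<le> det (Jm (\<lambda>j x. g j x + f j (shift g x)) x)"
    by (simp add: Jm_comp[OF AP_Cb[OF dif_AP[OF f]] AP_Cb[OF dif_AP[OF g]]] det_mul)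
qed

lemma Diff_ap_dif:
  assumes o: "hoelder_order \<mu> (Suc q)"
  shows "\<phi> \<in> Diff_ap \<mu> \<longleftrightarrow> (\<exists>\<delta>. dif q \<delta> (\<lambda>j x. chart \<phi> x $ j))"
  unfolding Diff_ap_iff Cmv_ap_iff[OF o] dif_def by blast

lemma Diff_ap_comp:
  assumes o: "hoelder_order \<mu> (Suc q)" and \<phi>: "\<phi> \<in> Diff_ap \<mu>" and \<psi>: "\<psi> \<in> Diff_ap \<mu>"
  shows "\<phi> \<circ> \<psi> \<in> Diff_ap \<mu>"
proof -
  obtain \<delta> \<epsilon> where "dif q \<delta> (\<lambda>j x. chart \<phi> x $ j)" "dif q \<epsilon> (\<lambda>j x. chart \<psi> x $ j)"
    using \<phi> \<psi> unfolding Diff_ap_dif[OF o] by blast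
  from dif_comp[OF this]
  have "dif q (\<delta> * \<epsilon>) (\<lambda>j x. chart \<psi> x $ j + chart \<phi> (\<psi> x) $ j)" by (simp add: shift_chart)
  moreover have "(\<lambda>j x. chart \<psi> x $ j + chart \<phi> (\<psi> x) $ j) = (\<lambda>j x. chart (\<phi> \<circ> \<psi>) x $ j)"
    by (simp add: chart_def fun_eq_iff)
  ultimately show ?thesis unfolding Diff_ap_dif[OF o] by auto
qed

lemma Diff_ap_inv:
  assumes o: "hoelder_order \<mu> (Suc q)" and \<phi>: "\<phi> \<in> Diff_ap \<mu>"
  shows "bij \<phi>" "inv \<phi> \<in> Diff_ap \<mu>"
proof -
  obtain \<delta> where d: "dif q \<delta> (\<lambda>j x. chart \<phi> x $ j)" using \<phi> unfolding Diff_ap_dif[OF o] by blast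
  show "bij \<phi>" using dif_bij[OF d] by (simp add: shift_chart)
  have "inv_disp (\<lambda>j x. chart \<phi> x $ j) = (\<lambda>j x. chart (inv \<phi>) x $ j)"
    unfolding inv_disp_def[abs_def] shift_chart by (simp add: chart_def fun_eq_iff)
  then show "inv \<phi> \<in> Diff_ap \<mu>" using dif_inv_disp[OF d] unfolding Diff_ap_dif[OF o] by simp
qed

lemma Diff_ap_mono:
  assumes "hoelder_order \<mu> (Suc q)" "hoelder_order \<nu> (Suc q + r)"
  shows "Diff_ap \<nu> \<subseteq> Diff_ap \<mu>"
proof
  fix \<phi> assume \<phi>: "\<phi> \<in> Diff_ap \<nu>"
  then have "chart \<phi> \<in> Cmv_ap \<nu>" unfolding Diff_ap_iff by (rule conjunct1)
  then have "AP (Suc q + r) (\<lambda>x. chart \<phi> x $ j)" for j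
    unfolding Cmv_ap_iff[OF assms(2)] by (rule spec)
  then have "AP (Suc q) (\<lambda>x. chart \<phi> x $ j)" for j by (rule AP_embed_le[OF le_add1])
  then have "chart \<phi> \<in> Cmv_ap \<mu>" unfolding Cmv_ap_iff[OF assms(1)] by (rule allI)
  from this conjunct2[OF \<phi>[unfolded Diff_ap_iff]] show "\<phi> \<in> Diff_ap \<mu>"
    unfolding Diff_ap_iff by (rule conjI)
qed

lemma Diff_ap_subset_diff_b: "hoelder_order \<mu> (Suc q) \<Longrightarrow> Diff_ap \<mu> \<subseteq> diff_b \<mu>"
  unfolding Diff_ap_def diff_b_def using Cmv_ap_subset_cmv_b by blast

lemma id_Diff_ap: "hoelder_order \<mu> (Suc q) \<Longrightarrow> id \<in> Diff_ap \<mu>"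
proof -
  assume o: "hoelder_order \<mu> (Suc q)"
  have "pderiv_dir i (\<lambda>x :: real^'a. 0) = (\<lambda>x. 0)" for i by (rule has_pd_pderiv_dir[OF has_pd_const])
  then have "Jm (\<lambda>j x. 0) x = mat 1" for x :: "real^'a" by (simp add: Jm_def vec_eq_iff mat_def)
  then have "dif q 1 (\<lambda>j (x :: real^'a). 0)" by (simp add: dif_def AP_const)
  then show ?thesis unfolding Diff_ap_dif[OF o] by (auto simp: chart_def)
qed

lemma Cmv_norm_zero: "hoelder_order \<mu> p \<Longrightarrow> Cmv_norm \<mu> (0 :: real^'n::finite \<Rightarrow> real^'n) \<le> 0"
  using Cmv_norm_le[of \<mu> p 0 "0 :: real^'n \<Rightarrow> real^'n"] by (simp add: bd_zero)

lemma Cmv_ap_cr_domain: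
  fixes \<mu> :: real
  assumes o: "hoelder_order \<mu> p" and U: "U \<subseteq> (Cmv_ap \<mu> :: (real^'n::finite \<Rightarrow> real^'n) set)"
  shows "cr_domain \<gamma> (Cmv_ap \<mu>) (Cmv_norm \<mu>) U"
proof
  show "0 \<le> Cmv_norm \<mu> f" if "f \<in> Cmv_ap \<mu>" for f :: "real^'n \<Rightarrow> real^'n"
    using that by (intro Cmv_norm_nonneg[OF o] AP_Cb) (simp add: Cmv_ap_iff[OF o])
qed (use subspace_Cmv_ap[OF o] U in auto)

lemma cmp_bd: "hoelder_order \<mu> p \<Longrightarrow> f \<in> Cmv_ap \<mu> \<Longrightarrow> bd p (2 * Cmv_norm \<mu> f) (cmp f j)"
  by (intro bd_Cmv_norm AP_Cb) (simp_all add: Cmv_ap_iff)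

text \<open>The Jacobian determinant, as a bounded function, depends continuously on
  \<open>f\<close>, so a lower bound \<open>c\<close> becomes \<open>c / 2\<close> nearby. The
  family is considered on the whole space, since openness of the smaller set is what is to be
  shown.\<close>

lemma norm_open_Diff_ap:
  assumes o: "hoelder_order \<mu> (Suc q)"
  shows "norm_open (Cmv_ap \<mu>) (Cmv_norm \<mu>) (chart ` Diff_ap \<mu> :: (real^'n::finite \<Rightarrow> real^'n) set)"
proof -
  let ?V = "Cmv_ap \<mu> :: (real^'n \<Rightarrow> real^'n) set"
  interpret D: cr_domain \<gamma> ?V "Cmv_norm \<mu>" ?V by (rule Cmv_ap_cr_domain[OF o order_refl])
  have "D.Sm 0 {} (Suc q) (\<lambda>f h. cmp f i)" for i
  proof (rule D.Sm_coord[where C = 2])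
    show "AP (Suc q) (cmp f i)" if "f \<in> ?V" for f
      using that unfolding Cmv_ap_iff[OF o] by (rule spec)
    show "bd (Suc q) (2 * Cmv_norm \<mu> f) (cmp f i)" if "f \<in> ?V" for f by (rule cmp_bd[OF o that])
  qed (simp_all add: scaleR_fun_def)
  then have Sm: "D.Sm 0 {} q (\<lambda>f h t. det (Jm (cmp f) t))" by (rule D.Sm_det_Jm)
  show ?thesis
    unfolding norm_open_def
  proof (intro conjI ballI)
    show "chart ` Diff_ap \<mu> \<subseteq> ?V" by (auto simp: Diff_ap_iff)
    fix f :: "real^'n \<Rightarrow> real^'n" assume "f \<in> chart ` Diff_ap \<mu>"
    then obtain c where f: "f \<in> ?V" and c: "c > 0" "\<forall>x. c \<le> det (Jm (cmp f) x)" unfolding chart_Diff_ap by blast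
    have "cv q (\<lambda>f t. det (Jm (cmp f) t)) (\<lambda>t. det (Jm (cmp f) t)) (D.nb f)"
      using Sm f unfolding D.Sm0_empty by blast
    from smallD[OF this[unfolded cv_def], of "c / 2"] c(1)
    obtain d where d: "d > 0" and dP: "\<forall>y\<in>?V. Cmv_norm \<mu> (y - f) < d \<longrightarrow> bd q (c / 2) (\<lambda>t. det (Jm (cmp y) t) - det (Jm (cmp f) t))"
      unfolding D.eventually_nb by auto
    show "\<exists>e>0. \<forall>y\<in>?V. Cmv_norm \<mu> (y - f) < e \<longrightarrow> y \<in> chart ` Diff_ap \<mu>"
    proof (intro exI[of _ d] conjI d ballI impI)
      fix y assume y: "y \<in> ?V" and lt: "Cmv_norm \<mu> (y - f) < d"
      have "c / 2 \<le> det (Jm (cmp y) t)" for t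
        using bd_abs[OF dP[rule_format, OF y lt], of t] c(2)[rule_format, of t] by linarith
      then show "y \<in> chart ` Diff_ap \<mu>" unfolding chart_Diff_ap using y c(1) by (auto intro!: exI[of _ "c / 2"])
    qed
  qed
qed

lemma is_Cr_inv:
  assumes o: "hoelder_order \<mu> (Suc q)" and o': "hoelder_order \<nu> (Suc q + r)"
  shows "is_Cr r (Cmv_ap \<nu>) (Cmv_norm \<nu>) (Cmv_ap \<mu> :: (real^'n::finite \<Rightarrow> real^'n) set) (Cmv_norm \<mu>)
    (chart ` Diff_ap \<nu>) (\<lambda>f. chart (inv (\<lambda>x. x + f x)))"
proof -
  let ?V = "Cmv_ap \<nu> :: (real^'n \<Rightarrow> real^'n) set"
  let ?U = "chart ` Diff_ap \<nu> :: (real^'n \<Rightarrow> real^'n) set"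
  have U: "?U \<subseteq> ?V" by (auto simp: Diff_ap_iff)
  interpret D: cr_domain \<gamma> ?V "Cmv_norm \<nu>" ?U by (rule Cmv_ap_cr_domain[OF o' U])
  have o'': "hoelder_order \<nu> (Suc (q + r))" using o' by simp
  show ?thesis
  proof (rule D.is_Cr_of_Sm[OF o _ norm_open_Diff_ap[OF o''], where G = "\<lambda>j f. inv_disp (cmp f) j"])
    show "Cmv_norm \<nu> (0 :: real^'n \<Rightarrow> real^'n) \<le> 1" using Cmv_norm_zero[OF o', where ?'n = 'n] by linarith
    show "D.Sm r {} (Suc q) (\<lambda>f h. inv_disp (cmp f) j)" for j
    proof (rule D.Sm_inv_disp[where C = 2 and r = r])
      show "AP (Suc q + r) (cmp f j)" if "f \<in> ?V" for f j using that by (simp add: Cmv_ap_iff[OF o'])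
      show "bd (Suc q + r) (2 * Cmv_norm \<nu> f) (cmp f j)" if "f \<in> ?V" for f j by (rule cmp_bd[OF o' that])
      show "\<exists>\<delta>>0. \<forall>t. \<delta> \<le> det (Jm (cmp f) t)" if "f \<in> ?U" for f using that unfolding chart_Diff_ap by blast
    qed (simp_all add: scaleR_fun_def)
    show "chart (inv (\<lambda>x. x + f x)) t $ j = inv_disp (cmp f) j t" for f :: "real^'n \<Rightarrow> real^'n" and t j
      by (simp add: inv_disp_def shift_cmp chart_def)
  qed
qed

lemma is_Cr_comp:
  assumes o: "hoelder_order \<mu> (Suc q)" and o': "hoelder_order \<nu> (Suc q + r)"
  shows "is_Cr r (Cmv_ap \<nu> \<times> Cmv_ap \<mu>) (\<lambda>(f, g). max (Cmv_norm \<nu> f) (Cmv_norm \<mu> g))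
    (Cmv_ap \<mu> :: (real^'n::finite \<Rightarrow> real^'n) set) (Cmv_norm \<mu>) (chart ` Diff_ap \<nu> \<times> chart ` Diff_ap \<mu>)
    (\<lambda>(f, g). chart ((\<lambda>x. x + f x) \<circ> (\<lambda>x. x + g x)))"
proof -
  let ?V = "Cmv_ap \<nu> :: (real^'n \<Rightarrow> real^'n) set" and ?W = "Cmv_ap \<mu> :: (real^'n \<Rightarrow> real^'n) set"
  let ?U = "chart ` Diff_ap \<nu> \<times> chart ` Diff_ap \<mu> :: ((real^'n \<Rightarrow> real^'n) \<times> (real^'n \<Rightarrow> real^'n)) set"
  let ?N = "\<lambda>(f :: real^'n \<Rightarrow> real^'n, g :: real^'n \<Rightarrow> real^'n). max (Cmv_norm \<nu> f) (Cmv_norm \<mu> g)"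
  have o'': "hoelder_order \<nu> (Suc (q + r))" using o' by simp
  have N0: "0 \<le> Cmv_norm \<mu> g" if "g \<in> ?W" for g
    using that by (intro Cmv_norm_nonneg[OF o] AP_Cb) (simp add: Cmv_ap_iff[OF o])
  interpret D: cr_domain \<gamma> "?V \<times> ?W" ?N ?U
  proof
    show "subspace (?V \<times> ?W)" by (intro subspace_Times subspace_Cmv_ap[OF o] subspace_Cmv_ap[OF o'])
    show "0 \<le> ?N x" if "x \<in> ?V \<times> ?W" for x using that N0 by (auto simp: le_max_iff_disj)
    show "?U \<subseteq> ?V \<times> ?W" by (auto simp: Diff_ap_iff)
  qed
  have fS: "D.Sm r {} (Suc q + r) (\<lambda>x h. cmp (fst x) j)" for j
  proof (rule D.Sm_coord[where C = 2])
    show "AP (Suc q + r) (cmp (fst x) j)" if "x \<in> ?V \<times> ?W" for x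
      using mem_Times_iff[THEN iffD1, OF that] unfolding Cmv_ap_iff[OF o'] by blast
    show "bd (Suc q + r) (2 * ?N x) (cmp (fst x) j)" if "x \<in> ?V \<times> ?W" for x
    proof (rule bd_mono)
      have "fst x \<in> ?V" using that by (simp only: mem_Times_iff)
      then show "bd (Suc q + r) (2 * Cmv_norm \<nu> (fst x)) (cmp (fst x) j)" by (rule cmp_bd[OF o'])
      show "2 * Cmv_norm \<nu> (fst x) \<le> 2 * ?N x" by (cases x) simp
    qed
  qed (simp_all add: scaleR_fun_def)
  have gS: "D.Sm r {} (Suc q) (\<lambda>x h. cmp (snd x) j)" for j
  proof (rule D.Sm_coord[where C = 2])
    show "AP (Suc q) (cmp (snd x) j)" if "x \<in> ?V \<times> ?W" for x
      using mem_Times_iff[THEN iffD1, OF that] unfolding Cmv_ap_iff[OF o] by blast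
    show "bd (Suc q) (2 * ?N x) (cmp (snd x) j)" if "x \<in> ?V \<times> ?W" for x
    proof (rule bd_mono)
      have "snd x \<in> ?W" using that by (simp only: mem_Times_iff)
      then show "bd (Suc q) (2 * Cmv_norm \<mu> (snd x)) (cmp (snd x) j)" by (rule cmp_bd[OF o])
      show "2 * Cmv_norm \<mu> (snd x) \<le> 2 * ?N x" by (cases x) simp
    qed
  qed (simp_all add: scaleR_fun_def)
  show ?thesis
  \<comment> \<open>The displacement of the composite is that of the inner map plus that of the
    outer map along it; the first is linear in the pair, the second falls under
    \<open>Sm_comp\<close> without slots.\<close>
  proof (rule D.is_Cr_of_Sm[OF o, where G = "\<lambda>j x t. snd x t $ j + fst x (shift (cmp (snd x)) t) $ j"])
    show "?N 0 \<le> 1"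
      using Cmv_norm_zero[OF o', where ?'n = 'n] Cmv_norm_zero[OF o, where ?'n = 'n]
      by (simp add: zero_prod_def max_def)
    show "D.Sm r {} (Suc q) (\<lambda>x h t. snd x t $ j + fst x (shift (cmp (snd x)) t) $ j)" for j
    proof (rule D.Sm_add[OF gS])
      have "D.Sm r {} (Suc q + r + (if {} = ({} :: nat set) then 0 else 1)) (\<lambda>x h. cmp (fst x) j)"
        using fS[of j] by simp
      from D.Sm_comp[where g = "\<lambda>j x. cmp (snd x) j", OF _ this gS]
      show "D.Sm r {} (Suc q) (\<lambda>x h t. fst x (shift (cmp (snd x)) t) $ j)" by simp
    qed
    show "(case x of (f, g) \<Rightarrow> chart ((\<lambda>x. x + f x) \<circ> (\<lambda>x. x + g x))) t $ j = snd x t $ j + fst x (shift (cmp (snd x)) t) $ j"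
      for x :: "(real^'n \<Rightarrow> real^'n) \<times> (real^'n \<Rightarrow> real^'n)" and t j
      by (cases x) (simp add: chart_def shift_cmp)
    show "norm_open (?V \<times> ?W) ?N ?U"
      unfolding norm_open_def
    proof (intro conjI ballI D.U)
      fix x assume "x \<in> ?U"
      then obtain f g where x: "x = (f, g)" "f \<in> chart ` Diff_ap \<nu>" "g \<in> chart ` Diff_ap \<mu>" by auto
      obtain d where d: "d > 0" "\<forall>y\<in>?V. Cmv_norm \<nu> (y - f) < d \<longrightarrow> y \<in> chart ` Diff_ap \<nu>"
        using norm_open_Diff_ap[OF o'', where ?'n = 'n] x(2) unfolding norm_open_def by blast
      obtain d' where d': "d' > 0" "\<forall>y\<in>?W. Cmv_norm \<mu> (y - g) < d' \<longrightarrow> y \<in> chart ` Diff_ap \<mu>"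
        using norm_open_Diff_ap[OF o, where ?'n = 'n] x(3) unfolding norm_open_def by blast
      show "\<exists>e>0. \<forall>y\<in>?V \<times> ?W. ?N (y - x) < e \<longrightarrow> y \<in> ?U"
      proof (intro exI[of _ "min d d'"] conjI ballI impI)
        show "min d d' > 0" using d(1) d'(1) by simp
        fix y assume y: "y \<in> ?V \<times> ?W" and lt: "?N (y - x) < min d d'"
        obtain a b where ab: "y = (a, b)" "a \<in> ?V" "b \<in> ?W" using y by (rule SigmaE)
        then have "Cmv_norm \<nu> (a - f) < d" "Cmv_norm \<mu> (b - g) < d'" using lt x(1) by simp_all
        then show "y \<in> ?U"
          unfolding ab(1) using d(2)[rule_format, OF ab(2)] d'(2)[rule_format, OF ab(3)] by (intro SigmaI)
      qed
    qed
  qed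
qed

end

theorem theorem3p3:
  fixes m :: real and r :: nat
  assumes "m \<ge> 1"
  shows
   "(Diff_ap m \<subseteq> (diff_b m :: (real^'n::finite \<Rightarrow> real^'n) set) \<and>
     id \<in> (Diff_ap m :: (real^'n \<Rightarrow> real^'n) set) \<and>
     (\<forall>\<phi>\<in>(Diff_ap m :: (real^'n \<Rightarrow> real^'n) set). \<forall>\<psi>\<in>Diff_ap m. \<phi> \<circ> \<psi> \<in> Diff_ap m) \<and>
     (\<forall>\<phi>\<in>(Diff_ap m :: (real^'n \<Rightarrow> real^'n) set). bij \<phi> \<and> inv \<phi> \<in> Diff_ap m))
    \<and>
    ((\<forall>\<phi>\<in>(Diff_ap (m + real r) :: (real^'n \<Rightarrow> real^'n) set). \<forall>\<psi>\<in>Diff_ap m.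
        \<phi> \<circ> \<psi> \<in> Diff_ap m) \<and>
     is_Cr r (Cmv_ap (m + real r) \<times> Cmv_ap m)
        (\<lambda>(f, g). max (Cmv_norm (m + real r) f) (Cmv_norm m g))
        (Cmv_ap m :: (real^'n \<Rightarrow> real^'n) set) (Cmv_norm m)
        (chart ` Diff_ap (m + real r) \<times> chart ` Diff_ap m)
        (\<lambda>(f, g). chart ((\<lambda>x. x + f x) \<circ> (\<lambda>x. x + g x))))
    \<and>
    ((\<forall>\<phi>\<in>(Diff_ap (m + real r) :: (real^'n \<Rightarrow> real^'n) set). inv \<phi> \<in> Diff_ap m) \<and>
     is_Cr r (Cmv_ap (m + real r)) (Cmv_norm (m + real r))
        (Cmv_ap m :: (real^'n \<Rightarrow> real^'n) set) (Cmv_norm m)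
        (chart ` Diff_ap (m + real r))
        (\<lambda>f. chart (inv (\<lambda>x. x + f x))))"
proof -
  interpret hoelder "hgam m"
    by unfold_locales (simp_all add: hgam_def, linarith)
  \<comment> \<open>Since \<open>m \<ge> 1\<close>, the integer part is a successor;
    \<open>q\<close> is the integer order that remains for the Jacobian.\<close>
  define q where "q = hk m - 1"
  have hk: "hk m = Suc q" using assms by (simp add: q_def hk_def)
  have o: "hoelder_order m (Suc q)" by (simp add: hoelder_order_def hk)
  have fl: "\<lfloor>m + real r\<rfloor> = \<lfloor>m\<rfloor> + int r" by linarith
  have "0 \<le> \<lfloor>m\<rfloor>" using assms by simp
  then have "hk (m + real r) = hk m + r" by (simp add: hk_def fl nat_add_distrib)
  moreover have "hgam (m + real r) = hgam m" by (simp add: hgam_def fl)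
  ultimately have o': "hoelder_order (m + real r) (Suc q + r)" by (simp add: hoelder_order_def hk)
  have mono: "\<phi> \<in> Diff_ap m" if "\<phi> \<in> Diff_ap (m + real r)" for \<phi> :: "real^'n \<Rightarrow> real^'n"
    using Diff_ap_mono[OF o o'] that by blast
  show ?thesis
  proof (intro conjI Diff_ap_subset_diff_b[OF o] id_Diff_ap[OF o] is_Cr_comp[OF o o'] is_Cr_inv[OF o o'])
    show "\<forall>\<phi>\<in>(Diff_ap m :: (real^'n \<Rightarrow> real^'n) set). \<forall>\<psi>\<in>Diff_ap m. \<phi> \<circ> \<psi> \<in> Diff_ap m"
      using Diff_ap_comp[OF o] by blast
    show "\<forall>\<phi>\<in>(Diff_ap m :: (real^'n \<Rightarrow> real^'n) set). bij \<phi> \<and> inv \<phi> \<in> Diff_ap m"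
      using Diff_ap_inv[OF o] by blast
    show "\<forall>\<phi>\<in>(Diff_ap (m + real r) :: (real^'n \<Rightarrow> real^'n) set). \<forall>\<psi>\<in>Diff_ap m. \<phi> \<circ> \<psi> \<in> Diff_ap m"
      using Diff_ap_comp[OF o mono] by blast
    show "\<forall>\<phi>\<in>(Diff_ap (m + real r) :: (real^'n \<Rightarrow> real^'n) set). inv \<phi> \<in> Diff_ap m"
      using Diff_ap_inv(2)[OF o mono] by blast
  qed
qed

end
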